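(* Let $G\rightrightarrows M$ be a (possibly local) Lie groupoid with Lie algebroid $A$, let $V\to M$ be a representation of $G$, and fix (a germ of) a tubular structure for $G$ with associated retraction $\lambda_t$. The van Est integration map $R_G=\mathsf q\circ(1+\delta\mathsf k)^{-1}\circ\mathsf i\colon\mathsf C^\bullet(A,V)\to\mathsf C^\bullet(G,V)_M$ is given on degree $p$ elements $\alpha\in\mathsf C^p(A,V)$ by the formula $$R_G(\alpha)(g_1,\ldots,g_p)=\int_{[0,1]^p}\big(\gamma^{(p)}(g_1,\ldots,g_p)\big)^*\big(\alpha^L|_{\mathsf t^{-1}(m_0)}\big),$$ where $m_0=\mathsf t(g_1)$ and $$\gamma^{(p)}_{t_1,\ldots,t_p}(g_1,\ldots,g_p)=\lambda_{t_1}\Big(g_1\,\lambda_{t_2}\big(g_2\cdots\lambda_{t_p}(g_p)\cdots\big)\Big),$$ which for fixed $(g_1,\ldots,g_p)$ close to $M$ is a smooth map from the unit cube $[0,1]^p$ into the $\mathsf t$-fiber of $m_0$.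
   Context: Groupoid notation: $\mathsf s,\mathsf t\colon G\to M$ are source and target; $gh$ is defined when $\mathsf s(g)=\mathsf t(h)$; $u\colon M\to G$ is the inclusion of units. $B_pG$ is the manifold of composable $p$-tuples $(g_1,\ldots,g_p)$, $\mathsf s(g_i)=\mathsf t(g_{i+1})$, with base points $m_0=\mathsf t(g_1)$, $m_i=\mathsf s(g_i)$; $B_0G=M$. $E_pG=B_pG\times_MG=\{(g_1,\ldots,g_p;g): m_p=\mathsf t(g)\}$, with $\pi_p(g_1,\ldots,g_p;g)=\mathsf s(g)$. $M$ is regarded as a submanifold of $B_pG$ and of $E_pG$ (constant arrows). A subscript $M$ on a space of sections or forms means germs along $M$. Complexes: $A=\ker(T\mathsf t)|_M$, with sections identified with left-invariant vector fields on $G$ (tangent to $\mathsf t$-fibers). $\mathsf C^p(G,V)_M$ is the space of germs along $M$ of sections of the bundle $B_pG\times_MV\to B_pG$, whose fiber at $(g_1,\ldots,g_p)$ is $V_{m_p}$. $\mathsf C^q(A,V)=\Gamma(V\otimes\wedge^qA^* )$. For $\alpha\in\mathsf C^q(A,V)$, $\alpha^L$ is the corresponding left-invariant foliated ($\mathsf t$-fiberwise) form on $G$ with values in $\mathsf t^*V$, whose restriction to $M$ is $\alpha$. It is thought of as a family of $V_m$-valued forms on the fibers $\mathsf t^{-1}(m)$; since $\gamma^{(p)}(g_1,\ldots,g_p)$ takes values in one such fiber, the pullback is an ordinary form on $[0,1]^p$. Double complex: $\mathsf D^{p,q}(G,V)_M$ is the space of germs along $M\subset E_pG$ of sections $\psi$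 of $\pi_p^*(V\otimes\wedge^qA^* )$, with horizontal (simplicial) differential $(\delta\psi)(g_1,\ldots,g_{p+1};g)=\psi(g_2,\ldots,g_{p+1};g)+\sum_{i=1}^p(-1)^i\psi(g_1,\ldots,g_ig_{i+1},\ldots,g_{p+1};g)+(-1)^{p+1}\psi(g_1,\ldots,g_p;g_{p+1}g)$. Equivalently, using left translation $A_{\mathsf s(g)}\cong T_g\mathsf t^{-1}(\mathsf t(g))$ and the isomorphism $\mathsf s^*V\cong\mathsf t^*V$ given by the representation, elements are (germs of) smooth families $\beta(g_1,\ldots,g_p)$ of $V_{m_p}$-valued $q$-forms on $\mathsf t^{-1}(m_p)$. Maps: $\mathsf i(\alpha)=\pi_0^*\alpha\in\mathsf D^{0,q}$ (in terms of forms: $\alpha^L$). A tubular structure is a tubular neighborhood embedding $A\to G$ taking fibers of $A\to M$ to $\mathsf t$-fibers, with differential along $M$ the identity of $A$. It transports scalar multiplication by $t\in[0,1]$ on $A$ to (the germ along $[0,1]\times M$ of) a retraction $\lambda\colon[0,1]\times G\to G$ along $\mathsf t$-fibers, with $\lambda_0=u\circ\mathsf t$. Let $T$ be the homotopy operator on foliated $\mathsf t^*V$-valued forms given by pullback under $\lambda$ followed by integration over $[0,1]$, and $(\mathsf k\beta)(g_1,\ldots,g_p)=(-1)^pT(\beta(g_1,\ldots,g_p))$. On bidegree $(p,0)$, $(\mathsf q\beta)(g_1,\ldots,g_p)$ is the restriction of $\beta(g_1,\ldots,g_p)$ to the unit at $m_p$; $\mathsf q$ vanishes on bidegree $(p,q)$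 with $q>0$. On elements of degree $p$, $R_G=(-1)^p\,\mathsf q\circ(\delta\mathsf k)^p\circ\mathsf i$.
   Formalization: The integral takes values in the fibre of V at m_0, while R_G(α)(g_1,…,g_p) lies in the fibre at m_p; the formal formula applies the action of (g_1⋯g_p)^{-1} to the integral, without which the displayed equality fails for nontrivial representations. *)

theory Defs
  imports "HOL-Analysis.Analysis"
begin

section \<open>Model spaces and smooth functions\<close>

text \<open>Finite-dimensional real vector spaces. Unlike class \<open>euclidean_space\<close>, dimension zero is not
  excluded: this is needed for Lie groups (base manifold a point), for instance. The topological
  superclasses are automatic in finite dimension.\<close>

class findim = banach + second_countable_topology +
  assumes finite_coords:
    "\<exists>B f K. finite B \<and> (\<forall>b x y. f b (x + y) = f b x + f b y) \<and>
       (\<forall>b r x. f b (r *\<^sub>R x) = r * f b x) \<and> (\<forall>b x. \<bar>f b x\<bar> \<le> norm x * K b) \<and>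
       (\<forall>x. x = (\<Sum>b\<in>B. f b x *\<^sub>R b))"

lemma finite_coordinates:
  "\<exists>(B :: 'a::findim set) f. finite B \<and> (\<forall>b. bounded_linear (f b)) \<and> (\<forall>x. x = (\<Sum>b\<in>B. f b x *\<^sub>R b))"
proof -
  obtain B :: "'a set" and f K where *: "finite B" "\<forall>b x y. f b (x + y) = f b x + f b y"
      "\<forall>b r x. f b (r *\<^sub>R x) = r * f b x" "\<forall>b x. \<bar>f b x\<bar> \<le> norm x * K b"
      "\<forall>x. x = (\<Sum>b\<in>B. f b x *\<^sub>R b)"
    using finite_coords by (elim exE conjE) (rule that)
  have "bounded_linear (f b)" for b
    by (rule bounded_linear_intro[of _ "K b"]) (use *(2-4) in \<open>simp_all add: mult.commute\<close>)
  then show ?thesis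
    by (intro exI[of _ B] exI[of _ f] conjI allI *(1) *(5)[rule_format])
qed

lemma findim_class_coordsI:
  fixes B :: "'a::real_normed_vector set" and f :: "'a \<Rightarrow> 'a \<Rightarrow> real"
  assumes "finite B" "\<And>b. bounded_linear (f b)" "\<And>x. x = (\<Sum>b\<in>B. f b x *\<^sub>R b)"
  shows "\<exists>B f K. finite B \<and> (\<forall>b x y. f b (x + y) = f b x + f b y) \<and>
       (\<forall>b r x. f b (r *\<^sub>R x) = r * f b x) \<and> (\<forall>b x. \<bar>f b x\<bar> \<le> norm x * K b) \<and>
       (\<forall>x::'a. x = (\<Sum>b\<in>B. f b x *\<^sub>R b))"
proof -
  have "\<exists>K. \<forall>b. \<forall>x. \<bar>f b x\<bar> \<le> norm x * K b"
    by (rule choice) (use bounded_linear.bounded[OF assms(2)] in \<open>simp add: mult.commute\<close>)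
  then obtain K where "\<forall>b x. \<bar>f b x\<bar> \<le> norm x * K b" by blast
  moreover have "\<forall>b x y. f b (x + y) = f b x + f b y" "\<forall>b r x. f b (r *\<^sub>R x) = r * f b x"
    using bounded_linear.linear[OF assms(2)] by (auto simp: linear_add linear_scale)
  ultimately show ?thesis
    by (intro exI[of _ B] exI[of _ f] exI[of _ K] conjI assms(1) allI assms(3)) simp_all
qed

instance euclidean_space \<subseteq> findim
  by standard
    (rule findim_class_coordsI[of Basis "\<lambda>b x. inner x b"],
      auto simp: euclidean_representation bounded_linear_inner_left)

instance prod :: (findim, findim) findim
proof
  obtain B :: "'a set" and f where B: "finite B" "\<And>b. bounded_linear (f b)"
      "\<And>x. x = (\<Sum>b\<in>B. f b x *\<^sub>R b)"
    using finite_coordinates[where 'a = 'a]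
    by (elim exE conjE) (rule that, assumption, erule spec, erule spec)
  obtain C :: "'b set" and g where C: "finite C" "\<And>c. bounded_linear (g c)"
      "\<And>y. y = (\<Sum>c\<in>C. g c y *\<^sub>R c)"
    using finite_coordinates[where 'a = 'b]
    by (elim exE conjE) (rule that, assumption, erule spec, erule spec)
  let ?D1 = "(\<lambda>b. (b, 0::'b)) ` B" and ?D2 = "(\<lambda>c. (0::'a, c)) ` C"
  define h :: "'a \<times> 'b \<Rightarrow> 'a \<times> 'b \<Rightarrow> real" where
    "h d z = (if d \<in> ?D1 then f (fst d) (fst z) else 0) + (if d \<in> ?D2 then g (snd d) (snd z) else 0)"
    for d z
  have bl: "\<And>d. bounded_linear (h d)"
  proof -
    fix d
    have 1: "bounded_linear (\<lambda>z :: 'a \<times> 'b. if d \<in> ?D1 then f (fst d) (fst z) else 0)"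
      using bounded_linear_compose[OF B(2) bounded_linear_fst] by (cases "d \<in> ?D1") simp_all
    have 2: "bounded_linear (\<lambda>z :: 'a \<times> 'b. if d \<in> ?D2 then g (snd d) (snd z) else 0)"
      using bounded_linear_compose[OF C(2) bounded_linear_snd] by (cases "d \<in> ?D2") simp_all
    show "bounded_linear (h d)"
      unfolding h_def[abs_def] by (rule bounded_linear_add[OF 1 2])
  qed
  have eq: "z = (\<Sum>d\<in>?D1 \<union> ?D2. h d z *\<^sub>R d)" for z
  proof -
    have fin: "finite (?D1 \<union> ?D2)" using B(1) C(1) by simp
    have "(\<Sum>d\<in>?D1 \<union> ?D2. h d z *\<^sub>R d)
        = (\<Sum>d\<in>?D1 \<union> ?D2. (if d \<in> ?D1 then f (fst d) (fst z) *\<^sub>R d else 0))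
        + (\<Sum>d\<in>?D1 \<union> ?D2. (if d \<in> ?D2 then g (snd d) (snd z) *\<^sub>R d else 0))"
      unfolding sum.distrib[symmetric] h_def
      by (rule sum.cong[OF refl]) (simp add: scaleR_add_left split: if_split del: image_iff Un_iff)
    also have "(\<Sum>d\<in>?D1 \<union> ?D2. (if d \<in> ?D1 then f (fst d) (fst z) *\<^sub>R d else 0))
        = (\<Sum>d\<in>?D1. f (fst d) (fst z) *\<^sub>R d)"
      using sum.inter_restrict[OF fin, of "\<lambda>d. f (fst d) (fst z) *\<^sub>R d" ?D1]
      by (simp only: Int_absorb1[OF Un_upper1])
    also have "\<dots> = (\<Sum>b\<in>B. (f b (fst z) *\<^sub>R b, 0))"
      by (subst sum.reindex) (auto simp: inj_on_def scaleR_Pair)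
    also have "\<dots> = (fst z, 0)"
      by (simp add: prod_eq_iff fst_sum snd_sum B(3)[symmetric])
    also have "(\<Sum>d\<in>?D1 \<union> ?D2. (if d \<in> ?D2 then g (snd d) (snd z) *\<^sub>R d else 0))
        = (\<Sum>d\<in>?D2. g (snd d) (snd z) *\<^sub>R d)"
      using sum.inter_restrict[OF fin, of "\<lambda>d. g (snd d) (snd z) *\<^sub>R d" ?D2]
      by (simp only: Int_absorb1[OF Un_upper2])
    also have "\<dots> = (\<Sum>c\<in>C. (0, g c (snd z) *\<^sub>R c))"
      by (subst sum.reindex) (auto simp: inj_on_def scaleR_Pair)
    also have "\<dots> = (0, snd z)"
      by (simp add: prod_eq_iff fst_sum snd_sum C(3)[symmetric])
    finally show ?thesis by simp
  qed
  have fin: "finite (?D1 \<union> ?D2)" using B(1) C(1) by simp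
  show "\<exists>B f K. finite B \<and> (\<forall>b x y. f b (x + y) = f b x + f b y) \<and>
       (\<forall>b r x. f b (r *\<^sub>R x) = r * f b x) \<and> (\<forall>b x. \<bar>f b x\<bar> \<le> norm x * K b) \<and>
       (\<forall>x::'a \<times> 'b. x = (\<Sum>b\<in>B. f b x *\<^sub>R b))"
    by (rule findim_class_coordsI[OF fin bl eq])
qed

primrec Ck_on :: "nat \<Rightarrow> 'a::real_normed_vector set \<Rightarrow> ('a \<Rightarrow> 'b::real_normed_vector) \<Rightarrow> bool" where
  "Ck_on 0 S f \<longleftrightarrow> continuous_on S f"
| "Ck_on (Suc n) S f \<longleftrightarrow> (\<forall>x\<in>S. f differentiable (at x)) \<and>
     (\<forall>v. Ck_on n S (\<lambda>x. frechet_derivative f (at x) v))"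

text \<open>Intended for open \<open>S\<close>.\<close>

definition smooth_on :: "'a::real_normed_vector set \<Rightarrow> ('a \<Rightarrow> 'b::real_normed_vector) \<Rightarrow> bool" where
  "smooth_on S f \<longleftrightarrow> (\<forall>n. Ck_on n S f)"

section \<open>Manifolds\<close>

text \<open>A manifold is a whole type with a topology, together with an atlas; a chart is a pair of its
  domain and the coordinate map. No separation or countability axiom is imposed (none is needed, and
  the space of arrows of a Lie groupoid is often allowed to be non-Hausdorff).\<close>

type_synonym ('a, 'e) atlas = "('a set \<times> ('a \<Rightarrow> 'e)) set"

definition manifold_atlas :: "('a::topological_space, 'e::findim) atlas \<Rightarrow> bool" where
  "manifold_atlas \<A> \<longleftrightarrow>
     (\<Union>(fst ` \<A>) = UNIV) \<and>
     (\<forall>(U, \<phi>)\<in>\<A>. open U \<and> open (\<phi> ` U) \<and> (\<exists>\<psi>. homeomorphism U (\<phi> ` U) \<phi> \<psi>)) \<and>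
     (\<forall>(U, \<phi>)\<in>\<A>. \<forall>(W, \<theta>)\<in>\<A>. smooth_on (\<phi> ` (U \<inter> W)) (\<theta> \<circ> inv_into U \<phi>))"

definition vs_atlas :: "('e, 'e) atlas" where
  "vs_atlas = {(UNIV, id)}"

definition prod_atlas :: "('a, 'e) atlas \<Rightarrow> ('b, 'f) atlas \<Rightarrow> ('a \<times> 'b, 'e \<times> 'f) atlas" where
  "prod_atlas \<A> \<B> = {(U \<times> W, map_prod \<phi> \<theta>) | U \<phi> W \<theta>. (U, \<phi>) \<in> \<A> \<and> (W, \<theta>) \<in> \<B>}"

text \<open>Smoothness of a map on a subset \<open>S\<close> of a manifold (typically an open subset of an embedded
  submanifold): in charts, it locally extends to a smooth function on an open set.\<close>

definition smooth_map_on ::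
    "('a, 'e::findim) atlas \<Rightarrow> ('b, 'f::findim) atlas \<Rightarrow> 'a set \<Rightarrow> ('a \<Rightarrow> 'b) \<Rightarrow> bool" where
  "smooth_map_on \<A> \<B> S f \<longleftrightarrow>
     (\<forall>x\<in>S. \<forall>(U, \<phi>)\<in>\<A>. \<forall>(W, \<theta>)\<in>\<B>. x \<in> U \<longrightarrow> f x \<in> W \<longrightarrow>
        (\<exists>Q F. open Q \<and> \<phi> x \<in> Q \<and> Q \<subseteq> \<phi> ` U \<and> smooth_on Q F \<and>
           (\<forall>y\<in>S \<inter> U. \<phi> y \<in> Q \<longrightarrow> f y \<in> W \<and> \<theta> (f y) = F (\<phi> y))))"

definition rel_open :: "('a, 'e::findim) atlas \<Rightarrow> 'a set \<Rightarrow> 'a set \<Rightarrow> bool" where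
  "rel_open \<A> S \<Omega> \<longleftrightarrow> \<Omega> \<subseteq> S \<and>
     (\<forall>x\<in>\<Omega>. \<forall>(U, \<phi>)\<in>\<A>. x \<in> U \<longrightarrow>
        (\<exists>Q. open Q \<and> \<phi> x \<in> Q \<and> (\<forall>y\<in>S \<inter> U. \<phi> y \<in> Q \<longrightarrow> y \<in> \<Omega>)))"

subsection \<open>Tangent vectors\<close>

text \<open>For every point \<open>x\<close> one chart \<open>chart_at \<A> x\<close> around \<open>x\<close> is singled out once and for all; the
  tangent space at \<open>x\<close> is identified with the model space by means of this chart. Passage to another
  chart is by \<open>tangent_coord\<close>, and the smooth structure of the tangent bundle is \<open>tangent_atlas\<close>
  (the product topology of the underlying type plays no role for it).\<close>

definition chart_at :: "('a, 'e) atlas \<Rightarrow> 'a \<Rightarrow> 'a set \<times> ('a \<Rightarrow> 'e)" where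
  "chart_at \<A> x = (SOME c. c \<in> \<A> \<and> x \<in> fst c)"

definition coord :: "('a, 'e) atlas \<Rightarrow> 'a \<Rightarrow> 'a \<Rightarrow> 'e" where
  "coord \<A> x = snd (chart_at \<A> x)"

definition coord_dom :: "('a, 'e) atlas \<Rightarrow> 'a \<Rightarrow> 'a set" where
  "coord_dom \<A> x = fst (chart_at \<A> x)"

definition coord_inv :: "('a, 'e) atlas \<Rightarrow> 'a \<Rightarrow> 'e \<Rightarrow> 'a" where
  "coord_inv \<A> x = inv_into (coord_dom \<A> x) (coord \<A> x)"

definition tangent_coord :: "('a, 'e::findim) atlas \<Rightarrow> ('a \<Rightarrow> 'e) \<Rightarrow> 'a \<Rightarrow> 'e \<Rightarrow> 'e" where
  "tangent_coord \<A> \<phi> x v = frechet_derivative (\<phi> \<circ> coord_inv \<A> x) (at (coord \<A> x x)) v"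

definition tangent_atlas :: "('a, 'e::findim) atlas \<Rightarrow> ('a \<times> 'e, 'e \<times> 'e) atlas" where
  "tangent_atlas \<A> = {(U \<times> UNIV, \<lambda>(x, v). (\<phi> x, tangent_coord \<A> \<phi> x v)) | U \<phi>. (U, \<phi>) \<in> \<A>}"

text \<open>The tangent map at \<open>x\<close> of a map defined on a subset \<open>S\<close>. It is meaningful only on vectors tangent
  to \<open>S\<close> (where the derivative within \<open>S\<close> is uniquely determined), and is only applied to these.\<close>

definition tmap ::
    "('a, 'e::findim) atlas \<Rightarrow> ('b, 'f::findim) atlas \<Rightarrow> 'a set \<Rightarrow> ('a \<Rightarrow> 'b) \<Rightarrow> 'a \<Rightarrow> 'e \<Rightarrow> 'f" where
  "tmap \<A> \<B> S f x =
     frechet_derivative (coord \<B> (f x) \<circ> f \<circ> coord_inv \<A> x)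
       (at (coord \<A> x x) within coord \<A> x ` (S \<inter> coord_dom \<A> x))"

definition velocity :: "('a, 'e::findim) atlas \<Rightarrow> real set \<Rightarrow> (real \<Rightarrow> 'a) \<Rightarrow> real \<Rightarrow> 'e" where
  "velocity \<A> I c r = vector_derivative (coord \<A> (c r) \<circ> c) (at r within I)"

section \<open>Local Lie groupoids\<close>

text \<open>\<open>cdom\<close> is the domain of the multiplication \<open>mlt\<close>, \<open>idom\<close> that of the inversion \<open>ivs\<close>. A Lie groupoid
  is the case where \<open>cdom\<close> consists of all \<open>(g, h)\<close> with \<open>src g = tgt h\<close>, and \<open>idom = UNIV\<close>.\<close>

record ('g, 'm, 'e, 'b) groupoid =
  chartsG :: "('g, 'e) atlas"
  chartsM :: "('m, 'b) atlas"
  src :: "'g \<Rightarrow> 'm"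
  tgt :: "'g \<Rightarrow> 'm"
  unt :: "'m \<Rightarrow> 'g"
  cdom :: "('g \<times> 'g) set"
  mlt :: "'g \<Rightarrow> 'g \<Rightarrow> 'g"
  idom :: "'g set"
  ivs :: "'g \<Rightarrow> 'g"

definition local_lie_groupoid ::
    "('g::topological_space, 'm::topological_space, 'e::findim, 'b::findim) groupoid \<Rightarrow> bool" where
  "local_lie_groupoid \<G> \<longleftrightarrow>
     manifold_atlas (chartsG \<G>) \<and> manifold_atlas (chartsM \<G>) \<and>
     \<comment> \<open>source and target are submersions, units\<close>
     smooth_map_on (chartsG \<G>) (chartsM \<G>) UNIV (src \<G>) \<and>
     smooth_map_on (chartsG \<G>) (chartsM \<G>) UNIV (tgt \<G>) \<and>
     (\<forall>g. surj (tmap (chartsG \<G>) (chartsM \<G>) UNIV (src \<G>) g)) \<and>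
     (\<forall>g. surj (tmap (chartsG \<G>) (chartsM \<G>) UNIV (tgt \<G>) g)) \<and>
     smooth_map_on (chartsM \<G>) (chartsG \<G>) UNIV (unt \<G>) \<and>
     (\<forall>m. src \<G> (unt \<G> m) = m \<and> tgt \<G> (unt \<G> m) = m) \<and>
     \<comment> \<open>multiplication\<close>
     (\<exists>N. open N \<and> cdom \<G> = N \<inter> {(g, h). src \<G> g = tgt \<G> h}) \<and>
     (\<forall>m. (unt \<G> m, unt \<G> m) \<in> cdom \<G>) \<and>
     smooth_map_on (prod_atlas (chartsG \<G>) (chartsG \<G>)) (chartsG \<G>) (cdom \<G>)
       (\<lambda>(g, h). mlt \<G> g h) \<and>
     (\<forall>(g, h)\<in>cdom \<G>. src \<G> (mlt \<G> g h) = src \<G> h \<and> tgt \<G> (mlt \<G> g h) = tgt \<G> g) \<and>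
     (\<forall>g h k. (g, h) \<in> cdom \<G> \<longrightarrow> (h, k) \<in> cdom \<G> \<longrightarrow> (mlt \<G> g h, k) \<in> cdom \<G> \<longrightarrow>
        (g, mlt \<G> h k) \<in> cdom \<G> \<longrightarrow> mlt \<G> (mlt \<G> g h) k = mlt \<G> g (mlt \<G> h k)) \<and>
     (\<forall>g. (g, unt \<G> (src \<G> g)) \<in> cdom \<G> \<longrightarrow> mlt \<G> g (unt \<G> (src \<G> g)) = g) \<and>
     (\<forall>g. (unt \<G> (tgt \<G> g), g) \<in> cdom \<G> \<longrightarrow> mlt \<G> (unt \<G> (tgt \<G> g)) g = g) \<and>
     \<comment> \<open>inversion\<close>
     open (idom \<G>) \<and> range (unt \<G>) \<subseteq> idom \<G> \<and>
     smooth_map_on (chartsG \<G>) (chartsG \<G>) (idom \<G>) (ivs \<G>) \<and>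
     (\<forall>g\<in>idom \<G>. src \<G> (ivs \<G> g) = tgt \<G> g \<and> tgt \<G> (ivs \<G> g) = src \<G> g \<and>
        (g, ivs \<G> g) \<in> cdom \<G> \<and> mlt \<G> g (ivs \<G> g) = unt \<G> (tgt \<G> g) \<and>
        (ivs \<G> g, g) \<in> cdom \<G> \<and> mlt \<G> (ivs \<G> g) g = unt \<G> (src \<G> g))"

definition tfib :: "('g, 'm, 'e, 'b) groupoid \<Rightarrow> 'm \<Rightarrow> 'g set" where
  "tfib \<G> m = {g. tgt \<G> g = m}"

text \<open>Composability of a list \<open>[g\<^sub>1, \<dots>, g\<^sub>p]\<close>, with \<open>m\<^sub>p = m\<close>. A point of \<open>B\<^sub>pG\<close> is represented by a pair
  \<open>(gs, m)\<close>, so that \<open>B\<^sub>0G\<close> is the space of objects; a point \<open>(g\<^sub>1, \<dots>, g\<^sub>p; g)\<close> of \<open>E\<^sub>pG\<close> is a pair \<open>(gs, g)\<close>.\<close>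

definition composable :: "('g, 'm, 'e, 'b) groupoid \<Rightarrow> 'g list \<Rightarrow> 'm \<Rightarrow> bool" where
  "composable \<G> gs m \<longleftrightarrow>
     (\<forall>i. Suc i < length gs \<longrightarrow> src \<G> (gs ! i) = tgt \<G> (gs ! Suc i)) \<and>
     (gs \<noteq> [] \<longrightarrow> src \<G> (last gs) = m)"

definition BG :: "('g, 'm, 'e, 'b) groupoid \<Rightarrow> nat \<Rightarrow> ('g list \<times> 'm) set" where
  "BG \<G> p = {(gs, m). length gs = p \<and> composable \<G> gs m}"

definition EG :: "('g, 'm, 'e, 'b) groupoid \<Rightarrow> nat \<Rightarrow> ('g list \<times> 'g) set" where
  "EG \<G> p = {(gs, g). length gs = p \<and> composable \<G> gs (tgt \<G> g)}"

definition base0 :: "('g, 'm, 'e, 'b) groupoid \<Rightarrow> 'g list \<Rightarrow> 'm \<Rightarrow> 'm" where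
  "base0 \<G> gs m = (if gs = [] then m else tgt \<G> (hd gs))"

text \<open>A property holds near \<open>M\<close> if it holds on a neighbourhood of the constant tuples of units, for the
  topology induced from the product topology on tuples of arrows.\<close>

definition near_units_B ::
    "('g::topological_space, 'm, 'e, 'b) groupoid \<Rightarrow> nat \<Rightarrow> ('g list \<Rightarrow> 'm \<Rightarrow> bool) \<Rightarrow> bool" where
  "near_units_B \<G> p P \<longleftrightarrow>
     (\<forall>m0. \<exists>N. open N \<and> unt \<G> m0 \<in> N \<and>
        (\<forall>(gs, m)\<in>BG \<G> p. set gs \<subseteq> N \<and> unt \<G> m \<in> N \<longrightarrow> P gs m))"

definition near_units_E ::
    "('g::topological_space, 'm, 'e, 'b) groupoid \<Rightarrow> nat \<Rightarrow> ('g list \<Rightarrow> 'g \<Rightarrow> bool) \<Rightarrow> bool" where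
  "near_units_E \<G> p P \<longleftrightarrow>
     (\<forall>m0. \<exists>N. open N \<and> unt \<G> m0 \<in> N \<and>
        (\<forall>(gs, g)\<in>EG \<G> p. set gs \<subseteq> N \<and> g \<in> N \<longrightarrow> P gs g))"

definition germ_B ::
    "('g::topological_space, 'm, 'e, 'b) groupoid \<Rightarrow> nat \<Rightarrow> ('g list \<Rightarrow> 'm \<Rightarrow> 'k) \<Rightarrow> ('g list \<Rightarrow> 'm \<Rightarrow> 'k) set"
  where
  "germ_B \<G> p c = {c'. near_units_B \<G> p (\<lambda>gs m. c' gs m = c gs m)}"

section \<open>The Lie algebroid and representations\<close>

text \<open>The fibre of \<open>A = ker (T tgt)|\<^sub>M\<close> at \<open>m\<close>, and the total space of \<open>A\<close> as a subset of the tangent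
  bundle of \<open>G\<close>.\<close>

definition algd :: "('g, 'm, 'e::findim, 'b::findim) groupoid \<Rightarrow> 'm \<Rightarrow> 'e set" where
  "algd \<G> m = {v. tmap (chartsG \<G>) (chartsM \<G>) UNIV (tgt \<G>) (unt \<G> m) v = 0}"

definition algd_total :: "('g, 'm, 'e::findim, 'b::findim) groupoid \<Rightarrow> ('g \<times> 'e) set" where
  "algd_total \<G> = {(unt \<G> m, a) | m a. a \<in> algd \<G> m}"

definition smooth_algd_section ::
    "('g, 'm, 'e::findim, 'b::findim) groupoid \<Rightarrow> 'm set \<Rightarrow> ('m \<Rightarrow> 'e) \<Rightarrow> bool" where
  "smooth_algd_section \<G> W a \<longleftrightarrow> (\<forall>m\<in>W. a m \<in> algd \<G> m) \<and>
     smooth_map_on (chartsM \<G>) (tangent_atlas (chartsG \<G>)) W (\<lambda>m. (unt \<G> m, a m))"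

text \<open>The left translation \<open>A\<^bsub>s(g)\<^esub> \<rightarrow> T\<^sub>g t\<^sup>-\<^sup>1(t(g))\<close>, the tangent map at the unit of \<open>h \<mapsto> gh\<close>.\<close>

definition ltrans :: "('g, 'm, 'e::findim, 'b::findim) groupoid \<Rightarrow> 'g \<Rightarrow> 'e \<Rightarrow> 'e" where
  "ltrans \<G> g = tmap (chartsG \<G>) (chartsG \<G>) (tfib \<G> (src \<G> g)) (mlt \<G> g) (unt \<G> (src \<G> g))"

definition ltrans_inv :: "('g, 'm, 'e::findim, 'b::findim) groupoid \<Rightarrow> 'g \<Rightarrow> 'e \<Rightarrow> 'e" where
  "ltrans_inv \<G> g = inv_into (algd \<G> (src \<G> g)) (ltrans \<G> g)"

text \<open>A vector bundle over \<open>M\<close> of rank \<open>dim 'k\<close>: each fibre \<open>V\<^sub>m\<close> is a copy of the vector space \<open>'k\<close>, and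
  the smooth structure is given by a family of local trivializations \<open>\<tau> m : V\<^sub>m \<rightarrow> 'k\<close>, \<open>m \<in> U\<close>. (No
  triviality is implied: the identification of the fibres with \<open>'k\<close> need not be continuous in \<open>m\<close>.)\<close>

type_synonym ('m, 'k) vbundle = "('m set \<times> ('m \<Rightarrow> 'k \<Rightarrow> 'k)) set"

definition vector_bundle ::
    "('m::topological_space, 'b::findim) atlas \<Rightarrow> ('m, 'k::findim) vbundle \<Rightarrow> bool" where
  "vector_bundle \<M> \<V> \<longleftrightarrow>
     (\<Union>(fst ` \<V>) = UNIV) \<and>
     (\<forall>(U, \<tau>)\<in>\<V>. open U \<and> (\<forall>m\<in>U. linear (\<tau> m) \<and> bij (\<tau> m))) \<and>
     (\<forall>(U, \<tau>)\<in>\<V>. \<forall>(U', \<tau>')\<in>\<V>. \<forall>k.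
        smooth_map_on \<M> vs_atlas (U \<inter> U') (\<lambda>m. \<tau>' m (inv (\<tau> m) k)))"

definition smooth_section ::
    "('m, 'b::findim) atlas \<Rightarrow> ('m, 'k::findim) vbundle \<Rightarrow> 'm set \<Rightarrow> ('m \<Rightarrow> 'k) \<Rightarrow> bool" where
  "smooth_section \<M> \<V> W \<sigma> \<longleftrightarrow>
     (\<forall>(U, \<tau>)\<in>\<V>. smooth_map_on \<M> vs_atlas (W \<inter> U) (\<lambda>m. \<tau> m (\<sigma> m)))"

text \<open>A representation: \<open>\<rho> g\<close> maps \<open>V\<^bsub>s(g)\<^esub>\<close> to \<open>V\<^bsub>t(g)\<^esub>\<close>.\<close>

definition groupoid_representation ::
    "('g, 'm, 'e::findim, 'b::findim) groupoid \<Rightarrow> ('m, 'k::findim) vbundle \<Rightarrow> ('g \<Rightarrow> 'k \<Rightarrow> 'k) \<Rightarrow> bool"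
  where
  "groupoid_representation \<G> \<V> \<rho> \<longleftrightarrow>
     (\<forall>g. linear (\<rho> g) \<and> bij (\<rho> g)) \<and>
     (\<forall>m. \<rho> (unt \<G> m) = id) \<and>
     (\<forall>(g, h)\<in>cdom \<G>. \<rho> (mlt \<G> g h) = \<rho> g \<circ> \<rho> h) \<and>
     (\<forall>(U, \<tau>)\<in>\<V>. \<forall>(U', \<tau>')\<in>\<V>. \<forall>k.
        smooth_map_on (chartsG \<G>) vs_atlas (src \<G> -` U \<inter> tgt \<G> -` U')
          (\<lambda>g. \<tau>' (tgt \<G> g) (\<rho> g (inv (\<tau> (src \<G> g)) k))))"

text \<open>The isomorphism \<open>V\<^bsub>m_p\<^esub> \<rightarrow> V\<^bsub>m_0\<^esub>\<close> given by the action of \<open>g\<^sub>1 \<cdots> g\<^sub>p\<close>.\<close>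

primrec act_list :: "('g \<Rightarrow> 'k \<Rightarrow> 'k) \<Rightarrow> 'g list \<Rightarrow> 'k \<Rightarrow> 'k" where
  "act_list \<rho> [] = id"
| "act_list \<rho> (g # gs) = \<rho> g \<circ> act_list \<rho> gs"

text \<open>A \<open>q\<close>-form on a vector space \<open>W\<close> is a function on lists of length \<open>q\<close> of elements of \<open>W\<close>.\<close>

definition alternating_form ::
    "nat \<Rightarrow> 'e::real_vector set \<Rightarrow> ('e list \<Rightarrow> 'k::real_vector) \<Rightarrow> bool" where
  "alternating_form q W \<omega> \<longleftrightarrow>
     (\<forall>vs. length vs = q \<and> set vs \<subseteq> W \<longrightarrow>
        (\<forall>i<q. \<forall>v\<in>W. \<forall>w\<in>W. \<omega> (vs[i := v + w]) = \<omega> (vs[i := v]) + \<omega> (vs[i := w])) \<and>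
        (\<forall>i<q. \<forall>v\<in>W. \<forall>r. \<omega> (vs[i := r *\<^sub>R v]) = r *\<^sub>R \<omega> (vs[i := v])) \<and>
        (\<forall>i<q. \<forall>j<q. i \<noteq> j \<and> vs ! i = vs ! j \<longrightarrow> \<omega> vs = 0))"

definition algd_cochains ::
    "('g, 'm::topological_space, 'e::findim, 'b::findim) groupoid \<Rightarrow> ('m, 'k::findim) vbundle \<Rightarrow> nat \<Rightarrow>
       ('m \<Rightarrow> 'e list \<Rightarrow> 'k) set" where
  "algd_cochains \<G> \<V> q =
     {\<alpha>. (\<forall>m. alternating_form q (algd \<G> m) (\<alpha> m)) \<and>
         (\<forall>W as. open W \<and> length as = q \<and> (\<forall>a\<in>set as. smooth_algd_section \<G> W a) \<longrightarrow>
            smooth_section (chartsM \<G>) \<V> W (\<lambda>m. \<alpha> m (map (\<lambda>a. a m) as)))}"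

text \<open>The left-invariant form \<open>\<alpha>\<^sup>L\<close>, at \<open>g\<close> and on vectors tangent to the \<open>t\<close>-fibre, with values in
  \<open>V\<^bsub>t(g)\<^esub>\<close>.\<close>

definition linv_form ::
    "('g, 'm, 'e::findim, 'b::findim) groupoid \<Rightarrow> ('g \<Rightarrow> 'k \<Rightarrow> 'k) \<Rightarrow> ('m \<Rightarrow> 'e list \<Rightarrow> 'k) \<Rightarrow>
       'g \<Rightarrow> 'e list \<Rightarrow> 'k" where
  "linv_form \<G> \<rho> \<alpha> g vs = \<rho> g (\<alpha> (src \<G> g) (map (ltrans_inv \<G> g) vs))"

section \<open>Tubular structures\<close>

text \<open>The germ of a tubular structure is represented by a map \<open>\<epsilon>\<close> defined on an open neighbourhood \<open>\<Omega>\<close> of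
  the zero section of \<open>A\<close> (\<open>\<Omega>\<close> may be all of \<open>A\<close>). It is a diffeomorphism onto an open subset of \<open>G\<close>.\<close>

definition tubular_structure ::
    "('g::topological_space, 'm, 'e::findim, 'b::findim) groupoid \<Rightarrow> ('g \<times> 'e) set \<Rightarrow>
       ('g \<times> 'e \<Rightarrow> 'g) \<Rightarrow> bool" where
  "tubular_structure \<G> \<Omega> \<epsilon> \<longleftrightarrow>
     rel_open (tangent_atlas (chartsG \<G>)) (algd_total \<G>) \<Omega> \<and>
     (\<forall>m. (unt \<G> m, 0) \<in> \<Omega> \<and> \<epsilon> (unt \<G> m, 0) = unt \<G> m) \<and>
     smooth_map_on (tangent_atlas (chartsG \<G>)) (chartsG \<G>) \<Omega> \<epsilon> \<and>
     inj_on \<epsilon> \<Omega> \<and> open (\<epsilon> ` \<Omega>) \<and>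
     smooth_map_on (chartsG \<G>) (tangent_atlas (chartsG \<G>)) (\<epsilon> ` \<Omega>) (inv_into \<Omega> \<epsilon>) \<and>
     (\<forall>m a. (unt \<G> m, a) \<in> \<Omega> \<longrightarrow> tgt \<G> (\<epsilon> (unt \<G> m, a)) = m) \<and>
     (\<forall>m. \<forall>a\<in>algd \<G> m. velocity (chartsG \<G>) UNIV (\<lambda>r. \<epsilon> (unt \<G> m, r *\<^sub>R a)) 0 = a)"

definition retr :: "('g \<times> 'e::findim) set \<Rightarrow> ('g \<times> 'e \<Rightarrow> 'g) \<Rightarrow> real \<Rightarrow> 'g \<Rightarrow> 'g" where
  "retr \<Omega> \<epsilon> r x = (case inv_into \<Omega> \<epsilon> x of (u, a) \<Rightarrow> \<epsilon> (u, r *\<^sub>R a))"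

section \<open>The double complex and the van Est integration map\<close>

text \<open>An element of bidegree \<open>(p,q)\<close> assigns to \<open>(g\<^sub>1, \<dots>, g\<^sub>p; g)\<close> near \<open>M\<close> a \<open>V\<^bsub>s(g)\<^esub>\<close>-valued alternating
  \<open>q\<close>-form on \<open>A\<^bsub>s(g)\<^esub>\<close>. Regularity of these sections is not imposed: the operators below make sense for
  arbitrary sections, and \<open>1 + \<delta>k\<close> is unipotent. Hence a solution \<open>\<Psi>\<close> of \<open>(1 + \<delta>k) \<Psi> = i(\<alpha>)\<close> in germs of
  smooth sections is also the unique solution in germs of arbitrary sections.\<close>

type_synonym ('g, 'e, 'k) dcochain = "'g list \<Rightarrow> 'g \<Rightarrow> 'e list \<Rightarrow> 'k"

definition dcochains ::
    "('g::topological_space, 'm, 'e::findim, 'b::findim) groupoid \<Rightarrow> nat \<Rightarrow> nat \<Rightarrow>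
       ('g, 'e, 'k::findim) dcochain set" where
  "dcochains \<G> p q = {\<psi>. near_units_E \<G> p (\<lambda>gs g. alternating_form q (algd \<G> (src \<G> g)) (\<psi> gs g))}"

definition dgerm_eq ::
    "('g::topological_space, 'm, 'e::findim, 'b::findim) groupoid \<Rightarrow> nat \<Rightarrow> nat \<Rightarrow>
       ('g, 'e, 'k::findim) dcochain \<Rightarrow> ('g, 'e, 'k) dcochain \<Rightarrow> bool" where
  "dgerm_eq \<G> p q \<psi> \<psi>' \<longleftrightarrow>
     near_units_E \<G> p (\<lambda>gs g. \<forall>vs. length vs = q \<and> set vs \<subseteq> algd \<G> (src \<G> g) \<longrightarrow>
       \<psi> gs g vs = \<psi>' gs g vs)"

definition merge_at :: "('g, 'm, 'e, 'b) groupoid \<Rightarrow> nat \<Rightarrow> 'g list \<Rightarrow> 'g list" where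
  "merge_at \<G> i gs = take (i - 1) gs @ [mlt \<G> (gs ! (i - 1)) (gs ! i)] @ drop (Suc i) gs"

definition dlt ::
    "('g, 'm, 'e::findim, 'b::findim) groupoid \<Rightarrow> nat \<Rightarrow> ('g, 'e, 'k::findim) dcochain \<Rightarrow>
       ('g, 'e, 'k) dcochain" where
  "dlt \<G> p \<psi> gs g vs =
     \<psi> (tl gs) g vs + (\<Sum>i = 1..p. (-1) ^ i *\<^sub>R \<psi> (merge_at \<G> i gs) g vs)
       + (-1) ^ (p + 1) *\<^sub>R \<psi> (butlast gs) (mlt \<G> (last gs) g) vs"

text \<open>The passage from sections \<open>\<psi>\<close> to families \<open>\<beta>(g\<^sub>1, \<dots>, g\<^sub>p)\<close> of \<open>V\<^bsub>m_p\<^esub>\<close>-valued forms on the \<open>t\<close>-fibre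
  of \<open>m\<^sub>p\<close>, and back.\<close>

definition to_form ::
    "('g, 'm, 'e::findim, 'b::findim) groupoid \<Rightarrow> ('g \<Rightarrow> 'k \<Rightarrow> 'k) \<Rightarrow> ('g, 'e, 'k::findim) dcochain \<Rightarrow>
       ('g, 'e, 'k) dcochain" where
  "to_form \<G> \<rho> \<psi> gs x vs = \<rho> x (\<psi> gs x (map (ltrans_inv \<G> x) vs))"

definition from_form ::
    "('g, 'm, 'e::findim, 'b::findim) groupoid \<Rightarrow> ('g \<Rightarrow> 'k \<Rightarrow> 'k) \<Rightarrow> ('g, 'e, 'k::findim) dcochain \<Rightarrow>
       ('g, 'e, 'k) dcochain" where
  "from_form \<G> \<rho> \<beta> gs x ws = inv (\<rho> x) (\<beta> gs x (map (ltrans \<G> x) ws))"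

text \<open>The homotopy operator: integration over \<open>[0,1]\<close> of the pullback under \<open>\<lambda>\<close>, the contraction with
  \<open>\<partial>/\<partial>r\<close> being in the first slot.\<close>

definition htpy ::
    "('g, 'm, 'e::findim, 'b::findim) groupoid \<Rightarrow> (real \<Rightarrow> 'g \<Rightarrow> 'g) \<Rightarrow> ('g \<Rightarrow> 'e list \<Rightarrow> 'k::findim) \<Rightarrow>
       'g \<Rightarrow> 'e list \<Rightarrow> 'k" where
  "htpy \<G> lam \<beta> x vs =
     (LINT r:{0..1}|lborel.
        \<beta> (lam r x)
          (velocity (chartsG \<G>) {0..1} (\<lambda>r'. lam r' x) r
             # map (tmap (chartsG \<G>) (chartsG \<G>) (tfib \<G> (tgt \<G> x)) (lam r) x) vs))"

definition kop ::
    "('g, 'm, 'e::findim, 'b::findim) groupoid \<Rightarrow> ('g \<Rightarrow> 'k \<Rightarrow> 'k) \<Rightarrow> (real \<Rightarrow> 'g \<Rightarrow> 'g) \<Rightarrow> nat \<Rightarrow>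
       ('g, 'e, 'k::findim) dcochain \<Rightarrow> ('g, 'e, 'k) dcochain" where
  "kop \<G> \<rho> lam p \<psi> =
     from_form \<G> \<rho> (\<lambda>gs x vs. (-1) ^ p *\<^sub>R htpy \<G> lam (to_form \<G> \<rho> \<psi> gs) x vs)"

definition iop :: "('g, 'm, 'e, 'b) groupoid \<Rightarrow> ('m \<Rightarrow> 'e list \<Rightarrow> 'k) \<Rightarrow> ('g, 'e, 'k) dcochain" where
  "iop \<G> \<alpha> gs g vs = \<alpha> (src \<G> g) vs"

definition qop ::
    "('g, 'm, 'e::findim, 'b::findim) groupoid \<Rightarrow> ('g \<Rightarrow> 'k \<Rightarrow> 'k) \<Rightarrow> ('g, 'e, 'k::findim) dcochain \<Rightarrow>
       'g list \<Rightarrow> 'm \<Rightarrow> 'k" where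
  "qop \<G> \<rho> \<psi> gs m = to_form \<G> \<rho> \<psi> gs (unt \<G> m) []"

text \<open>An element of total degree \<open>n\<close> is a family \<open>\<Psi> a\<close>, \<open>a \<le> n\<close>, of elements of bidegrees \<open>(a, n - a)\<close>.
  The operator \<open>\<delta>k\<close> maps bidegree \<open>(a, n - a)\<close> to \<open>(a + 1, n - a - 1)\<close>; \<open>k\<close> vanishes on bidegree \<open>(n, 0)\<close>.\<close>

definition one_plus_dk ::
    "('g, 'm, 'e::findim, 'b::findim) groupoid \<Rightarrow> ('g \<Rightarrow> 'k \<Rightarrow> 'k) \<Rightarrow> (real \<Rightarrow> 'g \<Rightarrow> 'g) \<Rightarrow>
       (nat \<Rightarrow> ('g, 'e, 'k::findim) dcochain) \<Rightarrow> nat \<Rightarrow> ('g, 'e, 'k) dcochain" where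
  "one_plus_dk \<G> \<rho> lam \<Psi> a gs g vs =
     \<Psi> a gs g vs +
     (case a of 0 \<Rightarrow> 0 | Suc b \<Rightarrow> dlt \<G> b (kop \<G> \<rho> lam b (\<Psi> b)) gs g vs)"

text \<open>\<open>R\<^sub>G(\<alpha>)\<close> for \<open>\<alpha>\<close> of degree \<open>n\<close>, as a germ along \<open>M\<close>: the set of representatives of \<open>q(\<Psi>)\<close>, where \<open>\<Psi>\<close> is
  the total cochain (unique as a germ) with \<open>(1 + \<delta>k) \<Psi> = i(\<alpha>)\<close>. Only the component of bidegree \<open>(n, 0)\<close>
  contributes to \<open>q(\<Psi>)\<close>.\<close>

definition van_est ::
    "('g::topological_space, 'm, 'e::findim, 'b::findim) groupoid \<Rightarrow> ('g \<Rightarrow> 'k \<Rightarrow> 'k) \<Rightarrow>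
       (real \<Rightarrow> 'g \<Rightarrow> 'g) \<Rightarrow> nat \<Rightarrow> ('m \<Rightarrow> 'e list \<Rightarrow> 'k::findim) \<Rightarrow> ('g list \<Rightarrow> 'm \<Rightarrow> 'k) set" where
  "van_est \<G> \<rho> lam n \<alpha> =
     {c. \<exists>\<Psi>. (\<forall>a\<le>n. \<Psi> a \<in> dcochains \<G> a (n - a)) \<and>
          (\<forall>a\<le>n. dgerm_eq \<G> a (n - a) (one_plus_dk \<G> \<rho> lam \<Psi> a)
                     (if a = 0 then iop \<G> \<alpha> else (\<lambda>_ _ _. 0))) \<and>
          c \<in> germ_B \<G> n (qop \<G> \<rho> (\<Psi> n))}"

section \<open>Cubes\<close>

text \<open>Points of the cube are extensional functions on the index set \<open>{..<p}\<close>; \<open>t i\<close> is the coordinate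
  \<open>t\<^bsub>i+1\<^esub>\<close>.\<close>

definition cube :: "nat \<Rightarrow> (nat \<Rightarrow> real) set" where
  "cube p = {..<p} \<rightarrow>\<^sub>E {0..1}"

primrec cube_Ck ::
    "nat \<Rightarrow> nat \<Rightarrow> (nat \<Rightarrow> real) set \<Rightarrow> ((nat \<Rightarrow> real) \<Rightarrow> 'a::real_normed_vector) \<Rightarrow> bool" where
  "cube_Ck p 0 Q f \<longleftrightarrow> continuous_on Q f"
| "cube_Ck p (Suc n) Q f \<longleftrightarrow> continuous_on Q f \<and>
     (\<forall>i<p. (\<forall>t\<in>Q. (\<lambda>h. f (t(i := h))) differentiable (at (t i))) \<and>
        cube_Ck p n Q (\<lambda>t. vector_derivative (\<lambda>h. f (t(i := h))) (at (t i))))"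

text \<open>Smooth maps from the closed cube \<open>[0,1]\<^sup>p\<close> to a manifold: locally, in a chart, there is an extension to
  an open set all of whose iterated partial derivatives exist and are continuous.\<close>

definition smooth_on_cube ::
    "nat \<Rightarrow> ('a, 'e::findim) atlas \<Rightarrow> ((nat \<Rightarrow> real) \<Rightarrow> 'a) \<Rightarrow> bool" where
  "smooth_on_cube p \<A> f \<longleftrightarrow>
     (\<forall>t\<in>cube p. \<exists>(U, \<phi>)\<in>\<A>. f t \<in> U \<and>
        (\<exists>Q F. open Q \<and> t \<in> Q \<and> (\<forall>n. cube_Ck p n Q F) \<and>
           (\<forall>t'\<in>cube p \<inter> Q. f t' \<in> U \<and> \<phi> (f t') = F t')))"

text \<open>Integral over \<open>[0,1]\<^sup>p\<close> of the pullback of a \<open>p\<close>-form \<open>\<omega>\<close> under \<open>f\<close>, for the standard orientation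
  \<open>dt\<^sub>1 \<and> \<dots> \<and> dt\<^sub>p\<close>.\<close>

definition cube_integral ::
    "('a, 'e::findim) atlas \<Rightarrow> nat \<Rightarrow> ((nat \<Rightarrow> real) \<Rightarrow> 'a) \<Rightarrow> ('a \<Rightarrow> 'e list \<Rightarrow> 'k::findim) \<Rightarrow> 'k" where
  "cube_integral \<A> p f \<omega> =
     (LINT t:cube p|(\<Pi>\<^sub>M i\<in>{..<p}. lborel).
        \<omega> (f t) (map (\<lambda>i. velocity \<A> {0..1} (\<lambda>h. f (t(i := h))) (t i)) [0..<p]))"

text \<open>The map \<open>\<gamma>\<^bsup>(p)\<^esup>\<close>; for \<open>p = 0\<close> it is the unit at the base point.\<close>

fun cube_map ::
    "('g, 'm, 'e, 'b) groupoid \<Rightarrow> (real \<Rightarrow> 'g \<Rightarrow> 'g) \<Rightarrow> 'g list \<Rightarrow> 'm \<Rightarrow> (nat \<Rightarrow> real) \<Rightarrow> 'g" where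
  "cube_map \<G> lam [] m t = unt \<G> m"
| "cube_map \<G> lam [g] m t = lam (t 0) g"
| "cube_map \<G> lam (g # h # gs) m t =
     lam (t 0) (mlt \<G> g (cube_map \<G> lam (h # gs) m (\<lambda>i. t (Suc i))))"

end

theory Submission
  imports Defs
begin

text \<open>For degree reasons \<open>R\<^sub>G(\<alpha>) = q((-\<delta>k)\<^sup>p i(\<alpha>))\<close>. As \<open>\<lambda>\<^sub>s \<circ> \<lambda>\<^sub>r = \<lambda>\<^sub>s\<^sub>r\<close>, the homotopy operator \<open>T\<close> squares
  to zero, and the forms in its image vanish at the units. So if \<open>k\<close> or \<open>q\<close> is applied to \<open>\<delta>k\<psi>\<close>, only the
  last term of \<open>\<delta>\<close>, the one involving \<open>g\<^bsub>p+1\<^esub>g\<close>, contributes. By induction \<open>k(-\<delta>k)\<^sup>a i(\<alpha>)\<close> is up to sign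
  the integral over the parameters in \<open>[0,1]\<^bsup>a+1\<^esup>\<close> of the pullback of \<open>\<alpha>\<^sup>L\<close> under
  \<open>\<lambda>\<^bsub>t_1\<^esub>(g\<^sub>1 \<lambda>\<^bsub>t_2\<^esub>(g\<^sub>2 \<cdots> \<lambda>\<^bsub>t_(a+1)\<^esub>(g)))\<close>; Fubini's theorem merges the iterated integrals. The integrand is
  continuous because \<open>A\<close> has local smooth frames, in which the coefficients of the pullback can be written
  down.\<close>

section \<open>Smooth functions\<close>

text \<open>Three obstacles shape the proof. First, products, inverses and retractions exist only
  near the units. All computations therefore take place in a decreasing sequence of open sets in
  which each operation costs one level, and a claim about germs is settled once some finite level
  suffices; the numerals in the later statements count such levels. Second, the tangent map of a map
  on a target fibre is a chosen derivative within that fibre and is determined only on tangent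
  vectors. Vectors are therefore handled as velocities of curves in the fibre, and vectors at
  different arrows are compared after left translation to the units. Third, a Bochner integral that
  does not converge has the value 0, so additivity and Fubini's theorem require integrable
  integrands. Integrability is established for the explicit pullbacks of
  \<open>\<alpha>\<^sup>L\<close>, and alternation of the iterated forms is read off from these. The
  sign of the explicit integral comes from the newest \<open>k\<close> alone: in
  \<open>-\<delta>k\<close> the signs of the last face and of the preceding \<open>k\<close>
  cancel.\<close>

lemma linear_imp_bounded_linear_findim:
  fixes f :: "'a::findim \<Rightarrow> 'b::real_normed_vector"
  assumes "linear f"
  shows "bounded_linear f"
proof -
  obtain B :: "'a set" and c where B: "finite B" "\<forall>b. bounded_linear (c b)" "\<forall>x. x = (\<Sum>b\<in>B. c b x *\<^sub>R b)"
    using finite_coordinates by blast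
  have "f x = (\<Sum>b\<in>B. c b x *\<^sub>R f b)" for x
    using arg_cong[OF B(3)[rule_format, of x], of f]
    by (simp add: linear_sum[OF assms] linear_scale[OF assms])
  then have "f = (\<lambda>x. \<Sum>b\<in>B. c b x *\<^sub>R f b)" by blast
  moreover have "bounded_linear (\<lambda>x. \<Sum>b\<in>B. c b x *\<^sub>R f b)"
    using B(2) by (intro bounded_linear_sum bounded_linear_compose[OF bounded_linear_scaleR_left]) auto
  ultimately show ?thesis by simp
qed

section \<open>Finitely often differentiable functions on open sets of a model space\<close>

lemma Ck_on_subset: "Ck_on n S f \<Longrightarrow> T \<subseteq> S \<Longrightarrow> Ck_on n T f"
  by (induction n arbitrary: f) (auto intro: continuous_on_subset)

lemma Ck_on_cong:
  assumes "open S" "\<And>x. x \<in> S \<Longrightarrow> f x = g x" "Ck_on n S f"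
  shows "Ck_on n S g"
  using assms(2,3)
proof (induction n arbitrary: f g)
  case 0
  then show ?case by (metis Ck_on.simps(1) continuous_on_cong)
next
  case (Suc n)
  have d: "(g has_derivative frechet_derivative f (at x)) (at x)" if "x \<in> S" for x
  proof (rule has_derivative_transform_within_open[OF _ \<open>open S\<close> that Suc.prems(1)])
    show "(f has_derivative frechet_derivative f (at x)) (at x)"
      using Suc.prems(2) that by (simp add: frechet_derivative_works)
  qed
  then have "frechet_derivative g (at x) = frechet_derivative f (at x)" if "x \<in> S" for x
    using frechet_derivative_at[OF d[OF that]] by simp
  moreover have "Ck_on n S (\<lambda>x. frechet_derivative f (at x) v)" for v
    using Suc.prems(2) by simp
  ultimately have "Ck_on n S (\<lambda>x. frechet_derivative g (at x) v)" for v
    using Suc.IH[of "\<lambda>x. frechet_derivative f (at x) v" "\<lambda>x. frechet_derivative g (at x) v"] by simp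
  then show ?case
    using d by (auto simp: differentiable_def)
qed

lemma Ck_on_SucD: "Ck_on (Suc n) S f \<Longrightarrow> Ck_on n S f"
proof (induction n arbitrary: f)
  case 0
  then show ?case
    by (auto intro!: continuous_at_imp_continuous_on differentiable_imp_continuous_within)
qed auto

text \<open>Allows the derivative to be given in closed form. The calculus rules below are
  inductions on the order in which this rule supplies the successor step.\<close>

lemma Ck_on_SucI:
  assumes "open S" "\<And>x. x \<in> S \<Longrightarrow> (f has_derivative f' x) (at x)" "\<And>v. Ck_on n S (\<lambda>x. f' x v)"
  shows "Ck_on (Suc n) S f"
proof -
  have "f' x v = frechet_derivative f (at x) v" if "x \<in> S" for x v
    using frechet_derivative_at[OF assms(2)[OF that]] by simp
  then have "Ck_on n S (\<lambda>x. frechet_derivative f (at x) v)" for v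
    by (rule Ck_on_cong[OF assms(1) _ assms(3)])
  with assms(2) show ?thesis
    by (auto simp: differentiable_def)
qed

lemma Ck_on_SucE:
  assumes "Ck_on (Suc n) S f"
  shows "\<And>x. x \<in> S \<Longrightarrow> (f has_derivative frechet_derivative f (at x)) (at x)"
    "\<And>v. Ck_on n S (\<lambda>x. frechet_derivative f (at x) v)"
  using assms by (auto simp: frechet_derivative_works)

lemma Ck_on_const: "open S \<Longrightarrow> Ck_on n S (\<lambda>x. c)"
  by (induction n arbitrary: c)
    (auto intro!: Ck_on_SucI[where f' = "\<lambda>_ _. 0"] simp del: Ck_on.simps(2))

lemma Ck_on_bounded_linear: "bounded_linear L \<Longrightarrow> open S \<Longrightarrow> Ck_on n S L"
  by (cases n)
    (auto intro!: Ck_on_SucI[where f' = "\<lambda>_. L"] Ck_on_const bounded_linear_imp_has_derivative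
      intro: linear_continuous_on simp del: Ck_on.simps(2))

lemma Ck_on_linear_comp:
  assumes "bounded_linear L" "open S" "Ck_on n S f"
  shows "Ck_on n S (\<lambda>x. L (f x))"
  using assms(3)
proof (induction n arbitrary: f)
  case 0
  then show ?case using bounded_linear.continuous_on[OF assms(1)] by simp
next
  case (Suc n)
  show ?case
    by (intro Ck_on_SucI[where f' = "\<lambda>x v. L (frechet_derivative f (at x) v)"]
        bounded_linear.has_derivative[OF assms(1)] assms(2) Suc.IH Ck_on_SucE[OF Suc.prems])
qed

lemma Ck_on_add:
  assumes "open S" "Ck_on n S f" "Ck_on n S g"
  shows "Ck_on n S (\<lambda>x. f x + g x)"
  using assms(2,3)
proof (induction n arbitrary: f g)
  case 0
  then show ?case by (simp add: continuous_on_add)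
next
  case (Suc n)
  show ?case
    by (intro Ck_on_SucI[where f' = "\<lambda>x v. frechet_derivative f (at x) v + frechet_derivative g (at x) v"]
        has_derivative_add assms(1) Suc.IH Ck_on_SucE[OF Suc.prems(1)] Ck_on_SucE[OF Suc.prems(2)])
qed

lemma Ck_on_sum:
  assumes "open S" "\<And>i. i \<in> I \<Longrightarrow> Ck_on n S (f i)"
  shows "Ck_on n S (\<lambda>x. \<Sum>i\<in>I. f i x)"
  using assms(2) by (induction I rule: infinite_finite_induct) (auto intro!: Ck_on_add Ck_on_const assms(1))

lemma Ck_on_scaleR:
  fixes a :: "'a::real_normed_vector \<Rightarrow> real"
  assumes "open S" "Ck_on n S a" "Ck_on n S f"
  shows "Ck_on n S (\<lambda>x. a x *\<^sub>R f x)"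
  using assms(2,3)
proof (induction n arbitrary: a f)
  case 0
  then show ?case by (simp add: continuous_on_scaleR)
next
  case (Suc n)
  then have "Ck_on n S a" "Ck_on n S f" by (auto simp del: Ck_on.simps dest: Ck_on_SucD)
  then show ?case
    by (intro Ck_on_SucI[where f' = "\<lambda>x v. a x *\<^sub>R frechet_derivative f (at x) v + frechet_derivative a (at x) v *\<^sub>R f x"]
        has_derivative_scaleR Ck_on_add assms(1) Suc.IH Ck_on_SucE[OF Suc.prems(1)] Ck_on_SucE[OF Suc.prems(2)])
qed

text \<open>The derivative at \<open>x\<close> is built from two factors \<open>inverse x\<close>
  and the vector, so the product rule and the induction hypothesis apply to it.\<close>

lemma Ck_on_inverse: "Ck_on n (- {0::real}) inverse"
proof (induction n)
  case 0
  then show ?case by (auto intro!: continuous_intros)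
next
  case (Suc n)
  have "Ck_on n (- {0}) (\<lambda>x. inverse x *\<^sub>R (inverse x *\<^sub>R (- v :: real)))" for v
    by (intro Ck_on_scaleR Suc Ck_on_const) auto
  then have "Ck_on n (- {0}) (\<lambda>x. - (inverse x * v * inverse x :: real))" for v
    by (simp add: mult_ac)
  then show ?case
    by (intro Ck_on_SucI[where f' = "\<lambda>x v. - (inverse x * v * inverse x)"])
      (auto intro!: derivative_eq_intros)
qed

text \<open>In the chain rule the derivative of \<open>g\<close> is applied to a vector that varies
  with \<open>x\<close>, while \<open>Ck_on\<close> speaks of fixed vectors only. Expanding that
  vector in finitely many coordinates gives a sum of products to which the induction hypothesis
  applies; this is where finite dimension enters.\<close>

lemma Ck_on_compose:
  fixes g :: "'b::findim \<Rightarrow> 'c::real_normed_vector"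
  assumes "open S" "Ck_on n U g" "Ck_on n S f" "f ` S \<subseteq> U"
  shows "Ck_on n S (\<lambda>x. g (f x))"
proof -
  obtain B :: "'b set" and c where B: "finite B" "\<forall>b. bounded_linear (c b)" "\<forall>x. x = (\<Sum>b\<in>B. c b x *\<^sub>R b)"
    using finite_coordinates by blast
  show ?thesis
    using assms(2-4)
  proof (induction n arbitrary: f g)
    case 0
    then show ?case by (auto intro: continuous_on_compose2)
  next
    case (Suc n)
    from Suc.prems(2) have f: "Ck_on n S f" by (rule Ck_on_SucD)
    note df = Ck_on_SucE(1)[OF Suc.prems(2)] and df' = Ck_on_SucE(2)[OF Suc.prems(2)]
    note dg = Ck_on_SucE(1)[OF Suc.prems(1)] and dg' = Ck_on_SucE(2)[OF Suc.prems(1)]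
    let ?D = "\<lambda>x v. \<Sum>b\<in>B. c b (frechet_derivative f (at x) v) *\<^sub>R frechet_derivative g (at (f x)) b"
    have "((\<lambda>x. g (f x)) has_derivative ?D x) (at x)" if "x \<in> S" for x
    proof -
      have fx: "f x \<in> U" using that Suc.prems(3) by auto
      have lin: "linear (frechet_derivative g (at (f x)))"
        using dg[OF fx] by (rule has_derivative_linear)
      have "?D x v = frechet_derivative g (at (f x)) (frechet_derivative f (at x) v)" for v
        using arg_cong[OF B(3)[rule_format, of "frechet_derivative f (at x) v"], of "frechet_derivative g (at (f x))"]
        by (simp only: linear_sum[OF lin] linear_scale[OF lin])
      then show ?thesis
        using has_derivative_compose[OF df[OF that] dg[OF fx]] by simp
    qed
    then show ?case
      by (intro Ck_on_SucI[where f' = ?D] assms(1) Ck_on_sum Ck_on_scaleR Suc.IH f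
          Ck_on_linear_comp[OF B(2)[rule_format]] df' dg' Suc.prems(3))
  qed
qed

lemma Ck_on_Pair:
  assumes "open S" "Ck_on n S f" "Ck_on n S g"
  shows "Ck_on n S (\<lambda>x. (f x, g x))"
proof -
  have "Ck_on n S (\<lambda>x. (f x, 0) + (0, g x))"
    by (intro Ck_on_add assms Ck_on_linear_comp[of "\<lambda>y. (y, 0)"] Ck_on_linear_comp[of "\<lambda>y. (0, y)"]
        bounded_linear_Pair bounded_linear_ident bounded_linear_zero)
  then show ?thesis by simp
qed

lemma smooth_on_subset: "smooth_on S f \<Longrightarrow> T \<subseteq> S \<Longrightarrow> smooth_on T f"
  unfolding smooth_on_def by (blast intro: Ck_on_subset)

lemma smooth_on_cong: "open S \<Longrightarrow> (\<And>x. x \<in> S \<Longrightarrow> f x = g x) \<Longrightarrow> smooth_on S f \<Longrightarrow> smooth_on S g"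
  unfolding smooth_on_def by (blast intro: Ck_on_cong)

lemma smooth_on_const: "open S \<Longrightarrow> smooth_on S (\<lambda>x. c)"
  unfolding smooth_on_def by (simp add: Ck_on_const)

lemma smooth_on_bounded_linear: "bounded_linear L \<Longrightarrow> open S \<Longrightarrow> smooth_on S L"
  unfolding smooth_on_def by (blast intro: Ck_on_bounded_linear)

lemma smooth_on_add: "open S \<Longrightarrow> smooth_on S f \<Longrightarrow> smooth_on S g \<Longrightarrow> smooth_on S (\<lambda>x. f x + g x)"
  unfolding smooth_on_def by (blast intro: Ck_on_add)

lemma smooth_on_sum: "open S \<Longrightarrow> (\<And>i. i \<in> I \<Longrightarrow> smooth_on S (f i)) \<Longrightarrow> smooth_on S (\<lambda>x. \<Sum>i\<in>I. f i x)"
  unfolding smooth_on_def by (blast intro: Ck_on_sum)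

lemma smooth_on_scaleR:
  fixes a :: "_ \<Rightarrow> real"
  shows "open S \<Longrightarrow> smooth_on S a \<Longrightarrow> smooth_on S f \<Longrightarrow> smooth_on S (\<lambda>x. a x *\<^sub>R f x)"
  unfolding smooth_on_def by (blast intro: Ck_on_scaleR)

lemma smooth_on_compose:
  fixes g :: "'b::findim \<Rightarrow> 'c::real_normed_vector"
  shows "open S \<Longrightarrow> smooth_on U g \<Longrightarrow> smooth_on S f \<Longrightarrow> f ` S \<subseteq> U \<Longrightarrow> smooth_on S (\<lambda>x. g (f x))"
  unfolding smooth_on_def by (blast intro: Ck_on_compose)

lemma smooth_on_Pair: "open S \<Longrightarrow> smooth_on S f \<Longrightarrow> smooth_on S g \<Longrightarrow> smooth_on S (\<lambda>x. (f x, g x))"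
  unfolding smooth_on_def by (blast intro: Ck_on_Pair)

lemma smooth_on_inverse:
  fixes a :: "_ \<Rightarrow> real"
  assumes "open S" "smooth_on S a" "\<And>x. x \<in> S \<Longrightarrow> a x \<noteq> 0"
  shows "smooth_on S (\<lambda>x. inverse (a x))"
  by (rule smooth_on_compose[OF assms(1) _ assms(2), of "- {0}"])
    (use assms(3) Ck_on_inverse in \<open>auto simp: smooth_on_def\<close>)

lemma smooth_on_continuous: "smooth_on S f \<Longrightarrow> continuous_on S f"
  unfolding smooth_on_def by (metis Ck_on.simps(1))

lemma smooth_on_has_derivative:
  "smooth_on S f \<Longrightarrow> x \<in> S \<Longrightarrow> (f has_derivative frechet_derivative f (at x)) (at x)"
  unfolding smooth_on_def by (metis Ck_on.simps(2) frechet_derivative_works)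

lemma smooth_on_frechet: "smooth_on S f \<Longrightarrow> smooth_on S (\<lambda>x. frechet_derivative f (at x) v)"
  unfolding smooth_on_def by (metis Ck_on.simps(2))

text \<open>Again a varying vector is expanded in coordinates, so that the derivative is only
  applied to fixed vectors.\<close>

lemma smooth_on_frechet_var:
  fixes f :: "'a::findim \<Rightarrow> 'b::real_normed_vector" and v :: "'c::real_normed_vector \<Rightarrow> 'a"
  assumes S: "open S" and U: "smooth_on U f" and x: "smooth_on S x" "x ` S \<subseteq> U" and v: "smooth_on S v"
  shows "smooth_on S (\<lambda>y. frechet_derivative f (at (x y)) (v y))"
proof -
  obtain B :: "'a set" and c where B: "finite B" "\<forall>b. bounded_linear (c b)" "\<forall>x. x = (\<Sum>b\<in>B. c b x *\<^sub>R b)"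
    using finite_coordinates by blast
  have *: "smooth_on S (\<lambda>y. \<Sum>b\<in>B. c b (v y) *\<^sub>R frechet_derivative f (at (x y)) b)"
    by (intro smooth_on_sum smooth_on_scaleR S
        smooth_on_compose[OF S smooth_on_bounded_linear[OF B(2)[rule_format] open_UNIV] v]
        smooth_on_compose[OF S smooth_on_frechet[OF U] x(1) x(2)]) auto
  have "(\<Sum>b\<in>B. c b (v y) *\<^sub>R frechet_derivative f (at (x y)) b) = frechet_derivative f (at (x y)) (v y)"
    if "y \<in> S" for y
  proof -
    have lin: "linear (frechet_derivative f (at (x y)))"
      using x(2) that by (intro has_derivative_linear[OF smooth_on_has_derivative[OF U]]) auto
    show ?thesis
      using arg_cong[OF B(3)[rule_format, of "v y"], of "frechet_derivative f (at (x y))"]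
      by (simp only: linear_sum[OF lin] linear_scale[OF lin])
  qed
  with * show ?thesis by (rule smooth_on_cong[OF S, rotated])
qed

section \<open>Iterated partial derivatives in finitely many real parameters\<close>

lemma cube_Ck_continuous: "cube_Ck p n Q f \<Longrightarrow> continuous_on Q f"
  by (cases n) auto

lemma cube_Ck_subset: "cube_Ck p n Q f \<Longrightarrow> Q' \<subseteq> Q \<Longrightarrow> cube_Ck p n Q' f"
  by (induction n arbitrary: f) (auto intro: continuous_on_subset)

lemma continuous_on_fun_upd:
  fixes x :: "'a::topological_space \<Rightarrow> 'i \<Rightarrow> 'b::topological_space"
  assumes "continuous_on S x" "continuous_on S h"
  shows "continuous_on S (\<lambda>s. (x s)(i := h s))"
proof (rule continuous_on_coordinatewise_then_product)
  fix j
  show "continuous_on S (\<lambda>s. ((x s)(i := h s)) j)"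
    using assms continuous_on_product_then_coordinatewise[OF assms(1), of j] by (cases "j = i") auto
qed

lemma eventually_fun_upd_open:
  fixes t :: "'i \<Rightarrow> 'b::topological_space"
  assumes "open Q" "t(i := h0) \<in> Q"
  shows "\<forall>\<^sub>F h in nhds h0. t(i := h) \<in> Q"
proof -
  have "continuous_on UNIV (\<lambda>h. t(i := h))"
    by (intro continuous_on_fun_upd continuous_on_const continuous_on_id)
  then have "open ((\<lambda>h. t(i := h)) -` Q)"
    using assms(1) continuous_on_open_vimage[of UNIV] by auto
  then show ?thesis
    using assms(2) by (auto simp: eventually_nhds intro!: exI[of _ "(\<lambda>h. t(i := h)) -` Q"])
qed

lemma cube_Ck_cong:
  assumes "open Q" "\<And>t. t \<in> Q \<Longrightarrow> f t = g t" "cube_Ck p n Q f"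
  shows "cube_Ck p n Q g"
  using assms(2,3)
proof (induction n arbitrary: f g)
  case 0
  then show ?case using continuous_on_cong[of Q Q f g] by simp
next
  case (Suc n)
  let ?d = "\<lambda>f i t. vector_derivative (\<lambda>h. f (t(i := h))) (at (t i))"
  have d: "((\<lambda>h. g (t(i := h))) has_vector_derivative ?d f i t) (at (t i))" if it: "i < p" "t \<in> Q" for i t
  proof -
    have "((\<lambda>h. f (t(i := h))) has_vector_derivative ?d f i t) (at (t i))"
      using Suc.prems(2) it by (simp only: cube_Ck.simps vector_derivative_works)
    moreover have "\<forall>\<^sub>F h in nhds (t i). h \<in> UNIV \<longrightarrow> f (t(i := h)) = g (t(i := h))"
      using eventually_fun_upd_open[OF assms(1), of t i "t i"] it Suc.prems(1)
      by (auto elim!: eventually_mono)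
    ultimately show ?thesis
      using has_vector_derivative_cong_ev[where x = "t i" and S = UNIV and f = "\<lambda>h. f (t(i := h))" and g = "\<lambda>h. g (t(i := h))"] it Suc.prems(1)
      by simp
  qed
  have "cube_Ck p n Q (?d g i)" if "i < p" for i
  proof (rule Suc.IH[of "?d f i" "?d g i"])
    show "?d f i t = ?d g i t" if "t \<in> Q" for t
      using vector_derivative_at[OF d[OF \<open>i < p\<close> that]] by simp
    show "cube_Ck p n Q (?d f i)" using Suc.prems(2) that by simp
  qed
  moreover have "continuous_on Q g"
    using Suc.prems continuous_on_cong[of Q Q f g] by simp
  ultimately show ?case
    using d by (auto intro: differentiableI_vector)
qed

lemma cube_Ck_SucI:
  assumes "open Q" "continuous_on Q f"
    and "\<And>i t. i < p \<Longrightarrow> t \<in> Q \<Longrightarrow> ((\<lambda>h. f (t(i := h))) has_vector_derivative f' i t) (at (t i))"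
    and "\<And>i. i < p \<Longrightarrow> cube_Ck p n Q (f' i)"
  shows "cube_Ck p (Suc n) Q f"
proof -
  have "f' i t = vector_derivative (\<lambda>h. f (t(i := h))) (at (t i))" if "i < p" "t \<in> Q" for i t
    using vector_derivative_at[OF assms(3)[OF that]] by simp
  then have "cube_Ck p n Q (\<lambda>t. vector_derivative (\<lambda>h. f (t(i := h))) (at (t i)))" if "i < p" for i
    using that by (intro cube_Ck_cong[OF assms(1) _ assms(4)[OF that]]) auto
  with assms(2,3) show ?thesis
    by (auto intro: differentiableI_vector)
qed

lemma cube_Ck_SucE:
  assumes "cube_Ck p (Suc n) Q f"
  shows "continuous_on Q f"
    "\<And>i t. i < p \<Longrightarrow> t \<in> Q \<Longrightarrow> ((\<lambda>h. f (t(i := h))) has_vector_derivative vector_derivative (\<lambda>h. f (t(i := h))) (at (t i))) (at (t i))"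
    "\<And>i. i < p \<Longrightarrow> cube_Ck p n Q (\<lambda>t. vector_derivative (\<lambda>h. f (t(i := h))) (at (t i)))"
  using assms by (auto simp: vector_derivative_works)

text \<open>Every order of \<open>cube_Ck\<close> contains continuity, since the existence of
  partial derivatives does not imply it; compare \<open>Ck_on_SucD\<close>, where it follows from
  differentiability.\<close>

lemma cube_Ck_SucD: "cube_Ck p (Suc n) Q f \<Longrightarrow> cube_Ck p n Q f"
  by (induction n arbitrary: f) auto

lemma cube_Ck_const: "open Q \<Longrightarrow> cube_Ck p n Q (\<lambda>t. c)"
  by (induction n arbitrary: c)
    (auto intro!: cube_Ck_SucI[where f' = "\<lambda>_ _. 0"] continuous_intros simp del: cube_Ck.simps(2))

lemma cube_Ck_coord:
  assumes "open Q" shows "cube_Ck p n Q (\<lambda>t. t j)"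
proof -
  have cont: "continuous_on Q (\<lambda>t::nat \<Rightarrow> real. t j)"
    by (intro continuous_on_product_coordinates continuous_on_subset[OF _ subset_UNIV])
  show ?thesis
  proof (cases n)
    case (Suc m)
    show ?thesis
      unfolding Suc using assms cont
      by (intro cube_Ck_SucI[where f' = "\<lambda>i _. if i = j then 1 else 0"] cube_Ck_const)
        (auto intro!: derivative_eq_intros)
  qed (use cont in auto)
qed

lemma cube_Ck_linear_comp:
  assumes "bounded_linear L" "open Q" "cube_Ck p n Q f"
  shows "cube_Ck p n Q (\<lambda>t. L (f t))"
  using assms(3)
proof (induction n arbitrary: f)
  case 0
  then show ?case using bounded_linear.continuous_on[OF assms(1)] by simp
next
  case (Suc n)
  show ?case
    by (intro cube_Ck_SucI[where f' = "\<lambda>i t. L (vector_derivative (\<lambda>h. f (t(i := h))) (at (t i)))"]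
        bounded_linear.has_vector_derivative[OF assms(1)] assms(2) Suc.IH bounded_linear.continuous_on[OF assms(1)] cube_Ck_SucE[OF Suc.prems])
qed

lemma cube_Ck_add:
  assumes "open Q" "cube_Ck p n Q f" "cube_Ck p n Q g"
  shows "cube_Ck p n Q (\<lambda>t. f t + g t)"
  using assms(2,3)
proof (induction n arbitrary: f g)
  case 0
  then show ?case by (simp add: continuous_on_add)
next
  case (Suc n)
  show ?case
    by (intro cube_Ck_SucI[where f' = "\<lambda>i t. vector_derivative (\<lambda>h. f (t(i := h))) (at (t i)) + vector_derivative (\<lambda>h. g (t(i := h))) (at (t i))"]
        has_vector_derivative_add assms(1) Suc.IH continuous_on_add cube_Ck_SucE[OF Suc.prems(1)] cube_Ck_SucE[OF Suc.prems(2)])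
qed

lemma cube_Ck_sum:
  assumes "open Q" "\<And>i. i \<in> I \<Longrightarrow> cube_Ck p n Q (f i)"
  shows "cube_Ck p n Q (\<lambda>x. \<Sum>i\<in>I. f i x)"
  using assms(2) by (induction I rule: infinite_finite_induct) (auto intro!: cube_Ck_add cube_Ck_const assms(1))

lemma cube_Ck_scaleR:
  fixes a :: "_ \<Rightarrow> real"
  assumes "open Q" "cube_Ck p n Q a" "cube_Ck p n Q f"
  shows "cube_Ck p n Q (\<lambda>t. a t *\<^sub>R f t)"
  using assms(2,3)
proof (induction n arbitrary: a f)
  case 0
  then show ?case by (simp add: continuous_on_scaleR)
next
  case (Suc n)
  then have af: "cube_Ck p n Q a" "cube_Ck p n Q f" by (auto simp del: cube_Ck.simps dest: cube_Ck_SucD)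
  let ?d = "\<lambda>f i t. vector_derivative (\<lambda>h. f (t(i := h))) (at (t i))"
  note a = cube_Ck_SucE[OF Suc.prems(1)]
  note f = cube_Ck_SucE[OF Suc.prems(2)]
  show ?case
  proof (rule cube_Ck_SucI[where f' = "\<lambda>i t. a t *\<^sub>R ?d f i t + ?d a i t *\<^sub>R f t"])
    fix i t assume it: "i < p" "t \<in> Q"
    have "((\<lambda>h. a (t(i := h))) has_field_derivative ?d a i t) (at (t i))"
      using a(2)[OF it] by (simp only: has_real_derivative_iff_has_vector_derivative)
    from has_vector_derivative_scaleR[OF this f(2)[OF it]]
    show "((\<lambda>h. a (t(i := h)) *\<^sub>R f (t(i := h))) has_vector_derivative a t *\<^sub>R ?d f i t + ?d a i t *\<^sub>R f t) (at (t i))"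
      by (simp only: fun_upd_triv)
  qed (intro assms a f continuous_intros cube_Ck_add Suc.IH af | assumption)+
qed

text \<open>Only one coordinate moves at a time, so the one-variable chain rule suffices. The outer
  derivative is expanded in coordinates as in \<open>Ck_on_compose\<close>.\<close>

lemma cube_Ck_compose:
  fixes g :: "'b::findim \<Rightarrow> 'c::real_normed_vector"
  assumes "open Q" "Ck_on n U g" "cube_Ck p n Q f" "f ` Q \<subseteq> U"
  shows "cube_Ck p n Q (\<lambda>x. g (f x))"
proof -
  obtain B :: "'b set" and c where B: "finite B" "\<forall>b. bounded_linear (c b)" "\<forall>x. x = (\<Sum>b\<in>B. c b x *\<^sub>R b)"
    using finite_coordinates by blast
  show ?thesis
    using assms(2-4)
  proof (induction n arbitrary: f g)
    case 0
    then show ?case by (auto intro: continuous_on_compose2)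
  next
    case (Suc n)
    have fn: "cube_Ck p n Q f" by (rule cube_Ck_SucD[OF Suc.prems(2)])
    let ?d = "\<lambda>f i t. vector_derivative (\<lambda>h. f (t(i := h))) (at (t i))"
    note f = cube_Ck_SucE[OF Suc.prems(2)]
    note dg = Ck_on_SucE(1)[OF Suc.prems(1)] and dg' = Ck_on_SucE(2)[OF Suc.prems(1)]
    have g0: "continuous_on U g"
      using Suc.prems(1) by (auto intro!: continuous_at_imp_continuous_on differentiable_imp_continuous_within)
    let ?D = "\<lambda>i t. \<Sum>b\<in>B. c b (?d f i t) *\<^sub>R frechet_derivative g (at (f t)) b"
    have "((\<lambda>h. g (f (t(i := h)))) has_vector_derivative ?D i t) (at (t i))" if it: "i < p" "t \<in> Q" for i t
    proof -
      have fx: "f t \<in> U" using that Suc.prems(3) by auto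
      have lin: "linear (frechet_derivative g (at (f t)))"
        using dg[OF fx] by (rule has_derivative_linear)
      have D: "?D i t = frechet_derivative g (at (f t)) (?d f i t)"
        using arg_cong[OF B(3)[rule_format, of "?d f i t"], of "frechet_derivative g (at (f t))"]
        by (simp only: linear_sum[OF lin] linear_scale[OF lin])
      have "(g has_derivative frechet_derivative g (at (f t))) (at (f (t(i := t i))) within range (\<lambda>h. f (t(i := h))))"
        using dg[OF fx] by (simp add: has_derivative_at_withinI)
      from vector_derivative_diff_chain_within[OF f(2)[OF it] this]
      show ?thesis unfolding D by (simp only: o_def)
    qed
    then show ?case
      by (intro cube_Ck_SucI[where f' = ?D] assms(1) cube_Ck_sum cube_Ck_scaleR Suc.IH fn
          cube_Ck_linear_comp[OF B(2)[rule_format]] f(3) dg' Suc.prems(3)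
          continuous_on_compose2[OF g0 f(1)])
  qed
qed

lemma cube_Ck_Pair:
  assumes "open Q" "cube_Ck p n Q f" "cube_Ck p n Q g"
  shows "cube_Ck p n Q (\<lambda>x. (f x, g x))"
proof -
  have "cube_Ck p n Q (\<lambda>x. (f x, 0) + (0, g x))"
    by (intro cube_Ck_add assms cube_Ck_linear_comp[of "\<lambda>y. (y, 0)"] cube_Ck_linear_comp[of "\<lambda>y. (0, y)"]
        bounded_linear_Pair bounded_linear_ident bounded_linear_zero)
  then show ?thesis by simp
qed

section \<open>Smooth maps and smooth families\<close>

text \<open>The part of the manifold axioms that continuity arguments use on the source side. It
  passes to product atlases without any discussion of their transition maps.\<close>

definition cts_atlas :: "('a::topological_space, 'e::findim) atlas \<Rightarrow> bool" where
  "cts_atlas \<A> \<longleftrightarrow> \<Union>(fst ` \<A>) = UNIV \<and> (\<forall>(U, \<phi>)\<in>\<A>. open U \<and> continuous_on U \<phi>)"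

lemma atlas_cover: "\<Union>(fst ` \<A>) = UNIV \<Longrightarrow> \<exists>U \<phi>. (U, \<phi>) \<in> \<A> \<and> x \<in> U"
  by (metis UN_E UNIV_I prod.collapse)

lemma manifold_atlas_cover: "manifold_atlas \<A> \<Longrightarrow> \<Union>(fst ` \<A>) = UNIV"
  by (simp add: manifold_atlas_def)

lemma cts_atlas_cover: "cts_atlas \<A> \<Longrightarrow> \<Union>(fst ` \<A>) = UNIV"
  by (simp add: cts_atlas_def)

lemma manifold_chart:
  assumes "manifold_atlas \<A>" "(U, \<phi>) \<in> \<A>"
  shows "open U" "open (\<phi> ` U)" "inj_on \<phi> U" "continuous_on U \<phi>"
    and "\<And>X. open X \<Longrightarrow> open (\<phi> ` (U \<inter> X))"
proof -
  have *: "open U \<and> open (\<phi> ` U) \<and> (\<exists>\<psi>. homeomorphism U (\<phi> ` U) \<phi> \<psi>)"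
    using assms by (auto simp: manifold_atlas_def)
  then obtain \<psi> where \<psi>: "homeomorphism U (\<phi> ` U) \<phi> \<psi>" by blast
  show "open U" "open (\<phi> ` U)" using * by auto
  show "inj_on \<phi> U" using \<psi> by (metis homeomorphism_apply1 inj_onI)
  show "continuous_on U \<phi>" using \<psi> by (rule homeomorphism_cont1)
  show "open (\<phi> ` (U \<inter> X))" if "open X" for X
  proof -
    have "openin (top_of_set (\<phi> ` U)) (\<phi> ` (U \<inter> X))"
      using homeomorphism_imp_open_map[OF \<psi>] that by (simp add: openin_open_Int)
    then show ?thesis using * by (simp add: openin_open_eq)
  qed
qed

lemma manifold_transition:
  assumes "manifold_atlas \<A>" "(U, \<phi>) \<in> \<A>" "(W, \<theta>) \<in> \<A>"
  shows "smooth_on (\<phi> ` (U \<inter> W)) (\<theta> \<circ> inv_into U \<phi>)" "open (\<phi> ` (U \<inter> W))"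
proof -
  show "smooth_on (\<phi> ` (U \<inter> W)) (\<theta> \<circ> inv_into U \<phi>)"
    using assms unfolding manifold_atlas_def by blast
  show "open (\<phi> ` (U \<inter> W))"
    using manifold_chart(5)[OF assms(1,2)] manifold_chart(1)[OF assms(1,3)] by blast
qed

lemma manifold_imp_cts_atlas: "manifold_atlas \<A> \<Longrightarrow> cts_atlas \<A>"
  unfolding cts_atlas_def by (intro conjI ballI case_prodI2) (simp_all add: manifold_atlas_cover manifold_chart)

lemma cts_atlas_vs: "cts_atlas vs_atlas"
  by (simp add: cts_atlas_def vs_atlas_def)

lemma cts_atlas_prod:
  assumes "cts_atlas \<A>" "cts_atlas \<B>"
  shows "cts_atlas (prod_atlas \<A> \<B>)"
proof -
  have "\<exists>c\<in>prod_atlas \<A> \<B>. (x, y) \<in> fst c" for x y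
  proof -
    obtain U \<phi> W \<theta> where "(U, \<phi>) \<in> \<A>" "x \<in> U" "(W, \<theta>) \<in> \<B>" "y \<in> W"
      using assms atlas_cover cts_atlas_cover by metis
    then show ?thesis
      by (intro bexI[of _ "(U \<times> W, map_prod \<phi> \<theta>)"]) (auto simp: prod_atlas_def)
  qed
  then have "\<Union>(fst ` prod_atlas \<A> \<B>) = UNIV" by fastforce
  moreover have "open (U \<times> W) \<and> continuous_on (U \<times> W) (map_prod \<phi> \<theta>)"
    if "(U, \<phi>) \<in> \<A>" "(W, \<theta>) \<in> \<B>" for U \<phi> W \<theta>
  proof -
    from that assms have c: "open U" "continuous_on U \<phi>" "open W" "continuous_on W \<theta>"
      by (auto simp: cts_atlas_def)
    have "continuous_on (U \<times> W) (\<lambda>z. (\<phi> (fst z), \<theta> (snd z)))"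
      by (intro continuous_on_Pair continuous_on_compose2[OF c(2)] continuous_on_compose2[OF c(4)]
          continuous_on_fst continuous_on_snd continuous_on_id) auto
    with c show ?thesis by (auto simp: open_Times map_prod_def case_prod_unfold)
  qed
  ultimately show ?thesis by (auto simp: cts_atlas_def prod_atlas_def)
qed

section \<open>Smooth maps on subsets and their composition with parametrised families\<close>

lemma open_vimage_Int: "continuous_on U f \<Longrightarrow> open U \<Longrightarrow> open B \<Longrightarrow> open (f -` B \<inter> U)"
  using continuous_on_open_vimage by blast

lemma smooth_map_onD:
  assumes "smooth_map_on \<A> \<B> S f" "x \<in> S" "(U, \<phi>) \<in> \<A>" "x \<in> U" "(W, \<theta>) \<in> \<B>" "f x \<in> W"
  obtains Q F where "open Q" "\<phi> x \<in> Q" "Q \<subseteq> \<phi> ` U" "smooth_on Q F"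
    "\<And>y. y \<in> S \<Longrightarrow> y \<in> U \<Longrightarrow> \<phi> y \<in> Q \<Longrightarrow> f y \<in> W \<and> \<theta> (f y) = F (\<phi> y)"
proof -
  from assms(1)[unfolded smooth_map_on_def, rule_format, OF assms(2,3)] assms(4-6)
  have "\<exists>Q F. open Q \<and> \<phi> x \<in> Q \<and> Q \<subseteq> \<phi> ` U \<and> smooth_on Q F \<and>
      (\<forall>y\<in>S \<inter> U. \<phi> y \<in> Q \<longrightarrow> f y \<in> W \<and> \<theta> (f y) = F (\<phi> y))"
    by blast
  then show ?thesis using that by blast
qed

lemma smooth_map_onI:
  assumes "\<And>x U \<phi> W \<theta>. x \<in> S \<Longrightarrow> (U, \<phi>) \<in> \<A> \<Longrightarrow> x \<in> U \<Longrightarrow> (W, \<theta>) \<in> \<B> \<Longrightarrow> f x \<in> W \<Longrightarrow>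
    \<exists>Q F. open Q \<and> \<phi> x \<in> Q \<and> Q \<subseteq> \<phi> ` U \<and> smooth_on Q F \<and>
      (\<forall>y\<in>S \<inter> U. \<phi> y \<in> Q \<longrightarrow> f y \<in> W \<and> \<theta> (f y) = F (\<phi> y))"
  shows "smooth_map_on \<A> \<B> S f"
  unfolding smooth_map_on_def using assms by blast

lemma smooth_on_open_vimage: "smooth_on Q F \<Longrightarrow> open Q \<Longrightarrow> open T \<Longrightarrow> open {q \<in> Q. F q \<in> T}"
  using continuous_open_preimage[OF smooth_on_continuous, of Q F T]
  by (auto simp: vimage_def Int_def)

text \<open>Charts of the target are open maps, so a neighbourhood of \<open>f x\<close> becomes an
  open set of the model space and can be pulled back along the local extension \<open>F\<close>. On
  the source side continuous charts are enough.\<close>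

lemma smooth_map_on_continuous:
  assumes "cts_atlas \<A>" "manifold_atlas \<B>" "smooth_map_on \<A> \<B> S f"
  shows "continuous_on S f"
  unfolding continuous_on_topological
proof (intro ballI allI impI)
  fix x X assume x: "x \<in> S" and X: "open X" "f x \<in> X"
  obtain U \<phi> W \<theta> where ch: "(U, \<phi>) \<in> \<A>" "x \<in> U" "(W, \<theta>) \<in> \<B>" "f x \<in> W"
    using assms atlas_cover cts_atlas_cover manifold_atlas_cover by metis
  obtain Q F where Q: "open Q" "\<phi> x \<in> Q" "Q \<subseteq> \<phi> ` U" "smooth_on Q F"
    "\<And>y. y \<in> S \<Longrightarrow> y \<in> U \<Longrightarrow> \<phi> y \<in> Q \<Longrightarrow> f y \<in> W \<and> \<theta> (f y) = F (\<phi> y)"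
    using smooth_map_onD[OF assms(3) x ch] by blast
  note W = manifold_chart[OF assms(2) ch(3)]
  let ?T = "{q \<in> Q. F q \<in> \<theta> ` (W \<inter> X)}"
  have "open ?T" by (rule smooth_on_open_vimage[OF Q(4,1) W(5)[OF X(1)]])
  moreover have "open U" "continuous_on U \<phi>" using assms(1) ch(1) by (auto simp: cts_atlas_def)
  ultimately have "open (\<phi> -` ?T \<inter> U)" by (intro open_vimage_Int)
  moreover have "x \<in> \<phi> -` ?T \<inter> U" using Q(2) Q(5)[OF x ch(2) Q(2)] ch(2) X(2) by force
  moreover have "f y \<in> X" if "y \<in> S" "y \<in> \<phi> -` ?T \<inter> U" for y
  proof -
    from that have "f y \<in> W" "\<theta> (f y) \<in> \<theta> ` (W \<inter> X)" using Q(5)[of y] by auto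
    with W(3) show ?thesis by (auto dest: inj_onD)
  qed
  ultimately show "\<exists>A. open A \<and> x \<in> A \<and> (\<forall>y\<in>S. y \<in> A \<longrightarrow> f y \<in> X)" by blast
qed

text \<open>Used for left multiplication by a fixed arrow and for the retraction at a fixed
  time.\<close>

lemma smooth_map_on_partial:
  assumes cov: "\<Union>(fst ` \<A>) = UNIV" and f: "smooth_map_on (prod_atlas \<A> \<B>) \<C> S f"
  shows "smooth_map_on \<B> \<C> {y. (x, y) \<in> S} (\<lambda>y. f (x, y))"
proof (rule smooth_map_onI)
  fix y U \<phi> W \<theta>
  assume y: "y \<in> {y. (x, y) \<in> S}" and ch: "(U, \<phi>) \<in> \<B>" "y \<in> U" "(W, \<theta>) \<in> \<C>" "f (x, y) \<in> W"
  obtain V \<psi> where V: "(V, \<psi>) \<in> \<A>" "x \<in> V" using atlas_cover[OF cov] by blast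
  have p: "(V \<times> U, map_prod \<psi> \<phi>) \<in> prod_atlas \<A> \<B>" using V ch by (auto simp: prod_atlas_def)
  obtain Q F where Q: "open Q" "map_prod \<psi> \<phi> (x, y) \<in> Q" "Q \<subseteq> map_prod \<psi> \<phi> ` (V \<times> U)" "smooth_on Q F"
    "\<And>z. z \<in> S \<Longrightarrow> z \<in> V \<times> U \<Longrightarrow> map_prod \<psi> \<phi> z \<in> Q \<Longrightarrow> f z \<in> W \<and> \<theta> (f z) = F (map_prod \<psi> \<phi> z)"
  proof (rule smooth_map_onD[OF f _ p _ ch(3,4)])
    show "(x, y) \<in> S" "(x, y) \<in> V \<times> U" using y ch V by auto
  qed blast
  let ?Q = "Pair (\<psi> x) -` Q"
  have oQ: "open ?Q"
    using Q(1) continuous_on_open_vimage[of UNIV "Pair (\<psi> x)"] by (auto intro!: continuous_intros)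
  have "smooth_on ?Q (\<lambda>q. F (\<psi> x, q))"
    by (rule smooth_on_compose[OF oQ Q(4) smooth_on_Pair[OF oQ smooth_on_const[OF oQ]
          smooth_on_bounded_linear[OF bounded_linear_ident oQ]]]) auto
  moreover have "?Q \<subseteq> \<phi> ` U" using Q(3) by auto
  ultimately show "\<exists>Q F. open Q \<and> \<phi> y \<in> Q \<and> Q \<subseteq> \<phi> ` U \<and> smooth_on Q F \<and>
      (\<forall>y\<in>{y. (x, y) \<in> S} \<inter> U. \<phi> y \<in> Q \<longrightarrow> f (x, y) \<in> W \<and> \<theta> (f (x, y)) = F (\<phi> y))"
    using oQ Q(2) Q(5)[of "(x, _)"] V by (intro exI[of _ ?Q] exI[of _ "\<lambda>q. F (\<psi> x, q)"]) auto
qed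

text \<open>The parameters range over an open set, larger than the cube in applications, so that
  partial derivatives are two-sided even on the boundary of the cube. The condition is imposed in
  all charts, which lets families be composed with maps chart by chart.\<close>

definition smooth_family ::
    "('a, 'e::findim) atlas \<Rightarrow> nat \<Rightarrow> (nat \<Rightarrow> real) set \<Rightarrow> ((nat \<Rightarrow> real) \<Rightarrow> 'a) \<Rightarrow> bool" where
  "smooth_family \<A> p Q f \<longleftrightarrow> open Q \<and> (\<forall>t\<in>Q. \<forall>(U, \<phi>)\<in>\<A>. f t \<in> U \<longrightarrow>
     (\<exists>Q'. open Q' \<and> t \<in> Q' \<and> Q' \<subseteq> Q \<and> f ` Q' \<subseteq> U \<and> (\<forall>n. cube_Ck p n Q' (\<lambda>t. \<phi> (f t)))))"

lemma smooth_familyD: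
  assumes "smooth_family \<A> p Q f" "t \<in> Q" "(U, \<phi>) \<in> \<A>" "f t \<in> U"
  obtains Q' where "open Q'" "t \<in> Q'" "Q' \<subseteq> Q" "f ` Q' \<subseteq> U" "\<And>n. cube_Ck p n Q' (\<lambda>t. \<phi> (f t))"
proof -
  from assms(1)[unfolded smooth_family_def, THEN conjunct2, rule_format, OF assms(2,3)] assms(4)
  have "\<exists>Q'. open Q' \<and> t \<in> Q' \<and> Q' \<subseteq> Q \<and> f ` Q' \<subseteq> U \<and> (\<forall>n. cube_Ck p n Q' (\<lambda>t. \<phi> (f t)))"
    by blast
  then show ?thesis using that by blast
qed

lemma smooth_family_const: "open Q \<Longrightarrow> smooth_family \<A> p Q (\<lambda>t. c)"
  unfolding smooth_family_def using cube_Ck_const by blast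

lemma smooth_family_vs: "open Q \<Longrightarrow> (\<And>n. cube_Ck p n Q f) \<Longrightarrow> smooth_family vs_atlas p Q f"
  unfolding smooth_family_def vs_atlas_def by auto

lemma smooth_family_Pair:
  assumes "smooth_family \<A> p Q f" "smooth_family \<B> p Q g"
  shows "smooth_family (prod_atlas \<A> \<B>) p Q (\<lambda>t. (f t, g t))"
  unfolding smooth_family_def
proof safe
  show "open Q" using assms(1) by (simp add: smooth_family_def)
  fix t U \<phi> assume t: "t \<in> Q" "(U, \<phi>) \<in> prod_atlas \<A> \<B>" "(f t, g t) \<in> U"
  then obtain V \<psi> W \<theta> where U: "U = V \<times> W" "\<phi> = map_prod \<psi> \<theta>" and ch: "(V, \<psi>) \<in> \<A>" "(W, \<theta>) \<in> \<B>"
    by (auto simp: prod_atlas_def)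
  from t U have "f t \<in> V" "g t \<in> W" by auto
  obtain P where P: "open P" "t \<in> P" "P \<subseteq> Q" "f ` P \<subseteq> V" "\<And>n. cube_Ck p n P (\<lambda>t. \<psi> (f t))"
    using smooth_familyD[OF assms(1) t(1) ch(1) \<open>f t \<in> V\<close>] by blast
  obtain R where R: "open R" "t \<in> R" "R \<subseteq> Q" "g ` R \<subseteq> W" "\<And>n. cube_Ck p n R (\<lambda>t. \<theta> (g t))"
    using smooth_familyD[OF assms(2) t(1) ch(2) \<open>g t \<in> W\<close>] by blast
  have "cube_Ck p n (P \<inter> R) (\<lambda>t. \<phi> (f t, g t))" for n
    unfolding U map_prod_simp using P R
    by (intro cube_Ck_Pair cube_Ck_subset[OF P(5)] cube_Ck_subset[OF R(5)]) auto
  then show "\<exists>P. open P \<and> t \<in> P \<and> P \<subseteq> Q \<and> (\<lambda>t. (f t, g t)) ` P \<subseteq> U \<and> (\<forall>n. cube_Ck p n P (\<lambda>t. \<phi> (f t, g t)))"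
    using P R U by (intro exI[of _ "P \<inter> R"]) auto
qed

lemma smooth_family_compose:
  assumes cov: "\<Union>(fst ` \<A>) = UNIV" and g: "smooth_map_on \<A> \<B> S g"
    and f: "smooth_family \<A> p Q f" "f ` Q \<subseteq> S"
  shows "smooth_family \<B> p Q (\<lambda>t. g (f t))"
  unfolding smooth_family_def
proof safe
  show "open Q" using f(1) by (simp add: smooth_family_def)
  fix t W \<theta> assume t: "t \<in> Q" "(W, \<theta>) \<in> \<B>" "g (f t) \<in> W"
  obtain U \<phi> where U: "(U, \<phi>) \<in> \<A>" "f t \<in> U" using atlas_cover[OF cov] by blast
  obtain P where P: "open P" "t \<in> P" "P \<subseteq> Q" "f ` P \<subseteq> U" "\<And>n. cube_Ck p n P (\<lambda>t. \<phi> (f t))"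
    using smooth_familyD[OF f(1) t(1) U] by blast
  have "f t \<in> S" using t f(2) by blast
  obtain R F where R: "open R" "\<phi> (f t) \<in> R" "R \<subseteq> \<phi> ` U" "smooth_on R F"
    "\<And>y. y \<in> S \<Longrightarrow> y \<in> U \<Longrightarrow> \<phi> y \<in> R \<Longrightarrow> g y \<in> W \<and> \<theta> (g y) = F (\<phi> y)"
    using smooth_map_onD[OF g \<open>f t \<in> S\<close> U t(2,3)] by blast
  \<comment> \<open>The parameters for which the coordinates of \<open>f\<close> stay where the
    local extension \<open>F\<close> of \<open>g\<close> lives.\<close>
  let ?P = "(\<lambda>t. \<phi> (f t)) -` R \<inter> P"
  have oP: "open ?P"
    using cube_Ck_continuous[OF P(5)] P(1) R(1) by (intro open_vimage_Int)
  have g_eq: "g (f s) \<in> W \<and> \<theta> (g (f s)) = F (\<phi> (f s))" if "s \<in> ?P" for s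
    using that P(3,4) f(2) by (intro R(5)) auto
  have Ck: "cube_Ck p n ?P (\<lambda>t. \<theta> (g (f t)))" for n
  proof (rule cube_Ck_cong[OF oP])
    show "cube_Ck p n ?P (\<lambda>t. F (\<phi> (f t)))"
      by (rule cube_Ck_compose[OF oP R(4)[unfolded smooth_on_def, rule_format] cube_Ck_subset[OF P(5)]]) auto
  qed (use g_eq in auto)
  show "\<exists>P. open P \<and> t \<in> P \<and> P \<subseteq> Q \<and> (\<lambda>t. g (f t)) ` P \<subseteq> W \<and> (\<forall>n. cube_Ck p n P (\<lambda>t. \<theta> (g (f t))))"
    by (rule exI[of _ ?P], intro conjI allI oP Ck) (use P R(2) g_eq in auto)
qed

lemma smooth_family_continuous:
  assumes "manifold_atlas \<A>" "smooth_family \<A> p Q f"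
  shows "continuous_on Q f"
  unfolding continuous_on_topological
proof (intro ballI allI impI)
  fix t X assume t: "t \<in> Q" and X: "open X" "f t \<in> X"
  obtain U \<phi> where U: "(U, \<phi>) \<in> \<A>" "f t \<in> U" using atlas_cover[OF manifold_atlas_cover[OF assms(1)]] by blast
  note ch = manifold_chart[OF assms(1) U(1)]
  obtain P where P: "open P" "t \<in> P" "P \<subseteq> Q" "f ` P \<subseteq> U" "\<And>n. cube_Ck p n P (\<lambda>t. \<phi> (f t))"
    using smooth_familyD[OF assms(2) t U] by blast
  let ?P = "(\<lambda>t. \<phi> (f t)) -` (\<phi> ` (U \<inter> X)) \<inter> P"
  have "open ?P"
    using cube_Ck_continuous[OF P(5)] P(1) ch(5)[OF X(1)] by (intro open_vimage_Int)
  moreover have "t \<in> ?P" using P U X by auto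
  moreover have "f s \<in> X" if "s \<in> ?P" for s
    using that P(4) inj_onD[OF ch(3)] by auto
  ultimately show "\<exists>A. open A \<and> t \<in> A \<and> (\<forall>s\<in>Q. s \<in> A \<longrightarrow> f s \<in> X)" by blast
qed

section \<open>Change of charts for tangent vectors\<close>

lemma chart_at_mem:
  assumes "manifold_atlas \<A>"
  shows "(coord_dom \<A> x, coord \<A> x) \<in> \<A>" "x \<in> coord_dom \<A> x"
proof -
  have "\<exists>c. c \<in> \<A> \<and> x \<in> fst c"
    using atlas_cover[OF manifold_atlas_cover[OF assms], of x] by auto
  from someI_ex[OF this] show "(coord_dom \<A> x, coord \<A> x) \<in> \<A>" "x \<in> coord_dom \<A> x"
    by (auto simp: coord_dom_def coord_def chart_at_def)
qed

lemma transition_has_derivative: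
  assumes "manifold_atlas \<A>" "(U, \<phi>) \<in> \<A>" "(W, \<theta>) \<in> \<A>" "x \<in> U" "x \<in> W"
  shows "((\<theta> \<circ> inv_into U \<phi>) has_derivative frechet_derivative (\<theta> \<circ> inv_into U \<phi>) (at (\<phi> x))) (at (\<phi> x))"
  using manifold_transition[OF assms(1-3)] assms(4,5) by (intro smooth_on_has_derivative) auto

text \<open>Chain rule for transition maps: on the image of the first overlap the middle chart
  cancels.\<close>

lemma transition_chain:
  assumes A: "manifold_atlas \<A>" and ch: "(U, \<phi>) \<in> \<A>" "(W, \<theta>) \<in> \<A>" "(V, \<psi>) \<in> \<A>"
    and x: "x \<in> U" "x \<in> W" "x \<in> V"
  shows "frechet_derivative (\<psi> \<circ> inv_into U \<phi>) (at (\<phi> x)) v =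
    frechet_derivative (\<psi> \<circ> inv_into W \<theta>) (at (\<theta> x)) (frechet_derivative (\<theta> \<circ> inv_into U \<phi>) (at (\<phi> x)) v)"
proof -
  have inj: "inj_on \<phi> U" "inj_on \<theta> W" using manifold_chart[OF A] ch by blast+
  have o: "open (\<phi> ` (U \<inter> W))" using manifold_transition[OF A ch(1,2)] by simp
  have 1: "(\<theta> \<circ> inv_into U \<phi>) (\<phi> x) = \<theta> x" using inj x by simp
  have "((\<psi> \<circ> inv_into W \<theta>) \<circ> (\<theta> \<circ> inv_into U \<phi>) has_derivative
      frechet_derivative (\<psi> \<circ> inv_into W \<theta>) (at (\<theta> x)) \<circ> frechet_derivative (\<theta> \<circ> inv_into U \<phi>) (at (\<phi> x))) (at (\<phi> x))"
    using diff_chain_at[OF transition_has_derivative[OF A ch(1,2) x(1,2)]] transition_has_derivative[OF A ch(2,3) x(2,3)]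
    unfolding 1 by blast
  then have "(\<psi> \<circ> inv_into U \<phi> has_derivative
      frechet_derivative (\<psi> \<circ> inv_into W \<theta>) (at (\<theta> x)) \<circ> frechet_derivative (\<theta> \<circ> inv_into U \<phi>) (at (\<phi> x))) (at (\<phi> x))"
    by (rule has_derivative_transform_within_open[OF _ o]) (use inj x in auto)
  then show ?thesis by (simp add: frechet_derivative_at[symmetric])
qed

lemma transition_self:
  assumes A: "manifold_atlas \<A>" and ch: "(U, \<phi>) \<in> \<A>" and x: "x \<in> U"
  shows "frechet_derivative (\<phi> \<circ> inv_into U \<phi>) (at (\<phi> x)) v = v"
proof -
  have "((\<lambda>y. y) has_derivative (\<lambda>v. v)) (at (\<phi> x))" by (rule has_derivative_ident)
  then have "(\<phi> \<circ> inv_into U \<phi> has_derivative (\<lambda>v. v)) (at (\<phi> x))"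
    by (rule has_derivative_transform_within_open[OF _ manifold_chart(2)[OF A ch]])
      (use manifold_chart(3)[OF A ch] x in \<open>auto simp: f_inv_into_f\<close>)
  then show ?thesis by (simp add: frechet_derivative_at[symmetric])
qed

lemma tangent_coord_alt:
  "tangent_coord \<A> \<phi> x = frechet_derivative (\<phi> \<circ> inv_into (coord_dom \<A> x) (coord \<A> x)) (at (coord \<A> x x))"
  by (simp add: tangent_coord_def coord_inv_def fun_eq_iff)

lemma tangent_coord_linear:
  assumes "manifold_atlas \<A>" "(U, \<phi>) \<in> \<A>" "x \<in> U"
  shows "linear (tangent_coord \<A> \<phi> x)"
  unfolding tangent_coord_alt
  by (rule has_derivative_linear[OF transition_has_derivative[OF assms(1) chart_at_mem(1) assms(2) chart_at_mem(2)]])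
    (use assms in auto)

lemma tangent_coord_coord:
  assumes "manifold_atlas \<A>"
  shows "tangent_coord \<A> (coord \<A> x) x v = v"
  unfolding tangent_coord_alt using transition_self[OF assms chart_at_mem[OF assms]] .

lemma tangent_coord_change:
  assumes "manifold_atlas \<A>" "(U, \<phi>) \<in> \<A>" "(W, \<theta>) \<in> \<A>" "x \<in> U" "x \<in> W"
  shows "tangent_coord \<A> \<theta> x v = frechet_derivative (\<theta> \<circ> inv_into U \<phi>) (at (\<phi> x)) (tangent_coord \<A> \<phi> x v)"
  unfolding tangent_coord_alt
  by (rule transition_chain[OF assms(1) chart_at_mem(1)[OF assms(1)] assms(2,3) chart_at_mem(2)[OF assms(1)] assms(4,5)])

text \<open>The inverse of the passage to a chart is the derivative of the reverse transition map.
  Having it explicitly matters for the frames of \<open>A\<close>, whose smoothness is checked in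
  charts.\<close>

lemma tangent_coord_inverse:
  assumes A: "manifold_atlas \<A>" "(U, \<phi>) \<in> \<A>" "x \<in> U"
  defines "\<tau> \<equiv> frechet_derivative (coord \<A> x \<circ> inv_into U \<phi>) (at (\<phi> x))"
  shows "\<tau> (tangent_coord \<A> \<phi> x v) = v" "tangent_coord \<A> \<phi> x (\<tau> v) = v"
proof -
  show "\<tau> (tangent_coord \<A> \<phi> x v) = v"
    unfolding \<tau>_def using tangent_coord_change[OF A(1,2) chart_at_mem(1)[OF A(1)] A(3) chart_at_mem(2)[OF A(1)], of v]
    by (simp add: tangent_coord_coord[OF A(1)])
  show "tangent_coord \<A> \<phi> x (\<tau> v) = v"
    unfolding \<tau>_def tangent_coord_alt
    using transition_chain[OF A(1,2) chart_at_mem(1)[OF A(1)] A(2,3) chart_at_mem(2)[OF A(1)] A(3), of v]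
      transition_self[OF A] by simp
qed

section \<open>Tangent vectors and curves\<close>

text \<open>First-order information at one parameter is all that a velocity needs. Continuity is
  demanded separately: the coordinate map has arbitrary values outside its domain, so
  differentiability of the composite alone would not keep the curve inside the chart.\<close>

definition smooth_curve_at :: "('a::topological_space, 'e::findim) atlas \<Rightarrow> (real \<Rightarrow> 'a) \<Rightarrow> real \<Rightarrow> bool" where
  "smooth_curve_at \<A> c h0 \<longleftrightarrow> isCont c h0 \<and> (coord \<A> (c h0) \<circ> c) differentiable (at h0)"

lemma isCont_eventually_open:
  "isCont c (h0::real) \<Longrightarrow> open U \<Longrightarrow> c h0 \<in> U \<Longrightarrow> \<forall>\<^sub>F h in nhds h0. c h \<in> U"
  unfolding isCont_def eventually_nhds_conv_at tendsto_def by blast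

lemma has_vector_derivative_cong_nhds:
  assumes "(f has_vector_derivative v) (at (x::real))" "\<forall>\<^sub>F h in nhds x. f h = g h"
  shows "(g has_vector_derivative v) (at x)"
  using assms has_vector_derivative_cong_ev[of UNIV f g x v] eventually_nhds_x_imp_x[OF assms(2)] by simp

lemma smooth_curve_atD:
  assumes "smooth_curve_at \<A> c h0"
  shows "((\<lambda>h. coord \<A> (c h0) (c h)) has_vector_derivative velocity \<A> UNIV c h0) (at h0)"
  using assms unfolding smooth_curve_at_def velocity_def
  by (simp add: o_def vector_derivative_works)

lemma velocityI:
  "((\<lambda>h. coord \<A> (c h0) (c h)) has_vector_derivative v) (at h0) \<Longrightarrow> velocity \<A> UNIV c h0 = v"
  unfolding velocity_def o_def by (simp add: vector_derivative_at)

lemma smooth_curve_at_chart: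
  assumes A: "manifold_atlas \<A>" "(U, \<phi>) \<in> \<A>" and c: "smooth_curve_at \<A> c h0" "c h0 \<in> U"
  shows "((\<lambda>h. \<phi> (c h)) has_vector_derivative tangent_coord \<A> \<phi> (c h0) (velocity \<A> UNIV c h0)) (at h0)"
proof -
  let ?x = "c h0"
  note ch = chart_at_mem[OF A(1), of ?x]
  have "(\<phi> \<circ> coord_inv \<A> ?x has_derivative tangent_coord \<A> \<phi> ?x) (at (coord \<A> ?x ?x))"
    unfolding tangent_coord_alt coord_inv_def
    by (rule transition_has_derivative[OF A(1) ch(1) A(2) ch(2) c(2)])
  then have "(\<phi> \<circ> coord_inv \<A> ?x has_derivative tangent_coord \<A> \<phi> ?x) (at (coord \<A> ?x ?x) within range (\<lambda>h. coord \<A> ?x (c h)))"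
    by (rule has_derivative_at_withinI)
  from vector_derivative_diff_chain_within[OF smooth_curve_atD[OF c(1)] this]
  have "((\<lambda>h. \<phi> (coord_inv \<A> ?x (coord \<A> ?x (c h)))) has_vector_derivative
      tangent_coord \<A> \<phi> ?x (velocity \<A> UNIV c h0)) (at h0)"
    by (simp add: o_def)
  moreover have "\<forall>\<^sub>F h in nhds h0. c h \<in> coord_dom \<A> ?x"
    using c(1) ch manifold_chart(1)[OF A(1) ch(1)] by (intro isCont_eventually_open) (auto simp: smooth_curve_at_def)
  then have "\<forall>\<^sub>F h in nhds h0. \<phi> (coord_inv \<A> ?x (coord \<A> ?x (c h))) = \<phi> (c h)"
    by eventually_elim (simp add: coord_inv_def manifold_chart(3)[OF A(1) ch(1)])
  ultimately show ?thesis by (rule has_vector_derivative_cong_nhds)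
qed

text \<open>One chart suffices as a test, because the transition to the chart singled out at the
  point is differentiable.\<close>

lemma smooth_curve_atI:
  assumes A: "manifold_atlas \<A>" "(U, \<phi>) \<in> \<A>" and c: "isCont c h0" "c h0 \<in> U"
    and d: "((\<lambda>h. \<phi> (c h)) has_vector_derivative v) (at h0)"
  shows "smooth_curve_at \<A> c h0"
proof -
  let ?x = "c h0"
  note ch = chart_at_mem[OF A(1), of ?x]
  have "(coord \<A> ?x \<circ> inv_into U \<phi> has_derivative frechet_derivative (coord \<A> ?x \<circ> inv_into U \<phi>) (at (\<phi> ?x)))
      (at (\<phi> ?x) within range (\<lambda>h. \<phi> (c h)))"
    by (rule has_derivative_at_withinI[OF transition_has_derivative[OF A ch(1) c(2) ch(2)]])
  from vector_derivative_diff_chain_within[OF d this]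
  have "((\<lambda>h. coord \<A> ?x (inv_into U \<phi> (\<phi> (c h)))) has_vector_derivative
      frechet_derivative (coord \<A> ?x \<circ> inv_into U \<phi>) (at (\<phi> ?x)) v) (at h0)"
    by (simp add: o_def)
  moreover have "\<forall>\<^sub>F h in nhds h0. c h \<in> U"
    by (rule isCont_eventually_open[OF c(1) manifold_chart(1)[OF A] c(2)])
  then have "\<forall>\<^sub>F h in nhds h0. coord \<A> ?x (inv_into U \<phi> (\<phi> (c h))) = coord \<A> ?x (c h)"
    by eventually_elim (simp add: manifold_chart(3)[OF A])
  ultimately have "((\<lambda>h. coord \<A> ?x (c h)) has_vector_derivative
      frechet_derivative (coord \<A> ?x \<circ> inv_into U \<phi>) (at (\<phi> ?x)) v) (at h0)"
    by (rule has_vector_derivative_cong_nhds)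
  with c(1) show ?thesis by (auto simp: smooth_curve_at_def o_def intro: differentiableI_vector)
qed

text \<open>The integrals are written with one-sided velocities on \<open>[0,1]\<close>. Curves that
  extend past the endpoints allow these to be replaced by two-sided ones, for which the chain rule
  is convenient.\<close>

lemma velocity_within_unit_interval:
  assumes "smooth_curve_at \<A> c h0" "h0 \<in> {0..1}"
  shows "velocity \<A> {0..1} c h0 = velocity \<A> UNIV c h0"
  using vector_derivative_at_within_ivl[OF smooth_curve_atD[OF assms(1)], of 0 1] assms(2)
  by (simp add: velocity_def o_def)

lemma smooth_curve_at_cong:
  assumes ev: "\<forall>\<^sub>F h in nhds h0. c h = d h"
  shows "velocity \<A> UNIV c h0 = velocity \<A> UNIV d h0"
    and "smooth_curve_at \<A> c h0 \<Longrightarrow> smooth_curve_at \<A> d h0"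
proof -
  have eq: "c h0 = d h0" using eventually_nhds_x_imp_x[OF ev] .
  have ev': "\<forall>\<^sub>F h in nhds h0. coord \<A> (c h0) (c h) = coord \<A> (d h0) (d h)"
    using ev by eventually_elim (simp add: eq)
  show "velocity \<A> UNIV c h0 = velocity \<A> UNIV d h0"
    unfolding velocity_def o_def by (rule vector_derivative_cong_eq) (use ev' in auto)
  assume c: "smooth_curve_at \<A> c h0"
  have "isCont d h0"
    using c isCont_cong[OF ev] by (simp add: smooth_curve_at_def)
  moreover have "((\<lambda>h. coord \<A> (d h0) (d h)) has_vector_derivative velocity \<A> UNIV c h0) (at h0)"
    using smooth_curve_atD[OF c] ev' by (rule has_vector_derivative_cong_nhds)
  ultimately show "smooth_curve_at \<A> d h0"
    by (auto simp: smooth_curve_at_def o_def intro: differentiableI_vector)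
qed

lemma smooth_curve_at_const: "smooth_curve_at \<A> (\<lambda>h. x) h0" "velocity \<A> UNIV (\<lambda>h. x) h0 = 0"
  unfolding smooth_curve_at_def velocity_def o_def by simp_all

text \<open>Applied to the retraction, where composing two scalings multiplies the
  parameters.\<close>

lemma smooth_curve_at_scale:
  assumes c: "smooth_curve_at \<A> c (k * h0)"
  shows "smooth_curve_at \<A> (\<lambda>h. c (k * h)) h0"
    "velocity \<A> UNIV (\<lambda>h. c (k * h)) h0 = k *\<^sub>R velocity \<A> UNIV c (k * h0)"
proof -
  have "((\<lambda>h. k * h) has_vector_derivative k) (at h0)"
    by (auto intro!: derivative_eq_intros)
  moreover have "((\<lambda>h. coord \<A> (c (k * h0)) (c h)) has_vector_derivative velocity \<A> UNIV c (k * h0)) (at (k * h0))"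
    by (rule smooth_curve_atD[OF c])
  ultimately have *: "((\<lambda>h. coord \<A> (c (k * h0)) (c (k * h))) has_vector_derivative k *\<^sub>R velocity \<A> UNIV c (k * h0)) (at h0)"
    using vector_diff_chain_at[of "\<lambda>h. k * h" k h0 "\<lambda>h. coord \<A> (c (k * h0)) (c h)"] by (simp add: o_def)
  have "isCont (\<lambda>h. c (k * h)) h0"
    using c by (auto simp: smooth_curve_at_def intro!: isCont_o2[of _ "\<lambda>h. k * h" c])
  with * show "smooth_curve_at \<A> (\<lambda>h. c (k * h)) h0"
    by (auto simp: smooth_curve_at_def o_def intro: differentiableI_vector)
  show "velocity \<A> UNIV (\<lambda>h. c (k * h)) h0 = k *\<^sub>R velocity \<A> UNIV c (k * h0)"
    by (rule velocityI) (rule *)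
qed

lemma smooth_family_curve:
  assumes A: "manifold_atlas \<A>" and f: "smooth_family \<A> p Q f" and t: "t \<in> Q" "i < p"
  shows "smooth_curve_at \<A> (\<lambda>h. f (t(i := h))) (t i)"
proof -
  obtain U \<phi> where U: "(U, \<phi>) \<in> \<A>" "f t \<in> U" using atlas_cover[OF manifold_atlas_cover[OF A]] by blast
  obtain P where P: "open P" "t \<in> P" "P \<subseteq> Q" "f ` P \<subseteq> U" "\<And>n. cube_Ck p n P (\<lambda>t. \<phi> (f t))"
    using smooth_familyD[OF f t(1) U] by blast
  have "isCont (\<lambda>h. f (t(i := h))) (t i)"
  proof -
    have Q: "open Q" using f by (simp add: smooth_family_def)
    have "open ((\<lambda>h. t(i := h)) -` Q)"
      by (rule open_vimage[OF Q]) (intro continuous_on_fun_upd continuous_on_const continuous_on_id)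
    moreover have "continuous_on ((\<lambda>h. t(i := h)) -` Q) (\<lambda>h. f (t(i := h)))"
      by (rule continuous_on_compose2[OF smooth_family_continuous[OF A f]])
        (auto intro!: continuous_on_fun_upd continuous_on_const continuous_on_id)
    ultimately show ?thesis
      using t by (auto simp: continuous_on_eq_continuous_at)
  qed
  moreover have "((\<lambda>h. \<phi> (f (t(i := h)))) has_vector_derivative
      vector_derivative (\<lambda>h. \<phi> (f (t(i := h)))) (at (t i))) (at (t i))"
    using cube_Ck_SucE(2)[OF P(5)[of 1, unfolded One_nat_def] t(2) P(2)] .
  ultimately show ?thesis
    using smooth_curve_atI[OF A U(1), where c = "\<lambda>h. f (t(i := h))" and ?h0.0 = "t i"] U(2) by simp
qed

section \<open>Tangent maps and the chain rule along curves\<close>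

lemma smooth_map_on_isCont:
  assumes "cts_atlas \<A>" "manifold_atlas \<B>" "smooth_map_on \<A> \<B> S f"
    and "isCont c (h0::real)" "\<forall>\<^sub>F h in nhds h0. c h \<in> S"
  shows "isCont (\<lambda>h. f (c h)) h0"
  unfolding isCont_def tendsto_def
proof (intro allI impI)
  fix X assume X: "open X" "f (c h0) \<in> X"
  have "c h0 \<in> S" using eventually_nhds_x_imp_x[OF assms(5)] .
  then obtain Y where Y: "open Y" "c h0 \<in> Y" "\<forall>y\<in>S. y \<in> Y \<longrightarrow> f y \<in> X"
    using smooth_map_on_continuous[OF assms(1-3)] X unfolding continuous_on_topological by blast
  have "\<forall>\<^sub>F h in nhds h0. f (c h) \<in> X"
    using isCont_eventually_open[OF assms(4) Y(1,2)] assms(5) by eventually_elim (use Y(3) in blast)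
  then show "\<forall>\<^sub>F h in at h0. f (c h) \<in> X" by (simp add: eventually_nhds_conv_at)
qed

text \<open>The map is smooth on \<open>S\<close>, while the derivative is taken within
  \<open>S'\<close>. In applications \<open>S'\<close> is a whole target fibre and \<open>X\<close>
  is a neighbourhood in which the multiplication or retraction is defined; only the part of
  \<open>S'\<close> near \<open>x\<close> influences the derivative.\<close>

lemma tmap_has_derivative:
  assumes A: "manifold_atlas \<A>" and B: "manifold_atlas \<B>" and f: "smooth_map_on \<A> \<B> S f"
    and x: "x \<in> S" "x \<in> S'" "x \<in> X" and X: "open X" "S' \<inter> X \<subseteq> S"
  shows "((\<lambda>q. coord \<B> (f x) (f (coord_inv \<A> x q))) has_derivative tmap \<A> \<B> S' f x)
    (at (coord \<A> x x) within coord \<A> x ` (S' \<inter> coord_dom \<A> x))"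
proof -
  let ?U = "coord_dom \<A> x" and ?\<phi> = "coord \<A> x"
  let ?R = "?\<phi> ` (S' \<inter> ?U)" and ?G = "\<lambda>q. coord \<B> (f x) (f (coord_inv \<A> x q))"
  note ch = chart_at_mem[OF A, of x] and ch' = chart_at_mem[OF B, of "f x"]
  note U = manifold_chart[OF A ch(1)]
  obtain Q F where Q: "open Q" "?\<phi> x \<in> Q" "Q \<subseteq> ?\<phi> ` ?U" "smooth_on Q F"
    "\<And>y. y \<in> S \<Longrightarrow> y \<in> ?U \<Longrightarrow> ?\<phi> y \<in> Q \<Longrightarrow> f y \<in> coord_dom \<B> (f x) \<and> coord \<B> (f x) (f y) = F (?\<phi> y)"
    using smooth_map_onD[OF f x(1) ch ch'] by blast
  have "open (Q \<inter> ?\<phi> ` (?U \<inter> X))" "?\<phi> x \<in> Q \<inter> ?\<phi> ` (?U \<inter> X)"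
    using Q(1,2) U(5)[OF X(1)] ch(2) x(3) by auto
  then obtain d where d: "d > 0" "ball (?\<phi> x) d \<subseteq> Q \<inter> ?\<phi> ` (?U \<inter> X)"
    by (meson open_contains_ball)
  have "(F has_derivative frechet_derivative F (at (?\<phi> x))) (at (?\<phi> x) within ?R)"
    by (rule has_derivative_at_withinI[OF smooth_on_has_derivative[OF Q(4,2)]])
  then have "(?G has_derivative frechet_derivative F (at (?\<phi> x))) (at (?\<phi> x) within ?R)"
  proof (rule has_derivative_transform_within[OF _ d(1)])
    show "?\<phi> x \<in> ?R" using x ch(2) by auto
    fix q assume q: "q \<in> ?R" "dist q (?\<phi> x) < d"
    then obtain y where y: "y \<in> S'" "y \<in> ?U" "q = ?\<phi> y" by blast
    have "q \<in> Q \<inter> ?\<phi> ` (?U \<inter> X)" using d(2) q(2) by (auto simp: dist_commute)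
    moreover from this y U(3) have "y \<in> X" by (auto dest: inj_onD)
    ultimately have "coord \<B> (f x) (f y) = F q" using Q(5)[of y] X(2) y by auto
    then show "F q = ?G q" using y U(3) by (simp add: coord_inv_def)
  qed
  \<comment> \<open>\<open>tmap\<close> chooses one of possibly many derivatives within
    \<open>S'\<close>, not necessarily that of \<open>F\<close>. So only the existence of a
    derivative is passed on.\<close>
  then have "?G differentiable (at (?\<phi> x) within ?R)" by (auto simp: differentiable_def)
  then show ?thesis by (simp add: frechet_derivative_works tmap_def o_def)
qed

lemma tmap_linear:
  assumes "manifold_atlas \<A>" "manifold_atlas \<B>" "smooth_map_on \<A> \<B> S f"
    and "x \<in> S" "x \<in> S'" "x \<in> X" "open X" "S' \<inter> X \<subseteq> S"
  shows "linear (tmap \<A> \<B> S' f x)"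
  using tmap_has_derivative[OF assms] by (rule has_derivative_linear)

text \<open>Any derivative within \<open>S'\<close> takes the same value on the velocity of a curve
  that stays in \<open>S'\<close>. This determines \<open>tmap\<close> on tangent vectors, whichever
  derivative was chosen.\<close>

lemma smooth_curve_chain:
  assumes A: "manifold_atlas \<A>" and B: "manifold_atlas \<B>" and f: "smooth_map_on \<A> \<B> S f"
    and c: "smooth_curve_at \<A> c h0" "\<forall>\<^sub>F h in nhds h0. c h \<in> S'"
    and x: "c h0 \<in> S" "c h0 \<in> X" and X: "open X" "S' \<inter> X \<subseteq> S"
  shows "smooth_curve_at \<B> (\<lambda>h. f (c h)) h0"
    and "velocity \<B> UNIV (\<lambda>h. f (c h)) h0 = tmap \<A> \<B> S' f (c h0) (velocity \<A> UNIV c h0)"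
proof -
  let ?x = "c h0"
  let ?U = "coord_dom \<A> ?x" and ?\<phi> = "coord \<A> ?x"
  let ?R = "?\<phi> ` (S' \<inter> ?U)" and ?G = "\<lambda>q. coord \<B> (f ?x) (f (coord_inv \<A> ?x q))"
  note ch = chart_at_mem[OF A, of ?x]
  have xS': "?x \<in> S'" using eventually_nhds_x_imp_x[OF c(2)] .
  note der = tmap_has_derivative[OF A B f x(1) xS' x(2) X]
  have cont: "isCont c h0" using c(1) by (simp add: smooth_curve_at_def)
  have evU: "\<forall>\<^sub>F h in nhds h0. c h \<in> ?U"
    by (rule isCont_eventually_open[OF cont manifold_chart(1)[OF A ch(1)] ch(2)])
  then have "\<forall>\<^sub>F h in nhds h0. c h \<in> S' \<inter> ?U" using c(2) by eventually_elim auto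
  then obtain I where I: "open I" "h0 \<in> I" "\<forall>h\<in>I. c h \<in> S' \<inter> ?U"
    unfolding eventually_nhds by blast
  have "((\<lambda>h. ?\<phi> (c h)) has_vector_derivative velocity \<A> UNIV c h0) (at h0 within I)"
    by (rule has_vector_derivative_at_within[OF smooth_curve_atD[OF c(1)]])
  \<comment> \<open>For parameters in \<open>I\<close> the curve lies in \<open>S'\<close>, so the
    derivative within \<open>S'\<close> restricts to the trace of the curve.\<close>
  moreover have "(?G has_derivative tmap \<A> \<B> S' f ?x) (at (?\<phi> ?x) within (\<lambda>h. ?\<phi> (c h)) ` I)"
    by (rule has_derivative_subset[OF der]) (use I(3) in auto)
  ultimately have "(?G \<circ> (\<lambda>h. ?\<phi> (c h)) has_vector_derivative tmap \<A> \<B> S' f ?x (velocity \<A> UNIV c h0)) (at h0 within I)"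
    by (rule vector_derivative_diff_chain_within)
  then have "((\<lambda>h. ?G (?\<phi> (c h))) has_vector_derivative tmap \<A> \<B> S' f ?x (velocity \<A> UNIV c h0)) (at h0)"
    by (simp only: o_def at_within_open[OF I(2,1)])
  moreover have "\<forall>\<^sub>F h in nhds h0. ?G (?\<phi> (c h)) = coord \<B> (f ?x) (f (c h))"
    using evU by eventually_elim (simp add: coord_inv_def manifold_chart(3)[OF A ch(1)])
  ultimately have d: "((\<lambda>h. coord \<B> (f ?x) (f (c h))) has_vector_derivative tmap \<A> \<B> S' f ?x (velocity \<A> UNIV c h0)) (at h0)"
    by (rule has_vector_derivative_cong_nhds)
  show "velocity \<B> UNIV (\<lambda>h. f (c h)) h0 = tmap \<A> \<B> S' f ?x (velocity \<A> UNIV c h0)"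
    by (rule velocityI) (rule d)
  have "\<forall>\<^sub>F h in nhds h0. c h \<in> S"
    using c(2) isCont_eventually_open[OF cont X(1) x(2)] by eventually_elim (use X(2) in auto)
  then have "isCont (\<lambda>h. f (c h)) h0"
    by (rule smooth_map_on_isCont[OF manifold_imp_cts_atlas[OF A] B f cont])
  with d show "smooth_curve_at \<B> (\<lambda>h. f (c h)) h0"
    by (auto simp: smooth_curve_at_def o_def intro: differentiableI_vector)
qed

lemma tangent_coord_tmap:
  assumes A: "manifold_atlas \<A>" and B: "manifold_atlas \<B>" and f: "smooth_map_on \<A> \<B> UNIV f"
    and ch: "(U, \<phi>) \<in> \<A>" "x \<in> U" "(W, \<theta>) \<in> \<B>" "f x \<in> W"
  shows "frechet_derivative (\<lambda>q. \<theta> (f (inv_into U \<phi> q))) (at (\<phi> x)) (tangent_coord \<A> \<phi> x v) =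
    tangent_coord \<B> \<theta> (f x) (tmap \<A> \<B> UNIV f x v)"
proof -
  let ?\<phi> = "coord \<A> x" and ?U = "coord_dom \<A> x"
  note cx = chart_at_mem[OF A, of x] and cy = chart_at_mem[OF B, of "f x"]
  note U = manifold_chart[OF A ch(1)] and Ux = manifold_chart[OF A cx(1)]
  let ?G = "\<lambda>q. coord \<B> (f x) (f (coord_inv \<A> x q))"
  have G: "(?G has_derivative tmap \<A> \<B> UNIV f x) (at (?\<phi> x))"
    using tmap_has_derivative[OF A B f, of x UNIV UNIV] at_within_open[OF imageI[OF cx(2)] Ux(2)] by simp
  have tr: "((?\<phi> \<circ> inv_into U \<phi>) has_derivative frechet_derivative (?\<phi> \<circ> inv_into U \<phi>) (at (\<phi> x))) (at (\<phi> x))"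
    by (rule transition_has_derivative[OF A ch(1) cx(1) ch(2) cx(2)])
  have e1: "(?\<phi> \<circ> inv_into U \<phi>) (\<phi> x) = ?\<phi> x" using U(3) ch(2) by simp
  have e2: "?G (?\<phi> x) = coord \<B> (f x) (f x)" using Ux(3) cx(2) by (simp add: coord_inv_def)
  have tr2: "((\<theta> \<circ> coord_inv \<B> (f x)) has_derivative tangent_coord \<B> \<theta> (f x)) (at (coord \<B> (f x) (f x)))"
    unfolding tangent_coord_alt coord_inv_def
    by (rule transition_has_derivative[OF B cy(1) ch(3) cy(2) ch(4)])
  have "((\<theta> \<circ> coord_inv \<B> (f x)) \<circ> (?G \<circ> (?\<phi> \<circ> inv_into U \<phi>)) has_derivative
      tangent_coord \<B> \<theta> (f x) \<circ> (tmap \<A> \<B> UNIV f x \<circ> frechet_derivative (?\<phi> \<circ> inv_into U \<phi>) (at (\<phi> x)))) (at (\<phi> x))"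
  proof (rule diff_chain_at[OF diff_chain_at[OF tr]])
    show "(?G has_derivative tmap \<A> \<B> UNIV f x) (at ((?\<phi> \<circ> inv_into U \<phi>) (\<phi> x)))"
      unfolding e1 by (rule G)
    show "(\<theta> \<circ> coord_inv \<B> (f x) has_derivative tangent_coord \<B> \<theta> (f x)) (at ((?G \<circ> (?\<phi> \<circ> inv_into U \<phi>)) (\<phi> x)))"
      unfolding o_apply[of ?G] e1 e2 by (rule tr2)
  qed
  moreover
  have cont: "continuous_on UNIV f" by (rule smooth_map_on_continuous[OF manifold_imp_cts_atlas[OF A] B f])
  have "open (f -` coord_dom \<B> (f x))"
    by (rule open_vimage[OF manifold_chart(1)[OF B cy(1)] cont])
  then have "open (?U \<inter> f -` coord_dom \<B> (f x))" using Ux(1) by blast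
  from U(5)[OF this] have "open (\<phi> ` (U \<inter> (?U \<inter> f -` coord_dom \<B> (f x))))" .
  ultimately have "((\<lambda>q. \<theta> (f (inv_into U \<phi> q))) has_derivative
      tangent_coord \<B> \<theta> (f x) \<circ> (tmap \<A> \<B> UNIV f x \<circ> frechet_derivative (?\<phi> \<circ> inv_into U \<phi>) (at (\<phi> x)))) (at (\<phi> x))"
    by (rule has_derivative_transform_within_open)
      (use U(3) Ux(3) cx(2) cy(2) ch(2) manifold_chart(3)[OF B cy(1)] in \<open>auto simp: coord_inv_def\<close>)
  from frechet_derivative_at[OF this] show ?thesis
    using tangent_coord_inverse(1)[OF A ch(1,2), of v] by (metis o_apply)
qed

text \<open>The coordinates supplied by the class may be redundant. The elimination below needs
  functionals that are dual to the chosen vectors.\<close>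

lemma findim_basis:
  obtains B :: "'b::findim set" and r :: "'b \<Rightarrow> 'b \<Rightarrow> real"
  where "finite B" "\<And>b. bounded_linear (r b)" "\<And>x. x = (\<Sum>b\<in>B. r b x *\<^sub>R b)"
    "\<And>b b'. b \<in> B \<Longrightarrow> b' \<in> B \<Longrightarrow> r b b' = (if b = b' then 1 else 0)"
proof -
  obtain C :: "'b set" and f where C: "finite C" "\<forall>b. bounded_linear (f b)" "\<forall>x. x = (\<Sum>b\<in>C. f b x *\<^sub>R b)"
    using finite_coordinates by blast
  have "span C = UNIV"
  proof -
    have "x \<in> span C" for x :: 'b
      by (subst C(3)[rule_format, of x]) (intro span_sum span_scale span_base)
    then show ?thesis by blast
  qed
  obtain B :: "'b set" where B: "independent B" "UNIV \<subseteq> span B"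
    using maximal_independent_subset[of "UNIV :: 'b set"] by blast
  have fin: "finite B" using independent_span_bound[OF C(1) B(1)] \<open>span C = UNIV\<close> by auto
  have sp: "span B = UNIV" using B(2) by blast
  show thesis
  proof (rule that[of B "\<lambda>b x. representation B x b"])
    have "linear (\<lambda>x. representation B x b)" for b
      by (rule linearI) (simp_all add: representation_add[OF B(1)] representation_scale[OF B(1)] sp)
    then show "bounded_linear (\<lambda>x. representation B x b)" for b
      by (rule linear_imp_bounded_linear_findim)
    show "x = (\<Sum>b\<in>B. representation B x b *\<^sub>R b)" for x
      using sum_representation_eq[OF B(1) _ fin, of x] sp by simp
    show "representation B b' b = (if b = b' then 1 else 0)" if "b \<in> B" "b' \<in> B" for b b'
      using representation_basis[OF B(1) that(2)] by auto
  qed (fact fin)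
qed

text \<open>Gaussian elimination: the coordinate functionals of the frame do not depend on the base point.\<close>

lemma smooth_kernel_frame:
  fixes D :: "'e::findim \<Rightarrow> 'e \<Rightarrow> 'b::findim"
  assumes Q: "open Q" "y0 \<in> Q" and sm: "\<And>v. smooth_on Q (\<lambda>y. D y v)"
    and lin: "\<And>y. y \<in> Q \<Longrightarrow> linear (D y)" and surj: "surj (D y0)"
  obtains L :: "'e set" and c :: "'e \<Rightarrow> 'e \<Rightarrow> real" and f Q'
  where "open Q'" "y0 \<in> Q'" "Q' \<subseteq> Q" "finite L" "\<And>l. bounded_linear (c l)"
    "\<And>l. l \<in> L \<Longrightarrow> smooth_on Q' (f l)" "\<And>l y. l \<in> L \<Longrightarrow> y \<in> Q' \<Longrightarrow> D y (f l y) = 0"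
    "\<And>y v. y \<in> Q' \<Longrightarrow> D y v = 0 \<Longrightarrow> v = (\<Sum>l\<in>L. c l v *\<^sub>R f l y)"
proof -
  obtain C :: "'e set" and c where C: "finite C" "\<forall>b. bounded_linear (c b)" "\<forall>x. x = (\<Sum>b\<in>C. c b x *\<^sub>R b)"
    using finite_coordinates by blast
  obtain B :: "'b set" and r where B: "finite B" "\<And>b. bounded_linear (r b)" "\<And>x. x = (\<Sum>b\<in>B. r b x *\<^sub>R b)"
    "\<And>b b'. b \<in> B \<Longrightarrow> b' \<in> B \<Longrightarrow> r b b' = (if b = b' then 1 else 0)"
    by (rule findim_basis[where 'b = 'b]) (rule that; assumption)
  \<comment> \<open>Induction over the equations: \<open>B'\<close> collects the components of
    \<open>D y v\<close> that are already required to vanish. With no equation at all, the frame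
    consists of the constant coordinate vectors.\<close>
  define frame where "frame B' L f Q' \<longleftrightarrow> open Q' \<and> y0 \<in> Q' \<and> Q' \<subseteq> Q \<and> finite L \<and>
      (\<forall>l\<in>L. smooth_on Q' (f l)) \<and>
      (\<forall>l\<in>L. \<forall>y\<in>Q'. \<forall>b\<in>B'. r b (D y (f l y)) = 0) \<and>
      (\<forall>y\<in>Q'. \<forall>v. (\<forall>b\<in>B'. r b (D y v) = 0) \<longrightarrow> v = (\<Sum>l\<in>L. c l v *\<^sub>R f l y))"
    for B' and L :: "'e set" and f Q'
  have frameD: "open Q'" "y0 \<in> Q'" "Q' \<subseteq> Q" "finite L" "\<And>l. l \<in> L \<Longrightarrow> smooth_on Q' (f l)"
      "\<And>l y b. l \<in> L \<Longrightarrow> y \<in> Q' \<Longrightarrow> b \<in> B' \<Longrightarrow> r b (D y (f l y)) = 0"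
      "\<And>y v. y \<in> Q' \<Longrightarrow> (\<forall>b\<in>B'. r b (D y v) = 0) \<Longrightarrow> v = (\<Sum>l\<in>L. c l v *\<^sub>R f l y)"
    if "frame B' L f Q'" for B' L f Q'
    using that unfolding frame_def by blast+
  have "\<exists>L f Q'. frame B' L f Q'"
    if "finite B'" "B' \<subseteq> B" for B'
    using that
  proof (induction B' rule: finite_induct)
    case empty
    show ?case
      using Q C(1,3) smooth_on_const[OF Q(1)]
      unfolding frame_def by (intro exI[of _ C] exI[of _ "\<lambda>l y. l"] exI[of _ Q]) auto
  next
    case (insert b B')
    then obtain L f Q' where "frame B' L f Q'" by auto
    note IH = frameD[OF this]
    define d where "d l y = r b (D y (f l y))" for l y
    have rl: "linear (r b)" for b using B(2) by (rule bounded_linear.linear)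
    have lin': "linear (\<lambda>v. r b (D y v))" if "y \<in> Q'" for y b
      using linear_compose[OF lin rl] that IH(3) by (auto simp: o_def)
    have dsum: "r b (D y v) = (\<Sum>l\<in>L. c l v * d l y)" if "y \<in> Q'" "\<forall>b\<in>B'. r b (D y v) = 0" for y v
      using arg_cong[OF IH(7)[OF that], of "\<lambda>v. r b (D y v)"]
      by (simp only: linear_sum[OF lin'[OF that(1)]] linear_scale[OF lin'[OF that(1)]] d_def real_scaleR_def)
    \<comment> \<open>A pivot exists at \<open>y0\<close>: otherwise the new equation would be a
      consequence of the earlier ones there, but a preimage of \<open>b\<close> under
      \<open>D y0\<close> satisfies these and violates the new one.\<close>
    have "\<exists>i\<in>L. d i y0 \<noteq> 0"
    proof (rule ccontr)
      assume "\<not> ?thesis"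
      then have 0: "\<And>i. i \<in> L \<Longrightarrow> d i y0 = 0" by blast
      obtain v where v: "D y0 v = b" using surj by (metis surjD)
      have "\<forall>b'\<in>B'. r b' (D y0 v) = 0" using B(4) insert v by auto
      from dsum[OF IH(2) this] 0 have "r b (D y0 v) = 0" by simp
      with v B(4)[of b b] insert show False by simp
    qed
    then obtain i where i: "i \<in> L" "d i y0 \<noteq> 0" by blast
    have smd: "smooth_on Q' (d l)" if "l \<in> L" for l
    proof -
      have *: "smooth_on Q' (\<lambda>y. r b (D y (\<Sum>k\<in>C. c k (f l y) *\<^sub>R k)))"
      proof (rule smooth_on_cong[OF IH(1), rotated])
        show "smooth_on Q' (\<lambda>y. \<Sum>k\<in>C. c k (f l y) *\<^sub>R r b (D y k))"
          by (intro smooth_on_sum smooth_on_scaleR IH(1) that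
              smooth_on_compose[OF IH(1) smooth_on_bounded_linear[OF C(2)[rule_format] open_UNIV] IH(5)]
              smooth_on_compose[OF IH(1) smooth_on_bounded_linear[OF B(2) open_UNIV] smooth_on_subset[OF sm IH(3)]]) auto
        show "(\<Sum>k\<in>C. c k (f l y) *\<^sub>R r b (D y k)) = r b (D y (\<Sum>k\<in>C. c k (f l y) *\<^sub>R k))" if "y \<in> Q'" for y
          by (simp only: linear_sum[OF lin'[OF that]] linear_scale[OF lin'[OF that]])
      qed
      have "(\<lambda>y. r b (D y (\<Sum>k\<in>C. c k (f l y) *\<^sub>R k))) = d l"
        using C(3) by (auto simp: d_def)
      with * show ?thesis by simp
    qed
    define P where "P = {y \<in> Q'. d i y \<in> - {0}}"
    have P: "open P" "y0 \<in> P" "P \<subseteq> Q'"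
      using smooth_on_open_vimage[OF smd[OF i(1)] IH(1), of "- {0}"] i IH(2) by (auto simp: P_def)
    \<comment> \<open>Subtracting a multiple of the pivot vector makes the new component vanish; the
      multiple is smooth where the pivot coefficient is nonzero.\<close>
    define g where "g l y = f l y + (- (d l y * inverse (d i y))) *\<^sub>R f i y" for l y
    have nz: "d i y \<noteq> 0" if "y \<in> P" for y using that by (auto simp: P_def)
    have smg: "smooth_on P (g l)" if "l \<in> L" for l
    proof -
      have 1: "smooth_on P (\<lambda>y. inverse (d i y))"
        by (rule smooth_on_inverse[OF P(1) smooth_on_subset[OF smd[OF i(1)] P(3)] nz])
      have "smooth_on P (\<lambda>y. f l y + (-1) *\<^sub>R (d l y *\<^sub>R (inverse (d i y) *\<^sub>R f i y)))"
        by (intro smooth_on_add smooth_on_scaleR P(1) 1 smooth_on_const smooth_on_subset[OF smd P(3)]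
            smooth_on_subset[OF IH(5) P(3)] that i(1))
      then show ?thesis by (simp add: g_def[abs_def])
    qed
    have rg: "r b' (D y (g l y)) = r b' (D y (f l y)) - d l y * inverse (d i y) * r b' (D y (f i y))"
      if "y \<in> P" for l y b'
    proof -
      have l: "linear (\<lambda>v. r b' (D y v))" using lin' that P(3) by blast
      show ?thesis
        unfolding g_def by (simp add: linear_diff[OF l] linear_scale[OF l])
    qed
    show ?case
      unfolding frame_def
    proof (rule exI[of _ "L - {i}"], rule exI[of _ g], rule exI[of _ P], intro conjI ballI allI impI)
      show "smooth_on P (g l)" if "l \<in> L - {i}" for l using smg that by blast
      show "r b' (D y (g l y)) = 0" if "l \<in> L - {i}" "y \<in> P" "b' \<in> insert b B'" for b' l y
        using that i(1) IH(6)[of l y b'] IH(6)[of i y b'] P(3) nz[of y]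
        by (auto simp: rg d_def[symmetric])
      fix y v assume y: "y \<in> P" and v: "\<forall>b'\<in>insert b B'. r b' (D y v) = 0"
      have yQ: "y \<in> Q'" using y P(3) by blast
      have "(\<Sum>l\<in>L. c l v * d l y) = 0" using dsum[OF yQ, of v] v by auto
      then have "c i v * d i y = - (\<Sum>l\<in>L - {i}. c l v * d l y)"
        using sum.remove[OF IH(4) i(1), of "\<lambda>l. c l v * d l y"] by simp
      then have ci: "c i v = (\<Sum>l\<in>L - {i}. c l v * - (d l y * inverse (d i y)))"
        using nz[OF y] by (simp add: sum_divide_distrib[symmetric] sum_negf divide_inverse[symmetric] field_simps)
      have "v = (\<Sum>l\<in>L. c l v *\<^sub>R f l y)" using IH(7)[OF yQ] v by simp
      also have "\<dots> = c i v *\<^sub>R f i y + (\<Sum>l\<in>L - {i}. c l v *\<^sub>R f l y)"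
        by (rule sum.remove[OF IH(4) i(1)])
      also have "\<dots> = (\<Sum>l\<in>L - {i}. c l v *\<^sub>R g l y)"
        unfolding ci g_def by (simp add: scaleR_sum_left sum.distrib[symmetric] algebra_simps)
      finally show "v = (\<Sum>l\<in>L - {i}. c l v *\<^sub>R g l y)" .
    qed (use P IH in auto)
  qed
  from this[OF B(1) order_refl] obtain L f Q' where "frame B L f Q'" by blast
  note * = frameD[OF this]
  have r0: "r b 0 = 0" for b using B(2)[of b] by (simp add: bounded_linear.linear linear_0)
  show thesis
  proof (rule that[OF *(1-4) C(2)[rule_format] *(5)])
    show "D y (f l y) = 0" if "l \<in> L" "y \<in> Q'" for l y
      by (subst B(3)) (simp add: *(6)[OF that])
    show "v = (\<Sum>l\<in>L. c l v *\<^sub>R f l y)" if "y \<in> Q'" "D y v = 0" for y v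
      by (rule *(7)[OF that(1)]) (simp add: that(2) r0)
  qed
qed

section \<open>Groupoids with a tubular structure\<close>

text \<open>Composability without a prescribed end point. It treats both nerves alike:
  \<open>(gs, g)\<close> lies in \<open>EG\<close> exactly if \<open>gs @ [g]\<close> is
  chained.\<close>

definition chained :: "('g, 'm, 'e, 'b) groupoid \<Rightarrow> 'g list \<Rightarrow> bool" where
  "chained \<G> gs \<longleftrightarrow> (\<forall>i. Suc i < length gs \<longrightarrow> src \<G> (gs ! i) = tgt \<G> (gs ! Suc i))"

lemma chained_simps [simp]:
  "chained \<G> []" "chained \<G> [g]"
  "chained \<G> (g # h # gs) \<longleftrightarrow> src \<G> g = tgt \<G> h \<and> chained \<G> (h # gs)"
proof -
  show "chained \<G> (g # h # gs) \<longleftrightarrow> src \<G> g = tgt \<G> h \<and> chained \<G> (h # gs)"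
    unfolding chained_def by (auto simp: nth_Cons split: nat.splits)
qed (simp_all add: chained_def)

lemma chained_append:
  "chained \<G> (gs @ hs) \<longleftrightarrow> chained \<G> gs \<and> chained \<G> hs \<and>
     (gs \<noteq> [] \<longrightarrow> hs \<noteq> [] \<longrightarrow> src \<G> (last gs) = tgt \<G> (hd hs))"
proof (induction gs rule: induct_list012)
  case (2 g)
  then show ?case by (cases hs) auto
qed auto

lemma composable_iff: "composable \<G> gs m \<longleftrightarrow> chained \<G> gs \<and> (gs \<noteq> [] \<longrightarrow> src \<G> (last gs) = m)"
  by (simp add: composable_def chained_def)

text \<open>\<open>retr\<close> is a total function; these are the arguments for which its value is
  meaningful, that is, both the vector of \<open>x\<close> and its multiple belong to
  \<open>\<Omega>\<close>.\<close>

definition retr_dom :: "('g \<times> 'e::findim) set \<Rightarrow> ('g \<times> 'e \<Rightarrow> 'g) \<Rightarrow> (real \<times> 'g) set" where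
  "retr_dom \<Omega> \<epsilon> = {(r, x). x \<in> \<epsilon> ` \<Omega> \<and> (fst (inv_into \<Omega> \<epsilon> x), r *\<^sub>R snd (inv_into \<Omega> \<epsilon> x)) \<in> \<Omega>}"

lemma retr_eq: "retr \<Omega> \<epsilon> r x = \<epsilon> (fst (inv_into \<Omega> \<epsilon> x), r *\<^sub>R snd (inv_into \<Omega> \<epsilon> x))"
  by (simp add: retr_def case_prod_beta)

locale tubular_groupoid =
  fixes \<G> :: "('g::topological_space, 'm::topological_space, 'e::findim, 'b::findim) groupoid"
    and \<Omega> :: "('g \<times> 'e) set" and \<epsilon> :: "'g \<times> 'e \<Rightarrow> 'g"
  assumes lie: "local_lie_groupoid \<G>" and tub: "tubular_structure \<G> \<Omega> \<epsilon>"
begin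

abbreviation "\<A> \<equiv> chartsG \<G>"
abbreviation "\<M> \<equiv> chartsM \<G>"
abbreviation "lam \<equiv> retr \<Omega> \<epsilon>"
abbreviation vel :: "(real \<Rightarrow> 'g) \<Rightarrow> real \<Rightarrow> 'e" where "vel \<equiv> velocity \<A> UNIV"

section \<open>The structure maps, the tubular structure and the retraction near a unit\<close>

lemma manifolds: "manifold_atlas \<A>" "manifold_atlas \<M>"
  using lie by (simp_all add: local_lie_groupoid_def)

lemma smooth_src: "smooth_map_on \<A> \<M> UNIV (src \<G>)"
  and smooth_tgt: "smooth_map_on \<A> \<M> UNIV (tgt \<G>)"
  and smooth_unt: "smooth_map_on \<M> \<A> UNIV (unt \<G>)"
  and smooth_mlt: "smooth_map_on (prod_atlas \<A> \<A>) \<A> (cdom \<G>) (\<lambda>(g, h). mlt \<G> g h)"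
  and smooth_ivs: "smooth_map_on \<A> \<A> (idom \<G>) (ivs \<G>)"
  and surj_tgt: "surj (tmap \<A> \<M> UNIV (tgt \<G>) g)"
  using lie by (simp_all add: local_lie_groupoid_def)

lemma src_unt [simp]: "src \<G> (unt \<G> m) = m" and tgt_unt [simp]: "tgt \<G> (unt \<G> m) = m"
  and unt_cdom: "(unt \<G> m, unt \<G> m) \<in> cdom \<G>"
  and cdom_open: "\<exists>N. open N \<and> cdom \<G> = N \<inter> {(g, h). src \<G> g = tgt \<G> h}"
  and idom_open: "open (idom \<G>)" and unt_idom: "unt \<G> m \<in> idom \<G>"
  using lie by (auto simp: local_lie_groupoid_def)

lemma cdomD:
  assumes "(g, h) \<in> cdom \<G>"
  shows "src \<G> g = tgt \<G> h" "src \<G> (mlt \<G> g h) = src \<G> h" "tgt \<G> (mlt \<G> g h) = tgt \<G> g"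
  using lie assms by (auto simp: local_lie_groupoid_def)

lemma mlt_assoc:
  assumes "(g, h) \<in> cdom \<G>" "(h, k) \<in> cdom \<G>" "(mlt \<G> g h, k) \<in> cdom \<G>" "(g, mlt \<G> h k) \<in> cdom \<G>"
  shows "mlt \<G> (mlt \<G> g h) k = mlt \<G> g (mlt \<G> h k)"
proof -
  have "\<forall>g h k. (g, h) \<in> cdom \<G> \<longrightarrow> (h, k) \<in> cdom \<G> \<longrightarrow> (mlt \<G> g h, k) \<in> cdom \<G> \<longrightarrow>
        (g, mlt \<G> h k) \<in> cdom \<G> \<longrightarrow> mlt \<G> (mlt \<G> g h) k = mlt \<G> g (mlt \<G> h k)"
    using lie unfolding local_lie_groupoid_def by (elim conjE)
  with assms show ?thesis by blast
qed

lemma mlt_unt_right: "(g, unt \<G> (src \<G> g)) \<in> cdom \<G> \<Longrightarrow> mlt \<G> g (unt \<G> (src \<G> g)) = g"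
  and mlt_unt_left: "(unt \<G> (tgt \<G> g), g) \<in> cdom \<G> \<Longrightarrow> mlt \<G> (unt \<G> (tgt \<G> g)) g = g"
  using lie by (simp_all add: local_lie_groupoid_def)

lemma ivsD:
  assumes "g \<in> idom \<G>"
  shows "src \<G> (ivs \<G> g) = tgt \<G> g" "tgt \<G> (ivs \<G> g) = src \<G> g"
    "(g, ivs \<G> g) \<in> cdom \<G>" "mlt \<G> g (ivs \<G> g) = unt \<G> (tgt \<G> g)"
    "(ivs \<G> g, g) \<in> cdom \<G>" "mlt \<G> (ivs \<G> g) g = unt \<G> (src \<G> g)"
proof -
  have "\<forall>g\<in>idom \<G>. src \<G> (ivs \<G> g) = tgt \<G> g \<and> tgt \<G> (ivs \<G> g) = src \<G> g \<and>
        (g, ivs \<G> g) \<in> cdom \<G> \<and> mlt \<G> g (ivs \<G> g) = unt \<G> (tgt \<G> g) \<and>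
        (ivs \<G> g, g) \<in> cdom \<G> \<and> mlt \<G> (ivs \<G> g) g = unt \<G> (src \<G> g)"
    using lie unfolding local_lie_groupoid_def by (elim conjE)
  with assms show "src \<G> (ivs \<G> g) = tgt \<G> g" "tgt \<G> (ivs \<G> g) = src \<G> g"
    "(g, ivs \<G> g) \<in> cdom \<G>" "mlt \<G> g (ivs \<G> g) = unt \<G> (tgt \<G> g)"
    "(ivs \<G> g, g) \<in> cdom \<G>" "mlt \<G> (ivs \<G> g) g = unt \<G> (src \<G> g)" by blast+
qed

lemma
  shows \<Omega>_open: "rel_open (tangent_atlas \<A>) (algd_total \<G>) \<Omega>"
    and \<Omega>_zero: "(unt \<G> m, 0) \<in> \<Omega>" and \<epsilon>_zero: "\<epsilon> (unt \<G> m, 0) = unt \<G> m"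
    and smooth_\<epsilon>: "smooth_map_on (tangent_atlas \<A>) \<A> \<Omega> \<epsilon>"
    and inj_\<epsilon>: "inj_on \<epsilon> \<Omega>" and open_\<epsilon>: "open (\<epsilon> ` \<Omega>)"
    and smooth_inv_\<epsilon>: "smooth_map_on \<A> (tangent_atlas \<A>) (\<epsilon> ` \<Omega>) (inv_into \<Omega> \<epsilon>)"
    and tgt_\<epsilon>: "(unt \<G> m, a) \<in> \<Omega> \<Longrightarrow> tgt \<G> (\<epsilon> (unt \<G> m, a)) = m"
    and vel_\<epsilon>: "a \<in> algd \<G> m \<Longrightarrow> vel (\<lambda>r. \<epsilon> (unt \<G> m, r *\<^sub>R a)) 0 = a"
  using tub by (simp_all add: tubular_structure_def)

lemma algd_subspace: "subspace (algd \<G> m)"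
proof -
  have "linear (tmap \<A> \<M> UNIV (tgt \<G>) (unt \<G> m))"
    by (rule tmap_linear[OF manifolds smooth_tgt, of _ _ UNIV]) auto
  then show ?thesis unfolding algd_def by (rule linear_subspace_kernel)
qed

lemma \<Omega>_cases:
  assumes "z \<in> \<Omega>" obtains m a where "z = (unt \<G> m, a)" "a \<in> algd \<G> m"
  using assms \<Omega>_open by (auto simp: rel_open_def algd_total_def)

lemma tangent_chart:
  assumes "(U, \<phi>) \<in> \<A>"
  shows "(U \<times> UNIV, \<lambda>(x, v). (\<phi> x, tangent_coord \<A> \<phi> x v)) \<in> tangent_atlas \<A>"
  using assms by (auto simp: tangent_atlas_def)

text \<open>Near a zero vector, being in \<open>\<Omega>\<close> and being mapped into
  \<open>N\<close> both follow from membership of the tangent coordinates in one open set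
  \<open>Q\<close>. Since these coordinates are linear on fibres, multiples of vectors can then be
  controlled in the model space.\<close>

lemma \<epsilon>_tube:
  assumes N: "open N" "unt \<G> m \<in> N"
  obtains U \<phi> Q where "(U, \<phi>) \<in> \<A>" "unt \<G> m \<in> U" "open Q" "(\<phi> (unt \<G> m), 0) \<in> Q"
    "\<And>m' a. a \<in> algd \<G> m' \<Longrightarrow> unt \<G> m' \<in> U \<Longrightarrow> (\<phi> (unt \<G> m'), tangent_coord \<A> \<phi> (unt \<G> m') a) \<in> Q \<Longrightarrow>
       (unt \<G> m', a) \<in> \<Omega> \<and> \<epsilon> (unt \<G> m', a) \<in> N"
proof -
  obtain U \<phi> where U: "(U, \<phi>) \<in> \<A>" "unt \<G> m \<in> U"
    using atlas_cover[OF manifold_atlas_cover[OF manifolds(1)]] by blast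
  let ?\<phi> = "\<lambda>(x, v). (\<phi> x, tangent_coord \<A> \<phi> x v)"
  note ch = manifold_chart[OF manifolds(1) U(1)]
  note tc = tangent_chart[OF U(1)]
  have t0: "tangent_coord \<A> \<phi> (unt \<G> m) 0 = 0"
    using tangent_coord_linear[OF manifolds(1) U] by (rule linear_0)
  have "\<exists>Q. open Q \<and> ?\<phi> (unt \<G> m, 0) \<in> Q \<and> (\<forall>y\<in>algd_total \<G> \<inter> (U \<times> UNIV). ?\<phi> y \<in> Q \<longrightarrow> y \<in> \<Omega>)"
    using \<Omega>_open[unfolded rel_open_def, THEN conjunct2, THEN bspec, OF \<Omega>_zero, THEN bspec, OF tc] U(2)
    by simp
  then obtain Q1 where "open Q1" and Q1': "?\<phi> (unt \<G> m, 0) \<in> Q1"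
    "\<forall>y\<in>algd_total \<G> \<inter> (U \<times> UNIV). ?\<phi> y \<in> Q1 \<longrightarrow> y \<in> \<Omega>" by blast
  then have Q1: "open Q1" "(\<phi> (unt \<G> m), 0) \<in> Q1"
    "\<And>y. y \<in> algd_total \<G> \<Longrightarrow> fst y \<in> U \<Longrightarrow> ?\<phi> y \<in> Q1 \<Longrightarrow> y \<in> \<Omega>"
    by (simp_all add: t0 mem_Times_iff)
  have u: "(unt \<G> m, 0) \<in> U \<times> UNIV" "\<epsilon> (unt \<G> m, 0) \<in> U" using U(2) \<epsilon>_zero by auto
  obtain Q2 F where Q2: "open Q2" "?\<phi> (unt \<G> m, 0) \<in> Q2" "smooth_on Q2 F"
    "\<And>y. y \<in> \<Omega> \<Longrightarrow> y \<in> U \<times> UNIV \<Longrightarrow> ?\<phi> y \<in> Q2 \<Longrightarrow> \<epsilon> y \<in> U \<and> \<phi> (\<epsilon> y) = F (?\<phi> y)"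
    by (rule smooth_map_onD[OF smooth_\<epsilon> \<Omega>_zero tc u(1) U(1) u(2)]) blast
  \<comment> \<open>\<open>Q1\<close> ensures membership in \<open>\<Omega>\<close>; the other set
    says, through the local extension \<open>F\<close> of \<open>\<epsilon>\<close>, that the value
    lies in \<open>N\<close>.\<close>
  define Q where "Q = Q1 \<inter> {q \<in> Q2. F q \<in> \<phi> ` (U \<inter> N)}"
  have "open Q" unfolding Q_def
    using Q1(1) smooth_on_open_vimage[OF Q2(3,1) ch(5)[OF N(1)]] by blast
  moreover have "(\<phi> (unt \<G> m), 0) \<in> Q"
  proof -
    have "F (\<phi> (unt \<G> m), 0) = \<phi> (unt \<G> m)"
      using Q2(4)[OF \<Omega>_zero _ Q2(2)] U(2) t0 \<epsilon>_zero by simp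
    then show ?thesis using Q1(2) Q2(2) t0 U(2) N(2) by (auto simp: Q_def)
  qed
  moreover have "(unt \<G> m', a) \<in> \<Omega> \<and> \<epsilon> (unt \<G> m', a) \<in> N"
    if a: "a \<in> algd \<G> m'" "unt \<G> m' \<in> U" "(\<phi> (unt \<G> m'), tangent_coord \<A> \<phi> (unt \<G> m') a) \<in> Q" for m' a
  proof -
    have \<Omega>: "(unt \<G> m', a) \<in> \<Omega>" using a by (intro Q1(3)) (auto simp: Q_def algd_total_def)
    have e: "\<epsilon> (unt \<G> m', a) \<in> U \<and> \<phi> (\<epsilon> (unt \<G> m', a)) = F (?\<phi> (unt \<G> m', a))"
      using a by (intro Q2(4) \<Omega>) (auto simp: Q_def)
    moreover have "F (?\<phi> (unt \<G> m', a)) \<in> \<phi> ` (U \<inter> N)" using a by (simp add: Q_def)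
    ultimately have "\<epsilon> (unt \<G> m', a) \<in> N" using ch(3) by (auto dest: inj_onD)
    with \<Omega> show ?thesis by simp
  qed
  ultimately show thesis using that[OF U] by blast
qed

text \<open>Joint smoothness in time and arrow. In tangent charts scalar multiplication only scales
  the second component, so the retraction is a composite of the local extensions of the inverse of
  \<open>\<epsilon>\<close>, of scaling, and of \<open>\<epsilon>\<close>.\<close>

lemma smooth_retr: "smooth_map_on (prod_atlas vs_atlas \<A>) \<A> (retr_dom \<Omega> \<epsilon>) (\<lambda>(r, x). lam r x)"
proof (rule smooth_map_onI)
  fix z U' \<phi>' W \<theta>
  assume z: "z \<in> retr_dom \<Omega> \<epsilon>" and ch': "(U', \<phi>') \<in> prod_atlas vs_atlas \<A>" "z \<in> U'"
    and W: "(W, \<theta>) \<in> \<A>" "(case z of (r, x) \<Rightarrow> lam r x) \<in> W"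
  obtain r x where zrx: "z = (r, x)" by (cases z)
  obtain U \<phi> where U': "U' = UNIV \<times> U" "\<phi>' = map_prod id \<phi>" and U: "(U, \<phi>) \<in> \<A>"
    using ch'(1) by (auto simp: prod_atlas_def vs_atlas_def)
  obtain u a where ua: "inv_into \<Omega> \<epsilon> x = (u, a)" by (cases "inv_into \<Omega> \<epsilon> x")
  have x: "x \<in> \<epsilon> ` \<Omega>" "x \<in> U" and ra: "(u, r *\<^sub>R a) \<in> \<Omega>"
    using z ch'(2) by (auto simp: zrx U' retr_dom_def ua)
  have W': "\<epsilon> (u, r *\<^sub>R a) \<in> W" using W(2) by (simp add: zrx retr_eq ua)
  obtain V \<psi> where V: "(V, \<psi>) \<in> \<A>" "u \<in> V"
    using atlas_cover[OF manifold_atlas_cover[OF manifolds(1)]] by blast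
  let ?\<psi> = "\<lambda>(x, v). (\<psi> x, tangent_coord \<A> \<psi> x v)"
  note tc = tangent_chart[OF V(1)]
  have scale: "?\<psi> (u', s *\<^sub>R a') = (fst (?\<psi> (u', a')), s *\<^sub>R snd (?\<psi> (u', a')))" if "u' \<in> V" for u' s a'
    using tangent_coord_linear[OF manifolds(1) V(1) that] by (simp add: linear_scale)
  obtain Q1 F1 where Q1: "open Q1" "\<phi> x \<in> Q1" "Q1 \<subseteq> \<phi> ` U" "smooth_on Q1 F1"
    "\<And>y. y \<in> \<epsilon> ` \<Omega> \<Longrightarrow> y \<in> U \<Longrightarrow> \<phi> y \<in> Q1 \<Longrightarrow> inv_into \<Omega> \<epsilon> y \<in> V \<times> UNIV \<and> ?\<psi> (inv_into \<Omega> \<epsilon> y) = F1 (\<phi> y)"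
  proof (rule smooth_map_onD[OF smooth_inv_\<epsilon> x(1) U x(2) tc])
    show "inv_into \<Omega> \<epsilon> x \<in> V \<times> UNIV" using ua V(2) by simp
  qed blast
  have ra_V: "(u, r *\<^sub>R a) \<in> V \<times> UNIV" using V(2) by simp
  obtain Q2 F2 where Q2: "open Q2" "?\<psi> (u, r *\<^sub>R a) \<in> Q2" "smooth_on Q2 F2"
    "\<And>y. y \<in> \<Omega> \<Longrightarrow> y \<in> V \<times> UNIV \<Longrightarrow> ?\<psi> y \<in> Q2 \<Longrightarrow> \<epsilon> y \<in> W \<and> \<theta> (\<epsilon> y) = F2 (?\<psi> y)"
    by (rule smooth_map_onD[OF smooth_\<epsilon> ra tc ra_V W(1) W']) blast
  \<comment> \<open>The scaled vector in tangent coordinates, as a function of time and of the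
    coordinates of the arrow.\<close>
  define H where "H z = (fst (F1 (snd z)), fst z *\<^sub>R snd (F1 (snd z)))" for z :: "real \<times> 'e"
  have o1: "open (UNIV \<times> Q1 :: (real \<times> 'e) set)" using Q1(1) by (simp add: open_Times)
  have sF1: "smooth_on (UNIV \<times> Q1) (\<lambda>z :: real \<times> 'e. F1 (snd z))"
    by (rule smooth_on_compose[OF o1 Q1(4) smooth_on_bounded_linear[OF bounded_linear_snd o1]]) auto
  have sH: "smooth_on (UNIV \<times> Q1) H"
    unfolding H_def[abs_def]
    by (intro smooth_on_Pair smooth_on_scaleR o1 smooth_on_bounded_linear[OF bounded_linear_fst o1]
        smooth_on_compose[OF o1 smooth_on_bounded_linear[OF bounded_linear_fst open_UNIV] sF1]
        smooth_on_compose[OF o1 smooth_on_bounded_linear[OF bounded_linear_snd open_UNIV] sF1]) auto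
  define Q where "Q = {z \<in> UNIV \<times> Q1. H z \<in> Q2}"
  have oQ: "open Q" unfolding Q_def by (rule smooth_on_open_vimage[OF sH o1 Q2(1)])
  have key: "(case y of (r, x) \<Rightarrow> lam r x) \<in> W \<and> \<theta> (case y of (r, x) \<Rightarrow> lam r x) = F2 (H (\<phi>' y))"
    if y: "y \<in> retr_dom \<Omega> \<epsilon>" "y \<in> U'" "H (\<phi>' y) \<in> Q2" "\<phi> (snd y) \<in> Q1" for y
  proof -
    obtain s x' where sx: "y = (s, x')" by (cases y)
    obtain u' a' where ua': "inv_into \<Omega> \<epsilon> x' = (u', a')" by (cases "inv_into \<Omega> \<epsilon> x'")
    have x': "x' \<in> \<epsilon> ` \<Omega>" "x' \<in> U" and ra': "(u', s *\<^sub>R a') \<in> \<Omega>"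
      using y by (auto simp: sx U' retr_dom_def ua')
    have 1: "u' \<in> V" "?\<psi> (u', a') = F1 (\<phi> x')" using Q1(5)[OF x'] y(4) by (auto simp: ua' sx)
    have 2: "?\<psi> (u', s *\<^sub>R a') = H (\<phi>' y)" using scale[OF 1(1), of s a'] by (simp add: H_def sx U' 1(2)[symmetric])
    show ?thesis using Q2(4)[OF ra'] 1(1) y(3) unfolding 2 by (simp add: sx retr_eq ua')
  qed
  have "\<phi>' z \<in> Q"
  proof -
    have e: "?\<psi> (u, a) = F1 (\<phi> x)" using Q1(5)[OF x Q1(2)] by (simp add: ua)
    have "H (\<phi>' z) = ?\<psi> (u, r *\<^sub>R a)" using scale[OF V(2), of r a] by (simp add: H_def zrx U' e[symmetric])
    then show ?thesis using Q1(2) Q2(2) by (simp add: Q_def zrx U')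
  qed
  moreover have "Q \<subseteq> \<phi>' ` U'"
  proof
    fix q assume "q \<in> Q"
    then obtain y where "y \<in> U" "snd q = \<phi> y" using Q1(3) by (auto simp: Q_def)
    then show "q \<in> \<phi>' ` U'" by (intro image_eqI[of _ _ "(fst q, y)"]) (auto simp: U' prod_eq_iff)
  qed
  moreover have "smooth_on Q (\<lambda>q. F2 (H q))"
    by (rule smooth_on_compose[OF oQ Q2(3) smooth_on_subset[OF sH]]) (auto simp: Q_def)
  ultimately show "\<exists>Q F. open Q \<and> \<phi>' z \<in> Q \<and> Q \<subseteq> \<phi>' ` U' \<and> smooth_on Q F \<and>
      (\<forall>y\<in>retr_dom \<Omega> \<epsilon> \<inter> U'. \<phi>' y \<in> Q \<longrightarrow> (case y of (r, x) \<Rightarrow> lam r x) \<in> W \<and> \<theta> (case y of (r, x) \<Rightarrow> lam r x) = F (\<phi>' y))"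
    by (intro exI[of _ Q] exI[of _ "\<lambda>q. F2 (H q)"] conjI oQ ballI impI key) (auto simp: Q_def U')
qed

lemma \<epsilon>_image_cases:
  assumes "x \<in> \<epsilon> ` \<Omega>"
  obtains a where "a \<in> algd \<G> (tgt \<G> x)" "(unt \<G> (tgt \<G> x), a) \<in> \<Omega>" "x = \<epsilon> (unt \<G> (tgt \<G> x), a)"
    "inv_into \<Omega> \<epsilon> x = (unt \<G> (tgt \<G> x), a)"
proof -
  have i: "inv_into \<Omega> \<epsilon> x \<in> \<Omega>" "\<epsilon> (inv_into \<Omega> \<epsilon> x) = x"
    using assms by (auto intro: inv_into_into f_inv_into_f)
  obtain m a where m: "inv_into \<Omega> \<epsilon> x = (unt \<G> m, a)" "a \<in> algd \<G> m" using \<Omega>_cases[OF i(1)] .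
  with i tgt_\<epsilon>[of m a] have "tgt \<G> x = m" by simp
  with m i that show thesis by simp
qed

lemma unt_mem_\<epsilon>: "unt \<G> m \<in> \<epsilon> ` \<Omega>" and inv_\<epsilon>_unt: "inv_into \<Omega> \<epsilon> (unt \<G> m) = (unt \<G> m, 0)"
  using \<Omega>_zero[of m] \<epsilon>_zero[of m] inv_into_f_f[OF inj_\<epsilon> \<Omega>_zero[of m]] by (force, simp)

lemma lam_unt [simp]: "lam r (unt \<G> m) = unt \<G> m"
  by (simp add: retr_eq inv_\<epsilon>_unt \<epsilon>_zero)

text \<open>The domain condition says that the inverse of \<open>\<epsilon>\<close> recovers the
  scaled vector, so the two scalings multiply.\<close>

lemma lam_lam: "(r, x) \<in> retr_dom \<Omega> \<epsilon> \<Longrightarrow> lam s (lam r x) = lam (s * r) x"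
  by (simp add: retr_eq retr_dom_def inv_into_f_f[OF inj_\<epsilon>])

lemma tgt_lam: "(r, x) \<in> retr_dom \<Omega> \<epsilon> \<Longrightarrow> tgt \<G> (lam r x) = tgt \<G> x"
  by (auto simp: retr_dom_def retr_eq elim!: \<epsilon>_image_cases intro: tgt_\<epsilon>)

text \<open>\<open>shrinks N B\<close>: the structure maps, and the retraction for parameters in \<open>[-1,2]\<close>, send arrows of \<open>B\<close>
  to \<open>N\<close>. The margin around \<open>[0,1]\<close> yields smooth extensions to a neighbourhood of the cube.\<close>

definition shrinks :: "'g set \<Rightarrow> 'g set \<Rightarrow> bool" where
  "shrinks N B \<longleftrightarrow> B \<subseteq> N \<and>
     (\<forall>x\<in>B. \<forall>y\<in>B. src \<G> x = tgt \<G> y \<longrightarrow> (x, y) \<in> cdom \<G> \<and> mlt \<G> x y \<in> N) \<and>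
     (\<forall>x\<in>B. x \<in> idom \<G> \<and> ivs \<G> x \<in> N \<and> unt \<G> (src \<G> x) \<in> N \<and> unt \<G> (tgt \<G> x) \<in> N) \<and>
     (\<forall>x\<in>B. \<forall>r\<in>{-1..2}. (r, x) \<in> retr_dom \<Omega> \<epsilon> \<and> lam r x \<in> N)"

lemma ex_mlt_nhd:
  assumes N: "open N" "unt \<G> m \<in> N"
  shows "\<exists>B. open B \<and> unt \<G> m \<in> B \<and> (\<forall>x\<in>B. \<forall>y\<in>B. src \<G> x = tgt \<G> y \<longrightarrow> (x, y) \<in> cdom \<G> \<and> mlt \<G> x y \<in> N)"
proof -
  obtain K where K: "open K" "cdom \<G> = K \<inter> {(g, h). src \<G> g = tgt \<G> h}" using cdom_open by blast
  have cts: "continuous_on (cdom \<G>) (\<lambda>(g, h). mlt \<G> g h)"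
    using smooth_map_on_continuous[OF cts_atlas_prod manifolds(1) smooth_mlt] manifold_imp_cts_atlas[OF manifolds(1)] by blast
  have "mlt \<G> (unt \<G> m) (unt \<G> m) = unt \<G> m" using mlt_unt_right[of "unt \<G> m"] unt_cdom by simp
  then have "\<exists>P. open P \<and> (unt \<G> m, unt \<G> m) \<in> P \<and> (\<forall>z\<in>cdom \<G>. z \<in> P \<longrightarrow> (case z of (g, h) \<Rightarrow> mlt \<G> g h) \<in> N)"
    using cts[unfolded continuous_on_topological, rule_format, OF unt_cdom N(1), of m] N(2) by simp
  then obtain P where P: "open P" "(unt \<G> m, unt \<G> m) \<in> P"
    "\<forall>z\<in>cdom \<G>. z \<in> P \<longrightarrow> (case z of (g, h) \<Rightarrow> mlt \<G> g h) \<in> N" by blast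
  have "open (P \<inter> K)" "(unt \<G> m, unt \<G> m) \<in> P \<inter> K" using P K unt_cdom by auto
  then obtain B C where "open B" "open C" "unt \<G> m \<in> B" "unt \<G> m \<in> C" "B \<times> C \<subseteq> P \<inter> K"
    by (auto elim!: open_prod_elim)
  moreover have "(x, y) \<in> cdom \<G> \<and> mlt \<G> x y \<in> N"
    if "x \<in> B \<inter> C" "y \<in> B \<inter> C" "src \<G> x = tgt \<G> y" for x y
  proof -
    have "(x, y) \<in> P" "(x, y) \<in> cdom \<G>" using that \<open>B \<times> C \<subseteq> P \<inter> K\<close> K(2) by auto
    with P(3) show ?thesis by fastforce
  qed
  ultimately show ?thesis by (intro exI[of _ "B \<inter> C"]) blast
qed

lemma ex_ivs_nhd:
  assumes N: "open N" "unt \<G> m \<in> N"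
  shows "\<exists>B. open B \<and> unt \<G> m \<in> B \<and> (\<forall>x\<in>B. x \<in> idom \<G> \<and> ivs \<G> x \<in> N \<and> unt \<G> (src \<G> x) \<in> N \<and> unt \<G> (tgt \<G> x) \<in> N)"
proof -
  note c = manifold_imp_cts_atlas[OF manifolds(1)] manifold_imp_cts_atlas[OF manifolds(2)]
  let ?i = "ivs \<G> (unt \<G> m)"
  have "mlt \<G> (unt \<G> (tgt \<G> ?i)) ?i = ?i"
    using ivsD[OF unt_idom, of m] by (intro mlt_unt_left) simp
  then have "?i = unt \<G> m" using ivsD[OF unt_idom, of m] by simp
  moreover have "continuous_on (idom \<G>) (ivs \<G>)"
    by (rule smooth_map_on_continuous[OF c(1) manifolds(1) smooth_ivs])
  then have "open (ivs \<G> -` N \<inter> idom \<G>)" by (rule open_vimage_Int[OF _ idom_open N(1)])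
  moreover have u: "open (unt \<G> -` N)"
    by (rule open_vimage[OF N(1) smooth_map_on_continuous[OF c(2) manifolds(1) smooth_unt]])
  have "open (src \<G> -` (unt \<G> -` N))" "open (tgt \<G> -` (unt \<G> -` N))"
    by (rule open_vimage[OF u smooth_map_on_continuous[OF c(1) manifolds(2) smooth_src]],
        rule open_vimage[OF u smooth_map_on_continuous[OF c(1) manifolds(2) smooth_tgt]])
  ultimately show ?thesis
    using N unt_idom
    by (intro exI[of _ "(ivs \<G> -` N \<inter> idom \<G>) \<inter> src \<G> -` (unt \<G> -` N) \<inter> tgt \<G> -` (unt \<G> -` N)"]) auto
qed

lemma ex_retr_nhd:
  assumes N: "open N" "unt \<G> m \<in> N"
  shows "\<exists>B. open B \<and> unt \<G> m \<in> B \<and> (\<forall>x\<in>B. \<forall>r\<in>{-1..2}. (r, x) \<in> retr_dom \<Omega> \<epsilon> \<and> lam r x \<in> N)"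
proof -
  obtain U \<phi> Q where U: "(U, \<phi>) \<in> \<A>" "unt \<G> m \<in> U" and Q: "open Q" "(\<phi> (unt \<G> m), 0) \<in> Q"
    "\<And>m' a. a \<in> algd \<G> m' \<Longrightarrow> unt \<G> m' \<in> U \<Longrightarrow> (\<phi> (unt \<G> m'), tangent_coord \<A> \<phi> (unt \<G> m') a) \<in> Q \<Longrightarrow>
       (unt \<G> m', a) \<in> \<Omega> \<and> \<epsilon> (unt \<G> m', a) \<in> N"
    using \<epsilon>_tube[OF N] by blast
  obtain A E where AE: "open A" "open E" "\<phi> (unt \<G> m) \<in> A" "0 \<in> E" "A \<times> E \<subseteq> Q"
    using open_prod_elim[OF Q(1,2)] by (metis mem_Sigma_iff)
  then obtain d where d: "d > 0" "ball 0 d \<subseteq> E" by (meson open_contains_ball)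
  let ?\<phi> = "\<lambda>(x, v). (\<phi> x, tangent_coord \<A> \<phi> x v)"
  note ch = manifold_chart[OF manifolds(1) U(1)]
  note lin = tangent_coord_linear[OF manifolds(1) U(1)]
  have i0: "inv_into \<Omega> \<epsilon> (unt \<G> m) \<in> U \<times> UNIV" by (simp add: inv_\<epsilon>_unt U(2))
  obtain Q1 F1 where Q1: "open Q1" "\<phi> (unt \<G> m) \<in> Q1" "smooth_on Q1 F1"
    "\<And>y. y \<in> \<epsilon> ` \<Omega> \<Longrightarrow> y \<in> U \<Longrightarrow> \<phi> y \<in> Q1 \<Longrightarrow> inv_into \<Omega> \<epsilon> y \<in> U \<times> UNIV \<and> ?\<phi> (inv_into \<Omega> \<epsilon> y) = F1 (\<phi> y)"
    by (rule smooth_map_onD[OF smooth_inv_\<epsilon> unt_mem_\<epsilon> U tangent_chart[OF U(1)] i0]) blast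
  \<comment> \<open>Half the radius suffices because the parameter is at most 2 in absolute value on
    \<open>[-1,2]\<close>.\<close>
  let ?P = "{q \<in> Q1. F1 q \<in> A \<times> ball 0 (d / 2)}"
  have oP: "open ?P" by (rule smooth_on_open_vimage[OF Q1(3,1)]) (auto intro: open_Times AE)
  have "F1 (\<phi> (unt \<G> m)) = (\<phi> (unt \<G> m), 0)"
    using Q1(4)[OF unt_mem_\<epsilon> U(2) Q1(2)] linear_0[OF lin[OF U(2)]] by (simp add: inv_\<epsilon>_unt)
  then have mP: "\<phi> (unt \<G> m) \<in> ?P" using Q1(2) AE d by simp
  let ?B = "(\<phi> -` ?P \<inter> U) \<inter> \<epsilon> ` \<Omega>"
  have oB: "open ?B" by (intro open_Int open_vimage_Int[OF ch(4,1) oP] open_\<epsilon>)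
  have uB: "unt \<G> m \<in> ?B" by (intro IntI vimageI2 mP U(2) unt_mem_\<epsilon>)
  have rB: "(r, x) \<in> retr_dom \<Omega> \<epsilon> \<and> lam r x \<in> N" if x: "x \<in> ?B" and r: "r \<in> {-1..2}" for x r
  proof -
    obtain a where a: "a \<in> algd \<G> (tgt \<G> x)" "inv_into \<Omega> \<epsilon> x = (unt \<G> (tgt \<G> x), a)"
      using x by (auto elim!: \<epsilon>_image_cases)
    let ?u = "unt \<G> (tgt \<G> x)"
    have 1: "?u \<in> U" "?\<phi> (?u, a) = F1 (\<phi> x)" using Q1(4)[of x] x a(2) by auto
    then have 2: "\<phi> ?u \<in> A" "norm (tangent_coord \<A> \<phi> ?u a) < d / 2" using x by auto
    have "norm (r *\<^sub>R tangent_coord \<A> \<phi> ?u a) \<le> 2 * norm (tangent_coord \<A> \<phi> ?u a)"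
      using r by (auto simp: intro!: mult_right_mono)
    then have "tangent_coord \<A> \<phi> ?u (r *\<^sub>R a) \<in> E"
      using 2(2) d(2) by (auto simp: linear_scale[OF lin[OF 1(1)]] subset_iff)
    then have "(?u, r *\<^sub>R a) \<in> \<Omega> \<and> \<epsilon> (?u, r *\<^sub>R a) \<in> N"
      using 2(1) AE(5) by (intro Q(3) 1(1) subspace_scale[OF algd_subspace] a(1)) auto
    then show ?thesis using x a(2) by (simp add: retr_dom_def retr_eq)
  qed
  show ?thesis
    by (rule exI[of _ ?B], intro conjI[OF oB] conjI[OF uB] ballI rB)
qed

lemma ex_shrinks:
  assumes N: "open N" "unt \<G> m \<in> N"
  shows "\<exists>B. (open B \<and> unt \<G> m \<in> B) \<and> shrinks N B"
proof -
  obtain B1 where B1: "open B1" "unt \<G> m \<in> B1" "\<forall>x\<in>B1. \<forall>y\<in>B1. src \<G> x = tgt \<G> y \<longrightarrow> (x, y) \<in> cdom \<G> \<and> mlt \<G> x y \<in> N"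
    using ex_mlt_nhd[OF N] by blast
  obtain B2 where B2: "open B2" "unt \<G> m \<in> B2" "\<forall>x\<in>B2. x \<in> idom \<G> \<and> ivs \<G> x \<in> N \<and> unt \<G> (src \<G> x) \<in> N \<and> unt \<G> (tgt \<G> x) \<in> N"
    using ex_ivs_nhd[OF N] by blast
  obtain B3 where B3: "open B3" "unt \<G> m \<in> B3" "\<forall>x\<in>B3. \<forall>r\<in>{-1..2}. (r, x) \<in> retr_dom \<Omega> \<epsilon> \<and> lam r x \<in> N"
    using ex_retr_nhd[OF N] by blast
  let ?B = "B1 \<inter> B2 \<inter> B3 \<inter> N"
  have "open ?B \<and> unt \<G> m \<in> ?B" using B1 B2 B3 N by (simp add: open_Int)
  moreover have "shrinks N ?B"
    unfolding shrinks_def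
  proof (intro conjI)
    show "\<forall>x\<in>?B. \<forall>y\<in>?B. src \<G> x = tgt \<G> y \<longrightarrow> (x, y) \<in> cdom \<G> \<and> mlt \<G> x y \<in> N"
      using B1(3) by (meson IntD1)
    show "\<forall>x\<in>?B. x \<in> idom \<G> \<and> ivs \<G> x \<in> N \<and> unt \<G> (src \<G> x) \<in> N \<and> unt \<G> (tgt \<G> x) \<in> N"
      using B2(3) by (meson IntD1 IntD2)
    show "\<forall>x\<in>?B. \<forall>r\<in>{-1..2}. (r, x) \<in> retr_dom \<Omega> \<epsilon> \<and> lam r x \<in> N"
      using B3(3) by (meson IntD1 IntD2)
  qed blast
  ultimately show ?thesis by blast
qed

end

section \<open>Calculus in the fibres of the target map\<close>

lemma cube_map_Cons:
  "hs \<noteq> [] \<Longrightarrow> cube_map \<G> lam (g # hs) m t = lam (t 0) (mlt \<G> g (cube_map \<G> lam hs m (\<lambda>i. t (Suc i))))"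
  by (cases hs) auto

text \<open>\<open>cube_map\<close> unfolds from the first arrow, but the simplicial differential
  and the homotopy operator act on the last one. This moves the innermost retraction into the last
  arrow.\<close>

lemma cube_map_snoc2:
  "cube_map \<G> lam (gs @ [g, x]) m t = cube_map \<G> lam (gs @ [mlt \<G> g (lam (t (Suc (length gs))) x)]) m t"
proof (induction gs arbitrary: t)
  case (Cons a gs)
  then show ?case by (simp add: cube_map_Cons)
qed simp

lemma cube_map_cong:
  "(\<And>i. i < length gs \<Longrightarrow> t i = t' i) \<Longrightarrow> cube_map \<G> lam gs m t = cube_map \<G> lam gs m t'"
proof (induction gs arbitrary: t t')
  case (Cons a gs)
  show ?case
  proof (cases "gs = []")
    case False
    have "cube_map \<G> lam gs m (\<lambda>i. t (Suc i)) = cube_map \<G> lam gs m (\<lambda>i. t' (Suc i))"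
      by (rule Cons.IH) (use Cons.prems in auto)
    then show ?thesis using False Cons.prems[of 0] by (simp add: cube_map_Cons)
  qed (use Cons.prems[of 0] in simp)
qed simp

lemma cube_map_base: "gs \<noteq> [] \<Longrightarrow> cube_map \<G> lam gs m t = cube_map \<G> lam gs m' t"
proof (induction gs arbitrary: t)
  case (Cons a gs)
  then show ?case by (cases "gs = []") (auto simp: cube_map_Cons)
qed simp

context tubular_groupoid
begin

text \<open>Curves that represent vectors tangent to a target fibre: on their velocities the tangent
  map within the fibre is determined.\<close>

definition fcurve :: "'m \<Rightarrow> (real \<Rightarrow> 'g) \<Rightarrow> real \<Rightarrow> bool" where
  "fcurve m c h0 \<longleftrightarrow> smooth_curve_at \<A> c h0 \<and> (\<forall>\<^sub>F h in nhds h0. tgt \<G> (c h) = m)"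

lemma fcurve_isCont: "fcurve m c h0 \<Longrightarrow> isCont c h0"
  by (simp add: fcurve_def smooth_curve_at_def)

lemma fcurve_tgt: "fcurve m c h0 \<Longrightarrow> tgt \<G> (c h0) = m"
  unfolding fcurve_def by (auto dest: eventually_nhds_x_imp_x)

text \<open>The target is constant along the curve, so its differential kills the velocity.\<close>

lemma fcurve_algd:
  assumes "fcurve m c h0" "c h0 = unt \<G> m"
  shows "vel c h0 \<in> algd \<G> m"
proof -
  have "velocity \<M> UNIV (\<lambda>h. tgt \<G> (c h)) h0 = tmap \<A> \<M> UNIV (tgt \<G>) (c h0) (vel c h0)"
    using assms by (intro smooth_curve_chain(2)[OF manifolds smooth_tgt, of _ _ UNIV UNIV]) (auto simp: fcurve_def)
  moreover have "velocity \<M> UNIV (\<lambda>h. tgt \<G> (c h)) h0 = velocity \<M> UNIV (\<lambda>h. m) h0"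
    by (rule smooth_curve_at_cong(1)) (use assms(1) in \<open>simp add: fcurve_def\<close>)
  ultimately show ?thesis using assms(2) by (simp add: algd_def smooth_curve_at_const(2))
qed

text \<open>The domain of left multiplication by \<open>g\<close> is the trace of an open set on a
  target fibre. In this form \<open>smooth_curve_chain\<close> applies with the whole fibre as the
  set within which one differentiates.\<close>

lemma mlt_partial:
  obtains K where "open K" "tfib \<G> (src \<G> g) \<inter> K = {h. (g, h) \<in> cdom \<G>}"
    "smooth_map_on \<A> \<A> {h. (g, h) \<in> cdom \<G>} (mlt \<G> g)"
proof -
  obtain K where K: "open K" "cdom \<G> = K \<inter> {(g, h). src \<G> g = tgt \<G> h}" using cdom_open by blast
  have "open (Pair g -` K)" by (rule open_vimage[OF K(1)]) (intro continuous_intros)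
  moreover have "tfib \<G> (src \<G> g) \<inter> Pair g -` K = {h. (g, h) \<in> cdom \<G>}" by (auto simp: K(2) tfib_def)
  moreover have "smooth_map_on \<A> \<A> {h. (g, h) \<in> cdom \<G>} (mlt \<G> g)"
    using smooth_map_on_partial[OF manifold_atlas_cover[OF manifolds(1)] smooth_mlt, of g] by simp
  ultimately show thesis using that by blast
qed

lemma fcurve_mlt:
  assumes c: "fcurve (src \<G> g) c h0" and g: "(g, c h0) \<in> cdom \<G>"
  shows "\<forall>\<^sub>F h in nhds h0. (g, c h) \<in> cdom \<G>"
    and "fcurve (tgt \<G> g) (\<lambda>h. mlt \<G> g (c h)) h0"
    and "vel (\<lambda>h. mlt \<G> g (c h)) h0 = tmap \<A> \<A> (tfib \<G> (src \<G> g)) (mlt \<G> g) (c h0) (vel c h0)"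
proof -
  obtain K where K: "open K" "tfib \<G> (src \<G> g) \<inter> K = {h. (g, h) \<in> cdom \<G>}"
    "smooth_map_on \<A> \<A> {h. (g, h) \<in> cdom \<G>} (mlt \<G> g)" by (rule mlt_partial)
  have c1: "smooth_curve_at \<A> c h0" and c2: "\<forall>\<^sub>F h in nhds h0. c h \<in> tfib \<G> (src \<G> g)"
    using c by (simp_all add: fcurve_def tfib_def)
  have x: "c h0 \<in> {h. (g, h) \<in> cdom \<G>}" "c h0 \<in> K" using g K(2) by auto
  show ev: "\<forall>\<^sub>F h in nhds h0. (g, c h) \<in> cdom \<G>"
    using c2 isCont_eventually_open[OF fcurve_isCont[OF c] K(1) x(2)]
    by eventually_elim (use K(2) in blast)
  note ch = smooth_curve_chain[OF manifolds(1) manifolds(1) K(3) c1 c2 x K(1) equalityD1[OF K(2)]]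
  have "\<forall>\<^sub>F h in nhds h0. tgt \<G> (mlt \<G> g (c h)) = tgt \<G> g"
    using ev by eventually_elim (rule cdomD(3))
  with ch(1) show "fcurve (tgt \<G> g) (\<lambda>h. mlt \<G> g (c h)) h0" by (simp add: fcurve_def)
  show "vel (\<lambda>h. mlt \<G> g (c h)) h0 = tmap \<A> \<A> (tfib \<G> (src \<G> g)) (mlt \<G> g) (c h0) (vel c h0)"
    by (rule ch(2))
qed

lemma tmap_mlt_linear:
  assumes "(g, h) \<in> cdom \<G>"
  shows "linear (tmap \<A> \<A> (tfib \<G> (src \<G> g)) (mlt \<G> g) h)"
proof -
  obtain K where K: "open K" "tfib \<G> (src \<G> g) \<inter> K = {h. (g, h) \<in> cdom \<G>}"
    "smooth_map_on \<A> \<A> {h. (g, h) \<in> cdom \<G>} (mlt \<G> g)" by (rule mlt_partial)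
  show ?thesis
    using assms K(2)
    by (intro tmap_linear[OF manifolds(1) manifolds(1) K(3) _ _ _ K(1) equalityD1[OF K(2)]]) auto
qed

lemma smooth_lam: "smooth_map_on \<A> \<A> {x. (r, x) \<in> retr_dom \<Omega> \<epsilon>} (lam r)"
  using smooth_map_on_partial[OF cts_atlas_cover[OF cts_atlas_vs] smooth_retr, of r] by simp

lemma family_mlt:
  assumes "smooth_family \<A> p Q f" "smooth_family \<A> p Q g" "\<And>t. t \<in> Q \<Longrightarrow> (f t, g t) \<in> cdom \<G>"
  shows "smooth_family \<A> p Q (\<lambda>t. mlt \<G> (f t) (g t))"
proof -
  have "smooth_family \<A> p Q (\<lambda>t. case (f t, g t) of (x, y) \<Rightarrow> mlt \<G> x y)"
    by (rule smooth_family_compose[OF cts_atlas_cover[OF cts_atlas_prod] smooth_mlt smooth_family_Pair[OF assms(1,2)]])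
      (use assms(3) manifold_imp_cts_atlas[OF manifolds(1)] in auto)
  then show ?thesis by simp
qed

lemma family_lam:
  assumes "smooth_family \<A> p Q x" "\<And>n. cube_Ck p n Q \<tau>" "\<And>t. t \<in> Q \<Longrightarrow> (\<tau> t, x t) \<in> retr_dom \<Omega> \<epsilon>"
  shows "smooth_family \<A> p Q (\<lambda>t. lam (\<tau> t) (x t))"
proof -
  have Q: "open Q" using assms(1) by (simp add: smooth_family_def)
  have "smooth_family \<A> p Q (\<lambda>t. case (\<tau> t, x t) of (r, x) \<Rightarrow> lam r x)"
    by (rule smooth_family_compose[OF cts_atlas_cover[OF cts_atlas_prod] smooth_retr
          smooth_family_Pair[OF smooth_family_vs[OF Q assms(2)] assms(1)]])
      (use assms(3) manifold_imp_cts_atlas[OF manifolds(1)] cts_atlas_vs in auto)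
  then show ?thesis by simp
qed

lemma family_ivs:
  assumes "smooth_family \<A> p Q x" "\<And>t. t \<in> Q \<Longrightarrow> x t \<in> idom \<G>"
  shows "smooth_family \<A> p Q (\<lambda>t. ivs \<G> (x t))"
  by (rule smooth_family_compose[OF manifold_atlas_cover[OF manifolds(1)] smooth_ivs assms(1)]) (use assms(2) in auto)

end

text \<open>A chain of neighbourhoods in which the structure maps lower the index by one. The index
  of an arrow thus counts the operations that it may still undergo, and it replaces the domain
  conditions of a local groupoid.\<close>

locale unit_tower = tubular_groupoid +
  fixes N :: "nat \<Rightarrow> 'a set"
  assumes N_open: "open (N k)" and N_shrinks: "shrinks (N k) (N (Suc k))"
begin

section \<open>Products, inverses and retractions in the tower\<close>

lemma N_mono: "j \<le> k \<Longrightarrow> x \<in> N k \<Longrightarrow> x \<in> N j"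
proof (induction k rule: dec_induct)
  case (step k)
  then show ?case using N_shrinks[of k] by (auto simp: shrinks_def)
qed

lemma N_mlt:
  assumes "x \<in> N (Suc k)" "y \<in> N (Suc k)" "src \<G> x = tgt \<G> y"
  shows "(x, y) \<in> cdom \<G>" "mlt \<G> x y \<in> N k" "src \<G> (mlt \<G> x y) = src \<G> y" "tgt \<G> (mlt \<G> x y) = tgt \<G> x"
proof -
  show "(x, y) \<in> cdom \<G>" "mlt \<G> x y \<in> N k" using N_shrinks[of k] assms unfolding shrinks_def by blast+
  then show "src \<G> (mlt \<G> x y) = src \<G> y" "tgt \<G> (mlt \<G> x y) = tgt \<G> x" using cdomD by blast+
qed

lemma N_ivs:
  assumes "x \<in> N (Suc k)"
  shows "x \<in> idom \<G>" "ivs \<G> x \<in> N k" "src \<G> (ivs \<G> x) = tgt \<G> x" "tgt \<G> (ivs \<G> x) = src \<G> x"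
proof -
  show "x \<in> idom \<G>" "ivs \<G> x \<in> N k" using N_shrinks[of k] assms unfolding shrinks_def by blast+
  then show "src \<G> (ivs \<G> x) = tgt \<G> x" "tgt \<G> (ivs \<G> x) = src \<G> x" using ivsD by blast+
qed

lemma N_unt: "x \<in> N (Suc k) \<Longrightarrow> unt \<G> (src \<G> x) \<in> N k" "x \<in> N (Suc k) \<Longrightarrow> unt \<G> (tgt \<G> x) \<in> N k"
  using N_shrinks[of k] unfolding shrinks_def by blast+

lemma N_lam:
  assumes "x \<in> N (Suc k)" "r \<in> {-1..2}"
  shows "(r, x) \<in> retr_dom \<Omega> \<epsilon>" "lam r x \<in> N k" "tgt \<G> (lam r x) = tgt \<G> x"
proof -
  show "(r, x) \<in> retr_dom \<Omega> \<epsilon>" "lam r x \<in> N k" using N_shrinks[of k] assms unfolding shrinks_def by blast+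
  then show "tgt \<G> (lam r x) = tgt \<G> x" using tgt_lam by blast
qed

text \<open>Local associativity presupposes that all four products exist; two levels provide for
  this.\<close>

lemma N_assoc:
  assumes "x \<in> N (Suc (Suc k))" "y \<in> N (Suc (Suc k))" "z \<in> N (Suc (Suc k))" "src \<G> x = tgt \<G> y" "src \<G> y = tgt \<G> z"
  shows "mlt \<G> (mlt \<G> x y) z = mlt \<G> x (mlt \<G> y z)"
proof -
  note xy = N_mlt[OF assms(1,2,4)] and yz = N_mlt[OF assms(2,3,5)]
  have "x \<in> N (Suc k)" "y \<in> N (Suc k)" "z \<in> N (Suc k)" using assms(1-3) N_mono[of "Suc k" "Suc (Suc k)"] by auto
  with xy yz assms show ?thesis by (intro mlt_assoc N_mlt(1)[of _ k]) auto
qed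

lemma N_unt_left: "x \<in> N (Suc (Suc k)) \<Longrightarrow> mlt \<G> (unt \<G> (tgt \<G> x)) x = x"
  using N_unt(2)[of x "Suc k"] N_mono[of "Suc k" "Suc (Suc k)" x] N_mlt(1)[of "unt \<G> (tgt \<G> x)" k x]
  by (intro mlt_unt_left) simp

lemma N_unt_right:
  assumes "x \<in> N (Suc (Suc k))"
  shows "(x, unt \<G> (src \<G> x)) \<in> cdom \<G>" "mlt \<G> x (unt \<G> (src \<G> x)) = x"
proof -
  show "(x, unt \<G> (src \<G> x)) \<in> cdom \<G>"
    using assms N_unt(1)[of x "Suc k"] N_mono[of "Suc k" "Suc (Suc k)" x] by (intro N_mlt(1)[of _ k]) auto
  then show "mlt \<G> x (unt \<G> (src \<G> x)) = x" by (rule mlt_unt_right)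
qed

text \<open>The inverse uses one level more than the associativity law to which it is
  submitted.\<close>

lemma N_mlt_ivs:
  assumes "y \<in> N (Suc (Suc (Suc k)))" "c \<in> N (Suc (Suc (Suc k)))" "tgt \<G> y = tgt \<G> c"
  shows "mlt \<G> y (mlt \<G> (ivs \<G> y) c) = c"
proof -
  have "y \<in> N (Suc (Suc k))" "c \<in> N (Suc (Suc k))" using assms N_mono[of "Suc (Suc k)" "Suc (Suc (Suc k))"] by auto
  then have "mlt \<G> (mlt \<G> y (ivs \<G> y)) c = mlt \<G> y (mlt \<G> (ivs \<G> y) c)"
    using N_ivs[OF assms(1)] assms(3) by (intro N_assoc[of _ k]) auto
  then show ?thesis
    using ivsD(4)[OF N_ivs(1)[OF assms(1)]] assms(3) N_unt_left[OF \<open>c \<in> N (Suc (Suc k))\<close>] by simp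
qed

section \<open>Curves in the target fibres and left translation\<close>

lemma fcurve_lam:
  assumes c: "fcurve m c h0" and x: "c h0 \<in> N (Suc k)" and r: "r \<in> {-1..2}"
  shows "fcurve m (\<lambda>h. lam r (c h)) h0"
    and "vel (\<lambda>h. lam r (c h)) h0 = tmap \<A> \<A> (tfib \<G> m) (lam r) (c h0) (vel c h0)"
proof -
  have c1: "smooth_curve_at \<A> c h0" and c2: "\<forall>\<^sub>F h in nhds h0. c h \<in> tfib \<G> m"
    using c by (simp_all add: fcurve_def tfib_def)
  have sub: "tfib \<G> m \<inter> N (Suc k) \<subseteq> {x. (r, x) \<in> retr_dom \<Omega> \<epsilon>}" using N_lam(1)[OF _ r] by blast
  have x': "c h0 \<in> {x. (r, x) \<in> retr_dom \<Omega> \<epsilon>}" using N_lam(1)[OF x r] by blast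
  note ch = smooth_curve_chain[OF manifolds(1) manifolds(1) smooth_lam c1 c2 x' x N_open sub]
  have "\<forall>\<^sub>F h in nhds h0. tgt \<G> (lam r (c h)) = m"
    using c2 isCont_eventually_open[OF fcurve_isCont[OF c] N_open x]
    by eventually_elim (use N_lam(3)[OF _ r] in \<open>simp add: tfib_def\<close>)
  with ch(1) show "fcurve m (\<lambda>h. lam r (c h)) h0" by (simp add: fcurve_def)
  show "vel (\<lambda>h. lam r (c h)) h0 = tmap \<A> \<A> (tfib \<G> m) (lam r) (c h0) (vel c h0)" by (rule ch(2))
qed

lemma tmap_lam_linear:
  assumes "x \<in> N (Suc k)" "r \<in> {-1..2}" "tgt \<G> x = m"
  shows "linear (tmap \<A> \<A> (tfib \<G> m) (lam r) x)"
  by (rule tmap_linear[OF manifolds(1) manifolds(1) smooth_lam[of r] _ _ assms(1) N_open])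
    (use N_lam(1)[OF _ assms(2)] assms(1,3) in \<open>auto simp: tfib_def\<close>)

lemma fcurve_lam_param:
  assumes x: "x \<in> N (Suc k)" and r: "-1 < r" "r < 2"
  shows "fcurve (tgt \<G> x) (\<lambda>h. lam h x) r"
proof -
  let ?Q = "{t :: nat \<Rightarrow> real. -1 < t 0 \<and> t 0 < 2}"
  have Q: "open ?Q"
    by (intro open_Collect_conj open_Collect_less continuous_on_const continuous_on_product_coordinates)
  have "smooth_family \<A> 1 ?Q (\<lambda>t. lam (t 0) x)"
    by (intro family_lam smooth_family_const cube_Ck_coord Q) (use N_lam(1)[OF x] in auto)
  from smooth_family_curve[OF manifolds(1) this, of "\<lambda>_. r" 0]
  have "smooth_curve_at \<A> (\<lambda>h. lam h x) r" using r by simp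
  moreover have "open {-1<..<2 :: real}" "r \<in> {-1<..<2}" using r by auto
  then have "\<forall>\<^sub>F h in nhds r. h \<in> {-1<..<2}" by (rule eventually_nhds_in_open)
  then have "\<forall>\<^sub>F h in nhds r. tgt \<G> (lam h x) = tgt \<G> x"
    by eventually_elim (rule N_lam(3)[OF x], auto)
  ultimately show ?thesis by (simp add: fcurve_def)
qed

text \<open>A short multiple \<open>\<delta> *\<^sub>R w\<close> is sent by
  \<open>\<epsilon>\<close> to an arrow \<open>e\<close> in the tower, and the ray through it is the
  retraction path of \<open>e\<close> with rescaled time. What is known about \<open>lam\<close>
  therefore carries over to rays of arbitrary vectors.\<close>

lemma exp_eq_lam:
  assumes m: "unt \<G> m \<in> N k" and w: "w \<in> algd \<G> m"
  obtains \<delta> e where "\<delta> > 0" "e \<in> N k" "tgt \<G> e = m" "\<And>s. \<epsilon> (unt \<G> m, s *\<^sub>R w) = lam (s / \<delta>) e"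
proof -
  obtain U \<phi> Q where U: "(U, \<phi>) \<in> \<A>" "unt \<G> m \<in> U" and Q: "open Q" "(\<phi> (unt \<G> m), 0) \<in> Q"
    "\<And>m' a. a \<in> algd \<G> m' \<Longrightarrow> unt \<G> m' \<in> U \<Longrightarrow> (\<phi> (unt \<G> m'), tangent_coord \<A> \<phi> (unt \<G> m') a) \<in> Q \<Longrightarrow>
       (unt \<G> m', a) \<in> \<Omega> \<and> \<epsilon> (unt \<G> m', a) \<in> N k"
    using \<epsilon>_tube[OF N_open m] by blast
  let ?u = "unt \<G> m"
  note lin = tangent_coord_linear[OF manifolds(1) U]
  let ?f = "\<lambda>s. (\<phi> ?u, s *\<^sub>R tangent_coord \<A> \<phi> ?u w)"
  have "open (?f -` Q)" by (rule open_vimage[OF Q(1)]) (intro continuous_intros)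
  moreover have "0 \<in> ?f -` Q" using Q(2) by simp
  ultimately obtain d where d: "d > 0" "ball 0 d \<subseteq> ?f -` Q" by (meson open_contains_ball)
  define \<delta> where "\<delta> = d / 2"
  have \<delta>: "\<delta> > 0" "\<delta> \<in> ball 0 d" using d(1) by (auto simp: \<delta>_def)
  have "(?u, \<delta> *\<^sub>R w) \<in> \<Omega> \<and> \<epsilon> (?u, \<delta> *\<^sub>R w) \<in> N k"
    using d(2) \<delta>(2) by (intro Q(3) subspace_scale[OF algd_subspace] w U(2)) (auto simp: linear_scale[OF lin])
  then have e: "(?u, \<delta> *\<^sub>R w) \<in> \<Omega>" "\<epsilon> (?u, \<delta> *\<^sub>R w) \<in> N k" by auto
  show thesis
    by (rule that[OF \<delta>(1) e(2) tgt_\<epsilon>[OF e(1)]]) (use \<delta>(1) in \<open>simp add: retr_eq inv_into_f_f[OF inj_\<epsilon> e(1)]\<close>)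
qed

lemma fcurve_exp:
  assumes m: "unt \<G> m \<in> N (Suc k)" and w: "w \<in> algd \<G> m"
  shows "fcurve m (\<lambda>s. \<epsilon> (unt \<G> m, s *\<^sub>R w)) 0"
proof -
  obtain \<delta> e where e: "\<delta> > 0" "e \<in> N (Suc k)" "tgt \<G> e = m" "\<And>s. \<epsilon> (unt \<G> m, s *\<^sub>R w) = lam (s / \<delta>) e"
    using exp_eq_lam[OF assms] by blast
  have f: "fcurve m (\<lambda>h. lam h e) 0" using fcurve_lam_param[OF e(2), of 0] e(3) by simp
  have "smooth_curve_at \<A> (\<lambda>s. lam (1 / \<delta> * s) e) 0"
    by (rule smooth_curve_at_scale) (use f in \<open>simp add: fcurve_def\<close>)
  moreover have "\<forall>\<^sub>F s in nhds 0. tgt \<G> (lam (1 / \<delta> * s) e) = m"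
  proof -
    have "filterlim (\<lambda>s. 1 / \<delta> * s) (nhds 0) (nhds 0)"
      using tendsto_mult_right_zero[OF filterlim_ident, of "1 / \<delta>"] by (simp add: filterlim_def filtermap_ident)
    then show ?thesis
      using f unfolding fcurve_def by (auto dest: eventually_compose_filterlim)
  qed
  ultimately show ?thesis by (simp add: fcurve_def e(4))
qed

lemma fcurve_ltrans:
  assumes y: "y \<in> N (Suc (Suc k))" and c: "fcurve (src \<G> y) c h0" "c h0 = unt \<G> (src \<G> y)"
  shows "fcurve (tgt \<G> y) (\<lambda>h. mlt \<G> y (c h)) h0" "vel (\<lambda>h. mlt \<G> y (c h)) h0 = ltrans \<G> y (vel c h0)"
    "mlt \<G> y (c h0) = y"
  using fcurve_mlt(2,3)[OF c(1)] N_unt_right[OF y] c(2) by (simp_all add: ltrans_def)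

lemma ltrans_linear: "y \<in> N (Suc (Suc k)) \<Longrightarrow> linear (ltrans \<G> y)"
  unfolding ltrans_def by (rule tmap_mlt_linear[OF N_unt_right(1)])

text \<open>The tubular structure has the identity of \<open>A\<close> as differential along the
  units. Hence the ray in direction \<open>w\<close> has velocity \<open>w\<close>, and a left
  translated vector is the velocity of a left translated ray.\<close>

lemma ltrans_exp:
  assumes y: "y \<in> N (Suc (Suc k))" and w: "w \<in> algd \<G> (src \<G> y)"
  shows "fcurve (tgt \<G> y) (\<lambda>s. mlt \<G> y (\<epsilon> (unt \<G> (src \<G> y), s *\<^sub>R w))) 0"
    "vel (\<lambda>s. mlt \<G> y (\<epsilon> (unt \<G> (src \<G> y), s *\<^sub>R w))) 0 = ltrans \<G> y w"
  using fcurve_ltrans[OF y fcurve_exp[OF N_unt(1)[OF y] w]] vel_\<epsilon>[OF w] by (simp_all add: \<epsilon>_zero)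

text \<open>Left multiplication by the inverse arrow returns the left translated ray to the original
  one, so its tangent map is a left inverse of \<open>ltrans\<close>.\<close>

lemma ltrans_inj:
  assumes y: "y \<in> N (Suc (Suc (Suc k)))"
  shows "inj_on (ltrans \<G> y) (algd \<G> (src \<G> y))"
proof (rule inj_on_inverseI)
  fix w assume w: "w \<in> algd \<G> (src \<G> y)"
  let ?c = "\<lambda>s. \<epsilon> (unt \<G> (src \<G> y), s *\<^sub>R w)"
  have y2: "y \<in> N (Suc (Suc k))" using y N_mono[of "Suc (Suc k)" "Suc (Suc (Suc k))"] by auto
  note u = N_unt(1)[OF y]
  have fc: "fcurve (src \<G> y) ?c 0" by (rule fcurve_exp[OF N_unt(1)[OF y2] w])
  note l = ltrans_exp[OF y2 w]
  have c0: "?c 0 = unt \<G> (src \<G> y)" by (simp add: \<epsilon>_zero)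
  have d: "(ivs \<G> y, mlt \<G> y (?c 0)) \<in> cdom \<G>" unfolding c0 N_unt_right(2)[OF y2] by (rule ivsD(5)[OF N_ivs(1)[OF y]])
  have l': "fcurve (src \<G> (ivs \<G> y)) (\<lambda>s. mlt \<G> y (?c s)) 0" using l(1) N_ivs(3)[OF y] by simp
  \<comment> \<open>The cancellation uses associativity, whose products exist for small
    \<open>s\<close> by continuity.\<close>
  have ev: "\<forall>\<^sub>F s in nhds 0. mlt \<G> (ivs \<G> y) (mlt \<G> y (?c s)) = ?c s"
  proof -
    have 1: "\<forall>\<^sub>F s in nhds 0. (y, ?c s) \<in> cdom \<G>"
      by (rule fcurve_mlt(1)[OF fc]) (use c0 N_unt_right(1)[OF y2] in simp)
    have 2: "\<forall>\<^sub>F s in nhds 0. (ivs \<G> y, mlt \<G> y (?c s)) \<in> cdom \<G>"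
      by (rule fcurve_mlt(1)[OF l' d])
    have 3: "\<forall>\<^sub>F s in nhds 0. (unt \<G> (src \<G> y), ?c s) \<in> cdom \<G>"
      by (rule fcurve_mlt(1)) (use fc c0 unt_cdom in simp_all)
    from 1 2 3 fc[unfolded fcurve_def, THEN conjunct2] show ?thesis
    proof eventually_elim
      case (elim s)
      have "mlt \<G> (mlt \<G> (ivs \<G> y) y) (?c s) = mlt \<G> (ivs \<G> y) (mlt \<G> y (?c s))"
        using elim ivsD[OF N_ivs(1)[OF y]] by (intro mlt_assoc) simp_all
      moreover have "mlt \<G> (unt \<G> (tgt \<G> (?c s))) (?c s) = ?c s" using elim by (intro mlt_unt_left) simp
      ultimately show ?case using ivsD(6)[OF N_ivs(1)[OF y]] elim by simp
    qed
  qed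
  have "w = vel (\<lambda>s. mlt \<G> (ivs \<G> y) (mlt \<G> y (?c s))) 0"
    using smooth_curve_at_cong(1)[OF ev, of \<A>] vel_\<epsilon>[OF w] by simp
  also have "\<dots> = tmap \<A> \<A> (tfib \<G> (src \<G> (ivs \<G> y))) (mlt \<G> (ivs \<G> y)) y (ltrans \<G> y w)"
    using fcurve_mlt(3)[OF l' d] unfolding l(2) c0 N_unt_right(2)[OF y2] .
  finally show "tmap \<A> \<A> (tfib \<G> (src \<G> (ivs \<G> y))) (mlt \<G> (ivs \<G> y)) y (ltrans \<G> y w) = w" by simp
qed

lemma ltrans_inv_ltrans:
  "y \<in> N (Suc (Suc (Suc k))) \<Longrightarrow> w \<in> algd \<G> (src \<G> y) \<Longrightarrow> ltrans_inv \<G> y (ltrans \<G> y w) = w"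
  unfolding ltrans_inv_def by (rule inv_into_f_f[OF ltrans_inj])

text \<open>A curve \<open>c\<close> through \<open>y\<close> equals \<open>y\<close> times the
  curve \<open>h \<mapsto> y\<^sup>-\<^sup>1 c(h)\<close>, which passes through a unit. So its
  velocity lies in the image of \<open>ltrans\<close>, where \<open>ltrans_inv\<close> is a genuine
  inverse, and the preimage is itself a velocity.\<close>

lemma ltrans_inv_velocity:
  assumes y: "y \<in> N (Suc (Suc (Suc (Suc k))))" and c: "fcurve (tgt \<G> y) c h0" "c h0 = y"
  shows "fcurve (src \<G> y) (\<lambda>h. mlt \<G> (ivs \<G> y) (c h)) h0"
    "vel (\<lambda>h. mlt \<G> (ivs \<G> y) (c h)) h0 \<in> algd \<G> (src \<G> y)"
    "ltrans_inv \<G> y (vel c h0) = vel (\<lambda>h. mlt \<G> (ivs \<G> y) (c h)) h0"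
    "ltrans \<G> y (ltrans_inv \<G> y (vel c h0)) = vel c h0"
    "ltrans_inv \<G> y (vel c h0) \<in> algd \<G> (src \<G> y)"
proof -
  let ?d = "\<lambda>h. mlt \<G> (ivs \<G> y) (c h)"
  have y3: "y \<in> N (Suc (Suc (Suc k)))" and y2: "y \<in> N (Suc (Suc k))"
    using y N_mono[of _ "Suc (Suc (Suc (Suc k)))" y] by auto
  have d: "(ivs \<G> y, c h0) \<in> cdom \<G>" using c(2) ivsD(5)[OF N_ivs(1)[OF y]] by simp
  have d0: "?d h0 = unt \<G> (src \<G> y)" using c(2) ivsD(6)[OF N_ivs(1)[OF y]] by simp
  show fd: "fcurve (src \<G> y) ?d h0"
    using fcurve_mlt(2)[of "ivs \<G> y" c h0] d c(1) N_ivs(3,4)[OF y] by simp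
  show a: "vel ?d h0 \<in> algd \<G> (src \<G> y)" by (rule fcurve_algd[OF fd d0])
  have "\<forall>\<^sub>F h in nhds h0. c h \<in> N (Suc (Suc (Suc k)))"
    by (rule isCont_eventually_open[OF fcurve_isCont[OF c(1)] N_open]) (use c(2) y3 in simp)
  then have ev: "\<forall>\<^sub>F h in nhds h0. mlt \<G> y (?d h) = c h"
    using c(1)[unfolded fcurve_def, THEN conjunct2]
    by eventually_elim (rule N_mlt_ivs[OF y3], auto)
  have l: "vel c h0 = ltrans \<G> y (vel ?d h0)"
    using fcurve_ltrans(2)[OF y2 fd d0] smooth_curve_at_cong(1)[OF ev, of \<A>] by simp
  show i: "ltrans_inv \<G> y (vel c h0) = vel ?d h0"
    unfolding l by (rule ltrans_inv_ltrans[OF y3 a])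
  show "ltrans \<G> y (ltrans_inv \<G> y (vel c h0)) = vel c h0" by (simp only: i l[symmetric])
  show "ltrans_inv \<G> y (vel c h0) \<in> algd \<G> (src \<G> y)" unfolding i by (rule a)
qed

text \<open>In the induction the inner part is required to land two levels higher: one pays for the
  product with \<open>g\<close>, the other for the outer retraction.\<close>

lemma cube_map_mem:
  assumes "gs \<noteq> []" "set gs \<subseteq> N (k + 2 * length gs)" "chained \<G> gs" "\<And>i. i < length gs \<Longrightarrow> t i \<in> {-1..2}"
  shows "cube_map \<G> lam gs m t \<in> N k \<and> tgt \<G> (cube_map \<G> lam gs m t) = tgt \<G> (hd gs)"
  using assms
proof (induction gs arbitrary: k t)
  case (Cons g gs)
  show ?case
  proof (cases "gs = []")
    case True
    then have "g \<in> N (Suc k)" "t 0 \<in> {-1..2}" using Cons.prems N_mono[of "Suc k" "k + 2"] by auto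
    with True N_lam show ?thesis by simp
  next
    case False
    let ?y = "cube_map \<G> lam gs m (\<lambda>i. t (Suc i))"
    have t0: "t 0 \<in> {-1..2}" by (rule Cons.prems(4)) simp
    have g: "g \<in> N (Suc (Suc k))" using Cons.prems(2) N_mono[of "Suc (Suc k)" "k + 2 * length (g # gs)" g] by auto
    have src: "src \<G> g = tgt \<G> (hd gs)" "chained \<G> gs" using Cons.prems(3) False by (cases gs; simp)+
    have y: "?y \<in> N (Suc (Suc k)) \<and> tgt \<G> ?y = tgt \<G> (hd gs)"
      by (rule Cons.IH) (use Cons.prems False src in auto)
    have my: "mlt \<G> g ?y \<in> N (Suc k)" "tgt \<G> (mlt \<G> g ?y) = tgt \<G> g"
      using N_mlt[OF g, of ?y] y src by auto
    show ?thesis using N_lam[OF my(1) t0] my(2) by (simp add: cube_map_Cons[OF False])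
  qed
qed simp

text \<open>The arrows may depend on the parameters as well. This lets a motion of the last arrow be
  treated as one more coordinate.\<close>

lemma cube_map_family:
  assumes "gs \<noteq> []" "open Q" "\<And>g. g \<in> set gs \<Longrightarrow> smooth_family \<A> p Q g"
    and "\<And>i n. i < length gs \<Longrightarrow> cube_Ck p n Q (\<lambda>t. \<tau> t i)"
    and "\<And>t. t \<in> Q \<Longrightarrow> (\<lambda>g. g t) ` set gs \<subseteq> N (k + 2 * length gs) \<and> chained \<G> (map (\<lambda>g. g t) gs) \<and>
      (\<forall>i<length gs. \<tau> t i \<in> {-1..2})"
  shows "smooth_family \<A> p Q (\<lambda>t. cube_map \<G> lam (map (\<lambda>g. g t) gs) m (\<tau> t))"
  using assms
proof (induction gs arbitrary: k \<tau>)
  case (Cons g gs)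
  have g: "g t \<in> N (Suc (Suc k))" if "t \<in> Q" for t
    using Cons.prems(5)[OF that] N_mono[of "Suc (Suc k)" "k + 2 * length (g # gs)"] by auto
  have t0: "\<tau> t 0 \<in> {-1..2}" if "t \<in> Q" for t using Cons.prems(5)[OF that] by simp
  have sg: "smooth_family \<A> p Q g" using Cons.prems(3) by simp
  have s0: "cube_Ck p n Q (\<lambda>t. \<tau> t 0)" for n using Cons.prems(4)[of 0] by simp
  show ?case
  proof (cases "gs = []")
    case True
    have "smooth_family \<A> p Q (\<lambda>t. lam (\<tau> t 0) (g t))"
      using N_lam(1) g t0 by (intro family_lam sg s0) blast
    then show ?thesis using True by simp
  next
    case False
    let ?y = "\<lambda>t. cube_map \<G> lam (map (\<lambda>g. g t) gs) m (\<lambda>i. \<tau> t (Suc i))"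
    have ch: "chained \<G> (map (\<lambda>g. g t) gs) \<and> src \<G> (g t) = tgt \<G> (hd (map (\<lambda>g. g t) gs))" if "t \<in> Q" for t
      using Cons.prems(5)[OF that] False by (cases gs) auto
    have sub: "(\<lambda>g. g t) ` set gs \<subseteq> N (Suc (Suc k) + 2 * length gs)" "\<forall>i<length gs. \<tau> t (Suc i) \<in> {-1..2}" if "t \<in> Q" for t
      using Cons.prems(5)[OF that] by auto
    have sy: "smooth_family \<A> p Q ?y"
      by (rule Cons.IH[of "\<lambda>t i. \<tau> t (Suc i)" "Suc (Suc k)", OF False Cons.prems(2)]) (use Cons.prems(3,4) sub ch in auto)
    have y: "?y t \<in> N (Suc (Suc k)) \<and> tgt \<G> (?y t) = tgt \<G> (hd (map (\<lambda>g. g t) gs))" if "t \<in> Q" for t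
      by (rule cube_map_mem) (use False sub[OF that] ch[OF that] in auto)
    have "smooth_family \<A> p Q (\<lambda>t. lam (\<tau> t 0) (mlt \<G> (g t) (?y t)))"
    proof (intro family_lam family_mlt sg sy s0)
      fix t assume t: "t \<in> Q"
      note m = N_mlt[OF g[OF t], of "?y t"]
      show "(g t, ?y t) \<in> cdom \<G>" using m y[OF t] ch[OF t] by auto
      show "(\<tau> t 0, mlt \<G> (g t) (?y t)) \<in> retr_dom \<Omega> \<epsilon>"
        using m y[OF t] ch[OF t] t0[OF t] by (intro N_lam(1)[of _ k]) auto
    qed
    then show ?thesis using False by (simp add: cube_map_Cons)
  qed
qed simp

text \<open>\<open>L\<close> is a composite of tangent maps of left multiplications and retractions.
  The same \<open>L\<close> serves all curves through \<open>z\<close>, so the velocity of the image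
  depends only, and linearly, on the velocity of the last arrow.\<close>

lemma cube_map_tangent:
  assumes "set gs \<subseteq> N (k + 2 * Suc (length gs))" "z \<in> N (k + 2 * Suc (length gs))"
    and "chained \<G> (gs @ [z])" "\<And>i. i \<le> length gs \<Longrightarrow> t i \<in> {-1..2}"
  shows "\<exists>L. linear L \<and> (\<forall>c h0. fcurve (tgt \<G> z) c h0 \<longrightarrow> c h0 = z \<longrightarrow>
    fcurve (tgt \<G> (hd (gs @ [z]))) (\<lambda>h. cube_map \<G> lam (gs @ [c h]) m t) h0 \<and>
    vel (\<lambda>h. cube_map \<G> lam (gs @ [c h]) m t) h0 = L (vel c h0))"
  using assms
proof (induction gs arbitrary: k t)
  case Nil
  have z: "z \<in> N (Suc k)" "t 0 \<in> {-1..2}" using Nil N_mono[of "Suc k" "Suc (Suc k)"] by auto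
  show ?case
    by (rule exI[of _ "tmap \<A> \<A> (tfib \<G> (tgt \<G> z)) (lam (t 0)) z"])
      (use tmap_lam_linear[OF z refl] fcurve_lam[OF _ _ z(2)] z(1) in auto)
next
  case (Cons g gs)
  have t0: "t 0 \<in> {-1..2}" by (rule Cons.prems(4)) simp
  have g: "g \<in> N (Suc (Suc k))"
    using Cons.prems(1) N_mono[of "Suc (Suc k)" "k + 2 * Suc (length (g # gs))" g] by auto
  have src: "src \<G> g = tgt \<G> (hd (gs @ [z]))" "chained \<G> (gs @ [z])" using Cons.prems(3) by (cases gs; simp)+
  let ?t = "\<lambda>i. t (Suc i)"
  let ?y = "cube_map \<G> lam (gs @ [z]) m ?t"
  have y: "?y \<in> N (Suc (Suc k)) \<and> tgt \<G> ?y = tgt \<G> (hd (gs @ [z]))"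
    by (rule cube_map_mem) (use Cons.prems src in auto)
  note my = N_mlt[OF g conjunct1[OF y], unfolded conjunct2[OF y], OF src(1)]
  obtain L where L: "linear L" "\<And>c h0. fcurve (tgt \<G> z) c h0 \<Longrightarrow> c h0 = z \<Longrightarrow>
    fcurve (tgt \<G> (hd (gs @ [z]))) (\<lambda>h. cube_map \<G> lam (gs @ [c h]) m ?t) h0 \<and>
    vel (\<lambda>h. cube_map \<G> lam (gs @ [c h]) m ?t) h0 = L (vel c h0)"
    using Cons.IH[of "Suc (Suc k)" ?t] Cons.prems src by force
  let ?L1 = "tmap \<A> \<A> (tfib \<G> (src \<G> g)) (mlt \<G> g) ?y"
  let ?L2 = "tmap \<A> \<A> (tfib \<G> (tgt \<G> g)) (lam (t 0)) (mlt \<G> g ?y)"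
  show ?case
  proof (intro exI[of _ "\<lambda>v. ?L2 (?L1 (L v))"] conjI allI impI)
    show "linear (\<lambda>v. ?L2 (?L1 (L v)))"
      using linear_compose[OF linear_compose[OF L(1) tmap_mlt_linear[OF my(1)]] tmap_lam_linear[OF my(2) t0 my(4)]]
      by (simp add: o_def)
    fix c h0 assume c: "fcurve (tgt \<G> z) c h0" "c h0 = z"
    note l = L(2)[OF c]
    have 1: "fcurve (src \<G> g) (\<lambda>h. cube_map \<G> lam (gs @ [c h]) m ?t) h0" using l src(1) by simp
    have 2: "(g, cube_map \<G> lam (gs @ [c h0]) m ?t) \<in> cdom \<G>" using c(2) my(1) by simp
    note m = fcurve_mlt(2,3)[OF 1 2]
    have 3: "mlt \<G> g (cube_map \<G> lam (gs @ [c h0]) m ?t) \<in> N (Suc k)" using c(2) my(2) by simp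
    note f = fcurve_lam[OF m(1) 3 t0]
    show "fcurve (tgt \<G> (hd ((g # gs) @ [z]))) (\<lambda>h. cube_map \<G> lam ((g # gs) @ [c h]) m t) h0"
      using f(1) by (simp add: cube_map_Cons)
    show "vel (\<lambda>h. cube_map \<G> lam ((g # gs) @ [c h]) m t) h0 = ?L2 (?L1 (L (vel c h0)))"
      using f(2) m(2) l c(2) by (simp add: cube_map_Cons)
  qed
qed

end

section \<open>Smoothness of the left-invariant form\<close>

lemma manifold_atlas_vs: "manifold_atlas (vs_atlas :: ('e::findim, 'e) atlas)"
proof -
  have "homeomorphism UNIV UNIV (id :: 'e \<Rightarrow> 'e) id"
    by (simp add: homeomorphism_def)
  moreover have "smooth_on UNIV (\<lambda>x :: 'e. x)"
    by (rule smooth_on_bounded_linear[OF bounded_linear_ident open_UNIV])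
  then have "smooth_on UNIV (id \<circ> inv_into UNIV id :: 'e \<Rightarrow> 'e)"
    by (simp add: o_def id_def inv_into_f_f)
  ultimately show ?thesis unfolding manifold_atlas_def vs_atlas_def by auto
qed

lemma linear_inv_bij:
  assumes "linear f" "bij f"
  shows "linear (inv f)"
proof (rule linearI)
  have s: "f (inv f x) = x" for x using assms(2) by (simp add: bij_is_surj surj_f_inv_f)
  show "inv f (x + y) = inv f x + inv f y" for x y
    by (rule inv_f_eq[OF bij_is_inj[OF assms(2)]]) (simp add: linear_add[OF assms(1)] s)
  show "inv f (r *\<^sub>R x) = r *\<^sub>R inv f x" for r x
    by (rule inv_f_eq[OF bij_is_inj[OF assms(2)]]) (simp add: linear_scale[OF assms(1)] s)
qed

lemma smooth_map_vs_tendsto: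
  assumes "manifold_atlas \<A>" "smooth_map_on \<A> vs_atlas S f" "(y \<longlongrightarrow> x) F" "x \<in> S" "\<forall>\<^sub>F t in F. y t \<in> S"
  shows "((\<lambda>t. f (y t)) \<longlongrightarrow> f x) F"
  by (rule continuous_on_tendsto_compose[OF smooth_map_on_continuous[OF manifold_imp_cts_atlas[OF assms(1)] manifold_atlas_vs assms(2)] assms(3-5)])

lemma tendsto_eventually_open: "(y \<longlongrightarrow> x) F \<Longrightarrow> open U \<Longrightarrow> x \<in> U \<Longrightarrow> \<forall>\<^sub>F t in F. y t \<in> U"
  unfolding tendsto_def by blast

lemma alternating_form_linear:
  assumes a: "alternating_form q W \<omega>" and W: "subspace W"
    and len: "length xs + length ys + 1 = q" and sub: "set xs \<subseteq> W" "set ys \<subseteq> W"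
  shows "v \<in> W \<Longrightarrow> w \<in> W \<Longrightarrow> \<omega> (xs @ (v + w) # ys) = \<omega> (xs @ v # ys) + \<omega> (xs @ w # ys)"
    and "v \<in> W \<Longrightarrow> \<omega> (xs @ (r *\<^sub>R v) # ys) = r *\<^sub>R \<omega> (xs @ v # ys)"
    and "finite L \<Longrightarrow> (\<And>l. l \<in> L \<Longrightarrow> f l \<in> W) \<Longrightarrow>
      \<omega> (xs @ (\<Sum>l\<in>L. c l *\<^sub>R f l) # ys) = (\<Sum>l\<in>L. c l *\<^sub>R \<omega> (xs @ f l # ys))"
proof -
  have 0: "0 \<in> W" using W by (rule subspace_0)
  have vs: "length (xs @ 0 # ys) = q" "set (xs @ 0 # ys) \<subseteq> W" "length xs < q"
    using len sub 0 by auto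
  have A: "(\<forall>i<q. \<forall>v\<in>W. \<forall>w\<in>W. \<omega> ((xs @ 0 # ys)[i := v + w]) = \<omega> ((xs @ 0 # ys)[i := v]) + \<omega> ((xs @ 0 # ys)[i := w]))"
    "(\<forall>i<q. \<forall>v\<in>W. \<forall>r. \<omega> ((xs @ 0 # ys)[i := r *\<^sub>R v]) = r *\<^sub>R \<omega> ((xs @ 0 # ys)[i := v]))"
    using a vs unfolding alternating_form_def by blast+
  show add: "\<omega> (xs @ (v + w) # ys) = \<omega> (xs @ v # ys) + \<omega> (xs @ w # ys)" if "v \<in> W" "w \<in> W" for v w
    using A(1)[rule_format, OF vs(3) that] by simp
  show scale: "\<omega> (xs @ (r *\<^sub>R v) # ys) = r *\<^sub>R \<omega> (xs @ v # ys)" if "v \<in> W" for v r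
    using A(2)[rule_format, OF vs(3) that, of r] by simp
  show "\<omega> (xs @ (\<Sum>l\<in>L. c l *\<^sub>R f l) # ys) = (\<Sum>l\<in>L. c l *\<^sub>R \<omega> (xs @ f l # ys))"
    if "finite L" "\<And>l. l \<in> L \<Longrightarrow> f l \<in> W"
    using that
  proof (induction L rule: finite_induct)
    case empty
    then show ?case using scale[OF 0, of 0] by simp
  next
    case (insert l L)
    have "(\<Sum>l\<in>L. c l *\<^sub>R f l) \<in> W" using insert.prems by (intro subspace_sum[OF W] subspace_scale[OF W]) auto
    then show ?case
      using insert by (simp add: add scale subspace_scale[OF W])
  qed
qed

text \<open>With both entries replaced by \<open>e\<close> the form vanishes, and the scalars are
  then restored one slot after the other. Scalars may be zero, so neither entry has to span the
  line.\<close>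

lemma alternating_form_parallel:
  assumes a: "alternating_form q W \<omega>" and W: "subspace W" and vs: "length vs = q" "set vs \<subseteq> W"
    and ij: "i < q" "j < q" "i \<noteq> j" and e: "e \<in> W" "vs ! i = r *\<^sub>R e" "vs ! j = s *\<^sub>R e"
  shows "\<omega> vs = 0"
proof -
  have A: "\<And>vs i v r. length vs = q \<Longrightarrow> set vs \<subseteq> W \<Longrightarrow> i < q \<Longrightarrow> v \<in> W \<Longrightarrow> \<omega> (vs[i := r *\<^sub>R v]) = r *\<^sub>R \<omega> (vs[i := v])"
    and B: "\<And>vs i j. length vs = q \<Longrightarrow> set vs \<subseteq> W \<Longrightarrow> i < q \<Longrightarrow> j < q \<Longrightarrow> i \<noteq> j \<Longrightarrow> vs ! i = vs ! j \<Longrightarrow> \<omega> vs = 0"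
    using a unfolding alternating_form_def by blast+
  have s1: "set (vs[i := e]) \<subseteq> W" using set_update_subset_insert[of vs i e] vs(2) e(1) by blast
  have s2: "set (vs[i := e, j := e]) \<subseteq> W" using set_update_subset_insert[of "vs[i := e]" j e] s1 e(1) by blast
  have "\<omega> (vs[i := e, j := e]) = 0"
    by (rule B[OF _ s2 ij]) (use vs ij in \<open>simp_all add: nth_list_update\<close>)
  then have "\<omega> (vs[i := e, j := s *\<^sub>R e]) = 0" using A[OF _ s1 ij(2) e(1), of s] vs(1) by simp
  moreover have "vs[i := e, j := s *\<^sub>R e] = vs[i := e]"
    unfolding e(3)[symmetric] using ij(3) by (metis list_update_id nth_list_update_neq)
  ultimately have "\<omega> (vs[i := r *\<^sub>R e]) = 0" using A[OF vs ij(1) e(1), of r] by simp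
  then show ?thesis by (simp flip: e(2))
qed

context tubular_groupoid
begin

text \<open>\<open>A\<close> is the kernel of the differential of the target map, which is
  surjective. Elimination in a chart around the unit gives a frame whose coefficient functionals are
  fixed functionals of the tangent coordinates, hence continuous along converging vectors.\<close>

lemma algd_frame:
  assumes U: "(U, \<phi>) \<in> \<A>" "unt \<G> m0 \<in> U"
  obtains W and L :: "'e set" and c a where "open W" "m0 \<in> W" "finite L" "\<And>l. bounded_linear (c l :: 'e \<Rightarrow> real)"
    "\<And>l. l \<in> L \<Longrightarrow> smooth_algd_section \<G> W (a l)"
    "\<And>m v. m \<in> W \<Longrightarrow> v \<in> algd \<G> m \<Longrightarrow> v = (\<Sum>l\<in>L. c l (tangent_coord \<A> \<phi> (unt \<G> m) v) *\<^sub>R a l m)"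
proof -
  obtain Wt \<theta> where \<theta>: "(Wt, \<theta>) \<in> \<M>" "m0 \<in> Wt"
    using atlas_cover[OF manifold_atlas_cover[OF manifolds(2)]] by blast
  note chU = manifold_chart[OF manifolds(1) U(1)]
  have t0: "tgt \<G> (unt \<G> m0) \<in> Wt" using \<theta>(2) by simp
  obtain Q F where Q: "open Q" "\<phi> (unt \<G> m0) \<in> Q" "Q \<subseteq> \<phi> ` U" "smooth_on Q F"
    "\<And>y. y \<in> UNIV \<Longrightarrow> y \<in> U \<Longrightarrow> \<phi> y \<in> Q \<Longrightarrow> tgt \<G> y \<in> Wt \<and> \<theta> (tgt \<G> y) = F (\<phi> y)"
    by (rule smooth_map_onD[OF smooth_tgt UNIV_I U \<theta>(1) t0]) blast
  \<comment> \<open>The differential of the target map in charts: at units, its kernel is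
    \<open>A\<close> in tangent coordinates.\<close>
  define D where "D y = frechet_derivative F (at y)" for y
  have linD: "linear (D y)" if "y \<in> Q" for y
    unfolding D_def by (rule has_derivative_linear[OF smooth_on_has_derivative[OF Q(4) that]])
  have D_tc: "D (\<phi> x) (tangent_coord \<A> \<phi> x v) = tangent_coord \<M> \<theta> (tgt \<G> x) (tmap \<A> \<M> UNIV (tgt \<G>) x v)"
    if "x \<in> U" "\<phi> x \<in> Q" for x v
  proof -
    have "((\<lambda>q. \<theta> (tgt \<G> (inv_into U \<phi> q))) has_derivative D (\<phi> x)) (at (\<phi> x))"
      unfolding D_def
    proof (rule has_derivative_transform_within_open[OF smooth_on_has_derivative[OF Q(4) that(2)] Q(1) that(2)])
      fix q assume "q \<in> Q"
      then obtain y where "y \<in> U" "q = \<phi> y" using Q(3) by blast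
      with Q(5)[of y] \<open>q \<in> Q\<close> chU(3) show "F q = \<theta> (tgt \<G> (inv_into U \<phi> q))" by simp
    qed
    then have "D (\<phi> x) = frechet_derivative (\<lambda>q. \<theta> (tgt \<G> (inv_into U \<phi> q))) (at (\<phi> x))"
      by (rule frechet_derivative_at)
    then show ?thesis
      using tangent_coord_tmap[OF manifolds smooth_tgt U(1) that(1) \<theta>(1)] Q(5)[OF _ that] by simp
  qed
  have surjD: "surj (D (\<phi> (unt \<G> m0)))"
    unfolding surj_def
  proof
    fix b
    have t: "tgt \<G> (unt \<G> m0) \<in> Wt" using \<theta>(2) by simp
    obtain v where "tmap \<A> \<M> UNIV (tgt \<G>) (unt \<G> m0) v =
        frechet_derivative (coord \<M> (tgt \<G> (unt \<G> m0)) \<circ> inv_into Wt \<theta>) (at (\<theta> (tgt \<G> (unt \<G> m0)))) b"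
      using surj_tgt[of "unt \<G> m0"] by (metis surjD)
    then have "D (\<phi> (unt \<G> m0)) (tangent_coord \<A> \<phi> (unt \<G> m0) v) = b"
      using D_tc[OF U(2) Q(2)] tangent_coord_inverse(2)[OF manifolds(2) \<theta>(1) t] by simp
    then show "\<exists>x. b = D (\<phi> (unt \<G> m0)) x" by metis
  qed
  obtain Q' and L :: "'e set" and c f where f: "open Q'" "\<phi> (unt \<G> m0) \<in> Q'" "Q' \<subseteq> Q" "finite L" "\<And>l. bounded_linear (c l :: 'e \<Rightarrow> real)"
    "\<And>l. l \<in> L \<Longrightarrow> smooth_on Q' (f l)" "\<And>l y. l \<in> L \<Longrightarrow> y \<in> Q' \<Longrightarrow> D y (f l y) = 0"
    "\<And>y v. y \<in> Q' \<Longrightarrow> D y v = 0 \<Longrightarrow> v = (\<Sum>l\<in>L. c l v *\<^sub>R f l y)"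
  proof (rule smooth_kernel_frame[where D = D, OF Q(1,2) _ linD surjD])
    show "smooth_on Q (\<lambda>y. D y v)" for v unfolding D_def by (rule smooth_on_frechet[OF Q(4)])
  qed blast+
  define W where "W = {m. unt \<G> m \<in> U \<and> \<phi> (unt \<G> m) \<in> Q'}"
  have "open (\<phi> -` Q' \<inter> U)" by (rule open_vimage_Int[OF chU(4,1) f(1)])
  then have "open (unt \<G> -` (\<phi> -` Q' \<inter> U))"
    by (rule open_vimage[OF _ smooth_map_on_continuous[OF manifold_imp_cts_atlas[OF manifolds(2)] manifolds(1) smooth_unt]])
  then have oW: "open W" by (simp add: W_def vimage_def Int_def conj_commute)
  have m0W: "m0 \<in> W" using U(2) f(2) by (simp add: W_def)
  \<comment> \<open>The fibre of \<open>A\<close> at each unit is expressed in the chart singled out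
    there, which varies with \<open>m\<close>. \<open>\<tau> m\<close> carries vectors from the
    common chart \<open>\<phi>\<close> to that description.\<close>
  define \<tau> where "\<tau> m = frechet_derivative (coord \<A> (unt \<G> m) \<circ> inv_into U \<phi>) (at (\<phi> (unt \<G> m)))" for m
  define a where "a l m = \<tau> m (f l (\<phi> (unt \<G> m)))" for l m
  have \<tau>: "\<tau> m (tangent_coord \<A> \<phi> (unt \<G> m) v) = v" "tangent_coord \<A> \<phi> (unt \<G> m) (\<tau> m v) = v" "linear (\<tau> m)"
    if "m \<in> W" for m v
  proof -
    have u: "unt \<G> m \<in> U" using that by (simp add: W_def)
    show "\<tau> m (tangent_coord \<A> \<phi> (unt \<G> m) v) = v" "tangent_coord \<A> \<phi> (unt \<G> m) (\<tau> m v) = v"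
      unfolding \<tau>_def by (rule tangent_coord_inverse[OF manifolds(1) U(1) u])+
    show "linear (\<tau> m)"
      unfolding \<tau>_def
      by (rule has_derivative_linear[OF transition_has_derivative[OF manifolds(1) U(1) chart_at_mem(1)[OF manifolds(1)] u chart_at_mem(2)[OF manifolds(1)]]])
  qed
  have D_algd: "D (\<phi> (unt \<G> m)) (tangent_coord \<A> \<phi> (unt \<G> m) v) = 0 \<longleftrightarrow> v \<in> algd \<G> m" if m: "m \<in> W" for m v
  proof -
    have u: "unt \<G> m \<in> U" "\<phi> (unt \<G> m) \<in> Q" using m f(3) by (auto simp: W_def)
    have mt: "m \<in> Wt" using Q(5)[OF UNIV_I u] by simp
    have z: "tangent_coord \<M> \<theta> m 0 = 0"
      by (rule linear_0[OF tangent_coord_linear[OF manifolds(2) \<theta>(1) mt]])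
    have "tangent_coord \<M> \<theta> m x = 0 \<longleftrightarrow> x = 0" for x
      using tangent_coord_inverse(1)[OF manifolds(2) \<theta>(1) mt, of x]
        tangent_coord_inverse(1)[OF manifolds(2) \<theta>(1) mt, of 0] z by auto
    then show ?thesis unfolding D_tc[OF u] algd_def tgt_unt by simp
  qed
  have sec: "smooth_algd_section \<G> W (a l)" if l: "l \<in> L" for l
    unfolding smooth_algd_section_def
  proof
    show "\<forall>m\<in>W. a l m \<in> algd \<G> m"
      using f(7)[OF l] by (auto simp: D_algd[symmetric] a_def \<tau>(2)) (auto simp: W_def)
    show "smooth_map_on \<M> (tangent_atlas \<A>) W (\<lambda>m. (unt \<G> m, a l m))"
    proof (rule smooth_map_onI)
      fix m W1 \<theta>1 U2' \<phi>2'
      assume m: "m \<in> W" and W1: "(W1, \<theta>1) \<in> \<M>" "m \<in> W1"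
        and U2': "(U2', \<phi>2') \<in> tangent_atlas \<A>" "(unt \<G> m, a l m) \<in> U2'"
      obtain U2 \<phi>2 where U2: "(U2, \<phi>2) \<in> \<A>" and e: "U2' = U2 \<times> UNIV"
        "\<phi>2' = (\<lambda>(x, v). (\<phi>2 x, tangent_coord \<A> \<phi>2 x v))"
        using U2'(1) by (auto simp: tangent_atlas_def)
      have u2: "unt \<G> m \<in> U2" using U2'(2) e by simp
      have uU: "unt \<G> m \<in> U" using m by (simp add: W_def)
      obtain Q1 Y where Q1: "open Q1" "\<theta>1 m \<in> Q1" "Q1 \<subseteq> \<theta>1 ` W1" "smooth_on Q1 Y"
        "\<And>y. y \<in> UNIV \<Longrightarrow> y \<in> W1 \<Longrightarrow> \<theta>1 y \<in> Q1 \<Longrightarrow> unt \<G> y \<in> U \<and> \<phi> (unt \<G> y) = Y (\<theta>1 y)"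
        by (rule smooth_map_onD[OF smooth_unt UNIV_I W1 U(1) uU]) blast
      \<comment> \<open>Smoothness has to be tested in an arbitrary chart \<open>\<phi>2\<close>.
        There the frame vector is the derivative of the transition map applied to the vector found
        by elimination, and the chart singled out at the unit drops out.\<close>
      define \<kappa> where "\<kappa> = \<phi>2 \<circ> inv_into U \<phi>"
      note tr = manifold_transition[OF manifolds(1) U(1) U2, folded \<kappa>_def]
      let ?T = "Q' \<inter> \<phi> ` (U \<inter> U2)"
      have oT: "open ?T" using f(1) tr(2) by blast
      have sG: "smooth_on ?T (\<lambda>z. (\<kappa> z, frechet_derivative \<kappa> (at z) (f l z)))"
        by (intro smooth_on_Pair oT smooth_on_subset[OF tr(1)]
            smooth_on_frechet_var[OF oT tr(1) smooth_on_bounded_linear[OF bounded_linear_ident oT]]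
            smooth_on_subset[OF f(6)[OF l]]) auto
      let ?P = "{q \<in> Q1. Y q \<in> ?T}"
      have oP: "open ?P" by (rule smooth_on_open_vimage[OF Q1(4,1) oT])
      have "smooth_on ?P (\<lambda>q. (\<kappa> (Y q), frechet_derivative \<kappa> (at (Y q)) (f l (Y q))))"
        by (rule smooth_on_compose[OF oP sG smooth_on_subset[OF Q1(4)]]) auto
      moreover have "\<theta>1 m \<in> ?P"
      proof -
        have "\<phi> (unt \<G> m) \<in> ?T" using m u2 by (auto simp: W_def)
        then show ?thesis using Q1(5)[OF UNIV_I W1(2) Q1(2)] Q1(2) by simp
      qed
      moreover have "(unt \<G> m', a l m') \<in> U2' \<and> \<phi>2' (unt \<G> m', a l m') =
          (\<kappa> (Y (\<theta>1 m')), frechet_derivative \<kappa> (at (Y (\<theta>1 m'))) (f l (Y (\<theta>1 m'))))"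
        if m': "m' \<in> W" "m' \<in> W1" "\<theta>1 m' \<in> ?P" for m'
      proof -
        have Y: "unt \<G> m' \<in> U" "Y (\<theta>1 m') = \<phi> (unt \<G> m')" using Q1(5)[of m'] m' by auto
        with m'(3) chU(3) have u2': "unt \<G> m' \<in> U2" by (auto dest: inj_onD)
        have "tangent_coord \<A> \<phi>2 (unt \<G> m') (a l m') =
            frechet_derivative \<kappa> (at (\<phi> (unt \<G> m'))) (tangent_coord \<A> \<phi> (unt \<G> m') (a l m'))"
          unfolding \<kappa>_def by (rule tangent_coord_change[OF manifolds(1) U(1) U2 Y(1) u2'])
        moreover have "tangent_coord \<A> \<phi> (unt \<G> m') (a l m') = f l (\<phi> (unt \<G> m'))"
          unfolding a_def by (rule \<tau>(2)[OF m'(1)])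
        moreover have "\<kappa> (\<phi> (unt \<G> m')) = \<phi>2 (unt \<G> m')" using chU(3) Y(1) by (simp add: \<kappa>_def)
        ultimately show ?thesis using u2' by (simp add: e Y(2))
      qed
      ultimately show "\<exists>Q F. open Q \<and> \<theta>1 m \<in> Q \<and> Q \<subseteq> \<theta>1 ` W1 \<and> smooth_on Q F \<and>
          (\<forall>m'\<in>W \<inter> W1. \<theta>1 m' \<in> Q \<longrightarrow> (unt \<G> m', a l m') \<in> U2' \<and> \<phi>2' (unt \<G> m', a l m') = F (\<theta>1 m'))"
        using oP Q1(3)
        by (intro exI[of _ ?P] exI[of _ "\<lambda>q. (\<kappa> (Y q), frechet_derivative \<kappa> (at (Y q)) (f l (Y q)))"] conjI ballI impI) auto
    qed
  qed
  show thesis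
  proof (rule that[OF oW m0W f(4,5) sec])
    fix m v assume m: "m \<in> W" and v: "v \<in> algd \<G> m"
    let ?w = "tangent_coord \<A> \<phi> (unt \<G> m) v"
    have "\<phi> (unt \<G> m) \<in> Q'" using m by (simp add: W_def)
    from f(8)[OF this, of ?w] D_algd[OF m] v have "?w = (\<Sum>l\<in>L. c l ?w *\<^sub>R f l (\<phi> (unt \<G> m)))" by blast
    from arg_cong[OF this, of "\<tau> m"] show "v = (\<Sum>l\<in>L. c l ?w *\<^sub>R a l m)"
      by (simp only: \<tau>(1)[OF m] linear_sum[OF \<tau>(3)[OF m]] linear_scale[OF \<tau>(3)[OF m]] a_def)
  qed
qed

end

locale van_est_data = tubular_groupoid +
  fixes \<V> :: "('b, 'k::findim) vbundle" and \<rho> :: "'a \<Rightarrow> 'k \<Rightarrow> 'k" and n :: nat and \<alpha> :: "'b \<Rightarrow> 'c list \<Rightarrow> 'k"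
  assumes vb: "vector_bundle (chartsM \<G>) \<V>" and rep: "groupoid_representation \<G> \<V> \<rho>"
    and \<alpha>: "\<alpha> \<in> algd_cochains \<G> \<V> n"
begin

lemma rho_linear: "linear (\<rho> g)" and rho_bij: "bij (\<rho> g)" and rho_unt [simp]: "\<rho> (unt \<G> m) = id"
  and rho_mlt: "(g, h) \<in> cdom \<G> \<Longrightarrow> \<rho> (mlt \<G> g h) = \<rho> g \<circ> \<rho> h"
  using rep by (auto simp: groupoid_representation_def)

lemma alpha_alternating: "alternating_form n (algd \<G> m) (\<alpha> m)"
  using \<alpha> by (simp add: algd_cochains_def)

text \<open>Cochains are known to be smooth only on smooth sections, whereas the vectors at hand
  merely converge. Expanding them in a frame separates converging coefficients from values on
  sections. Constancy of the target keeps all values in one fibre of the vector bundle.\<close>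

lemma form_tendsto:
  fixes F :: "'s filter"
  assumes y: "(y \<longlongrightarrow> y0) F" "\<forall>\<^sub>F t in F. tgt \<G> (y t) = m0" "tgt \<G> y0 = m0"
    and \<xi>: "\<And>\<xi>. \<xi> \<in> set xs \<Longrightarrow> (\<forall>\<^sub>F t in F. fst \<xi> t \<in> algd \<G> (src \<G> (y t))) \<and> snd \<xi> \<in> algd \<G> (src \<G> y0) \<and>
      (\<forall>(U, \<phi>)\<in>\<A>. unt \<G> (src \<G> y0) \<in> U \<longrightarrow>
        ((\<lambda>t. tangent_coord \<A> \<phi> (unt \<G> (src \<G> (y t))) (fst \<xi> t)) \<longlongrightarrow>
          tangent_coord \<A> \<phi> (unt \<G> (src \<G> y0)) (snd \<xi>)) F)"
    and len: "length xs = n"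
  shows "((\<lambda>t. \<rho> (y t) (\<alpha> (src \<G> (y t)) (map (\<lambda>\<xi>. fst \<xi> t) xs))) \<longlongrightarrow>
      \<rho> y0 (\<alpha> (src \<G> y0) (map snd xs))) F"
proof -
  let ?m = "\<lambda>t. src \<G> (y t)" and ?base = "src \<G> y0"
  note cA = manifold_imp_cts_atlas[OF manifolds(1)]
  obtain U \<phi> where U: "(U, \<phi>) \<in> \<A>" "unt \<G> ?base \<in> U"
    using atlas_cover[OF manifold_atlas_cover[OF manifolds(1)]] by blast
  obtain W and L :: "'c set" and c a where W: "open W" "?base \<in> W" "finite L" "\<And>l. bounded_linear (c l :: 'c \<Rightarrow> real)"
    "\<And>l. l \<in> L \<Longrightarrow> smooth_algd_section \<G> W (a l)"
    "\<And>m v. m \<in> W \<Longrightarrow> v \<in> algd \<G> m \<Longrightarrow> v = (\<Sum>l\<in>L. c l (tangent_coord \<A> \<phi> (unt \<G> m) v) *\<^sub>R a l m)"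
    using algd_frame[OF U] by blast
  have cover: "\<Union>(fst ` \<V>) = UNIV" using vb by (simp add: vector_bundle_def)
  obtain U1 \<tau> where U1: "(U1, \<tau>) \<in> \<V>" "?base \<in> U1"
    using cover by (metis UN_E UNIV_I prod.collapse)
  obtain U0 \<tau>0 where U0: "(U0, \<tau>0) \<in> \<V>" "m0 \<in> U0"
    using cover by (metis UN_E UNIV_I prod.collapse)
  have triv: "open U'" "\<And>m. m \<in> U' \<Longrightarrow> linear (\<sigma> m)" "\<And>m. m \<in> U' \<Longrightarrow> bij (\<sigma> m)" if "(U', \<sigma>) \<in> \<V>" for U' \<sigma>
    using vb that unfolding vector_bundle_def by blast+
  have mt: "(?m \<longlongrightarrow> ?base) F"
    using smooth_map_on_continuous[OF cA manifolds(2) smooth_src] y(1)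
    by (rule continuous_on_tendsto_compose) auto
  have evW: "\<forall>\<^sub>F t in F. ?m t \<in> W \<inter> U1"
    using tendsto_eventually_open[OF mt] W(1,2) U1(2) triv(1)[OF U1(1)] by (metis IntI open_Int)
  have aW: "a l m \<in> algd \<G> m" if "l \<in> L" "m \<in> W" for l m
    using W(5)[OF that(1)] that(2) by (simp add: smooth_algd_section_def)
  \<comment> \<open>The vectors are traded for frame sections one at a time, from the right;
    \<open>ls\<close> records the sections chosen so far. When no vector is left, smoothness of the
    cochain applies.\<close>
  have main: "((\<lambda>t. \<tau> (?m t) (\<alpha> (?m t) (map (\<lambda>\<xi>. fst \<xi> t) xs @ map (\<lambda>l. a l (?m t)) ls))) \<longlongrightarrow>
      \<tau> ?base (\<alpha> ?base (map snd xs @ map (\<lambda>l. a l ?base) ls))) F"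
    if "set ls \<subseteq> L" "length xs + length ls = n" for ls
    using that \<xi>
  proof (induction xs arbitrary: ls rule: rev_induct)
    case Nil
    have "\<forall>as. open W \<and> length as = n \<and> (\<forall>a\<in>set as. smooth_algd_section \<G> W a) \<longrightarrow>
            smooth_section (chartsM \<G>) \<V> W (\<lambda>m. \<alpha> m (map (\<lambda>a. a m) as))"
      using \<alpha> unfolding algd_cochains_def by blast
    from this[rule_format, of "map a ls"]
    have "smooth_section (chartsM \<G>) \<V> W (\<lambda>m. \<alpha> m (map (\<lambda>l. a l m) ls))"
      using Nil.prems W(1,5) by (auto simp: o_def)
    then have "smooth_map_on \<M> vs_atlas (W \<inter> U1) (\<lambda>m. \<tau> m (\<alpha> m (map (\<lambda>l. a l m) ls)))"
      using U1(1) unfolding smooth_section_def by blast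
    from smooth_map_vs_tendsto[OF manifolds(2) this mt _ evW] show ?case using W(2) U1(2) by simp
  next
    case (snoc \<xi> xs)
    let ?c = "\<lambda>l m v. c l (tangent_coord \<A> \<phi> (unt \<G> m) v)"
    have \<xi>1: "\<forall>\<^sub>F t in F. fst \<xi> t \<in> algd \<G> (?m t)" "snd \<xi> \<in> algd \<G> ?base"
      and \<xi>2: "((\<lambda>t. tangent_coord \<A> \<phi> (unt \<G> (?m t)) (fst \<xi> t)) \<longlongrightarrow> tangent_coord \<A> \<phi> (unt \<G> ?base) (snd \<xi>)) F"
      using snoc.prems(3)[of \<xi>] U by auto
    have xs: "\<forall>\<^sub>F t in F. set (map (\<lambda>\<xi>. fst \<xi> t) xs) \<subseteq> algd \<G> (?m t)" "set (map snd xs) \<subseteq> algd \<G> ?base"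
      using snoc.prems(3) by (auto simp: eventually_ball_finite_distrib image_subset_iff)
    have expand: "\<tau> m (\<alpha> m (vs @ [v] @ map (\<lambda>l. a l m) ls)) =
        (\<Sum>l\<in>L. ?c l m v *\<^sub>R \<tau> m (\<alpha> m (vs @ map (\<lambda>l. a l m) (l # ls))))"
      if "m \<in> W" "m \<in> U1" "v \<in> algd \<G> m" "set vs \<subseteq> algd \<G> m" "length vs = length xs" for m v vs
    proof -
      have "\<alpha> m (vs @ v # map (\<lambda>l. a l m) ls) = \<alpha> m (vs @ (\<Sum>l\<in>L. ?c l m v *\<^sub>R a l m) # map (\<lambda>l. a l m) ls)"
        using W(6)[OF that(1,3)] by simp
      also have "\<dots> = (\<Sum>l\<in>L. ?c l m v *\<^sub>R \<alpha> m (vs @ a l m # map (\<lambda>l. a l m) ls))"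
        by (rule alternating_form_linear(3)[OF alpha_alternating algd_subspace _ that(4) _ W(3)])
          (use snoc.prems that aW in auto)
      finally show ?thesis
        using triv(2)[OF U1(1) that(2)] by (simp add: linear_sum linear_scale)
    qed
    have "((\<lambda>t. \<Sum>l\<in>L. ?c l (?m t) (fst \<xi> t) *\<^sub>R \<tau> (?m t) (\<alpha> (?m t) (map (\<lambda>\<xi>. fst \<xi> t) xs @ map (\<lambda>l. a l (?m t)) (l # ls)))) \<longlongrightarrow>
      (\<Sum>l\<in>L. ?c l ?base (snd \<xi>) *\<^sub>R \<tau> ?base (\<alpha> ?base (map snd xs @ map (\<lambda>l. a l ?base) (l # ls))))) F"
      using snoc.prems
      by (intro tendsto_sum tendsto_scaleR bounded_linear.tendsto[OF W(4)] \<xi>2 snoc.IH) auto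
    also have "(\<Sum>l\<in>L. ?c l ?base (snd \<xi>) *\<^sub>R \<tau> ?base (\<alpha> ?base (map snd xs @ map (\<lambda>l. a l ?base) (l # ls)))) =
        \<tau> ?base (\<alpha> ?base (map snd (xs @ [\<xi>]) @ map (\<lambda>l. a l ?base) ls))"
      using expand[OF W(2) U1(2) \<xi>1(2) xs(2)] by simp
    finally show ?case
    proof (rule Lim_transform_eventually)
      show "\<forall>\<^sub>F t in F. (\<Sum>l\<in>L. ?c l (?m t) (fst \<xi> t) *\<^sub>R \<tau> (?m t) (\<alpha> (?m t) (map (\<lambda>\<xi>. fst \<xi> t) xs @ map (\<lambda>l. a l (?m t)) (l # ls)))) =
        \<tau> (?m t) (\<alpha> (?m t) (map (\<lambda>\<xi>. fst \<xi> t) (xs @ [\<xi>]) @ map (\<lambda>l. a l (?m t)) ls))"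
        using evW \<xi>1(1) xs(1)
      proof eventually_elim
        case (elim t)
        then show ?case using expand[of "?m t" "fst \<xi> t" "map (\<lambda>\<xi>. fst \<xi> t) xs"] by simp
      qed
    qed
  qed
  let ?\<kappa> = "\<lambda>t. \<tau> (?m t) (\<alpha> (?m t) (map (\<lambda>\<xi>. fst \<xi> t) xs))" and ?lim = "\<tau> ?base (\<alpha> ?base (map snd xs))"
  have \<kappa>: "(?\<kappa> \<longlongrightarrow> ?lim) F" using main[of "[]"] len by simp
  obtain B :: "'k set" and d where B: "finite B" "\<forall>b. bounded_linear (d b)" "\<forall>x. x = (\<Sum>b\<in>B. d b x *\<^sub>R b)"
    using finite_coordinates by blast
  \<comment> \<open>In trivialisations the action is known to be smooth in the arrow for each fixed
    vector. It is therefore evaluated on finitely many fixed vectors, with the converging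
    coordinates of the value of \<open>\<alpha>\<close> as coefficients.\<close>
  define R where "R g k = \<tau>0 (tgt \<G> g) (\<rho> g (inv (\<tau> (src \<G> g)) k))" for g k
  have linR: "linear (R g)" if "src \<G> g \<in> U1" "tgt \<G> g \<in> U0" for g
  proof -
    have 1: "linear (inv (\<tau> (src \<G> g)))"
      using triv(2,3)[OF U1(1) that(1)] by (rule linear_inv_bij)
    show ?thesis
      unfolding R_def
      using linear_compose[OF linear_compose[OF 1 rho_linear[of g]] triv(2)[OF U0(1) that(2)]] by (simp add: o_def)
  qed
  let ?S = "src \<G> -` U1 \<inter> tgt \<G> -` U0"
  have Rs: "smooth_map_on \<A> vs_atlas ?S (\<lambda>g. R g k)" for k
    using rep U1(1) U0(1) unfolding groupoid_representation_def R_def by blast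
  have evS: "\<forall>\<^sub>F t in F. y t \<in> ?S" using evW y(2) by eventually_elim (use U0(2) in auto)
  have y0S: "y0 \<in> ?S" using U1(2) U0(2) y(3) by simp
  have Rsum: "(\<Sum>b\<in>B. d b k *\<^sub>R R g b) = R g k" if "g \<in> ?S" for g k
  proof -
    have l: "linear (R g)" using linR that by simp
    show ?thesis using arg_cong[OF B(3)[rule_format, of k], of "R g"] by (simp only: linear_sum[OF l] linear_scale[OF l])
  qed
  have "((\<lambda>t. \<Sum>b\<in>B. d b (?\<kappa> t) *\<^sub>R R (y t) b) \<longlongrightarrow> (\<Sum>b\<in>B. d b ?lim *\<^sub>R R y0 b)) F"
    by (intro tendsto_sum tendsto_scaleR bounded_linear.tendsto[OF B(2)[rule_format]] \<kappa>
        smooth_map_vs_tendsto[OF manifolds(1) Rs y(1) y0S evS])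
  \<comment> \<open>Since the arrows eventually have target \<open>m0\<close>, a single linear
    isomorphism \<open>\<tau>0 m0\<close> has to be undone, and it commutes with the limit.\<close>
  then have lim: "((\<lambda>t. inv (\<tau>0 m0) (\<Sum>b\<in>B. d b (?\<kappa> t) *\<^sub>R R (y t) b)) \<longlongrightarrow> inv (\<tau>0 m0) (\<Sum>b\<in>B. d b ?lim *\<^sub>R R y0 b)) F"
    by (rule bounded_linear.tendsto[OF linear_imp_bounded_linear_findim[OF linear_inv_bij[OF triv(2,3)[OF U0]]]])
  have fin: "inv (\<tau>0 m0) (\<Sum>b\<in>B. d b (\<tau> (src \<G> g) v) *\<^sub>R R g b) = \<rho> g v" if "g \<in> ?S" "tgt \<G> g = m0" for g v
  proof -
    have i: "inj (\<tau>0 m0)" "inj (\<tau> (src \<G> g))"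
      using triv(3)[OF U0] triv(3)[OF U1(1)] that(1) by (auto intro: bij_is_inj)
    have "R g (\<tau> (src \<G> g) v) = \<tau>0 m0 (\<rho> g v)" using i(2) by (simp add: R_def that(2))
    then show ?thesis using Rsum[OF that(1), of "\<tau> (src \<G> g) v"] i(1) by simp
  qed
  have "inv (\<tau>0 m0) (\<Sum>b\<in>B. d b ?lim *\<^sub>R R y0 b) = \<rho> y0 (\<alpha> ?base (map snd xs))"
    by (rule fin[OF y0S y(3)])
  with lim have "((\<lambda>t. inv (\<tau>0 m0) (\<Sum>b\<in>B. d b (?\<kappa> t) *\<^sub>R R (y t) b)) \<longlongrightarrow> \<rho> y0 (\<alpha> ?base (map snd xs))) F" by simp
  then show ?thesis
  proof (rule Lim_transform_eventually)
    show "\<forall>\<^sub>F t in F. inv (\<tau>0 m0) (\<Sum>b\<in>B. d b (?\<kappa> t) *\<^sub>R R (y t) b) = \<rho> (y t) (\<alpha> (?m t) (map (\<lambda>\<xi>. fst \<xi> t) xs))"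
      using evS y(2) by eventually_elim (rule fin)
  qed
qed

end

section \<open>The pullback under the iterated retraction\<close>

lemma cube_eq: "cube p = {t. \<forall>i. t i \<in> (if i < p then {0..1} else {undefined})}"
  by (auto simp: cube_def PiE_def Pi_def extensional_def split: if_splits)

lemma closed_cube: "closed (cube p)"
proof -
  have "closed {t :: nat \<Rightarrow> real. t i \<in> (if i < p then {0..1} else {undefined})}" for i
  proof -
    have "closed ((\<lambda>t :: nat \<Rightarrow> real. t i) -` (if i < p then {0..1} else {undefined}))"
      by (rule closed_vimage[OF _ continuous_on_product_coordinates]) auto
    then show ?thesis by (simp add: vimage_def)
  qed
  then have "closed {t :: nat \<Rightarrow> real. \<forall>i. t i \<in> (if i < p then {0..1} else {undefined})}"
    by (rule closed_Collect_all)
  then show ?thesis by (simp only: cube_eq)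
qed

text \<open>Extensionality fixes all coordinates from \<open>p\<close> on, so the cube is a product
  of compact sets over all indices and Tychonoff's theorem applies.\<close>

lemma compact_cube: "compact (cube p)"
proof -
  have eq: "cube p = (\<Pi>\<^sub>E i\<in>UNIV. if i < p then {0..1} else {undefined})"
    unfolding cube_eq PiE_UNIV_domain Pi_def by simp
  have "compactin (product_topology (\<lambda>i. euclidean) UNIV) (\<Pi>\<^sub>E i\<in>UNIV. if i < p then {0..1::real} else {undefined})"
    unfolding compactin_PiE by auto
  then show ?thesis by (simp add: eq euclidean_product_topology)
qed

abbreviation cube_measure :: "nat \<Rightarrow> (nat \<Rightarrow> real) measure" where
  "cube_measure p \<equiv> \<Pi>\<^sub>M i\<in>{..<p}. lborel"

text \<open>Links the two structures on parameters: continuity refers to the product topology on all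
  functions, the measure to the finite product indexed by \<open>{..<p}\<close>.\<close>

lemma measurable_id_PiM_borel: "(\<lambda>t. t) \<in> cube_measure p \<rightarrow>\<^sub>M borel"
proof -
  have "(\<lambda>t i. t i) \<in> cube_measure p \<rightarrow>\<^sub>M (\<Pi>\<^sub>M i\<in>UNIV. (borel :: real measure))"
  proof (rule measurable_PiM_single')
    fix i :: nat
    show "(\<lambda>t. t i) \<in> cube_measure p \<rightarrow>\<^sub>M borel"
    proof (cases "i < p")
      case True
      then have "(\<lambda>t. t i) \<in> cube_measure p \<rightarrow>\<^sub>M lborel" by (intro measurable_component_singleton) auto
      then show ?thesis by simp
    next
      case False
      then have "\<And>t. t \<in> space (cube_measure p) \<Longrightarrow> t i = undefined" by (auto simp: space_PiM PiE_def extensional_def)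
      then show ?thesis by (subst measurable_cong[where g = "\<lambda>_. undefined"]) auto
    qed
  qed simp
  then show ?thesis
    using measurable_cong_sets[OF refl sets_PiM_equal_borel] by blast
qed

interpretation cube_product: product_sigma_finite "\<lambda>_ :: nat. lborel :: real measure"
  by standard

lemma sets_cube: "cube p \<in> sets (cube_measure p)"
  unfolding cube_def by (rule sets_PiM_I_finite) auto

lemma emeasure_cube: "emeasure (cube_measure p) (cube p) = 1"
  unfolding cube_def by (subst cube_product.emeasure_PiM) auto

lemma continuous_cube_measurable:
  fixes f :: "(nat \<Rightarrow> real) \<Rightarrow> 'a::{banach, second_countable_topology}"
  assumes "continuous_on (cube p) f"
  shows "(\<lambda>t. indicator (cube p) t *\<^sub>R f t) \<in> borel_measurable (cube_measure p)"
proof -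
  have "(\<lambda>t. indicator (cube p) t *\<^sub>R f t) \<in> borel_measurable borel"
    by (rule borel_measurable_continuous_on_indicator[OF _ assms]) (simp add: closed_cube)
  from measurable_compose[OF measurable_id_PiM_borel this] show ?thesis .
qed

lemma continuous_cube_integrable:
  fixes f :: "(nat \<Rightarrow> real) \<Rightarrow> 'a::{banach, second_countable_topology}"
  assumes "continuous_on (cube p) f"
  shows "set_integrable (cube_measure p) (cube p) f"
proof -
  obtain B where B: "\<And>t. t \<in> cube p \<Longrightarrow> norm (f t) \<le> B"
    using compact_imp_bounded[OF compact_continuous_image[OF assms compact_cube]] by (auto simp: bounded_iff)
  have "integrable (cube_measure p) (\<lambda>t. indicator (cube p) t *\<^sub>R (indicator (cube p) t *\<^sub>R f t))"
    by (rule integrableI_bounded_set_indicator[OF sets_cube continuous_cube_measurable[OF assms], of B])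
      (use B in \<open>auto simp: emeasure_cube\<close>)
  then show ?thesis by (simp add: set_integrable_def indicator_inter_arith[symmetric])
qed

text \<open>The coordinate split off is the last one, because each new homotopy operator adds the
  parameter of the innermost retraction, and it becomes the outer integral.\<close>

lemma cube_fubini:
  fixes f :: "(nat \<Rightarrow> real) \<Rightarrow> 'a::{banach, second_countable_topology}"
  assumes f: "continuous_on (cube (Suc p)) f"
  shows "(LINT t:cube (Suc p)|cube_measure (Suc p). f t) =
    (LINT r:{0..1}|lborel. LINT t:cube p|cube_measure p. f (t(p := r)))"
proof -
  let ?g = "\<lambda>t. indicator (cube (Suc p)) t *\<^sub>R f t"
  have S: "{..<Suc p} = {p} \<union> {..<p}" by auto
  have int: "integrable (Pi\<^sub>M ({p} \<union> {..<p}) (\<lambda>_. lborel)) ?g"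
    using continuous_cube_integrable[OF f] unfolding set_integrable_def S .
  define h where "h r = (\<integral>y. ?g (y(p := r)) \<partial>cube_measure p)" for r
  have mg: "?g \<in> borel_measurable (Pi\<^sub>M (insert p {..<p}) (\<lambda>_. lborel))"
    using continuous_cube_measurable[OF f] by (simp add: lessThan_Suc)
  \<comment> \<open>Joint measurability makes the inner integral \<open>h\<close> measurable, which
    reducing the product over the index set \<open>{p}\<close> to \<open>lborel\<close>
    requires.\<close>
  have "(\<lambda>z. ?g ((snd z)(p := fst z))) \<in> borel_measurable (lborel \<Otimes>\<^sub>M cube_measure p)"
  proof -
    have "(\<lambda>(y, r). y(p := r)) \<in> measurable (cube_measure p \<Otimes>\<^sub>M lborel) (Pi\<^sub>M (insert p {..<p}) (\<lambda>_. lborel))"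
      by (rule measurable_add_dim)
    from measurable_compose[OF measurable_pair_swap' measurable_compose[OF this mg]]
    show ?thesis by (simp add: case_prod_beta)
  qed
  then have mh: "h \<in> borel_measurable lborel"
    unfolding h_def
    by (intro sigma_finite_measure.borel_measurable_lebesgue_integral cube_product.sigma_finite)
      (auto simp: case_prod_beta)
  have "(\<integral>t. ?g t \<partial>cube_measure (Suc p)) =
      (\<integral>x. (\<integral>y. ?g (merge {p} {..<p} (x, y)) \<partial>cube_measure p) \<partial>Pi\<^sub>M {p} (\<lambda>_. lborel))"
    unfolding S by (rule cube_product.product_integral_fold) (use int in auto)
  also have "\<dots> = (\<integral>x. h (x p) \<partial>Pi\<^sub>M {p} (\<lambda>_. lborel))"
  proof (rule Bochner_Integration.integral_cong[OF refl])
    fix x :: "nat \<Rightarrow> real"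
    have "merge {p} {..<p} (x, y) = y(p := x p)" if "y \<in> space (cube_measure p)" for y
      using that by (auto simp: merge_def space_PiM PiE_def extensional_def fun_eq_iff)
    then show "(\<integral>y. ?g (merge {p} {..<p} (x, y)) \<partial>cube_measure p) = h (x p)"
      unfolding h_def by (intro Bochner_Integration.integral_cong[OF refl]) simp
  qed
  also have "\<dots> = (\<integral>r. h r \<partial>lborel)" by (rule cube_product.product_integral_singleton) (rule mh)
  also have "\<dots> = (\<integral>r. indicator {0..1} r *\<^sub>R (LINT t:cube p|cube_measure p. f (t(p := r))) \<partial>lborel)"
  proof (rule Bochner_Integration.integral_cong[OF refl])
    fix r :: real
    have "indicator (cube (Suc p)) (y(p := r)) = (indicator {0..1} r * indicator (cube p) y :: real)"
      if "y \<in> space (cube_measure p)" for y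
    proof -
      have "y(p := r) \<in> cube (Suc p) \<longleftrightarrow> r \<in> {0..1} \<and> y \<in> cube p"
        using that by (auto simp: cube_def space_PiM PiE_iff extensional_def less_Suc_eq)
      then show ?thesis by (auto simp: indicator_def)
    qed
    then have "h r = (\<integral>y. indicator {0..1} r *\<^sub>R (indicator (cube p) y *\<^sub>R f (y(p := r))) \<partial>cube_measure p)"
      unfolding h_def by (intro Bochner_Integration.integral_cong[OF refl]) simp
    then show "h r = indicator {0..1} r *\<^sub>R (LINT t:cube p|cube_measure p. f (t(p := r)))"
      unfolding set_lebesgue_integral_def by (simp only: integral_scaleR_right)
  qed
  finally show ?thesis unfolding set_lebesgue_integral_def .
qed

section \<open>The iterated retraction as a function of its parameters and of its last arrow\<close>

context tubular_groupoid
begin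

text \<open>The base point in \<open>cube_map\<close> is irrelevant for nonempty lists.\<close>

definition iter_retr :: "'g list \<Rightarrow> 'g \<Rightarrow> (nat \<Rightarrow> real) \<Rightarrow> 'g" where
  "iter_retr gs x t = cube_map \<G> lam (gs @ [x]) undefined t"

definition cube_vel :: "'g list \<Rightarrow> 'g \<Rightarrow> (nat \<Rightarrow> real) \<Rightarrow> nat \<Rightarrow> 'e" where
  "cube_vel gs x t i = vel (\<lambda>h. iter_retr gs x (t(i := h))) (t i)"

text \<open>The partial derivative in the last arrow \<open>x\<close>; the vector \<open>w\<close> in the fibre of \<open>A\<close> at \<open>s(x)\<close> is left translated to \<open>x\<close>.\<close>

definition fibre_vel :: "'g list \<Rightarrow> 'g \<Rightarrow> (nat \<Rightarrow> real) \<Rightarrow> 'e \<Rightarrow> 'e" where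
  "fibre_vel gs x t w = vel (\<lambda>s. iter_retr gs (mlt \<G> x (\<epsilon> (unt \<G> (src \<G> x), s *\<^sub>R w))) t) 0"

lemma iter_retr_cong: "(\<And>i. i \<le> length gs \<Longrightarrow> t i = t' i) \<Longrightarrow> iter_retr gs x t = iter_retr gs x t'"
  unfolding iter_retr_def by (rule cube_map_cong) auto

lemma iter_retr_snoc: "iter_retr (gs @ [g]) x t = iter_retr gs (mlt \<G> g (lam (t (Suc (length gs))) x)) t"
  unfolding iter_retr_def using cube_map_snoc2[of \<G> lam gs g x undefined t] by simp

lemma cube_map_iter_retr: "cube_map \<G> lam (gs @ [x]) m t = iter_retr gs x t"
  unfolding iter_retr_def by (rule cube_map_base) simp

end

context unit_tower
begin

text \<open>Each arrow of the tuple costs two levels of the tower, one for a multiplication and one for a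
  retraction; \<open>k\<close> levels are left for the result.\<close>

definition admissible :: "nat \<Rightarrow> 'a list \<Rightarrow> 'a \<Rightarrow> bool" where
  "admissible k gs x \<longleftrightarrow> set gs \<subseteq> N (k + 2 * Suc (length gs)) \<and> x \<in> N (k + 2 * Suc (length gs)) \<and> chained \<G> (gs @ [x])"

lemma admissible_mono: "j \<le> k \<Longrightarrow> admissible k gs x \<Longrightarrow> admissible j gs x"
  using N_mono[of "j + 2 * Suc (length gs)" "k + 2 * Suc (length gs)"] by (auto simp: admissible_def)

lemma iter_retr_mem:
  assumes "admissible k gs x" "\<And>i. i \<le> length gs \<Longrightarrow> t i \<in> {-1..2}"
  shows "iter_retr gs x t \<in> N k" "tgt \<G> (iter_retr gs x t) = tgt \<G> (hd (gs @ [x]))"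
  using cube_map_mem[of "gs @ [x]" k t undefined] assms by (auto simp: admissible_def iter_retr_def)

lemma iter_retr_family:
  assumes Q: "open Q" and X: "smooth_family \<A> P Q X" and \<tau>: "\<And>i n. i \<le> length gs \<Longrightarrow> cube_Ck P n Q (\<lambda>t. \<tau> t i)"
    and admissible: "\<And>t. t \<in> Q \<Longrightarrow> admissible k gs (X t)" "\<And>t i. t \<in> Q \<Longrightarrow> i \<le> length gs \<Longrightarrow> \<tau> t i \<in> {-1..2}"
  shows "smooth_family \<A> P Q (\<lambda>t. iter_retr gs (X t) (\<tau> t))"
proof -
  let ?hs = "map (\<lambda>g _. g) gs @ [X]"
  have hs: "map (\<lambda>g. g t) ?hs = gs @ [X t]" for t by (simp add: o_def)
  have "smooth_family \<A> P Q (\<lambda>t. cube_map \<G> lam (map (\<lambda>g. g t) ?hs) undefined (\<tau> t))"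
  proof (rule cube_map_family[OF _ Q, of _ _ _ k])
    show "smooth_family \<A> P Q g" if "g \<in> set ?hs" for g
      using that X smooth_family_const[OF Q] by auto
    show "cube_Ck P n Q (\<lambda>t. \<tau> t i)" if "i < length ?hs" for i n using \<tau> that by auto
    fix t assume t: "t \<in> Q"
    have "(\<lambda>g. g t) ` set ?hs = set (gs @ [X t])" using hs[of t] by (metis set_map)
    then show "(\<lambda>g. g t) ` set ?hs \<subseteq> N (k + 2 * length ?hs) \<and> chained \<G> (map (\<lambda>g. g t) ?hs) \<and> (\<forall>i<length ?hs. \<tau> t i \<in> {-1..2})"
      unfolding hs using admissible(1)[OF t] admissible(2)[OF t] by (auto simp: admissible_def)
  qed simp
  then show ?thesis unfolding hs iter_retr_def .
qed

text \<open>\<open>F\<close> is a moving foot point and \<open>C\<close> passes through it when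
  coordinate \<open>j\<close> varies. The product of the inverse of \<open>F\<close> with
  \<open>C\<close> is a smooth family passing through units, and its partial derivative in direction
  \<open>j\<close> is the left translated velocity; so continuity of partial derivatives in a chart
  gives the limit. The cube directions and the fibre directions are both treated as such an extra
  coordinate.\<close>

lemma velocity_tendsto:
  fixes s :: "'s::topological_space \<Rightarrow> nat \<Rightarrow> real"
  assumes C: "smooth_family \<A> P Q C" and F: "smooth_family \<A> P Q F" and j: "j < P"
    and mem': "\<forall>t\<in>Q. F t \<in> N (Suc (Suc (Suc (Suc k)))) \<and> C t \<in> N (Suc (Suc (Suc (Suc k)))) \<and> tgt \<G> (C t) = tgt \<G> (F t)"
    and const: "\<And>t h. F (t(j := h)) = F t"
    and s: "continuous_on S s" "s ` S \<subseteq> Q" "\<And>\<sigma>. \<sigma> \<in> S \<Longrightarrow> C (s \<sigma>) = F (s \<sigma>)" and \<sigma>0: "\<sigma>0 \<in> S"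
  defines "w \<equiv> \<lambda>\<sigma>. vel (\<lambda>h. C ((s \<sigma>)(j := h))) (s \<sigma> j)"
  shows "\<And>\<sigma>. \<sigma> \<in> S \<Longrightarrow> fcurve (tgt \<G> (F (s \<sigma>))) (\<lambda>h. C ((s \<sigma>)(j := h))) (s \<sigma> j)"
    and "\<And>\<sigma>. \<sigma> \<in> S \<Longrightarrow> ltrans_inv \<G> (F (s \<sigma>)) (w \<sigma>) \<in> algd \<G> (src \<G> (F (s \<sigma>)))"
    and "\<And>U \<phi>. (U, \<phi>) \<in> \<A> \<Longrightarrow> unt \<G> (src \<G> (F (s \<sigma>0))) \<in> U \<Longrightarrow>
      ((\<lambda>\<sigma>. tangent_coord \<A> \<phi> (unt \<G> (src \<G> (F (s \<sigma>)))) (ltrans_inv \<G> (F (s \<sigma>)) (w \<sigma>))) \<longlongrightarrow>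
        tangent_coord \<A> \<phi> (unt \<G> (src \<G> (F (s \<sigma>0)))) (ltrans_inv \<G> (F (s \<sigma>0)) (w \<sigma>0))) (at \<sigma>0 within S)"
proof -
  note mem = mem'[rule_format]
  \<comment> \<open>\<open>F\<close> ignores coordinate \<open>j\<close>, so along it
    \<open>?D\<close> is left multiplication of the curve by one fixed arrow.\<close>
  let ?D = "\<lambda>t. mlt \<G> (ivs \<G> (F t)) (C t)"
  have Q: "open Q" using C by (simp add: smooth_family_def)
  have cd: "(ivs \<G> (F t), C t) \<in> cdom \<G>" if "t \<in> Q" for t
    using mem[OF that] N_ivs[of "F t" "Suc (Suc (Suc k))"] N_mono[of "Suc (Suc (Suc k))" "Suc (Suc (Suc (Suc k)))" "C t"]
    by (intro N_mlt(1)[of _ "Suc (Suc k)"]) auto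
  have D: "smooth_family \<A> P Q ?D"
    using mem N_ivs(1) by (intro family_mlt family_ivs F C cd) blast
  show fc: "fcurve (tgt \<G> (F (s \<sigma>))) (\<lambda>h. C ((s \<sigma>)(j := h))) (s \<sigma> j)" if \<sigma>: "\<sigma> \<in> S" for \<sigma>
  proof -
    have sQ: "s \<sigma> \<in> Q" using s(2) \<sigma> by blast
    have "smooth_curve_at \<A> (\<lambda>h. C ((s \<sigma>)(j := h))) (s \<sigma> j)"
      by (rule smooth_family_curve[OF manifolds(1) C sQ j])
    moreover have "\<forall>\<^sub>F h in nhds (s \<sigma> j). (s \<sigma>)(j := h) \<in> Q"
      by (rule eventually_fun_upd_open[OF Q]) (use sQ in simp)
    then have "\<forall>\<^sub>F h in nhds (s \<sigma> j). tgt \<G> (C ((s \<sigma>)(j := h))) = tgt \<G> (F (s \<sigma>))"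
      by eventually_elim (use mem const in simp)
    ultimately show ?thesis by (simp add: fcurve_def)
  qed
  have li: "ltrans_inv \<G> (F (s \<sigma>)) (w \<sigma>) = vel (\<lambda>h. ?D ((s \<sigma>)(j := h))) (s \<sigma> j)"
    "ltrans_inv \<G> (F (s \<sigma>)) (w \<sigma>) \<in> algd \<G> (src \<G> (F (s \<sigma>)))" "?D (s \<sigma>) = unt \<G> (src \<G> (F (s \<sigma>)))"
    if \<sigma>: "\<sigma> \<in> S" for \<sigma>
  proof -
    have sQ: "s \<sigma> \<in> Q" using s(2) \<sigma> by blast
    note l = ltrans_inv_velocity[OF conjunct1[OF mem[OF sQ]] fc[OF \<sigma>]]
    show "ltrans_inv \<G> (F (s \<sigma>)) (w \<sigma>) = vel (\<lambda>h. ?D ((s \<sigma>)(j := h))) (s \<sigma> j)"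
      unfolding w_def const by (rule l(3)) (use s(3)[OF \<sigma>] in simp)
    show "ltrans_inv \<G> (F (s \<sigma>)) (w \<sigma>) \<in> algd \<G> (src \<G> (F (s \<sigma>)))"
      unfolding w_def by (rule l(5)) (use s(3)[OF \<sigma>] in simp)
    show "?D (s \<sigma>) = unt \<G> (src \<G> (F (s \<sigma>)))"
      using ivsD(6)[OF N_ivs(1)[OF conjunct1[OF mem[OF sQ]]]] s(3)[OF \<sigma>] by simp
  qed
  then show "ltrans_inv \<G> (F (s \<sigma>)) (w \<sigma>) \<in> algd \<G> (src \<G> (F (s \<sigma>)))" if "\<sigma> \<in> S" for \<sigma> using that by blast
  fix U \<phi> assume U: "(U, \<phi>) \<in> \<A>" "unt \<G> (src \<G> (F (s \<sigma>0))) \<in> U"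
  have sQ0: "s \<sigma>0 \<in> Q" using s(2) \<sigma>0 by blast
  have "?D (s \<sigma>0) \<in> U" using li(3)[OF \<sigma>0] U(2) by simp
  then obtain Q' where Q': "open Q'" "s \<sigma>0 \<in> Q'" "Q' \<subseteq> Q" "?D ` Q' \<subseteq> U" "\<And>n. cube_Ck P n Q' (\<lambda>t. \<phi> (?D t))"
    using smooth_familyD[OF D sQ0 U(1)] by blast
  \<comment> \<open>One chart around the unit at the limit point serves all nearby parameters,
    although the units themselves move.\<close>
  let ?T = "\<lambda>t. vector_derivative (\<lambda>h. \<phi> (?D (t(j := h)))) (at (t j))"
  have T: "continuous_on Q' ?T"
    using cube_Ck_SucE(3)[OF Q'(5)[of 1, unfolded One_nat_def] j] by simp
  have eq: "?T (s \<sigma>) = tangent_coord \<A> \<phi> (unt \<G> (src \<G> (F (s \<sigma>)))) (ltrans_inv \<G> (F (s \<sigma>)) (w \<sigma>))"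
    if \<sigma>: "\<sigma> \<in> S" "s \<sigma> \<in> Q'" for \<sigma>
  proof -
    have sc: "smooth_curve_at \<A> (\<lambda>h. ?D ((s \<sigma>)(j := h))) (s \<sigma> j)"
      by (rule smooth_family_curve[OF manifolds(1) D _ j]) (use \<sigma>(2) Q'(3) in blast)
    have "?D ((s \<sigma>)(j := s \<sigma> j)) \<in> U" using \<sigma>(2) Q'(4) by (auto simp: fun_upd_triv)
    from vector_derivative_at[OF smooth_curve_at_chart[OF manifolds(1) U(1) sc this]]
    show ?thesis by (simp only: li(1)[OF \<sigma>(1)] fun_upd_triv li(3)[OF \<sigma>(1)])
  qed
  have st: "(s \<longlongrightarrow> s \<sigma>0) (at \<sigma>0 within S)" using s(1) \<sigma>0 by (auto simp: continuous_on_def)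
  have evQ: "\<forall>\<^sub>F \<sigma> in at \<sigma>0 within S. s \<sigma> \<in> Q'" by (rule tendsto_eventually_open[OF st Q'(1,2)])
  have evS: "\<forall>\<^sub>F \<sigma> in at \<sigma>0 within S. \<sigma> \<in> S" by (simp add: eventually_at_filter)
  have "((\<lambda>\<sigma>. ?T (s \<sigma>)) \<longlongrightarrow> ?T (s \<sigma>0)) (at \<sigma>0 within S)"
    by (rule continuous_on_tendsto_compose[OF T st Q'(2) evQ])
  then have "((\<lambda>\<sigma>. ?T (s \<sigma>)) \<longlongrightarrow> tangent_coord \<A> \<phi> (unt \<G> (src \<G> (F (s \<sigma>0)))) (ltrans_inv \<G> (F (s \<sigma>0)) (w \<sigma>0))) (at \<sigma>0 within S)"
    unfolding eq[OF \<sigma>0 Q'(2)] .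
  then show "((\<lambda>\<sigma>. tangent_coord \<A> \<phi> (unt \<G> (src \<G> (F (s \<sigma>)))) (ltrans_inv \<G> (F (s \<sigma>)) (w \<sigma>))) \<longlongrightarrow>
        tangent_coord \<A> \<phi> (unt \<G> (src \<G> (F (s \<sigma>0)))) (ltrans_inv \<G> (F (s \<sigma>0)) (w \<sigma>0))) (at \<sigma>0 within S)"
  proof (rule Lim_transform_eventually)
    show "\<forall>\<^sub>F \<sigma> in at \<sigma>0 within S. ?T (s \<sigma>) =
        tangent_coord \<A> \<phi> (unt \<G> (src \<G> (F (s \<sigma>)))) (ltrans_inv \<G> (F (s \<sigma>)) (w \<sigma>))"
      using evS evQ by eventually_elim (rule eq)
  qed
qed

text \<open>The margin leaves room on all sides of the cube; coordinate \<open>p\<close> is the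
  additional one along which curves run.\<close>

definition cube_nbhd :: "nat \<Rightarrow> real \<Rightarrow> real \<Rightarrow> (nat \<Rightarrow> real) set" where
  "cube_nbhd p a b = {t. (\<forall>i<p. -1 < t i \<and> t i < 2) \<and> a < t p \<and> t p < b}"

lemma open_cube_nbhd: "open (cube_nbhd p a b)"
proof -
  have o: "open {t :: nat \<Rightarrow> real. c < t i \<and> t i < d}" for c d i
    by (intro open_Collect_conj open_Collect_less continuous_on_const continuous_on_product_coordinates)
  have "cube_nbhd p a b = (\<Inter>i\<in>{..<p}. {t. -1 < t i \<and> t i < 2}) \<inter> {t. a < t p \<and> t p < b}"
    by (auto simp: cube_nbhd_def)
  then show ?thesis using o by (simp add: open_INT open_Int)
qed

lemma cube_nbhdD: "t \<in> cube_nbhd (Suc n) a b \<Longrightarrow> i \<le> n \<Longrightarrow> t i \<in> {-1..2}"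
  unfolding cube_nbhd_def by (simp add: less_imp_le le_imp_less_Suc)

lemma cubeD: "t \<in> cube p \<Longrightarrow> i < p \<Longrightarrow> 0 \<le> t i \<and> t i \<le> 1"
  unfolding cube_def by (drule PiE_mem[of _ _ _ i]) simp_all

lemma cube_in_nbhd:
  assumes "t \<in> cube p" "a < c" "c < b"
  shows "t(p := c) \<in> cube_nbhd p a b"
proof -
  have "-1 < t i \<and> t i < 2" if "i < p" for i using cubeD[OF assms(1) that] by linarith
  with assms(2,3) show ?thesis by (simp add: cube_nbhd_def)
qed

text \<open>The four extra levels are those demanded by \<open>ltrans_inv_velocity\<close>.\<close>

lemma cube_vel_facts:
  assumes admissible: "admissible (Suc (Suc (Suc (Suc k)))) gs x" and i: "i \<le> length gs" and t0: "t0 \<in> cube (Suc (length gs))"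
  shows "fcurve (tgt \<G> (hd (gs @ [x]))) (\<lambda>h. iter_retr gs x (t0(i := h))) (t0 i)"
    and "ltrans_inv \<G> (iter_retr gs x t0) (cube_vel gs x t0 i) \<in> algd \<G> (src \<G> (iter_retr gs x t0))"
    and "\<And>U \<phi>. (U, \<phi>) \<in> \<A> \<Longrightarrow> unt \<G> (src \<G> (iter_retr gs x t0)) \<in> U \<Longrightarrow>
      ((\<lambda>t. tangent_coord \<A> \<phi> (unt \<G> (src \<G> (iter_retr gs x t))) (ltrans_inv \<G> (iter_retr gs x t) (cube_vel gs x t i))) \<longlongrightarrow>
        tangent_coord \<A> \<phi> (unt \<G> (src \<G> (iter_retr gs x t0))) (ltrans_inv \<G> (iter_retr gs x t0) (cube_vel gs x t0 i))) (at t0 within cube (Suc (length gs)))"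
proof -
  let ?p = "Suc (length gs)"
  let ?Q = "cube_nbhd ?p (-1) 2"
  \<comment> \<open>Coordinate \<open>i\<close> is duplicated: \<open>?C\<close> reads it from
    position \<open>?p\<close>, \<open>?F\<close> keeps the original, and \<open>?s\<close> makes
    the two agree. Varying position \<open>?p\<close> then moves \<open>?C\<close> with the foot
    point held fixed.\<close>
  let ?C = "\<lambda>t. iter_retr gs x (t(i := t ?p))" and ?F = "iter_retr gs x" and ?s = "\<lambda>t. t(?p := t i)"
  have Q: "open ?Q" by (rule open_cube_nbhd)
  have cX: "smooth_family \<A> (Suc ?p) ?Q (\<lambda>_. x)" by (rule smooth_family_const[OF Q])
  have F: "smooth_family \<A> (Suc ?p) ?Q ?F"
    by (rule iter_retr_family[OF Q cX cube_Ck_coord[OF Q] admissible]) (rule cube_nbhdD)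
  have ti: "(t(i := t ?p)) i' \<in> {-1..2}" if "t \<in> ?Q" "i' \<le> length gs" for t i'
    using cube_nbhdD[OF that] that(1) by (auto simp: cube_nbhd_def)
  have "cube_Ck (Suc ?p) n ?Q (\<lambda>t. (t(i := t ?p)) i')" for i' n
    using cube_Ck_coord[OF Q] by (cases "i' = i") auto
  then have C: "smooth_family \<A> (Suc ?p) ?Q ?C"
    by (intro iter_retr_family[OF Q cX _ admissible] ti)
  have Fm: "?F t \<in> N (Suc (Suc (Suc (Suc k))))" "tgt \<G> (?F t) = tgt \<G> (hd (gs @ [x]))" if "t \<in> ?Q" for t
    using iter_retr_mem[OF admissible cube_nbhdD[OF that]] by auto
  have Cm: "?C t \<in> N (Suc (Suc (Suc (Suc k))))" "tgt \<G> (?C t) = tgt \<G> (hd (gs @ [x]))" if "t \<in> ?Q" for t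
    using iter_retr_mem[OF admissible, of "t(i := t ?p)"] ti[OF that] by blast+
  have const: "?F (t(?p := h)) = ?F t" for t h by (rule iter_retr_cong) auto
  have s: "continuous_on (cube ?p) ?s"
    by (intro continuous_on_fun_upd continuous_on_id continuous_on_subset[OF continuous_on_product_coordinates]) auto
  have sQ: "?s ` cube ?p \<subseteq> ?Q"
  proof (intro image_subsetI cube_in_nbhd)
    fix t assume "t \<in> cube ?p"
    from cubeD[OF this, of i] i show "-1 < t i" "t i < 2" by auto
  qed
  have eq: "?C (?s t) = ?F (?s t)" for t by (rule iter_retr_cong) auto
  have curve: "(\<lambda>h. ?C ((?s t)(?p := h))) = (\<lambda>h. iter_retr gs x (t(i := h)))" for t
    by (rule ext, rule iter_retr_cong) auto
  have F_s: "?F (?s t) = iter_retr gs x t" for t by (rule iter_retr_cong) auto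
  have s_p: "?s t ?p = t i" for t by simp
  have mem: "?F t \<in> N (Suc (Suc (Suc (Suc k)))) \<and> ?C t \<in> N (Suc (Suc (Suc (Suc k)))) \<and> tgt \<G> (?C t) = tgt \<G> (?F t)"
    if "t \<in> ?Q" for t using Fm[OF that] Cm[OF that] by simp
  have mem': "\<forall>t\<in>?Q. ?F t \<in> N (Suc (Suc (Suc (Suc k)))) \<and> ?C t \<in> N (Suc (Suc (Suc (Suc k)))) \<and> tgt \<G> (?C t) = tgt \<G> (?F t)"
    using mem by blast
  note v = velocity_tendsto[OF C F lessI mem' const s sQ eq t0, unfolded curve F_s s_p]
  have "tgt \<G> (iter_retr gs x t0) = tgt \<G> (hd (gs @ [x]))" using Fm(2)[of "?s t0"] sQ t0 F_s by auto
  with v(1)[OF t0] show "fcurve (tgt \<G> (hd (gs @ [x]))) (\<lambda>h. iter_retr gs x (t0(i := h))) (t0 i)" by simp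
  show "ltrans_inv \<G> (iter_retr gs x t0) (cube_vel gs x t0 i) \<in> algd \<G> (src \<G> (iter_retr gs x t0))"
    using v(2)[OF t0] by (simp add: cube_vel_def)
  show "((\<lambda>t. tangent_coord \<A> \<phi> (unt \<G> (src \<G> (iter_retr gs x t))) (ltrans_inv \<G> (iter_retr gs x t) (cube_vel gs x t i))) \<longlongrightarrow>
        tangent_coord \<A> \<phi> (unt \<G> (src \<G> (iter_retr gs x t0))) (ltrans_inv \<G> (iter_retr gs x t0) (cube_vel gs x t0 i))) (at t0 within cube (Suc (length gs)))"
    if "(U, \<phi>) \<in> \<A>" "unt \<G> (src \<G> (iter_retr gs x t0)) \<in> U" for U \<phi>
    using v(3)[OF that] by (simp add: cube_vel_def)
qed

lemma admissible_mlt: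
  assumes "admissible (Suc k) gs x" "e \<in> N (Suc k + 2 * Suc (length gs))" "tgt \<G> e = src \<G> x"
  shows "admissible k gs (mlt \<G> x e)"
proof -
  have 1: "N (Suc k + 2 * Suc (length gs)) = N (Suc (k + 2 * Suc (length gs)))" by simp
  have "mlt \<G> x e \<in> N (k + 2 * Suc (length gs))" "tgt \<G> (mlt \<G> x e) = tgt \<G> x"
    using N_mlt[of x "k + 2 * Suc (length gs)" e] assms unfolding admissible_def 1 by auto
  then show ?thesis
    using assms(1) admissible_mono[of k "Suc k" gs x] by (auto simp: admissible_def chained_append)
qed

text \<open>The ray that moves the last arrow becomes a smooth family with one more coordinate.
  Besides the four levels for left translation, three pay for the unit, the retraction and the
  product that produce this ray.\<close>

lemma fibre_vel_facts:
  assumes admissible: "admissible (Suc (Suc (Suc (Suc (Suc (Suc (Suc k))))))) gs x" and w: "w \<in> algd \<G> (src \<G> x)" and t0: "t0 \<in> cube (Suc (length gs))"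
  shows "fcurve (tgt \<G> (hd (gs @ [x]))) (\<lambda>s. iter_retr gs (mlt \<G> x (\<epsilon> (unt \<G> (src \<G> x), s *\<^sub>R w))) t0) 0"
    and "ltrans_inv \<G> (iter_retr gs x t0) (fibre_vel gs x t0 w) \<in> algd \<G> (src \<G> (iter_retr gs x t0))"
    and "\<And>U \<phi>. (U, \<phi>) \<in> \<A> \<Longrightarrow> unt \<G> (src \<G> (iter_retr gs x t0)) \<in> U \<Longrightarrow>
      ((\<lambda>t. tangent_coord \<A> \<phi> (unt \<G> (src \<G> (iter_retr gs x t))) (ltrans_inv \<G> (iter_retr gs x t) (fibre_vel gs x t w))) \<longlongrightarrow>
        tangent_coord \<A> \<phi> (unt \<G> (src \<G> (iter_retr gs x t0))) (ltrans_inv \<G> (iter_retr gs x t0) (fibre_vel gs x t0 w))) (at t0 within cube (Suc (length gs)))"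
proof -
  let ?p = "Suc (length gs)"
  let ?K = "Suc (Suc (Suc (Suc k))) + 2 * ?p"
  have x3: "x \<in> N (Suc (Suc (Suc ?K)))" using admissible by (simp add: admissible_def)
  have adm5: "admissible (Suc (Suc (Suc (Suc (Suc k))))) gs x" by (rule admissible_mono[OF _ admissible]) simp
  have adm4: "admissible (Suc (Suc (Suc (Suc k)))) gs x" by (rule admissible_mono[OF _ admissible]) simp
  obtain \<delta> e where e: "\<delta> > 0" "e \<in> N (Suc (Suc ?K))" "tgt \<G> e = src \<G> x"
    "\<And>s. \<epsilon> (unt \<G> (src \<G> x), s *\<^sub>R w) = lam (s / \<delta>) e"
    using exp_eq_lam[OF N_unt(1)[OF x3] w] by blast
  \<comment> \<open>By the choice of \<open>e\<close>, the ray at time \<open>s\<close> is the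
    retraction of \<open>e\<close> at time \<open>s / \<delta>\<close>. These bounds keep that time
    within \<open>[-1,2]\<close>.\<close>
  let ?Q = "cube_nbhd ?p (-\<delta>) (2 * \<delta>)"
  let ?X = "\<lambda>t. mlt \<G> x (\<epsilon> (unt \<G> (src \<G> x), t ?p *\<^sub>R w))"
  let ?C = "\<lambda>t. iter_retr gs (?X t) t" and ?F = "iter_retr gs x" and ?s = "\<lambda>t. t(?p := 0 :: real)"
  have Q: "open ?Q" by (rule open_cube_nbhd)
  have F: "smooth_family \<A> (Suc ?p) ?Q ?F"
    by (rule iter_retr_family[OF Q smooth_family_const[OF Q] cube_Ck_coord[OF Q] adm4]) (rule cube_nbhdD)
  have r: "t ?p / \<delta> \<in> {-1..2}" if "t \<in> ?Q" for t
    using that e(1) by (auto simp: cube_nbhd_def field_simps)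
  have le: "lam (t ?p / \<delta>) e \<in> N (Suc ?K)" "tgt \<G> (lam (t ?p / \<delta>) e) = src \<G> x"
    "(t ?p / \<delta>, e) \<in> retr_dom \<Omega> \<epsilon>" if "t \<in> ?Q" for t
    using N_lam[OF e(2) r[OF that]] e(3) by auto
  have adX: "admissible (Suc (Suc (Suc (Suc k)))) gs (?X t)" if t: "t \<in> ?Q" for t
    unfolding e(4) using le(1,2)[OF t] by (intro admissible_mlt adm5) simp_all
  have "smooth_family \<A> (Suc ?p) ?Q (\<lambda>t. mlt \<G> x (lam (t ?p / \<delta>) e))"
  proof (intro family_mlt family_lam smooth_family_const Q)
    show "cube_Ck (Suc ?p) n ?Q (\<lambda>t. t ?p / \<delta>)" for n
      by (rule cube_Ck_linear_comp[OF bounded_linear_divide Q cube_Ck_coord[OF Q]])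
    show "(t ?p / \<delta>, e) \<in> retr_dom \<Omega> \<epsilon>" if "t \<in> ?Q" for t by (rule le(3)[OF that])
    show "(x, lam (t ?p / \<delta>) e) \<in> cdom \<G>" if "t \<in> ?Q" for t
      using le[OF that] N_mono[of "Suc ?K" "Suc (Suc (Suc ?K))" x] x3 by (intro N_mlt(1)[of _ ?K]) simp_all
  qed
  then have X: "smooth_family \<A> (Suc ?p) ?Q ?X" by (simp add: e(4))
  have C: "smooth_family \<A> (Suc ?p) ?Q ?C"
  proof (rule iter_retr_family[where X = ?X and \<tau> = "\<lambda>t. t" and gs = gs and k = "Suc (Suc (Suc (Suc k)))", OF Q X])
    show "cube_Ck (Suc ?p) n ?Q (\<lambda>t. t i)" for i n by (rule cube_Ck_coord[OF Q])
    show "admissible (Suc (Suc (Suc (Suc k)))) gs (?X t)" if "t \<in> ?Q" for t by (rule adX[OF that])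
    show "t i \<in> {-1..2}" if "t \<in> ?Q" "i \<le> length gs" for t i by (rule cube_nbhdD[OF that])
  qed
  have hdX: "tgt \<G> (hd (gs @ [?X t])) = tgt \<G> (hd (gs @ [x]))" if "t \<in> ?Q" for t
    using N_mlt(4)[of x ?K "lam (t ?p / \<delta>) e"] le[OF that] N_mono[of "Suc ?K" "Suc (Suc (Suc ?K))" x] x3
    by (cases gs) (simp_all add: e(4))
  have mem: "?F t \<in> N (Suc (Suc (Suc (Suc k)))) \<and> ?C t \<in> N (Suc (Suc (Suc (Suc k)))) \<and> tgt \<G> (?C t) = tgt \<G> (?F t)"
    if "t \<in> ?Q" for t
    using iter_retr_mem[OF adm4 cube_nbhdD[OF that]] iter_retr_mem[OF adX[OF that] cube_nbhdD[OF that]] hdX[OF that] by simp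
  have const: "?F (t(?p := h)) = ?F t" for t h by (rule iter_retr_cong) auto
  have s: "continuous_on (cube ?p) ?s"
    by (intro continuous_on_fun_upd continuous_on_id continuous_on_const)
  have sQ: "?s ` cube ?p \<subseteq> ?Q" using e(1) by (intro image_subsetI cube_in_nbhd) simp_all
  have x2: "x \<in> N (Suc (Suc ?K))" using x3 N_mono[of "Suc (Suc ?K)" "Suc (Suc (Suc ?K))" x] by simp
  have eq: "?C (?s t) = ?F (?s t)" for t by (simp add: \<epsilon>_zero N_unt_right(2)[OF x2])
  have curve: "(\<lambda>h. ?C ((?s t)(?p := h))) = (\<lambda>h. iter_retr gs (mlt \<G> x (\<epsilon> (unt \<G> (src \<G> x), h *\<^sub>R w))) t)" for t
    by (rule ext, simp only: fun_upd_same, rule iter_retr_cong) auto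
  have F_s: "?F (?s t) = iter_retr gs x t" for t by (rule iter_retr_cong) auto
  have s_p: "?s t ?p = 0" for t by simp
  have mem': "\<forall>t\<in>?Q. ?F t \<in> N (Suc (Suc (Suc (Suc k)))) \<and> ?C t \<in> N (Suc (Suc (Suc (Suc k)))) \<and> tgt \<G> (?C t) = tgt \<G> (?F t)"
    using mem by blast
  note v = velocity_tendsto[OF C F lessI mem' const s sQ eq t0, unfolded curve F_s s_p]
  have "tgt \<G> (iter_retr gs x t0) = tgt \<G> (hd (gs @ [x]))" 
  proof (rule iter_retr_mem(2)[OF adm4])
    show "t0 i \<in> {-1..2}" if "i \<le> length gs" for i using cubeD[OF t0, of i] that by auto
  qed
  with v(1)[OF t0] show "fcurve (tgt \<G> (hd (gs @ [x]))) (\<lambda>s. iter_retr gs (mlt \<G> x (\<epsilon> (unt \<G> (src \<G> x), s *\<^sub>R w))) t0) 0" by simp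
  show "ltrans_inv \<G> (iter_retr gs x t0) (fibre_vel gs x t0 w) \<in> algd \<G> (src \<G> (iter_retr gs x t0))"
    using v(2)[OF t0] by (simp add: fibre_vel_def)
  show "((\<lambda>t. tangent_coord \<A> \<phi> (unt \<G> (src \<G> (iter_retr gs x t))) (ltrans_inv \<G> (iter_retr gs x t) (fibre_vel gs x t w))) \<longlongrightarrow>
        tangent_coord \<A> \<phi> (unt \<G> (src \<G> (iter_retr gs x t0))) (ltrans_inv \<G> (iter_retr gs x t0) (fibre_vel gs x t0 w))) (at t0 within cube (Suc (length gs)))"
    if "(U, \<phi>) \<in> \<A>" "unt \<G> (src \<G> (iter_retr gs x t0)) \<in> U" for U \<phi>
    using v(3)[OF that] by (simp add: fibre_vel_def)
qed

end

context van_est_data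
begin

definition pullback_form :: "'a list \<Rightarrow> 'a \<Rightarrow> 'c list \<Rightarrow> (nat \<Rightarrow> real) \<Rightarrow> 'k" where
  "pullback_form gs x ws t = linv_form \<G> \<rho> \<alpha> (iter_retr gs x t)
     (map (cube_vel gs x t) [0..<Suc (length gs)] @ map (fibre_vel gs x t) ws)"

text \<open>Up to the sign \<open>(-1)^(length gs)\<close> this is
  \<open>k(-\<delta>k)\<^sup>a i(\<alpha>)\<close> with \<open>a = length gs\<close>. The integral
  lives in the fibre of the bundle at the target of the first arrow; the inverse action brings it to
  the source of \<open>x\<close>, where sections of the double complex have their values.\<close>

definition cube_form :: "('a, 'c, 'k) dcochain" where
  "cube_form gs x ws = inv (act_list \<rho> (gs @ [x]))
     (LINT t:cube (Suc (length gs))|cube_measure (Suc (length gs)). pullback_form gs x ws t)"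

lemma act_list_append: "act_list \<rho> (gs @ hs) = act_list \<rho> gs \<circ> act_list \<rho> hs"
  by (induction gs) (auto simp: o_assoc)

lemma act_list_linear: "linear (act_list \<rho> gs)" and act_list_bij: "bij (act_list \<rho> gs)"
proof -
  have "linear (act_list \<rho> gs) \<and> bij (act_list \<rho> gs)"
  proof (induction gs)
    case Nil
    show ?case by (simp only: act_list.simps linear_id bij_id simp_thms)
  next
    case (Cons g gs)
    then show ?case
      unfolding act_list.simps by (intro conjI linear_compose bij_comp rho_linear rho_bij) auto
  qed
  then show "linear (act_list \<rho> gs)" "bij (act_list \<rho> gs)" by auto
qed

lemma inv_act_linear: "linear (inv (act_list \<rho> gs))"
  by (rule linear_inv_bij[OF act_list_linear act_list_bij])

lemma inv_act_append: "inv (act_list \<rho> (gs @ hs)) v = inv (act_list \<rho> hs) (inv (act_list \<rho> gs) v)"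
  unfolding act_list_append by (subst o_inv_distrib[OF act_list_bij act_list_bij]) simp

lemma inv_rho_linear: "linear (inv (\<rho> g))"
  by (rule linear_inv_bij[OF rho_linear rho_bij])

lemma inv_rho_rho [simp]: "inv (\<rho> g) (\<rho> g v) = v" and rho_inv_rho [simp]: "\<rho> g (inv (\<rho> g) v) = v"
  using rho_bij[of g] by (simp_all add: bij_is_inj bij_is_surj surj_f_inv_f)

text \<open>An invertible \<open>T\<close> preserves integrability in both directions, so the
  default value 0 of a divergent integral is respected too.\<close>

lemma set_integral_linear_bij:
  fixes T :: "'k \<Rightarrow> 'k"
  assumes "linear T" "bij T"
  shows "(LINT t:S|M. T (f t)) = T (LINT t:S|M. f t)"
proof -
  have "(\<integral>t. T (indicator S t *\<^sub>R f t) \<partial>M) = T (\<integral>t. indicator S t *\<^sub>R f t \<partial>M)"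
    by (rule integral_bounded_linear'[OF linear_imp_bounded_linear_findim[OF assms(1)]
          linear_imp_bounded_linear_findim[OF linear_inv_bij[OF assms]]])
      (use assms(2) in \<open>simp add: bij_is_inj\<close>)
  then show ?thesis by (simp add: set_lebesgue_integral_def linear_scale[OF assms(1)])
qed

end

section \<open>Alternating forms under linear maps, sums and integrals\<close>

lemma alternating_form_compose_linear:
  assumes "linear T" "alternating_form q W \<omega>"
  shows "alternating_form q W (\<lambda>vs. T (\<omega> vs))"
  using assms(2) unfolding alternating_form_def
  by (simp add: linear_add[OF assms(1)] linear_scale[OF assms(1)] linear_0[OF assms(1)])

lemma alternating_form_add:
  assumes "alternating_form q W \<omega>" "alternating_form q W \<eta>"
  shows "alternating_form q W (\<lambda>vs. \<omega> vs + \<eta> vs)"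
  using assms unfolding alternating_form_def by (simp add: algebra_simps)

lemma alternating_form_sum:
  assumes "\<And>i. i \<in> I \<Longrightarrow> alternating_form q W (\<omega> i)"
  shows "alternating_form q W (\<lambda>vs. \<Sum>i\<in>I. \<omega> i vs)"
proof -
  have "alternating_form q W (\<lambda>vs. 0)" by (simp add: alternating_form_def)
  with assms show ?thesis
    by (induction I rule: infinite_finite_induct) (simp, simp, subst sum.insert, auto intro!: alternating_form_add)
qed

lemma alternating_form_scale: "alternating_form q W \<omega> \<Longrightarrow> alternating_form q W (\<lambda>vs. c *\<^sub>R \<omega> vs)"
  by (rule alternating_form_compose_linear[of "\<lambda>v. c *\<^sub>R v"]) (auto intro: linearI simp: algebra_simps)

lemma alternating_form_cong:
  assumes W: "subspace W" and eq: "\<And>vs. length vs = q \<Longrightarrow> set vs \<subseteq> W \<Longrightarrow> \<omega> vs = \<eta> vs"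
    and a: "alternating_form q W \<omega>"
  shows "alternating_form q W \<eta>"
  unfolding alternating_form_def
proof (intro allI impI)
  fix vs assume vs: "length vs = q \<and> set vs \<subseteq> W"
  have up: "\<eta> (vs[i := v]) = \<omega> (vs[i := v])" if "v \<in> W" for i v
    using vs that set_update_subset_insert[of vs i v] by (intro eq[symmetric]) auto
  note a' = a[unfolded alternating_form_def, rule_format, OF vs]
  show "(\<forall>i<q. \<forall>v\<in>W. \<forall>w\<in>W. \<eta> (vs[i := v + w]) = \<eta> (vs[i := v]) + \<eta> (vs[i := w])) \<and>
      (\<forall>i<q. \<forall>v\<in>W. \<forall>r. \<eta> (vs[i := r *\<^sub>R v]) = r *\<^sub>R \<eta> (vs[i := v])) \<and>
      (\<forall>i<q. \<forall>j<q. i \<noteq> j \<and> vs ! i = vs ! j \<longrightarrow> \<eta> vs = 0)"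
  proof (intro conjI allI impI ballI)
    show "\<eta> (vs[i := v + w]) = \<eta> (vs[i := v]) + \<eta> (vs[i := w])" if "i < q" "v \<in> W" "w \<in> W" for i v w
      using a' that by (simp add: up subspace_add[OF W])
    show "\<eta> (vs[i := r *\<^sub>R v]) = r *\<^sub>R \<eta> (vs[i := v])" if "i < q" "v \<in> W" for i v r
      using a' that by (simp add: up subspace_scale[OF W])
    show "\<eta> vs = 0" if "i < q" "j < q" "i \<noteq> j \<and> vs ! i = vs ! j" for i j
      using a' that vs eq[of vs] by metis
  qed
qed

text \<open>Additivity in a slot rests on integrability of the summands; this is one of the uses of
  the continuity of pullbacks.\<close>

lemma alternating_form_integral:
  fixes \<omega> :: "'s \<Rightarrow> 'e::real_vector list \<Rightarrow> 'k::{banach, second_countable_topology}"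
  assumes W: "subspace W" and a: "\<And>t. t \<in> S \<Longrightarrow> alternating_form q W (\<omega> t)"
    and int: "\<And>vs. length vs = q \<Longrightarrow> set vs \<subseteq> W \<Longrightarrow> set_integrable M S (\<lambda>t. \<omega> t vs)"
    and S: "S \<in> sets M"
  shows "alternating_form q W (\<lambda>vs. LINT t:S|M. \<omega> t vs)"
  unfolding alternating_form_def
proof (intro allI impI)
  fix vs assume vs: "length vs = q \<and> set vs \<subseteq> W"
  have up: "set_integrable M S (\<lambda>t. \<omega> t (vs[i := v]))" if "v \<in> W" for i v
    using vs that set_update_subset_insert[of vs i v] by (intro int) auto
  note a' = a[unfolded alternating_form_def, rule_format, OF _ vs]
  show "(\<forall>i<q. \<forall>v\<in>W. \<forall>w\<in>W. (LINT t:S|M. \<omega> t (vs[i := v + w])) = (LINT t:S|M. \<omega> t (vs[i := v])) + (LINT t:S|M. \<omega> t (vs[i := w]))) \<and>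
      (\<forall>i<q. \<forall>v\<in>W. \<forall>r. (LINT t:S|M. \<omega> t (vs[i := r *\<^sub>R v])) = r *\<^sub>R (LINT t:S|M. \<omega> t (vs[i := v]))) \<and>
      (\<forall>i<q. \<forall>j<q. i \<noteq> j \<and> vs ! i = vs ! j \<longrightarrow> (LINT t:S|M. \<omega> t vs) = 0)"
  proof (intro conjI allI impI ballI)
    show "(LINT t:S|M. \<omega> t (vs[i := v + w])) = (LINT t:S|M. \<omega> t (vs[i := v])) + (LINT t:S|M. \<omega> t (vs[i := w]))"
      if "i < q" "v \<in> W" "w \<in> W" for i v w
    proof -
      have "(LINT t:S|M. \<omega> t (vs[i := v + w])) = (LINT t:S|M. \<omega> t (vs[i := v]) + \<omega> t (vs[i := w]))"
        using a' that by (intro set_lebesgue_integral_cong[OF S]) simp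
      also have "\<dots> = (LINT t:S|M. \<omega> t (vs[i := v])) + (LINT t:S|M. \<omega> t (vs[i := w]))"
        using up that by (intro set_integral_add(2)) auto
      finally show ?thesis .
    qed
    show "(LINT t:S|M. \<omega> t (vs[i := r *\<^sub>R v])) = r *\<^sub>R (LINT t:S|M. \<omega> t (vs[i := v]))" if "i < q" "v \<in> W" for i v r
    proof -
      have "(LINT t:S|M. \<omega> t (vs[i := r *\<^sub>R v])) = (LINT t:S|M. r *\<^sub>R \<omega> t (vs[i := v]))"
        using a' that by (intro set_lebesgue_integral_cong[OF S]) simp
      also have "\<dots> = r *\<^sub>R (LINT t:S|M. \<omega> t (vs[i := v]))" by simp
      finally show ?thesis .
    qed
    show "(LINT t:S|M. \<omega> t vs) = 0" if "i < q" "j < q" "i \<noteq> j \<and> vs ! i = vs ! j" for i j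
    proof -
      have "(LINT t:S|M. \<omega> t vs) = (LINT t:S|M. 0)"
        using a' that by (intro set_lebesgue_integral_cong[OF S]) blast
      then show ?thesis by (simp add: set_lebesgue_integral_def)
    qed
  qed
qed

locale van_est_tower =
  van_est_data \<G> \<Omega> \<epsilon> \<V> \<rho> n \<alpha> + unit_tower \<G> \<Omega> \<epsilon> N
  for \<G> :: "('g::topological_space, 'm::topological_space, 'e::findim, 'b::findim) groupoid"
    and \<Omega> :: "('g \<times> 'e) set" and \<epsilon> :: "'g \<times> 'e \<Rightarrow> 'g"
    and \<V> :: "('m, 'k::findim) vbundle" and \<rho> :: "'g \<Rightarrow> 'k \<Rightarrow> 'k" and n :: nat and \<alpha> :: "'m \<Rightarrow> 'e list \<Rightarrow> 'k"
    and N :: "nat \<Rightarrow> 'g set"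
begin

lemma iter_retr_family_cube:
  assumes admissible: "admissible k gs x"
  shows "smooth_family \<A> (Suc (length gs)) {t. \<forall>i\<in>{..length gs}. t i \<in> {-1<..<2}} (iter_retr gs x)"
proof -
  let ?Q = "{t :: nat \<Rightarrow> real. \<forall>i\<in>{..length gs}. t i \<in> {-1<..<2}}"
  have "?Q = (\<Inter>i\<in>{..length gs}. (\<lambda>t. t i) -` {-1<..<2})" by auto
  moreover have "open ((\<lambda>t :: nat \<Rightarrow> real. t i) -` {-1<..<2})" for i
    by (rule open_vimage[OF _ continuous_on_product_coordinates]) simp
  ultimately have Q: "open ?Q" by (simp add: open_INT)
  show ?thesis
  proof (rule iter_retr_family[where X = "\<lambda>_. x" and \<tau> = "\<lambda>t. t" and gs = gs and k = k, OF Q smooth_family_const[OF Q]])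
    show "cube_Ck (Suc (length gs)) n ?Q (\<lambda>t. t i)" for i n by (rule cube_Ck_coord[OF Q])
    show "admissible k gs x" by (rule admissible)
    show "t i \<in> {-1..2}" if "t \<in> ?Q" "i \<le> length gs" for t i
    proof -
      have "t i \<in> {-1<..<2}" using that by blast
      then show ?thesis by simp
    qed
  qed
qed

lemma cube_subset: "cube (Suc l) \<subseteq> {t. \<forall>i\<in>{..l}. t i \<in> {-1<..<2}}"
proof (intro subsetI CollectI ballI)
  fix t :: "nat \<Rightarrow> real" and i assume "t \<in> cube (Suc l)" "i \<in> {..l}"
  then show "t i \<in> {-1<..<2}" using cubeD[of t "Suc l" i] by auto
qed

lemma iter_retr_mem_cube:
  assumes "admissible k gs x" "t \<in> cube (Suc (length gs))"
  shows "iter_retr gs x t \<in> N k" "tgt \<G> (iter_retr gs x t) = tgt \<G> (hd (gs @ [x]))"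
proof -
  have "t i \<in> {-1..2}" if "i \<le> length gs" for i using cubeD[OF assms(2), of i] that by auto
  then show "iter_retr gs x t \<in> N k" "tgt \<G> (iter_retr gs x t) = tgt \<G> (hd (gs @ [x]))"
    using iter_retr_mem[OF assms(1), of t] by blast+
qed

text \<open>The iterated retraction is smooth on an open cube with a margin and thus serves as its
  own extension.\<close>

lemma iter_retr_smooth_on_cube:
  assumes admissible: "admissible k gs x"
  shows "smooth_on_cube (Suc (length gs)) \<A> (iter_retr gs x)"
  unfolding smooth_on_cube_def
proof
  fix t assume t: "t \<in> cube (Suc (length gs))"
  obtain U \<phi> where U: "(U, \<phi>) \<in> \<A>" "iter_retr gs x t \<in> U"
    using atlas_cover[OF manifold_atlas_cover[OF manifolds(1)]] by blast
  obtain Q where Q: "open Q" "t \<in> Q" "iter_retr gs x ` Q \<subseteq> U" "\<And>n. cube_Ck (Suc (length gs)) n Q (\<lambda>t. \<phi> (iter_retr gs x t))"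
    by (rule smooth_familyD[OF iter_retr_family_cube[OF admissible] subsetD[OF cube_subset t] U]) blast
  have "\<exists>Q F. open Q \<and> t \<in> Q \<and> (\<forall>n. cube_Ck (Suc (length gs)) n Q F) \<and>
      (\<forall>t'\<in>cube (Suc (length gs)) \<inter> Q. iter_retr gs x t' \<in> U \<and> \<phi> (iter_retr gs x t') = F t')"
    using Q by (intro exI[of _ Q] exI[of _ "\<lambda>t. \<phi> (iter_retr gs x t)"]) auto
  with U show "\<exists>(U, \<phi>)\<in>\<A>. iter_retr gs x t \<in> U \<and> (\<exists>Q F. open Q \<and> t \<in> Q \<and> (\<forall>n. cube_Ck (Suc (length gs)) n Q F) \<and>
      (\<forall>t'\<in>cube (Suc (length gs)) \<inter> Q. iter_retr gs x t' \<in> U \<and> \<phi> (iter_retr gs x t') = F t'))"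
    by blast
qed

text \<open>Level 7 is the demand of \<open>fibre_vel_facts\<close>. Cube directions and fibre
  directions are put at the same level because they occur together as arguments of one form.\<close>

lemma cube_vel_facts': "admissible 7 gs x \<Longrightarrow> i \<le> length gs \<Longrightarrow> t0 \<in> cube (Suc (length gs)) \<Longrightarrow>
    fcurve (tgt \<G> (hd (gs @ [x]))) (\<lambda>h. iter_retr gs x (t0(i := h))) (t0 i)"
  "admissible 7 gs x \<Longrightarrow> i \<le> length gs \<Longrightarrow> t0 \<in> cube (Suc (length gs)) \<Longrightarrow>
    ltrans_inv \<G> (iter_retr gs x t0) (cube_vel gs x t0 i) \<in> algd \<G> (src \<G> (iter_retr gs x t0))"
  "admissible 7 gs x \<Longrightarrow> i \<le> length gs \<Longrightarrow> t0 \<in> cube (Suc (length gs)) \<Longrightarrow> (U, \<phi>) \<in> \<A> \<Longrightarrow> unt \<G> (src \<G> (iter_retr gs x t0)) \<in> U \<Longrightarrow>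
      ((\<lambda>t. tangent_coord \<A> \<phi> (unt \<G> (src \<G> (iter_retr gs x t))) (ltrans_inv \<G> (iter_retr gs x t) (cube_vel gs x t i))) \<longlongrightarrow>
        tangent_coord \<A> \<phi> (unt \<G> (src \<G> (iter_retr gs x t0))) (ltrans_inv \<G> (iter_retr gs x t0) (cube_vel gs x t0 i))) (at t0 within cube (Suc (length gs)))"
  using cube_vel_facts[of 3 gs x i t0] by (simp_all add: eval_nat_numeral)

lemma fibre_vel_facts': "admissible 7 gs x \<Longrightarrow> w \<in> algd \<G> (src \<G> x) \<Longrightarrow> t0 \<in> cube (Suc (length gs)) \<Longrightarrow>
    ltrans_inv \<G> (iter_retr gs x t0) (fibre_vel gs x t0 w) \<in> algd \<G> (src \<G> (iter_retr gs x t0))"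
  "admissible 7 gs x \<Longrightarrow> w \<in> algd \<G> (src \<G> x) \<Longrightarrow> t0 \<in> cube (Suc (length gs)) \<Longrightarrow>
    fcurve (tgt \<G> (hd (gs @ [x]))) (\<lambda>s. iter_retr gs (mlt \<G> x (\<epsilon> (unt \<G> (src \<G> x), s *\<^sub>R w))) t0) 0"
  "admissible 7 gs x \<Longrightarrow> w \<in> algd \<G> (src \<G> x) \<Longrightarrow> t0 \<in> cube (Suc (length gs)) \<Longrightarrow> (U, \<phi>) \<in> \<A> \<Longrightarrow> unt \<G> (src \<G> (iter_retr gs x t0)) \<in> U \<Longrightarrow>
      ((\<lambda>t. tangent_coord \<A> \<phi> (unt \<G> (src \<G> (iter_retr gs x t))) (ltrans_inv \<G> (iter_retr gs x t) (fibre_vel gs x t w))) \<longlongrightarrow>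
        tangent_coord \<A> \<phi> (unt \<G> (src \<G> (iter_retr gs x t0))) (ltrans_inv \<G> (iter_retr gs x t0) (fibre_vel gs x t0 w))) (at t0 within cube (Suc (length gs)))"
  using fibre_vel_facts[of 0 gs x w t0] by (simp_all add: eval_nat_numeral)

text \<open>An instance of \<open>form_tendsto\<close>: the foot points stay in one target fibre,
  and the left translated velocities converge in tangent coordinates.\<close>

lemma pullback_form_continuous:
  assumes admissible: "admissible 7 gs x" and ws: "set ws \<subseteq> algd \<G> (src \<G> x)" and len: "Suc (length gs) + length ws = n"
  shows "continuous_on (cube (Suc (length gs))) (pullback_form gs x ws)"
  unfolding continuous_on_def
proof
  fix t0 assume t0: "t0 \<in> cube (Suc (length gs))"
  let ?S = "cube (Suc (length gs))"
  let ?l = "\<lambda>t v. ltrans_inv \<G> (iter_retr gs x t) v"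
  \<comment> \<open>Each entry pairs a left translated vector, as a function of \<open>t\<close>,
    with its value at \<open>t0\<close>, in the order of the arguments of the form.\<close>
  let ?xs = "map (\<lambda>i. (\<lambda>t. ?l t (cube_vel gs x t i), ?l t0 (cube_vel gs x t0 i))) [0..<Suc (length gs)] @
    map (\<lambda>w. (\<lambda>t. ?l t (fibre_vel gs x t w), ?l t0 (fibre_vel gs x t0 w))) ws"
  have evS: "\<forall>\<^sub>F t in at t0 within ?S. t \<in> ?S" by (simp add: eventually_at_filter)
  have "continuous_on ?S (iter_retr gs x)"
    by (rule continuous_on_subset[OF smooth_family_continuous[OF manifolds(1) iter_retr_family_cube[OF admissible]] cube_subset])
  then have 1: "(iter_retr gs x \<longlongrightarrow> iter_retr gs x t0) (at t0 within ?S)" using t0 by (simp add: continuous_on_def)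
  have 2: "\<forall>\<^sub>F t in at t0 within ?S. tgt \<G> (iter_retr gs x t) = tgt \<G> (hd (gs @ [x]))"
    using evS by eventually_elim (rule iter_retr_mem_cube(2)[OF admissible])
  have 3: "(\<forall>\<^sub>F t in at t0 within ?S. fst \<xi> t \<in> algd \<G> (src \<G> (iter_retr gs x t))) \<and> snd \<xi> \<in> algd \<G> (src \<G> (iter_retr gs x t0)) \<and>
      (\<forall>(U, \<phi>)\<in>\<A>. unt \<G> (src \<G> (iter_retr gs x t0)) \<in> U \<longrightarrow>
        ((\<lambda>t. tangent_coord \<A> \<phi> (unt \<G> (src \<G> (iter_retr gs x t))) (fst \<xi> t)) \<longlongrightarrow>
          tangent_coord \<A> \<phi> (unt \<G> (src \<G> (iter_retr gs x t0))) (snd \<xi>)) (at t0 within ?S))"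
    if "\<xi> \<in> set ?xs" for \<xi>
  proof -
    from that consider i where "i \<le> length gs" "\<xi> = (\<lambda>t. ?l t (cube_vel gs x t i), ?l t0 (cube_vel gs x t0 i))"
      | w where "w \<in> algd \<G> (src \<G> x)" "\<xi> = (\<lambda>t. ?l t (fibre_vel gs x t w), ?l t0 (fibre_vel gs x t0 w))"
      using ws by (auto simp: less_Suc_eq_le simp del: upt_Suc)
    then show ?thesis
    proof cases
      case 1
      have "\<forall>\<^sub>F t in at t0 within ?S. ?l t (cube_vel gs x t i) \<in> algd \<G> (src \<G> (iter_retr gs x t))"
        using evS by eventually_elim (rule cube_vel_facts'(2)[OF admissible 1(1)])
      then show ?thesis
        unfolding 1(2) fst_conv snd_conv
        using cube_vel_facts'(2,3)[OF admissible 1(1) t0] by blast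
    next
      case 2
      have "\<forall>\<^sub>F t in at t0 within ?S. ?l t (fibre_vel gs x t w) \<in> algd \<G> (src \<G> (iter_retr gs x t))"
        using evS by eventually_elim (rule fibre_vel_facts'(1)[OF admissible 2(1)])
      then show ?thesis
        unfolding 2(2) fst_conv snd_conv
        using fibre_vel_facts'(1,3)[OF admissible 2(1) t0] by blast
    qed
  qed
  have 4: "length ?xs = n" using len by simp
  have 5: "map (\<lambda>\<xi>. fst \<xi> t) ?xs = map (?l t) (map (cube_vel gs x t) [0..<Suc (length gs)] @ map (fibre_vel gs x t) ws)" for t
    by simp
  have 6: "map snd ?xs = map (?l t0) (map (cube_vel gs x t0) [0..<Suc (length gs)] @ map (fibre_vel gs x t0) ws)"
    by simp
  show "(pullback_form gs x ws \<longlongrightarrow> pullback_form gs x ws t0) (at t0 within ?S)"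
    using form_tendsto[OF 1 2 iter_retr_mem_cube(2)[OF admissible t0] 3 4]
    unfolding 5 6 pullback_form_def linv_form_def .
qed

lemma iter_retr_tangent:
  assumes "admissible k gs z" "\<forall>i\<le>length gs. t i \<in> {-1..2}"
  obtains L where "linear L" "\<And>c h0. fcurve (tgt \<G> z) c h0 \<Longrightarrow> c h0 = z \<Longrightarrow>
    fcurve (tgt \<G> (hd (gs @ [z]))) (\<lambda>h. iter_retr gs (c h) t) h0"
    "\<And>c h0. fcurve (tgt \<G> z) c h0 \<Longrightarrow> c h0 = z \<Longrightarrow> vel (\<lambda>h. iter_retr gs (c h) t) h0 = L (vel c h0)"
proof -
  have "\<exists>L. linear L \<and> (\<forall>c h0. fcurve (tgt \<G> z) c h0 \<longrightarrow> c h0 = z \<longrightarrow>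
    fcurve (tgt \<G> (hd (gs @ [z]))) (\<lambda>h. iter_retr gs (c h) t) h0 \<and>
    vel (\<lambda>h. iter_retr gs (c h) t) h0 = L (vel c h0))"
    unfolding iter_retr_def by (rule cube_map_tangent[of gs k]) (use assms in \<open>simp_all add: admissible_def\<close>)
  then obtain L where L: "linear L" "\<forall>c h0. fcurve (tgt \<G> z) c h0 \<longrightarrow> c h0 = z \<longrightarrow>
    fcurve (tgt \<G> (hd (gs @ [z]))) (\<lambda>h. iter_retr gs (c h) t) h0 \<and>
    vel (\<lambda>h. iter_retr gs (c h) t) h0 = L (vel c h0)" by (elim exE conjE)
  show thesis by (rule that[OF L(1)]) (use L(2) in simp_all)
qed

text \<open>The ray in the definition of \<open>fibre_vel\<close> may be replaced by any curve with
  the same velocity, since both are mapped by the same linear \<open>L\<close>.\<close>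

lemma fibre_vel_curve:
  assumes admissible: "admissible 2 gs z" and t: "\<forall>i\<le>length gs. t i \<in> {-1..2}"
    and c: "fcurve (tgt \<G> z) c h0" "c h0 = z" and w: "w \<in> algd \<G> (src \<G> z)" "ltrans \<G> z w = vel c h0"
  shows "fibre_vel gs z t w = vel (\<lambda>h. iter_retr gs (c h) t) h0"
proof -
  have z: "z \<in> N (Suc (Suc (2 * Suc (length gs))))" using admissible by (simp add: admissible_def eval_nat_numeral)
  obtain L where L: "linear L" "\<And>c h0. fcurve (tgt \<G> z) c h0 \<Longrightarrow> c h0 = z \<Longrightarrow>
      fcurve (tgt \<G> (hd (gs @ [z]))) (\<lambda>h. iter_retr gs (c h) t) h0"
    "\<And>c h0. fcurve (tgt \<G> z) c h0 \<Longrightarrow> c h0 = z \<Longrightarrow> vel (\<lambda>h. iter_retr gs (c h) t) h0 = L (vel c h0)"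
    by (rule iter_retr_tangent[OF admissible t]) (rule that; assumption)
  note e = ltrans_exp[OF z w(1)]
  have 1: "vel (\<lambda>h. iter_retr gs (mlt \<G> z (\<epsilon> (unt \<G> (src \<G> z), h *\<^sub>R w))) t) 0 = L (vel (\<lambda>s. mlt \<G> z (\<epsilon> (unt \<G> (src \<G> z), s *\<^sub>R w))) 0)"
    by (rule L(3)[OF e(1)]) (simp add: \<epsilon>_zero N_unt_right(2)[OF z])
  show ?thesis unfolding fibre_vel_def 1 e(2) w(2) by (rule L(3)[OF c, symmetric])
qed

lemma fibre_vel_linear:
  assumes admissible: "admissible 2 gs z" and t: "\<forall>i\<le>length gs. t i \<in> {-1..2}"
  shows "\<exists>L. linear L \<and> (\<forall>w\<in>algd \<G> (src \<G> z). fibre_vel gs z t w = L w)"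
proof -
  have z: "z \<in> N (Suc (Suc (2 * Suc (length gs))))" using admissible by (simp add: admissible_def eval_nat_numeral)
  obtain L where L: "linear L" "\<And>c h0. fcurve (tgt \<G> z) c h0 \<Longrightarrow> c h0 = z \<Longrightarrow>
      fcurve (tgt \<G> (hd (gs @ [z]))) (\<lambda>h. iter_retr gs (c h) t) h0"
    "\<And>c h0. fcurve (tgt \<G> z) c h0 \<Longrightarrow> c h0 = z \<Longrightarrow> vel (\<lambda>h. iter_retr gs (c h) t) h0 = L (vel c h0)"
    by (rule iter_retr_tangent[OF admissible t]) (rule that; assumption)
  show ?thesis
  proof (intro exI[of _ "\<lambda>w. L (ltrans \<G> z w)"] conjI ballI)
    show "linear (\<lambda>w. L (ltrans \<G> z w))" using linear_compose[OF ltrans_linear[OF z] L(1)] by (simp add: o_def)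
    fix w assume w: "w \<in> algd \<G> (src \<G> z)"
    note e = ltrans_exp[OF z w]
    show "fibre_vel gs z t w = L (ltrans \<G> z w)"
      unfolding fibre_vel_def e(2)[symmetric] by (rule L(3)[OF e(1)]) (simp add: \<epsilon>_zero N_unt_right(2)[OF z])
  qed
qed

text \<open>\<open>ltrans_inv\<close> is a set-theoretic inverse and is linear only on the image of
  \<open>ltrans\<close>. Velocities of curves in the target fibre through \<open>y\<close> lie in
  that image.\<close>

lemma ltrans_inv_linear_comb:
  assumes y: "y \<in> N 4" and c: "fcurve (tgt \<G> y) c h0" "c h0 = y" and d: "fcurve (tgt \<G> y) d k0" "d k0 = y"
  shows "ltrans_inv \<G> y (vel c h0 + vel d k0) = ltrans_inv \<G> y (vel c h0) + ltrans_inv \<G> y (vel d k0)"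
    and "ltrans_inv \<G> y (r *\<^sub>R vel c h0) = r *\<^sub>R ltrans_inv \<G> y (vel c h0)"
proof -
  have y4: "y \<in> N (Suc (Suc (Suc (Suc 0))))" using y by (simp add: eval_nat_numeral)
  have y3: "y \<in> N (Suc (Suc (Suc 0)))" by (rule N_mono[OF _ y4]) simp
  note lin = ltrans_linear[of y "Suc 0", OF y3]
  note C = ltrans_inv_velocity(4,5)[OF y4 c] and D = ltrans_inv_velocity(4,5)[OF y4 d]
  have "ltrans \<G> y (ltrans_inv \<G> y (vel c h0) + ltrans_inv \<G> y (vel d k0)) = vel c h0 + vel d k0"
    by (simp add: linear_add[OF lin] C D)
  then show "ltrans_inv \<G> y (vel c h0 + vel d k0) = ltrans_inv \<G> y (vel c h0) + ltrans_inv \<G> y (vel d k0)"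
    using ltrans_inv_ltrans[OF y3 subspace_add[OF algd_subspace C(2) D(2)]] by simp
  have "ltrans \<G> y (r *\<^sub>R ltrans_inv \<G> y (vel c h0)) = r *\<^sub>R vel c h0"
    by (simp add: linear_scale[OF lin] C)
  then show "ltrans_inv \<G> y (r *\<^sub>R vel c h0) = r *\<^sub>R ltrans_inv \<G> y (vel c h0)"
    using ltrans_inv_ltrans[OF y3 subspace_scale[OF algd_subspace C(2)]] by metis
qed

lemma pullback_form_alternating:
  assumes admissible: "admissible 7 gs x" and len: "Suc (length gs) + q = n" and t: "t \<in> cube (Suc (length gs))"
  shows "alternating_form q (algd \<G> (src \<G> x)) (\<lambda>ws. pullback_form gs x ws t)"
proof -
  let ?y = "iter_retr gs x t" and ?W = "algd \<G> (src \<G> x)"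
  let ?d = "\<lambda>w. ltrans_inv \<G> ?y (fibre_vel gs x t w)"
  let ?P = "map (\<lambda>i. ltrans_inv \<G> ?y (cube_vel gs x t i)) [0..<Suc (length gs)]"
  have ti: "t i \<in> {-1..2}" if "i \<le> length gs" for i using cubeD[OF t, of i] that by auto
  have y: "?y \<in> N 4" using iter_retr_mem_cube(1)[OF admissible t] N_mono[of 4 7] by simp
  have ty: "tgt \<G> ?y = tgt \<G> (hd (gs @ [x]))" by (rule iter_retr_mem_cube(2)[OF admissible t])
  have adm2: "admissible 2 gs x" by (rule admissible_mono[OF _ admissible]) simp
  obtain L where L: "linear L" "\<And>w. w \<in> ?W \<Longrightarrow> fibre_vel gs x t w = L w"
    using fibre_vel_linear[OF adm2, of t] ti by blast
  have x2: "x \<in> N (Suc (Suc 0))" using admissible N_mono[of "Suc (Suc 0)" "7 + 2 * Suc (length gs)" x] by (simp add: admissible_def)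
  have cur: "fcurve (tgt \<G> ?y) (\<lambda>s. iter_retr gs (mlt \<G> x (\<epsilon> (unt \<G> (src \<G> x), s *\<^sub>R w))) t) 0"
    "iter_retr gs (mlt \<G> x (\<epsilon> (unt \<G> (src \<G> x), 0 *\<^sub>R w))) t = ?y" if "w \<in> ?W" for w
    using fibre_vel_facts'(2)[OF admissible that t] by (simp_all add: ty \<epsilon>_zero N_unt_right(2)[OF x2])
  have dv: "fibre_vel gs x t w = vel (\<lambda>s. iter_retr gs (mlt \<G> x (\<epsilon> (unt \<G> (src \<G> x), s *\<^sub>R w))) t) 0" for w
    by (simp add: fibre_vel_def)
  have add: "?d (v + w) = ?d v + ?d w" if "v \<in> ?W" "w \<in> ?W" for v w
  proof -
    have "fibre_vel gs x t (v + w) = fibre_vel gs x t v + fibre_vel gs x t w"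
      using that by (simp add: L(2) subspace_add[OF algd_subspace] linear_add[OF L(1)])
    then show ?thesis unfolding dv using ltrans_inv_linear_comb(1)[OF y cur[OF that(1)] cur[OF that(2)]] by simp
  qed
  have scale: "?d (r *\<^sub>R w) = r *\<^sub>R ?d w" if "w \<in> ?W" for r w
  proof -
    have "fibre_vel gs x t (r *\<^sub>R w) = r *\<^sub>R fibre_vel gs x t w"
      using that by (simp add: L(2) subspace_scale[OF algd_subspace] linear_scale[OF L(1)])
    then show ?thesis unfolding dv using ltrans_inv_linear_comb(2)[OF y cur[OF that] cur[OF that]] by simp
  qed
  have mem: "?d w \<in> algd \<G> (src \<G> ?y)" if "w \<in> ?W" for w by (rule fibre_vel_facts'(1)[OF admissible that t])
  have P: "set ?P \<subseteq> algd \<G> (src \<G> ?y)" using cube_vel_facts'(2)[OF admissible _ t] by (auto simp: less_Suc_eq_le)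
  have form: "pullback_form gs x ws t = \<rho> ?y (\<alpha> (src \<G> ?y) (?P @ map ?d ws))" for ws
    by (simp add: pullback_form_def linv_form_def o_def)
  have "alternating_form q ?W (\<lambda>ws. \<alpha> (src \<G> ?y) (?P @ map ?d ws))"
    unfolding alternating_form_def
  proof (intro allI impI)
    fix vs assume vs: "length vs = q \<and> set vs \<subseteq> ?W"
    let ?vs = "?P @ map ?d vs"
    have vs': "length ?vs = n \<and> set ?vs \<subseteq> algd \<G> (src \<G> ?y)" using P mem vs len by auto
    note a = alpha_alternating[of "src \<G> ?y", unfolded alternating_form_def, rule_format, OF vs']
    \<comment> \<open>Slot \<open>i\<close> of the contracted form is slot
      \<open>Suc (length gs) + i\<close> of \<open>\<alpha>\<close>, behind the cube
      directions.\<close>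
    have up: "?P @ map ?d (vs[i := v]) = ?vs[Suc (length gs) + i := ?d v]" for i v
      by (simp add: map_update list_update_append)
    show "(\<forall>i<q. \<forall>v\<in>?W. \<forall>w\<in>?W. \<alpha> (src \<G> ?y) (?P @ map ?d (vs[i := v + w])) = \<alpha> (src \<G> ?y) (?P @ map ?d (vs[i := v])) + \<alpha> (src \<G> ?y) (?P @ map ?d (vs[i := w]))) \<and>
      (\<forall>i<q. \<forall>v\<in>?W. \<forall>r. \<alpha> (src \<G> ?y) (?P @ map ?d (vs[i := r *\<^sub>R v])) = r *\<^sub>R \<alpha> (src \<G> ?y) (?P @ map ?d (vs[i := v]))) \<and>
      (\<forall>i<q. \<forall>j<q. i \<noteq> j \<and> vs ! i = vs ! j \<longrightarrow> \<alpha> (src \<G> ?y) ?vs = 0)"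
    proof (intro conjI allI impI ballI)
      show "\<alpha> (src \<G> ?y) (?P @ map ?d (vs[i := v + w])) = \<alpha> (src \<G> ?y) (?P @ map ?d (vs[i := v])) + \<alpha> (src \<G> ?y) (?P @ map ?d (vs[i := w]))"
        if "i < q" "v \<in> ?W" "w \<in> ?W" for i v w
        unfolding up add[OF that(2,3)] using a[THEN conjunct1] mem that len by simp
      show "\<alpha> (src \<G> ?y) (?P @ map ?d (vs[i := r *\<^sub>R v])) = r *\<^sub>R \<alpha> (src \<G> ?y) (?P @ map ?d (vs[i := v]))"
        if "i < q" "v \<in> ?W" for i v r
        unfolding up scale[OF that(2)] using a[THEN conjunct2, THEN conjunct1] mem that len by simp
      show "\<alpha> (src \<G> ?y) ?vs = 0" if "i < q" "j < q" "i \<noteq> j \<and> vs ! i = vs ! j" for i j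
        using a[THEN conjunct2, THEN conjunct2, rule_format, of "Suc (length gs) + i" "Suc (length gs) + j"] that vs len
        by (simp add: nth_append)
    qed
  qed
  then show ?thesis unfolding form by (rule alternating_form_compose_linear[OF rho_linear])
qed

lemma cube_form_alternating:
  assumes admissible: "admissible 7 gs x" and len: "Suc (length gs) + q = n"
  shows "alternating_form q (algd \<G> (src \<G> x)) (cube_form gs x)"
proof -
  have "alternating_form q (algd \<G> (src \<G> x)) (\<lambda>ws. LINT t:cube (Suc (length gs))|cube_measure (Suc (length gs)). pullback_form gs x ws t)"
    by (rule alternating_form_integral[OF algd_subspace pullback_form_alternating[OF admissible len] continuous_cube_integrable[OF pullback_form_continuous[OF admissible]] sets_cube])
      (use len in auto)
  from alternating_form_compose_linear[OF inv_act_linear this] show ?thesis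
    by (simp add: cube_form_def[abs_def])
qed

end

section \<open>The homotopy operator\<close>

lemma alternating_form_zero:
  assumes a: "alternating_form q W \<omega>" and W: "subspace W" and vs: "length vs = q" "set vs \<subseteq> W"
    and i: "i < q" "vs ! i = 0"
  shows "\<omega> vs = 0"
proof -
  have "\<omega> (vs[i := 0 *\<^sub>R 0]) = 0 *\<^sub>R \<omega> (vs[i := 0])"
    using a vs i(1) subspace_0[OF W] unfolding alternating_form_def by blast
  moreover have "vs[i := 0] = vs" by (metis i(2) list_update_id)
  ultimately show ?thesis by simp
qed

text \<open>The cube of dimension zero is a single point of mass one.\<close>

lemma set_integral_cube_0:
  "(LINT t:cube 0|cube_measure 0. c) = (c :: 'a::{banach, second_countable_topology})"
  using emeasure_cube[of 0] sets_cube[of 0] by (simp add: set_lebesgue_integral_def measure_def)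

lemma cube_range: "t \<in> cube (Suc l) \<Longrightarrow> \<forall>i\<le>l. t i \<in> {-1..2}"
proof (intro allI impI)
  fix i assume "t \<in> cube (Suc l)" "i \<le> l"
  then have "t \<in> {..<Suc l} \<rightarrow>\<^sub>E {0..1}" by (simp only: cube_def)
  from PiE_mem[OF this, of i] \<open>i \<le> l\<close> have "t i \<in> {0..1}" by simp
  then show "t i \<in> {-1..2}" by auto
qed

context tubular_groupoid
begin

definition radial :: "'g \<Rightarrow> real \<Rightarrow> 'e" where
  "radial x r = ltrans_inv \<G> (lam r x) (velocity \<A> {0..1} (\<lambda>r'. lam r' x) r)"

definition transport :: "'g \<Rightarrow> real \<Rightarrow> 'e \<Rightarrow> 'e" where
  "transport x r w = ltrans_inv \<G> (lam r x) (tmap \<A> \<A> (tfib \<G> (tgt \<G> x)) (lam r) x (ltrans \<G> x w))"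

text \<open>In terms of sections over \<open>A\<close>, \<open>radial x r\<close> is the contracting vector \<open>\<partial>/\<partial>r\<close> and \<open>transport x r\<close> the tangent map of
  \<open>\<lambda>\<^sub>r\<close>.\<close>

lemma kop_eq:
  "kop \<G> \<rho> lam a \<psi> gs x ws = inv (\<rho> x) ((-1) ^ a *\<^sub>R
     (LINT r:{0..1}|lborel. \<rho> (lam r x) (\<psi> gs (lam r x) (radial x r # map (transport x r) ws))))"
  by (simp add: kop_def from_form_def htpy_def to_form_def radial_def transport_def[abs_def] o_def)

text \<open>The iterated retraction with its innermost scaling removed. It makes visible that the
  last cube coordinate enters only through the point \<open>u\<close>.\<close>

definition inner_map :: "'g list \<Rightarrow> 'g \<Rightarrow> (nat \<Rightarrow> real) \<Rightarrow> 'g" where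
  "inner_map gs u t = (if gs = [] then u else iter_retr (butlast gs) (mlt \<G> (last gs) u) t)"

lemma iter_retr_inner: "iter_retr gs z t = inner_map gs (lam (t (length gs)) z) t"
proof (cases gs rule: rev_cases)
  case Nil
  then show ?thesis by (simp add: iter_retr_def inner_map_def)
next
  case (snoc gs' g)
  then show ?thesis by (simp add: iter_retr_snoc inner_map_def)
qed

lemma inner_map_cong: "inner_map gs u (t(length gs := h)) = inner_map gs u t"
proof (cases gs rule: rev_cases)
  case (snoc gs' g)
  then show ?thesis by (auto simp: inner_map_def intro!: iter_retr_cong)
qed (simp add: inner_map_def)

end

context unit_tower
begin

lemma admissible_step:
  assumes "admissible k (gs @ [g]) x" "r \<in> {-1..2}"
  shows "admissible k gs (mlt \<G> g (lam r x))" "src \<G> g = tgt \<G> (lam r x)"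
    "g \<in> N (Suc (k + 2 * Suc (length gs)))" "lam r x \<in> N (Suc (k + 2 * Suc (length gs)))"
    "src \<G> (mlt \<G> g (lam r x)) = src \<G> (lam r x)"
proof -
  let ?K = "k + 2 * Suc (length gs)"
  have a: "set gs \<subseteq> N (Suc (Suc ?K))" "g \<in> N (Suc (Suc ?K))" "x \<in> N (Suc (Suc ?K))"
    "chained \<G> (gs @ [g])" "src \<G> g = tgt \<G> x"
    using assms(1) by (simp_all add: admissible_def chained_append)
  have gs: "set gs \<subseteq> N ?K" using a(1) N_mono[of ?K "Suc (Suc ?K)"] by auto
  note l = N_lam[OF a(3) assms(2)]
  show g: "g \<in> N (Suc ?K)" using a(2) N_mono[of "Suc ?K" "Suc (Suc ?K)"] by simp
  show s: "src \<G> g = tgt \<G> (lam r x)" using a(5) l(3) by simp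
  show "lam r x \<in> N (Suc ?K)" by (rule l(2))
  note m = N_mlt[OF g l(2) s]
  show "admissible k gs (mlt \<G> g (lam r x))"
    using a(4) gs m by (simp add: admissible_def chained_append)
  show "src \<G> (mlt \<G> g (lam r x)) = src \<G> (lam r x)" by (rule m(3))
qed

lemma radial_facts:
  assumes x: "x \<in> N 8" and r: "r \<in> {0..1}"
  shows "fcurve (tgt \<G> x) (\<lambda>h. lam h x) r" "lam r x \<in> N 7" "tgt \<G> (lam r x) = tgt \<G> x"
    "radial x r \<in> algd \<G> (src \<G> (lam r x))" "ltrans \<G> (lam r x) (radial x r) = vel (\<lambda>h. lam h x) r"
proof -
  have x': "x \<in> N (Suc 7)" using x by simp
  show c: "fcurve (tgt \<G> x) (\<lambda>h. lam h x) r" by (rule fcurve_lam_param[OF x']) (use r in auto)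
  show y: "lam r x \<in> N 7" "tgt \<G> (lam r x) = tgt \<G> x" using N_lam[OF x', of r] r by auto
  have y': "lam r x \<in> N (Suc (Suc (Suc (Suc 3))))" using y(1) by simp
  have v: "velocity \<A> {0..1} (\<lambda>h. lam h x) r = vel (\<lambda>h. lam h x) r"
    using c r by (intro velocity_within_unit_interval) (auto simp: fcurve_def)
  have c': "fcurve (tgt \<G> (lam r x)) (\<lambda>h. lam h x) r" using c y(2) by simp
  note l = ltrans_inv_velocity(4,5)[OF y' c' refl]
  show "radial x r \<in> algd \<G> (src \<G> (lam r x))" "ltrans \<G> (lam r x) (radial x r) = vel (\<lambda>h. lam h x) r"
    unfolding radial_def v by (rule l(2), rule l(1))
qed

lemma transport_facts:
  assumes x: "x \<in> N 8" and r: "r \<in> {0..1}" and w: "w \<in> algd \<G> (src \<G> x)"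
  shows "fcurve (tgt \<G> x) (\<lambda>s. lam r (mlt \<G> x (\<epsilon> (unt \<G> (src \<G> x), s *\<^sub>R w)))) 0"
    "lam r (mlt \<G> x (\<epsilon> (unt \<G> (src \<G> x), 0 *\<^sub>R w))) = lam r x"
    "transport x r w \<in> algd \<G> (src \<G> (lam r x))"
    "ltrans \<G> (lam r x) (transport x r w) = vel (\<lambda>s. lam r (mlt \<G> x (\<epsilon> (unt \<G> (src \<G> x), s *\<^sub>R w)))) 0"
proof -
  let ?c = "\<lambda>s. mlt \<G> x (\<epsilon> (unt \<G> (src \<G> x), s *\<^sub>R w))"
  have x6: "x \<in> N (Suc (Suc 6))" and x7: "x \<in> N (Suc 7)" using x by simp_all
  have r': "r \<in> {-1..2}" using r by auto
  note e = ltrans_exp[OF x6 w]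
  have c0: "?c 0 = x" by (simp add: \<epsilon>_zero N_unt_right(2)[OF x6])
  have c0N: "?c 0 \<in> N (Suc 7)" using x7 c0 by simp
  note f = fcurve_lam[OF e(1) c0N r']
  show "fcurve (tgt \<G> x) (\<lambda>s. lam r (?c s)) 0" by (rule f(1))
  show v0: "lam r (?c 0) = lam r x" using c0 by simp
  have y: "lam r x \<in> N (Suc (Suc (Suc (Suc 3))))" "tgt \<G> (lam r x) = tgt \<G> x" using N_lam[OF x7 r'] by simp_all
  have tr: "transport x r w = ltrans_inv \<G> (lam r x) (vel (\<lambda>s. lam r (?c s)) 0)"
    unfolding transport_def f(2) c0 e(2) by simp
  have f1: "fcurve (tgt \<G> (lam r x)) (\<lambda>s. lam r (?c s)) 0" using f(1) y(2) by simp
  note l = ltrans_inv_velocity(4,5)[OF y(1) f1 v0]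
  show "transport x r w \<in> algd \<G> (src \<G> (lam r x))"
    "ltrans \<G> (lam r x) (transport x r w) = vel (\<lambda>s. lam r (?c s)) 0"
    unfolding tr by (rule l(2), rule l(1))
qed

text \<open>Left translation by a product is left translation by \<open>y\<close> followed by the
  tangent map of left multiplication by \<open>g\<close>; on the ray in direction \<open>w\<close>
  this is associativity.\<close>

lemma ltrans_mlt:
  assumes g: "g \<in> N 6" and y: "y \<in> N 6" and gy: "src \<G> g = tgt \<G> y" and w: "w \<in> algd \<G> (src \<G> y)"
  shows "ltrans \<G> (mlt \<G> g y) w = tmap \<A> \<A> (tfib \<G> (src \<G> g)) (mlt \<G> g) y (ltrans \<G> y w)"
proof -
  let ?c = "\<lambda>s. \<epsilon> (unt \<G> (src \<G> y), s *\<^sub>R w)"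
  have g5: "g \<in> N (Suc 5)" "y \<in> N (Suc 5)" using g y by simp_all
  note m = N_mlt[OF g5 gy]
  have z: "mlt \<G> g y \<in> N (Suc (Suc 3))" using m(2) by simp
  have y2: "y \<in> N (Suc (Suc 4))" using y by simp
  have wz: "w \<in> algd \<G> (src \<G> (mlt \<G> g y))" using w m(3) by simp
  note ez = ltrans_exp(2)[OF z wz, unfolded m(3)]
  note ey = ltrans_exp[OF y2 w]
  have y0: "mlt \<G> y (?c 0) = y" by (simp add: \<epsilon>_zero N_unt_right(2)[OF y2])
  have u: "unt \<G> (src \<G> y) \<in> N (Suc (Suc 3))" using N_unt(1)[OF g5(2)] by simp
  have fc: "fcurve (src \<G> y) ?c 0" by (rule fcurve_exp[OF u w])
  have "\<forall>\<^sub>F s in nhds 0. ?c s \<in> N (Suc (Suc 3))"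
    by (rule isCont_eventually_open[OF fcurve_isCont[OF fc] N_open]) (use u in \<open>simp add: \<epsilon>_zero\<close>)
  then have ev: "\<forall>\<^sub>F s in nhds 0. mlt \<G> g (mlt \<G> y (?c s)) = mlt \<G> (mlt \<G> g y) (?c s)"
    using fc[unfolded fcurve_def, THEN conjunct2]
  proof eventually_elim
    case (elim s)
    have "g \<in> N (Suc (Suc 3))" "y \<in> N (Suc (Suc 3))" using g y N_mono[of "Suc (Suc 3)" 6] by auto
    then show ?case using elim gy by (intro N_assoc[symmetric, of _ 3]) auto
  qed
  have ey1: "fcurve (src \<G> g) (\<lambda>s. mlt \<G> y (?c s)) 0" using ey(1) gy by simp
  have cd: "(g, mlt \<G> y (?c 0)) \<in> cdom \<G>" unfolding y0 by (rule m(1))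
  have "vel (\<lambda>s. mlt \<G> g (mlt \<G> y (?c s))) 0 = tmap \<A> \<A> (tfib \<G> (src \<G> g)) (mlt \<G> g) y (ltrans \<G> y w)"
    using fcurve_mlt(3)[OF ey1 cd] unfolding y0 ey(2) .
  then show ?thesis using smooth_curve_at_cong(1)[OF ev, of \<A>] ez by simp
qed

lemma ltrans_mlt_curve:
  assumes g: "g \<in> N 6" and y: "y \<in> N 6" and gy: "src \<G> g = tgt \<G> y" and w: "w \<in> algd \<G> (src \<G> y)"
    and d: "fcurve (tgt \<G> y) d h0" "d h0 = y" "ltrans \<G> y w = vel d h0"
  shows "fcurve (tgt \<G> g) (\<lambda>h. mlt \<G> g (d h)) h0" "ltrans \<G> (mlt \<G> g y) w = vel (\<lambda>h. mlt \<G> g (d h)) h0"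
proof -
  have cd: "(g, d h0) \<in> cdom \<G>" unfolding d(2) by (rule N_mlt(1)[of _ 5]) (use g y gy in simp_all)
  have d': "fcurve (src \<G> g) d h0" using d(1) gy by simp
  show "fcurve (tgt \<G> g) (\<lambda>h. mlt \<G> g (d h)) h0" by (rule fcurve_mlt(2)[OF d' cd])
  show "ltrans \<G> (mlt \<G> g y) w = vel (\<lambda>h. mlt \<G> g (d h)) h0"
    unfolding ltrans_mlt[OF g y gy w] d(3) fcurve_mlt(3)[OF d' cd] d(2) ..
qed

end

context van_est_tower
begin

text \<open>Replacing \<open>x\<close> by \<open>g \<lambda>\<^sub>r(x)\<close> adds
  \<open>r\<close> as a new last cube coordinate. The radial vector becomes the derivative in this
  coordinate and stands directly behind the old cube directions, so no reordering sign appears; this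
  is why the contraction uses the first slot.\<close>

lemma pullback_form_step:
  assumes admissible: "admissible 12 (gs @ [g]) x" and r: "r \<in> {0..1}" and t: "t \<in> cube (Suc (length gs))"
    and ws: "set ws \<subseteq> algd \<G> (src \<G> x)"
  shows "pullback_form gs (mlt \<G> g (lam r x)) (radial x r # map (transport x r) ws) t =
    pullback_form (gs @ [g]) x ws (t(Suc (length gs) := r))"
proof -
  let ?p = "Suc (length gs)"
  let ?y = "lam r x" and ?z = "mlt \<G> g (lam r x)" and ?T = "t(Suc (length gs) := r)"
  have r': "r \<in> {-1..2}" using r by auto
  note st = admissible_step[OF admissible r']
  have adm2: "admissible 2 gs ?z" by (rule admissible_mono[OF _ st(1)]) simp
  have ti: "\<forall>i\<le>length gs. t i \<in> {-1..2}" by (rule cube_range[OF t])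
  have x8: "x \<in> N 8" using admissible N_mono[of 8 "12 + 2 * Suc (length (gs @ [g]))" x] by (simp add: admissible_def)
  have g6: "g \<in> N 6" and y6: "?y \<in> N 6"
    using st(3,4) N_mono[of 6 "Suc (12 + 2 * Suc (length gs))"] by simp_all
  note R = radial_facts[OF x8 r]
  have tg: "tgt \<G> ?z = tgt \<G> g" by (rule N_mlt(4)[of _ 5]) (use g6 y6 st(2) in simp_all)
  \<comment> \<open>Coordinate \<open>?p\<close> is the parameter of the retraction that acts on
    \<open>x\<close> itself.\<close>
  have A: "iter_retr (gs @ [g]) x (?T(?p := h)) = iter_retr gs (mlt \<G> g (lam h x)) t" for h
    unfolding iter_retr_snoc by (simp, rule iter_retr_cong) simp
  have A': "iter_retr (gs @ [g]) x ?T = iter_retr gs ?z t" using A[of r] by simp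
  have A'': "iter_retr (gs @ [g]) u ?T = iter_retr gs (mlt \<G> g (lam r u)) t" for u
    unfolding iter_retr_snoc by (simp, rule iter_retr_cong) simp
  have B: "cube_vel (gs @ [g]) x ?T i = cube_vel gs ?z t i" if "i < ?p" for i
  proof -
    have "iter_retr (gs @ [g]) x (?T(i := h)) = iter_retr gs ?z (t(i := h))" for h
      unfolding iter_retr_snoc using that by (simp, intro iter_retr_cong) simp
    then show ?thesis using that by (simp add: cube_vel_def)
  qed
  have wR: "radial x r \<in> algd \<G> (src \<G> ?z)" using R(4) st(5) by simp
  have R1: "fcurve (tgt \<G> ?y) (\<lambda>h. lam h x) r" using R(1,3) by simp
  note cR = ltrans_mlt_curve[OF g6 y6 st(2) R(4) R1 refl R(5)]
  have C: "cube_vel (gs @ [g]) x ?T ?p = fibre_vel gs ?z t (radial x r)"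
  proof -
    have "fibre_vel gs ?z t (radial x r) = vel (\<lambda>h. iter_retr gs (mlt \<G> g (lam h x)) t) r"
      by (rule fibre_vel_curve[OF adm2 ti _ refl wR cR(2)]) (use cR(1) tg in auto)
    then show ?thesis unfolding cube_vel_def A by simp
  qed
  have D: "fibre_vel (gs @ [g]) x ?T w = fibre_vel gs ?z t (transport x r w)" if w: "w \<in> algd \<G> (src \<G> x)" for w
  proof -
    let ?c = "\<lambda>s. lam r (mlt \<G> x (\<epsilon> (unt \<G> (src \<G> x), s *\<^sub>R w)))"
    note W = transport_facts[OF x8 r w]
    have W1: "fcurve (tgt \<G> ?y) ?c 0" using W(1) R(3) by simp
    note cW = ltrans_mlt_curve[OF g6 y6 st(2) W(3) W1 W(2) W(4)]
    have wW: "transport x r w \<in> algd \<G> (src \<G> ?z)" using W(3) st(5) by simp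
    have "fibre_vel gs ?z t (transport x r w) = vel (\<lambda>s. iter_retr gs (mlt \<G> g (?c s)) t) 0"
      by (rule fibre_vel_curve[OF adm2 ti _ _ wW cW(2)]) (use cW(1) tg W(2) in auto)
    then show ?thesis unfolding fibre_vel_def A'' by simp
  qed
  have E: "map (cube_vel (gs @ [g]) x ?T) [0..<Suc (length (gs @ [g]))] =
      map (cube_vel gs ?z t) [0..<?p] @ [fibre_vel gs ?z t (radial x r)]"
    using B C by simp
  have F: "map (fibre_vel (gs @ [g]) x ?T) ws = map (fibre_vel gs ?z t) (map (transport x r) ws)"
    using D ws by auto
  show ?thesis unfolding pullback_form_def A' E F by simp
qed

lemma inner_map_fcurve:
  assumes admissible: "admissible 2 gs x" and t: "t \<in> cube (Suc (length gs))"
    and c: "fcurve (tgt \<G> x) c h0" "c h0 \<in> N (Suc (2 * Suc (length gs)))"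
  shows "fcurve (tgt \<G> (hd (gs @ [x]))) (\<lambda>h. inner_map gs (c h) t) h0"
proof (cases gs rule: rev_cases)
  case Nil
  then show ?thesis using c by (simp add: inner_map_def)
next
  case (snoc gs' g)
  let ?l = "Suc (length gs')"
  have len: "length gs = ?l" using snoc by simp
  have g: "set gs' \<subseteq> N (2 + 2 * Suc ?l)" "g \<in> N (2 + 2 * Suc ?l)" "chained \<G> (gs' @ [g])" "src \<G> g = tgt \<G> x"
    using admissible by (simp_all add: admissible_def snoc chained_append)
  have g1: "g \<in> N (Suc (2 * Suc ?l))" using g(2) N_mono[of "Suc (2 * Suc ?l)" "2 + 2 * Suc ?l" g] by simp
  have c1: "c h0 \<in> N (Suc (2 * Suc ?l))" using c(2) len by simp
  have tc: "src \<G> g = tgt \<G> (c h0)" using g(4) fcurve_tgt[OF c(1)] by simp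
  note m = N_mlt[OF g1 c1 tc]
  have gs': "set gs' \<subseteq> N (2 * Suc ?l)" using g(1) N_mono[of "2 * Suc ?l" "2 + 2 * Suc ?l"] by auto
  have admissible': "admissible 2 gs' (mlt \<G> g (c h0))"
    using gs' m(2,4) g(3) by (simp add: admissible_def chained_append)
  have ti: "\<forall>i\<le>length gs'. t i \<in> {-1..2}" using cube_range[OF t] len by simp
  have fc: "fcurve (src \<G> g) c h0" using c(1) g(4) by simp
  have fm: "fcurve (tgt \<G> (mlt \<G> g (c h0))) (\<lambda>h. mlt \<G> g (c h)) h0"
    using fcurve_mlt(2)[OF fc m(1)] m(4) by simp
  have "fcurve (tgt \<G> (hd (gs' @ [mlt \<G> g (c h0)]))) (\<lambda>h. iter_retr gs' (mlt \<G> g (c h)) t) h0"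
    by (rule iter_retr_tangent[OF admissible' ti]) (use fm in simp)
  moreover have "tgt \<G> (hd (gs' @ [mlt \<G> g (c h0)])) = tgt \<G> (hd (gs @ [x]))"
    using snoc m(4) by (cases gs') auto
  ultimately show ?thesis using snoc by (simp add: inner_map_def)
qed

text \<open>With \<open>\<tau>\<close> the last cube coordinate, the point depends on
  \<open>\<tau>\<close> and \<open>r\<close> only through their product. The derivatives in
  \<open>\<tau>\<close> and in \<open>r\<close> are thus \<open>r\<close> and \<open>\<tau>\<close>
  times the velocity of one curve, the retraction path of \<open>x\<close> followed by
  \<open>inner_map\<close>.\<close>

lemma parallel_velocities:
  assumes admissible: "admissible 8 gs x" and r: "r \<in> {0..1}" and t: "t \<in> cube (Suc (length gs))"
  defines "e \<equiv> ltrans_inv \<G> (iter_retr gs (lam r x) t) (vel (\<lambda>h. inner_map gs (lam h x) t) (t (length gs) * r))"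
  shows "admissible 7 gs (lam r x)"
    "ltrans_inv \<G> (iter_retr gs (lam r x) t) (cube_vel gs (lam r x) t (length gs)) = r *\<^sub>R e"
    "ltrans_inv \<G> (iter_retr gs (lam r x) t) (fibre_vel gs (lam r x) t (radial x r)) = t (length gs) *\<^sub>R e"
    "e \<in> algd \<G> (src \<G> (iter_retr gs (lam r x) t))"
proof -
  let ?l = "length gs" and ?y = "lam r x"
  let ?\<tau> = "t ?l" and ?C = "\<lambda>h. inner_map gs (lam h x) t"
  have \<tau>: "0 \<le> ?\<tau>" "?\<tau> \<le> 1" using cubeD[OF t, of ?l] by auto
  have \<tau>r: "0 \<le> ?\<tau> * r" "?\<tau> * r \<le> 1" using \<tau> r by (auto intro: mult_le_one)
  have xN: "x \<in> N (Suc (7 + 2 * Suc ?l))" using admissible by (simp add: admissible_def)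
  have x8: "x \<in> N 8" using admissible N_mono[of 8 "8 + 2 * Suc ?l" x] by (simp add: admissible_def)
  note R = radial_facts[OF x8 r]
  have dom: "(r, x) \<in> retr_dom \<Omega> \<epsilon>" using N_lam(1)[OF xN, of r] r by auto
  have y: "?y \<in> N (7 + 2 * Suc ?l)" using N_lam(2)[OF xN, of r] r by auto
  show admy: "admissible 7 gs ?y"
    using admissible_mono[OF _ admissible, of 7] y R(3) by (auto simp: admissible_def chained_append)
  have adm2: "admissible 2 gs ?y" by (rule admissible_mono[OF _ admy]) simp
  have adm2x: "admissible 2 gs x" by (rule admissible_mono[OF _ admissible]) simp
  have ti: "\<forall>i\<le>?l. t i \<in> {-1..2}" by (rule cube_range[OF t])
  have hdy: "tgt \<G> (hd (gs @ [?y])) = tgt \<G> (hd (gs @ [x]))" using R(3) by (cases gs) auto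
  have C\<tau>: "lam (?\<tau> * r) x \<in> N (Suc (2 * Suc ?l))"
    using N_lam(2)[OF xN, of "?\<tau> * r"] \<tau>r N_mono[of "Suc (2 * Suc ?l)" "7 + 2 * Suc ?l" "lam (?\<tau> * r) x"] by auto
  have fl: "fcurve (tgt \<G> x) (\<lambda>h. lam h x) (?\<tau> * r)" by (rule fcurve_lam_param[OF xN]) (use \<tau>r in auto)
  have C: "fcurve (tgt \<G> (hd (gs @ [x]))) ?C (?\<tau> * r)" by (rule inner_map_fcurve[OF adm2x t fl C\<tau>])
  have val: "?C (?\<tau> * r) = iter_retr gs ?y t" by (simp add: iter_retr_inner lam_lam[OF dom])
  have sc: "smooth_curve_at \<A> ?C (?\<tau> * r)" using C by (simp add: fcurve_def)
  have F: "iter_retr gs ?y t \<in> N 4" "tgt \<G> (iter_retr gs ?y t) = tgt \<G> (hd (gs @ [x]))"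
    using iter_retr_mem_cube[OF admy t] N_mono[of 4 7] hdy by simp_all
  have CF: "fcurve (tgt \<G> (iter_retr gs ?y t)) ?C (?\<tau> * r)" using C F(2) by simp
  have F4: "iter_retr gs ?y t \<in> N (Suc (Suc (Suc (Suc 0))))" using F(1) by (simp add: eval_nat_numeral)
  show "e \<in> algd \<G> (src \<G> (iter_retr gs ?y t))"
    unfolding e_def by (rule ltrans_inv_velocity(5)[OF F4 CF val])
  have scale: "ltrans_inv \<G> (iter_retr gs ?y t) (c *\<^sub>R vel ?C (?\<tau> * r)) = c *\<^sub>R e" for c
    unfolding e_def by (rule ltrans_inv_linear_comb(2)[OF F(1) CF val CF val])
  have "cube_vel gs ?y t ?l = vel (\<lambda>h. ?C (r * h)) ?\<tau>"
    unfolding cube_vel_def by (simp add: iter_retr_inner inner_map_cong lam_lam[OF dom] mult.commute)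
  also have "\<dots> = r *\<^sub>R vel ?C (?\<tau> * r)"
    using smooth_curve_at_scale(2)[of \<A> ?C r ?\<tau>] sc by (simp add: mult.commute)
  finally show "ltrans_inv \<G> (iter_retr gs ?y t) (cube_vel gs ?y t ?l) = r *\<^sub>R e" using scale by simp
  have R1: "fcurve (tgt \<G> ?y) (\<lambda>h. lam h x) r" using R(1,3) by simp
  have "fibre_vel gs ?y t (radial x r) = vel (\<lambda>h. iter_retr gs (lam h x) t) r"
    by (rule fibre_vel_curve[OF adm2 ti R1 refl R(4,5)])
  also have "\<dots> = vel (\<lambda>h. ?C (?\<tau> * h)) r"
  proof (rule smooth_curve_at_cong(1))
    have "\<forall>\<^sub>F h in nhds r. h \<in> {-1<..<2}" by (rule eventually_nhds_in_open) (use r in auto)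
    then show "\<forall>\<^sub>F h in nhds r. iter_retr gs (lam h x) t = ?C (?\<tau> * h)"
    proof eventually_elim
      case (elim h)
      then have "(h, x) \<in> retr_dom \<Omega> \<epsilon>" by (intro N_lam(1)[OF xN]) auto
      then show ?case by (simp add: iter_retr_inner lam_lam)
    qed
  qed
  also have "\<dots> = ?\<tau> *\<^sub>R vel ?C (?\<tau> * r)" by (rule smooth_curve_at_scale(2)[OF sc])
  finally show "ltrans_inv \<G> (iter_retr gs ?y t) (fibre_vel gs ?y t (radial x r)) = ?\<tau> *\<^sub>R e" using scale by simp
qed

lemma pullback_form_args:
  assumes admissible: "admissible 7 gs x" and t: "t \<in> cube (Suc (length gs))" and ws: "set ws \<subseteq> algd \<G> (src \<G> x)"
  shows "set (map (ltrans_inv \<G> (iter_retr gs x t)) (map (cube_vel gs x t) [0..<Suc (length gs)] @ map (fibre_vel gs x t) ws))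
    \<subseteq> algd \<G> (src \<G> (iter_retr gs x t))"
proof
  fix v assume "v \<in> set (map (ltrans_inv \<G> (iter_retr gs x t)) (map (cube_vel gs x t) [0..<Suc (length gs)] @ map (fibre_vel gs x t) ws))"
  then consider i where "i \<le> length gs" "v = ltrans_inv \<G> (iter_retr gs x t) (cube_vel gs x t i)"
    | w where "w \<in> algd \<G> (src \<G> x)" "v = ltrans_inv \<G> (iter_retr gs x t) (fibre_vel gs x t w)"
    using ws by (auto simp: less_Suc_eq_le simp del: upt_Suc)
  then show "v \<in> algd \<G> (src \<G> (iter_retr gs x t))"
    using cube_vel_facts'(2)[OF admissible _ t] fibre_vel_facts'(1)[OF admissible _ t] by cases auto
qed

text \<open>The homotopy operator squares to zero: \<open>\<lambda>\<^sub>s \<circ> \<lambda>\<^sub>r = \<lambda>\<^sub>s\<^sub>r\<close>, so the two radial directions are parallel.\<close>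

lemma cube_form_radial:
  assumes admissible: "admissible 8 gs x" and r: "r \<in> {0..1}" and us: "set us \<subseteq> algd \<G> (src \<G> (lam r x))"
    and len: "Suc (length gs) + Suc (length us) = n"
  shows "cube_form gs (lam r x) (radial x r # us) = 0"
proof -
  let ?l = "length gs" and ?y = "lam r x"
  have x8: "x \<in> N 8" using admissible N_mono[of 8 "8 + 2 * Suc ?l" x] by (simp add: admissible_def)
  have "pullback_form gs ?y (radial x r # us) t = 0" if t: "t \<in> cube (Suc ?l)" for t
  proof -
    note P = parallel_velocities[OF admissible r t]
    let ?F = "iter_retr gs ?y t"
    let ?vs = "map (ltrans_inv \<G> ?F) (map (cube_vel gs ?y t) [0..<Suc ?l] @ map (fibre_vel gs ?y t) (radial x r # us))"
    have ws: "set (radial x r # us) \<subseteq> algd \<G> (src \<G> ?y)" using radial_facts(4)[OF x8 r] us by simp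
    have "\<alpha> (src \<G> ?F) ?vs = 0"
      by (rule alternating_form_parallel[where i = ?l and j = "Suc ?l" and r = r and s = "t ?l",
            OF alpha_alternating algd_subspace _ pullback_form_args[OF P(1) t ws] _ _ _ P(4)])
        (use len P(2,3) in \<open>simp_all add: nth_append\<close>)
    then show ?thesis by (simp add: pullback_form_def linv_form_def linear_0[OF rho_linear] del: upt_Suc)
  qed
  then have "(LINT t:cube (Suc ?l)|cube_measure (Suc ?l). pullback_form gs ?y (radial x r # us) t) =
      (LINT t:cube (Suc ?l)|cube_measure (Suc ?l). 0)"
    by (intro set_lebesgue_integral_cong[OF sets_cube]) blast
  then show ?thesis by (simp add: cube_form_def set_lebesgue_integral_def linear_0[OF inv_act_linear])
qed

text \<open>Forms in the image of the homotopy operator vanish at units: a unit is fixed by the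
  retraction, so the last cube direction is zero. Formally this is
  \<open>parallel_velocities\<close> at \<open>r = 0\<close>, where the factor \<open>r\<close>
  kills that direction.\<close>

lemma cube_form_unit:
  assumes admissible: "admissible 8 gs (unt \<G> m)" and len: "Suc (length gs) = n"
  shows "cube_form gs (unt \<G> m) [] = 0"
proof -
  let ?l = "length gs" and ?y = "unt \<G> m"
  have "pullback_form gs ?y [] t = 0" if t: "t \<in> cube (Suc ?l)" for t
  proof -
    have "(0::real) \<in> {0..1}" by simp
    note P = parallel_velocities[OF admissible this t, unfolded lam_unt]
    let ?F = "iter_retr gs ?y t"
    let ?vs = "map (ltrans_inv \<G> ?F) (map (cube_vel gs ?y t) [0..<Suc ?l] @ map (fibre_vel gs ?y t) [])"
    have ws: "set [] \<subseteq> algd \<G> (src \<G> ?y)" by simp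
    have "\<alpha> (src \<G> ?F) ?vs = 0"
      by (rule alternating_form_zero[OF alpha_alternating algd_subspace _ pullback_form_args[OF P(1) t ws], of ?l])
        (use len P(2) in \<open>simp_all add: nth_append\<close>)
    then show ?thesis by (simp add: pullback_form_def linv_form_def linear_0[OF rho_linear] del: upt_Suc)
  qed
  then have "(LINT t:cube (Suc ?l)|cube_measure (Suc ?l). pullback_form gs ?y [] t) =
      (LINT t:cube (Suc ?l)|cube_measure (Suc ?l). 0)"
    by (intro set_lebesgue_integral_cong[OF sets_cube]) blast
  then show ?thesis by (simp add: cube_form_def set_lebesgue_integral_def linear_0[OF inv_act_linear])
qed

text \<open>The surviving face followed by the homotopy operator, apart from signs.
  \<open>pullback_form_step\<close> identifies the integrands, and Fubini's theorem turns the
  integral over \<open>r\<close> of integrals over a cube into one over the cube with the additional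
  coordinate.\<close>

lemma cube_form_step:
  assumes admissible: "admissible 12 (gs @ [g]) x" and ws: "set ws \<subseteq> algd \<G> (src \<G> x)" and len: "Suc (Suc (length gs)) + length ws = n"
  shows "inv (\<rho> x) (LINT r:{0..1}|lborel. \<rho> (lam r x) (cube_form gs (mlt \<G> g (lam r x)) (radial x r # map (transport x r) ws))) =
    cube_form (gs @ [g]) x ws"
proof -
  let ?p = "Suc (length gs)"
  let ?T = "inv (act_list \<rho> (gs @ [g]))"
  let ?I = "\<lambda>r. LINT t:cube ?p|cube_measure ?p. pullback_form (gs @ [g]) x ws (t(?p := r))"
  have "\<rho> (lam r x) (cube_form gs (mlt \<G> g (lam r x)) (radial x r # map (transport x r) ws)) = ?T (?I r)" if r: "r \<in> {0..1}" for r
  proof -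
    have r': "r \<in> {-1..2}" using r by auto
    note st = admissible_step[OF admissible r']
    have cd: "(g, lam r x) \<in> cdom \<G>" by (rule N_mlt(1)[OF st(3,4,2)])
    have "(LINT t:cube ?p|cube_measure ?p. pullback_form gs (mlt \<G> g (lam r x)) (radial x r # map (transport x r) ws) t) = ?I r"
      by (rule set_lebesgue_integral_cong[OF sets_cube]) (use pullback_form_step[OF admissible r _ ws] in blast)
    then have "cube_form gs (mlt \<G> g (lam r x)) (radial x r # map (transport x r) ws) = inv (act_list \<rho> (gs @ [mlt \<G> g (lam r x)])) (?I r)"
      by (simp add: cube_form_def)
    \<comment> \<open>Splitting off the action of \<open>lam r x\<close> cancels the one in the
      integrand. What remains does not depend on \<open>r\<close> and leaves the integral.\<close>
    also have "act_list \<rho> (gs @ [mlt \<G> g (lam r x)]) = act_list \<rho> ((gs @ [g]) @ [lam r x])"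
      by (simp add: act_list_append rho_mlt[OF cd] o_assoc)
    also have "inv (act_list \<rho> ((gs @ [g]) @ [lam r x])) (?I r) = inv (\<rho> (lam r x)) (?T (?I r))"
      unfolding inv_act_append[of "gs @ [g]"] by simp
    finally show ?thesis by simp
  qed
  then have "(LINT r:{0..1}|lborel. \<rho> (lam r x) (cube_form gs (mlt \<G> g (lam r x)) (radial x r # map (transport x r) ws))) =
      (LINT r:{0..1}|lborel. ?T (?I r))"
    by (intro set_lebesgue_integral_cong) auto
  also have "\<dots> = ?T (LINT r:{0..1}|lborel. ?I r)"
    by (rule set_integral_linear_bij[OF inv_act_linear bij_imp_bij_inv[OF act_list_bij]])
  also have "(LINT r:{0..1}|lborel. ?I r) = (LINT t:cube (Suc ?p)|cube_measure (Suc ?p). pullback_form (gs @ [g]) x ws t)"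
  proof (rule cube_fubini[symmetric])
    have "admissible 7 (gs @ [g]) x" by (rule admissible_mono[OF _ admissible]) simp
    from pullback_form_continuous[OF this ws] len
    show "continuous_on (cube (Suc ?p)) (pullback_form (gs @ [g]) x ws)" by simp
  qed
  finally show ?thesis
    unfolding cube_form_def inv_act_append[of "gs @ [g]" "[x]"] by simp
qed

text \<open>The first homotopy operator acts on \<open>\<alpha>\<^sup>L\<close> itself. It fits the
  general pattern with Fubini's theorem for a cube of dimension zero and one further
  coordinate.\<close>

lemma cube_form_base:
  assumes admissible: "admissible 7 [] x" and ws: "set ws \<subseteq> algd \<G> (src \<G> x)" and len: "Suc (length ws) = n"
  shows "inv (\<rho> x) (LINT r:{0..1}|lborel. \<rho> (lam r x) (\<alpha> (src \<G> (lam r x)) (radial x r # map (transport x r) ws))) =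
    cube_form [] x ws"
proof -
  have x8: "x \<in> N 8" using admissible N_mono[of 8 9 x] by (simp add: admissible_def)
  have "(LINT t:cube 0|cube_measure 0. pullback_form [] x ws (t(0 := r))) =
      \<rho> (lam r x) (\<alpha> (src \<G> (lam r x)) (radial x r # map (transport x r) ws))" if r: "r \<in> {0..1}" for r
  proof -
    have v: "velocity \<A> {0..1} (\<lambda>r'. lam r' x) r = vel (\<lambda>h. lam h x) r"
      using radial_facts(1)[OF x8 r] r by (intro velocity_within_unit_interval) (auto simp: fcurve_def)
    have x6: "x \<in> N (Suc (Suc 6))" "x \<in> N (Suc 7)" using x8 by simp_all
    have tr: "vel (\<lambda>s. lam r (mlt \<G> x (\<epsilon> (unt \<G> (src \<G> x), s *\<^sub>R w)))) 0 =
        tmap \<A> \<A> (tfib \<G> (tgt \<G> x)) (lam r) x (ltrans \<G> x w)" if w: "w \<in> algd \<G> (src \<G> x)" for w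
    proof -
      note e = ltrans_exp[OF x6(1) w]
      have c0: "mlt \<G> x (\<epsilon> (unt \<G> (src \<G> x), 0 *\<^sub>R w)) = x" by (simp add: \<epsilon>_zero N_unt_right(2)[OF x6(1)])
      have c0N: "mlt \<G> x (\<epsilon> (unt \<G> (src \<G> x), 0 *\<^sub>R w)) \<in> N (Suc 7)" unfolding c0 by (rule x6(2))
      show ?thesis using fcurve_lam(2)[OF e(1) c0N, of r] r unfolding c0 e(2) by simp
    qed
    have trw: "map (\<lambda>w. ltrans_inv \<G> (lam r x) (vel (\<lambda>s. lam r (mlt \<G> x (\<epsilon> (unt \<G> (src \<G> x), s *\<^sub>R w)))) 0)) ws = map (transport x r) ws"
      using ws tr by (intro map_cong refl) (auto simp: transport_def)
    have "pullback_form [] x ws (t(0 := r)) = \<rho> (lam r x) (\<alpha> (src \<G> (lam r x)) (radial x r # map (transport x r) ws))" for t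
      by (simp add: pullback_form_def linv_form_def iter_retr_def cube_vel_def fibre_vel_def radial_def v o_def trw del: map_eq_conv)
    then show ?thesis by (simp only: set_integral_cube_0)
  qed
  then have "(LINT r:{0..1}|lborel. \<rho> (lam r x) (\<alpha> (src \<G> (lam r x)) (radial x r # map (transport x r) ws))) =
      (LINT r:{0..1}|lborel. LINT t:cube 0|cube_measure 0. pullback_form [] x ws (t(0 := r)))"
    by (intro set_lebesgue_integral_cong) auto
  also have "\<dots> = (LINT t:cube (Suc 0)|cube_measure (Suc 0). pullback_form [] x ws t)"
    using pullback_form_continuous[OF admissible ws] len by (intro cube_fubini[symmetric]) simp
  finally show ?thesis by (simp add: cube_form_def)
qed

end

section \<open>Germs\<close>

lemma EG_iff: "(gs, g) \<in> EG \<G> p \<longleftrightarrow> length gs = p \<and> chained \<G> (gs @ [g])"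
  by (auto simp: EG_def composable_iff chained_append)

lemma chained_Cons: "chained \<G> (x # xs) \<longleftrightarrow> (xs \<noteq> [] \<longrightarrow> src \<G> x = tgt \<G> (hd xs)) \<and> chained \<G> xs"
  by (cases xs) auto

lemma near_units_E_iff:
  "near_units_E \<G> p P \<longleftrightarrow> (\<forall>m0. \<exists>N. open N \<and> unt \<G> m0 \<in> N \<and>
     (\<forall>gs g. (gs, g) \<in> EG \<G> p \<longrightarrow> set gs \<subseteq> N \<longrightarrow> g \<in> N \<longrightarrow> P gs g))"
  unfolding near_units_E_def Ball_def split_paired_All prod.case by (simp only: imp_conjL)

lemma near_units_B_iff:
  "near_units_B \<G> p P \<longleftrightarrow> (\<forall>m0. \<exists>N. open N \<and> unt \<G> m0 \<in> N \<and>
     (\<forall>gs m. (gs, m) \<in> BG \<G> p \<longrightarrow> set gs \<subseteq> N \<longrightarrow> unt \<G> m \<in> N \<longrightarrow> P gs m))"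
  unfolding near_units_B_def Ball_def split_paired_All prod.case by (simp only: imp_conjL)

lemma near_units_E_conj:
  assumes "near_units_E \<G> p P" "near_units_E \<G> p Q"
    and R: "\<And>gs g. (gs, g) \<in> EG \<G> p \<Longrightarrow> P gs g \<Longrightarrow> Q gs g \<Longrightarrow> R gs g"
  shows "near_units_E \<G> p R"
  unfolding near_units_E_iff
proof
  fix m0
  obtain N1 where N1: "open N1" "unt \<G> m0 \<in> N1" "\<forall>gs g. (gs, g) \<in> EG \<G> p \<longrightarrow> set gs \<subseteq> N1 \<longrightarrow> g \<in> N1 \<longrightarrow> P gs g"
    using spec[OF assms(1)[unfolded near_units_E_iff], of m0] by (elim exE conjE) (rule that)
  obtain N2 where N2: "open N2" "unt \<G> m0 \<in> N2" "\<forall>gs g. (gs, g) \<in> EG \<G> p \<longrightarrow> set gs \<subseteq> N2 \<longrightarrow> g \<in> N2 \<longrightarrow> Q gs g"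
    using spec[OF assms(2)[unfolded near_units_E_iff], of m0] by (elim exE conjE) (rule that)
  show "\<exists>N. open N \<and> unt \<G> m0 \<in> N \<and> (\<forall>gs g. (gs, g) \<in> EG \<G> p \<longrightarrow> set gs \<subseteq> N \<longrightarrow> g \<in> N \<longrightarrow> R gs g)"
  proof (rule exI[of _ "N1 \<inter> N2"], intro conjI allI impI)
    fix gs g assume "(gs, g) \<in> EG \<G> p" "set gs \<subseteq> N1 \<inter> N2" "g \<in> N1 \<inter> N2"
    then show "R gs g" using N1(3) N2(3) by (intro R) simp_all
  qed (use N1 N2 in auto)
qed

lemma near_units_B_conj:
  assumes "near_units_B \<G> p P" "near_units_B \<G> p Q"
    and R: "\<And>gs m. P gs m \<Longrightarrow> Q gs m \<Longrightarrow> R gs m"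
  shows "near_units_B \<G> p R"
  unfolding near_units_B_iff
proof
  fix m0
  obtain N1 where N1: "open N1" "unt \<G> m0 \<in> N1" "\<forall>gs m. (gs, m) \<in> BG \<G> p \<longrightarrow> set gs \<subseteq> N1 \<longrightarrow> unt \<G> m \<in> N1 \<longrightarrow> P gs m"
    using spec[OF assms(1)[unfolded near_units_B_iff], of m0] by (elim exE conjE) (rule that)
  obtain N2 where N2: "open N2" "unt \<G> m0 \<in> N2" "\<forall>gs m. (gs, m) \<in> BG \<G> p \<longrightarrow> set gs \<subseteq> N2 \<longrightarrow> unt \<G> m \<in> N2 \<longrightarrow> Q gs m"
    using spec[OF assms(2)[unfolded near_units_B_iff], of m0] by (elim exE conjE) (rule that)
  show "\<exists>N. open N \<and> unt \<G> m0 \<in> N \<and> (\<forall>gs m. (gs, m) \<in> BG \<G> p \<longrightarrow> set gs \<subseteq> N \<longrightarrow> unt \<G> m \<in> N \<longrightarrow> R gs m)"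
  proof (rule exI[of _ "N1 \<inter> N2"], intro conjI allI impI)
    fix gs m assume "(gs, m) \<in> BG \<G> p" "set gs \<subseteq> N1 \<inter> N2" "unt \<G> m \<in> N1 \<inter> N2"
    then show "R gs m" using N1(3) N2(3) by (intro R) simp_all
  qed (use N1 N2 in auto)
qed

lemma near_units_B_of_E:
  assumes "local_lie_groupoid \<G>" "near_units_E \<G> p P"
    and Q: "\<And>gs m. P gs (unt \<G> m) \<Longrightarrow> Q gs m"
  shows "near_units_B \<G> p Q"
  unfolding near_units_B_iff
proof
  fix m0
  obtain N where N: "open N" "unt \<G> m0 \<in> N" "\<forall>gs g. (gs, g) \<in> EG \<G> p \<longrightarrow> set gs \<subseteq> N \<longrightarrow> g \<in> N \<longrightarrow> P gs g"
    using spec[OF assms(2)[unfolded near_units_E_iff], of m0] by (elim exE conjE) (rule that)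
  have "tgt \<G> (unt \<G> m) = m" for m using assms(1) by (simp add: local_lie_groupoid_def)
  then have "(gs, unt \<G> m) \<in> EG \<G> p" if "(gs, m) \<in> BG \<G> p" for gs m
    using that by (simp add: EG_def BG_def)
  with N show "\<exists>N. open N \<and> unt \<G> m0 \<in> N \<and> (\<forall>gs m. (gs, m) \<in> BG \<G> p \<longrightarrow> set gs \<subseteq> N \<longrightarrow> unt \<G> m \<in> N \<longrightarrow> Q gs m)"
    by (intro exI[of _ N] conjI allI impI Q) simp_all
qed

lemma germ_B_cong:
  assumes "near_units_B \<G> p (\<lambda>gs m. c gs m = c' gs m)"
  shows "germ_B \<G> p c = germ_B \<G> p c'"
proof (intro set_eqI iffI)
  fix d assume "d \<in> germ_B \<G> p c"
  then show "d \<in> germ_B \<G> p c'"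
    unfolding germ_B_def mem_Collect_eq by (rule near_units_B_conj[OF _ assms]) simp
next
  fix d assume "d \<in> germ_B \<G> p c'"
  then show "d \<in> germ_B \<G> p c"
    unfolding germ_B_def mem_Collect_eq by (rule near_units_B_conj[OF _ assms]) simp
qed

section \<open>Faces of composable tuples and operators on germs\<close>

context unit_tower
begin

text \<open>Each face contains at most one product, so a single level accounts for all of
  them.\<close>

lemma faces:
  assumes len: "length gs = Suc a" and ch: "chained \<G> (gs @ [g])" and gs: "set gs \<subseteq> N (Suc k)" and g: "g \<in> N (Suc k)"
  shows "length (tl gs) = a" "chained \<G> (tl gs @ [g])" "set (tl gs) \<subseteq> N k"
    "\<And>i. i \<in> {1..a} \<Longrightarrow> length (merge_at \<G> i gs) = a \<and> chained \<G> (merge_at \<G> i gs @ [g]) \<and> set (merge_at \<G> i gs) \<subseteq> N k"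
    "length (butlast gs) = a" "chained \<G> (butlast gs @ [mlt \<G> (last gs) g])" "set (butlast gs) \<subseteq> N k"
    "mlt \<G> (last gs) g \<in> N k" "src \<G> (mlt \<G> (last gs) g) = src \<G> g" "g \<in> N k"
proof -
  have mono: "x \<in> N k" if "x \<in> N (Suc k)" for x using N_mono[OF _ that, of k] by simp
  show "g \<in> N k" by (rule mono[OF g])
  obtain h gs' where h: "gs = h # gs'" using len by (cases gs) auto
  show "length (tl gs) = a" "set (tl gs) \<subseteq> N k" using len gs mono by (auto simp: h)
  show "chained \<G> (tl gs @ [g])" using ch by (cases gs') (auto simp: h)
  obtain A u where A: "gs = A @ [u]" using len by (cases gs rule: rev_cases) auto
  have u: "u \<in> N (Suc k)" "src \<G> u = tgt \<G> g" "chained \<G> (A @ [u])" using ch gs by (auto simp: A chained_append)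
  note m = N_mlt[OF u(1) g u(2)]
  show "length (butlast gs) = a" "set (butlast gs) \<subseteq> N k" using len gs mono by (auto simp: A)
  show "chained \<G> (butlast gs @ [mlt \<G> (last gs) g])" using u(3) m(4) by (simp add: A chained_append)
  show "mlt \<G> (last gs) g \<in> N k" "src \<G> (mlt \<G> (last gs) g) = src \<G> g" using m(2,3) by (simp_all add: A)
  fix i assume i: "i \<in> {1..a}"
  let ?A = "take (i - 1) gs" and ?u = "gs ! (i - 1)" and ?v = "gs ! i" and ?B = "drop (Suc i) gs"
  have e1: "gs = ?A @ ?u # drop (Suc (i - 1)) gs" by (rule id_take_nth_drop) (use i len in auto)
  have e2: "drop (Suc (i - 1)) gs = ?v # ?B" using i len by (simp add: Cons_nth_drop_Suc)
  have gs_eq: "gs = ?A @ [?u] @ [?v] @ ?B" using e1 unfolding e2 by simp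
  have ch': "chained \<G> (?A @ [?u] @ [?v] @ ?B @ [g])" using ch gs_eq by (metis append_assoc)
  have uv: "?u \<in> N (Suc k)" "?v \<in> N (Suc k)" using gs i len by (auto simp: subset_iff)
  have suv: "src \<G> ?u = tgt \<G> ?v" using ch' by (simp add: chained_append)
  note m = N_mlt[OF uv suv]
  have "chained \<G> (?A @ [mlt \<G> ?u ?v] @ ?B @ [g])"
    using ch' m(3,4) by (simp add: chained_append chained_Cons)
  moreover have "set ?A \<subseteq> N k" "set ?B \<subseteq> N k"
    using gs mono set_take_subset[of "i - 1" gs] set_drop_subset[of "Suc i" gs] by blast+
  ultimately show "length (merge_at \<G> i gs) = a \<and> chained \<G> (merge_at \<G> i gs @ [g]) \<and> set (merge_at \<G> i gs) \<subseteq> N k"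
    using i len m(2) by (auto simp: merge_at_def min_def)
qed

end

context tubular_groupoid
begin

text \<open>The bridge between germs and towers. \<open>H\<close> is a germ property already known,
  for tuples of a possibly different length; the tower starts inside its neighbourhood. The level
  \<open>k\<close> may depend on the tower, which is chosen separately at each unit.\<close>

lemma near_units_E_tower:
  assumes H: "near_units_E \<G> q H"
    and step: "\<And>N. unit_tower \<G> \<Omega> \<epsilon> N \<Longrightarrow> (\<And>gs g. length gs = q \<Longrightarrow> chained \<G> (gs @ [g]) \<Longrightarrow> set gs \<subseteq> N 0 \<Longrightarrow> g \<in> N 0 \<Longrightarrow> H gs g) \<Longrightarrow>
      \<exists>k. \<forall>gs g. length gs = p \<longrightarrow> chained \<G> (gs @ [g]) \<longrightarrow> set gs \<subseteq> N k \<longrightarrow> g \<in> N k \<longrightarrow> P gs g"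
  shows "near_units_E \<G> p P"
  unfolding near_units_E_iff
proof
  fix m0
  obtain X where X: "open X" "unt \<G> m0 \<in> X" "\<forall>gs g. (gs, g) \<in> EG \<G> q \<longrightarrow> set gs \<subseteq> X \<longrightarrow> g \<in> X \<longrightarrow> H gs g"
    using spec[OF H[unfolded near_units_E_iff], of m0] by (elim exE conjE) (rule that)
  \<comment> \<open>Dependent choice: each neighbourhood is chosen to shrink into the previous one
    and still contains the unit.\<close>
  have "\<exists>f. \<forall>k. (open (f k) \<and> unt \<G> m0 \<in> f k \<and> f k \<subseteq> X) \<and> shrinks (f k) (f (Suc k))"
  proof (rule dependent_nat_choice)
    show "\<exists>B. open B \<and> unt \<G> m0 \<in> B \<and> B \<subseteq> X" using X(1,2) by blast
    fix B :: "'g set" and k :: nat assume B: "open B \<and> unt \<G> m0 \<in> B \<and> B \<subseteq> X"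
    then obtain B' where B': "open B'" "unt \<G> m0 \<in> B'" "shrinks B B'" using ex_shrinks[of B m0] by blast
    then have "B' \<subseteq> B" by (simp add: shrinks_def)
    with B B' show "\<exists>B'. (open B' \<and> unt \<G> m0 \<in> B' \<and> B' \<subseteq> X) \<and> shrinks B B'" by blast
  qed
  then obtain N where N: "\<forall>k. (open (N k) \<and> unt \<G> m0 \<in> N k \<and> N k \<subseteq> X) \<and> shrinks (N k) (N (Suc k))" by blast
  have tower: "unit_tower \<G> \<Omega> \<epsilon> N"
    by (intro unit_tower.intro tubular_groupoid_axioms unit_tower_axioms.intro) (use N in simp_all)
  have N0: "N 0 \<subseteq> X" using N by blast
  have HN: "H gs g" if "length gs = q" "chained \<G> (gs @ [g])" "set gs \<subseteq> N 0" "g \<in> N 0" for gs g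
  proof -
    have "(gs, g) \<in> EG \<G> q" using that(1,2) by (simp add: EG_iff)
    with X(3) that(3,4) N0 show ?thesis by blast
  qed
  obtain k where k: "\<forall>gs g. length gs = p \<longrightarrow> chained \<G> (gs @ [g]) \<longrightarrow> set gs \<subseteq> N k \<longrightarrow> g \<in> N k \<longrightarrow> P gs g"
    using step[OF tower HN] by blast
  show "\<exists>N. open N \<and> unt \<G> m0 \<in> N \<and> (\<forall>gs g. (gs, g) \<in> EG \<G> p \<longrightarrow> set gs \<subseteq> N \<longrightarrow> g \<in> N \<longrightarrow> P gs g)"
    by (rule exI[of _ "N k"]) (use N k in \<open>simp add: EG_iff\<close>)
qed

lemma near_units_E_True: "near_units_E \<G> 0 (\<lambda>_ _. True)"
  unfolding near_units_E_def by (intro allI exI[of _ UNIV]) simp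

lemma dgerm_eq_trans:
  assumes "dgerm_eq \<G> p q \<psi> \<psi>'" "dgerm_eq \<G> p q \<psi>' \<psi>''"
  shows "dgerm_eq \<G> p q \<psi> \<psi>''"
  using near_units_E_conj[OF assms[unfolded dgerm_eq_def]] unfolding dgerm_eq_def by simp

lemma dgerm_eq_uminus:
  "dgerm_eq \<G> p q \<psi> \<psi>' \<Longrightarrow> dgerm_eq \<G> p q (\<lambda>gs g vs. - \<psi> gs g vs) (\<lambda>gs g vs. - \<psi>' gs g vs)"
  unfolding dgerm_eq_def by simp

lemma dcochains_germ:
  assumes "\<psi>' \<in> dcochains \<G> p q" "dgerm_eq \<G> p q \<psi> \<psi>'"
  shows "\<psi> \<in> dcochains \<G> p q"
proof -
  have "near_units_E \<G> p (\<lambda>gs g. alternating_form q (algd \<G> (src \<G> g)) (\<psi> gs g))"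
  proof (rule near_units_E_conj[OF assms(1)[unfolded dcochains_def mem_Collect_eq] assms(2)[unfolded dgerm_eq_def]])
    fix gs g
    assume a: "alternating_form q (algd \<G> (src \<G> g)) (\<psi>' gs g)"
      and e: "\<forall>vs. length vs = q \<and> set vs \<subseteq> algd \<G> (src \<G> g) \<longrightarrow> \<psi> gs g vs = \<psi>' gs g vs"
    show "alternating_form q (algd \<G> (src \<G> g)) (\<psi> gs g)"
      by (rule alternating_form_cong[OF algd_subspace _ a]) (use e in simp)
  qed
  then show ?thesis by (simp add: dcochains_def)
qed

text \<open>The operator uses values along retraction paths only, and these stay near the units when
  they start near them. So it is well defined on germs.\<close>

lemma dgerm_kop:
  assumes "dgerm_eq \<G> a (Suc q) \<psi> \<psi>'"
  shows "dgerm_eq \<G> a q (kop \<G> \<rho> lam a \<psi>) (kop \<G> \<rho> lam a \<psi>')"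
  unfolding dgerm_eq_def
proof (rule near_units_E_tower[OF assms[unfolded dgerm_eq_def]])
  fix N assume tower: "unit_tower \<G> \<Omega> \<epsilon> N"
    and H: "\<And>gs g. length gs = a \<Longrightarrow> chained \<G> (gs @ [g]) \<Longrightarrow> set gs \<subseteq> N 0 \<Longrightarrow> g \<in> N 0 \<Longrightarrow>
      \<forall>vs. length vs = Suc q \<and> set vs \<subseteq> algd \<G> (src \<G> g) \<longrightarrow> \<psi> gs g vs = \<psi>' gs g vs"
  interpret unit_tower \<G> \<Omega> \<epsilon> N by (rule tower)
  have "kop \<G> \<rho> lam a \<psi> gs x ws = kop \<G> \<rho> lam a \<psi>' gs x ws"
    if gs: "length gs = a" "chained \<G> (gs @ [x])" "set gs \<subseteq> N 8" "x \<in> N 8"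
      and ws: "length ws = q" "set ws \<subseteq> algd \<G> (src \<G> x)" for gs x ws
  proof -
    have "\<psi> gs (lam r x) (radial x r # map (transport x r) ws) = \<psi>' gs (lam r x) (radial x r # map (transport x r) ws)"
      if r: "r \<in> {0..1}" for r
    proof -
      note R = radial_facts[OF gs(4) r]
      have "chained \<G> (gs @ [lam r x])" using gs(2) R(3) by (simp add: chained_append)
      moreover have "set gs \<subseteq> N 0" using gs(3) N_mono[of 0 8] by auto
      moreover have "lam r x \<in> N 0" using R(2) N_mono[of 0 7] by simp
      moreover have "set (radial x r # map (transport x r) ws) \<subseteq> algd \<G> (src \<G> (lam r x))"
        using R(4) transport_facts(3)[OF gs(4) r] ws(2) by auto
      ultimately show ?thesis using H[OF gs(1)] ws(1) by simp
    qed
    then have "(LINT r:{0..1}|lborel. \<rho> (lam r x) (\<psi> gs (lam r x) (radial x r # map (transport x r) ws))) =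
        (LINT r:{0..1}|lborel. \<rho> (lam r x) (\<psi>' gs (lam r x) (radial x r # map (transport x r) ws)))"
      by (intro set_lebesgue_integral_cong) auto
    then show ?thesis by (simp add: kop_eq)
  qed
  then show "\<exists>k. \<forall>gs g. length gs = a \<longrightarrow> chained \<G> (gs @ [g]) \<longrightarrow> set gs \<subseteq> N k \<longrightarrow> g \<in> N k \<longrightarrow>
      (\<forall>vs. length vs = q \<and> set vs \<subseteq> algd \<G> (src \<G> g) \<longrightarrow> kop \<G> \<rho> lam a \<psi> gs g vs = kop \<G> \<rho> lam a \<psi>' gs g vs)"
    by (intro exI[of _ 8]) simp
qed

lemma dgerm_dlt:
  assumes "dgerm_eq \<G> a q \<phi> \<phi>'"
  shows "dgerm_eq \<G> (Suc a) q (dlt \<G> a \<phi>) (dlt \<G> a \<phi>')"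
  unfolding dgerm_eq_def
proof (rule near_units_E_tower[OF assms[unfolded dgerm_eq_def]])
  fix N assume tower: "unit_tower \<G> \<Omega> \<epsilon> N"
    and H: "\<And>gs g. length gs = a \<Longrightarrow> chained \<G> (gs @ [g]) \<Longrightarrow> set gs \<subseteq> N 0 \<Longrightarrow> g \<in> N 0 \<Longrightarrow>
      \<forall>vs. length vs = q \<and> set vs \<subseteq> algd \<G> (src \<G> g) \<longrightarrow> \<phi> gs g vs = \<phi>' gs g vs"
  interpret unit_tower \<G> \<Omega> \<epsilon> N by (rule tower)
  have "dlt \<G> a \<phi> gs x vs = dlt \<G> a \<phi>' gs x vs"
    if gs: "length gs = Suc a" "chained \<G> (gs @ [x])" "set gs \<subseteq> N (Suc 0)" "x \<in> N (Suc 0)"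
      and vs: "length vs = q" "set vs \<subseteq> algd \<G> (src \<G> x)" for gs x vs
  proof -
    note f = faces[OF gs]
    have "\<phi> (tl gs) x vs = \<phi>' (tl gs) x vs" using H[OF f(1-3,10)] vs by blast
    moreover have "\<phi> (merge_at \<G> i gs) x vs = \<phi>' (merge_at \<G> i gs) x vs" if "i \<in> {1..a}" for i
      using H[OF _ _ _ f(10), of "merge_at \<G> i gs"] f(4)[OF that] vs by blast
    moreover have "\<phi> (butlast gs) (mlt \<G> (last gs) x) vs = \<phi>' (butlast gs) (mlt \<G> (last gs) x) vs"
      using H[OF f(5-8)] f(9) vs by simp
    ultimately show ?thesis by (simp add: dlt_def)
  qed
  then show "\<exists>k. \<forall>gs g. length gs = Suc a \<longrightarrow> chained \<G> (gs @ [g]) \<longrightarrow> set gs \<subseteq> N k \<longrightarrow> g \<in> N k \<longrightarrow>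
      (\<forall>vs. length vs = q \<and> set vs \<subseteq> algd \<G> (src \<G> g) \<longrightarrow> dlt \<G> a \<phi> gs g vs = dlt \<G> a \<phi>' gs g vs)"
    by (intro exI[of _ "Suc 0"]) simp
qed

lemma dlt_dcochains:
  assumes "\<phi> \<in> dcochains \<G> a q"
  shows "(\<lambda>gs g vs. - dlt \<G> a \<phi> gs g vs) \<in> dcochains \<G> (Suc a) q"
proof -
  have "near_units_E \<G> (Suc a) (\<lambda>gs g. alternating_form q (algd \<G> (src \<G> g)) (\<lambda>vs. - dlt \<G> a \<phi> gs g vs))"
  proof (rule near_units_E_tower[OF assms[unfolded dcochains_def mem_Collect_eq]])
    fix N assume tower: "unit_tower \<G> \<Omega> \<epsilon> N"
      and H: "\<And>gs g. length gs = a \<Longrightarrow> chained \<G> (gs @ [g]) \<Longrightarrow> set gs \<subseteq> N 0 \<Longrightarrow> g \<in> N 0 \<Longrightarrow>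
        alternating_form q (algd \<G> (src \<G> g)) (\<phi> gs g)"
    interpret unit_tower \<G> \<Omega> \<epsilon> N by (rule tower)
    have "alternating_form q (algd \<G> (src \<G> x)) (\<lambda>vs. - dlt \<G> a \<phi> gs x vs)"
      if gs: "length gs = Suc a" "chained \<G> (gs @ [x])" "set gs \<subseteq> N (Suc 0)" "x \<in> N (Suc 0)" for gs x
    proof -
      note f = faces[OF gs]
      have "alternating_form q (algd \<G> (src \<G> x)) (\<phi> (tl gs) x)" by (rule H[OF f(1-3,10)])
      moreover have "alternating_form q (algd \<G> (src \<G> x)) (\<phi> (merge_at \<G> i gs) x)" if "i \<in> {1..a}" for i
        using H[OF _ _ _ f(10), of "merge_at \<G> i gs"] f(4)[OF that] by blast
      moreover have "alternating_form q (algd \<G> (src \<G> x)) (\<phi> (butlast gs) (mlt \<G> (last gs) x))"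
        using H[OF f(5-8)] f(9) by simp
      ultimately have "alternating_form q (algd \<G> (src \<G> x)) (\<lambda>vs. (-1) *\<^sub>R dlt \<G> a \<phi> gs x vs)"
        unfolding dlt_def
        by (intro alternating_form_scale alternating_form_add alternating_form_sum)
      then show ?thesis by simp
    qed
    then show "\<exists>k. \<forall>gs g. length gs = Suc a \<longrightarrow> chained \<G> (gs @ [g]) \<longrightarrow> set gs \<subseteq> N k \<longrightarrow> g \<in> N k \<longrightarrow>
        alternating_form q (algd \<G> (src \<G> g)) (\<lambda>vs. - dlt \<G> a \<phi> gs g vs)"
      by (intro exI[of _ "Suc 0"]) simp
  qed
  then show ?thesis by (simp add: dcochains_def)
qed

end

section \<open>Solving \<open>(1 + \<delta>k) \<Psi> = i(\<alpha>)\<close> and evaluating at the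
  units\<close>

context van_est_data
begin

lemma van_est_towerI: "unit_tower \<G> \<Omega> \<epsilon> N \<Longrightarrow> van_est_tower \<G> \<Omega> \<epsilon> \<V> \<rho> n \<alpha> N"
  by (intro van_est_tower.intro van_est_data_axioms)

text \<open>The Neumann series of \<open>(1 + \<delta>k)\<^sup>-\<^sup>1\<close> applied to
  \<open>i(\<alpha>)\<close>: each bidegree contains exactly one of its terms.\<close>

primrec dk_iterate :: "nat \<Rightarrow> ('a, 'c, 'k) dcochain" where
  "dk_iterate 0 = iop \<G> \<alpha>"
| "dk_iterate (Suc a) = (\<lambda>gs g vs. - dlt \<G> a (kop \<G> \<rho> lam a (dk_iterate a)) gs g vs)"

definition signed_cube_form :: "nat \<Rightarrow> ('a, 'c, 'k) dcochain" where
  "signed_cube_form a gs x ws = (-1) ^ a *\<^sub>R cube_form gs x ws"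

text \<open>The leading minus, the sign \<open>(-1)^(a + 1)\<close> of the last face and the sign
  \<open>(-1)^a\<close> of the form multiply to 1.\<close>

lemma dlt_signed_cube_form:
  assumes "cube_form (tl gs) y vs = 0" "\<And>i. i \<in> {1..a} \<Longrightarrow> cube_form (merge_at \<G> i gs) y vs = 0"
  shows "- dlt \<G> a (signed_cube_form a) gs y vs = cube_form (butlast gs) (mlt \<G> (last gs) y) vs"
  using assms by (simp add: dlt_def signed_cube_form_def)

lemma kop_dk_iterate:
  "Suc a \<le> n \<Longrightarrow> dgerm_eq \<G> a (n - Suc a) (kop \<G> \<rho> lam a (dk_iterate a)) (signed_cube_form a)"
proof (induction a)
  case 0
  show ?case
    unfolding dgerm_eq_def
  proof (rule near_units_E_tower[OF near_units_E_True])
    fix N assume tower: "unit_tower \<G> \<Omega> \<epsilon> N"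
    interpret van_est_tower \<G> \<Omega> \<epsilon> \<V> \<rho> n \<alpha> N by (rule van_est_towerI[OF tower])
    have "kop \<G> \<rho> lam 0 (dk_iterate 0) [] x ws = signed_cube_form 0 [] x ws"
      if "x \<in> N 9" "length ws = n - Suc 0" "set ws \<subseteq> algd \<G> (src \<G> x)" for x ws
    proof -
      have "admissible 7 [] x" using that(1) by (simp add: admissible_def)
      from cube_form_base[OF this that(3)] that(2) 0 show ?thesis
        by (simp add: kop_eq iop_def signed_cube_form_def)
    qed
    then show "\<exists>k. \<forall>gs g. length gs = 0 \<longrightarrow> chained \<G> (gs @ [g]) \<longrightarrow> set gs \<subseteq> N k \<longrightarrow> g \<in> N k \<longrightarrow>
        (\<forall>vs. length vs = n - Suc 0 \<and> set vs \<subseteq> algd \<G> (src \<G> g) \<longrightarrow>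
          kop \<G> \<rho> lam 0 (dk_iterate 0) gs g vs = signed_cube_form 0 gs g vs)"
      by (intro exI[of _ 9]) simp
  qed
next
  case (Suc a)
  let ?q = "n - Suc (Suc a)"
  let ?d = "\<lambda>gs g vs. - dlt \<G> a (signed_cube_form a) gs g vs"
  have q: "n - Suc a = Suc ?q" using Suc.prems by simp
  have IH: "dgerm_eq \<G> a (Suc ?q) (kop \<G> \<rho> lam a (dk_iterate a)) (signed_cube_form a)"
    using Suc.IH Suc.prems by (simp add: q)
  \<comment> \<open>Both operators respect germs, so the recursive iterate may be replaced by the
    explicit integral before \<open>k\<close> is applied once more.\<close>
  have 1: "dgerm_eq \<G> (Suc a) ?q (kop \<G> \<rho> lam (Suc a) (dk_iterate (Suc a))) (kop \<G> \<rho> lam (Suc a) ?d)"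
    unfolding dk_iterate.simps by (rule dgerm_kop[OF dgerm_eq_uminus[OF dgerm_dlt[OF IH]]])
  have "dgerm_eq \<G> (Suc a) ?q (kop \<G> \<rho> lam (Suc a) ?d) (signed_cube_form (Suc a))"
    unfolding dgerm_eq_def
  proof (rule near_units_E_tower[OF near_units_E_True])
    fix N assume tower: "unit_tower \<G> \<Omega> \<epsilon> N"
    interpret van_est_tower \<G> \<Omega> \<epsilon> \<V> \<rho> n \<alpha> N by (rule van_est_towerI[OF tower])
    \<comment> \<open>\<open>cube_form_step\<close> asks for \<open>admissible 12\<close> of a tuple
      with \<open>Suc a\<close> arrows besides \<open>x\<close>; the outer \<open>Suc\<close> pays
      for taking faces.\<close>
    let ?k = "Suc (12 + 2 * Suc (Suc a))"
    have "kop \<G> \<rho> lam (Suc a) ?d gs x ws = signed_cube_form (Suc a) gs x ws"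
      if gs: "length gs = Suc a" "chained \<G> (gs @ [x])" "set gs \<subseteq> N ?k" "x \<in> N ?k"
        and ws: "length ws = ?q" "set ws \<subseteq> algd \<G> (src \<G> x)" for gs x ws
    proof -
      note f = faces[OF gs]
      obtain gs' g where gs': "gs = gs' @ [g]" using gs(1) by (cases gs rule: rev_cases) auto
      have x8: "x \<in> N 8" using gs(4) N_mono[of 8 ?k x] by simp
      have mono: "y \<in> N (8 + 2 * Suc a)" if "y \<in> N (12 + 2 * Suc (Suc a))" for y
        using N_mono[of "8 + 2 * Suc a" "12 + 2 * Suc (Suc a)" y] that by simp
      have admissible: "admissible 12 (gs' @ [g]) x"
        proof -
        have "set gs \<subseteq> N (12 + 2 * Suc (Suc a))" using gs(3) N_mono[of "12 + 2 * Suc (Suc a)" ?k] by (intro subsetI) (simp add: subset_iff)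
        then show ?thesis using gs(1,2) f(10) unfolding admissible_def gs' by simp
      qed
      have mono': "A \<subseteq> N (12 + 2 * Suc (Suc a)) \<Longrightarrow> A \<subseteq> N (8 + 2 * Suc a)" for A
        by (rule subsetI) (erule (1) mono[OF subsetD])
      have admissible_tl: "admissible 8 (tl gs) x"
        unfolding admissible_def f(1) by (intro conjI f(2) mono'[OF f(3)] mono[OF f(10)])
      have admissible_merge: "admissible 8 (merge_at \<G> i gs) x" if "i \<in> {1..a}" for i
        unfolding admissible_def using f(4)[OF that] mono[OF f(10)] mono' by simp
      have "?d gs (lam r x) (radial x r # map (transport x r) ws) = cube_form gs' (mlt \<G> g (lam r x)) (radial x r # map (transport x r) ws)"
        if r: "r \<in> {0..1}" for r
      proof -
        have us: "set (map (transport x r) ws) \<subseteq> algd \<G> (src \<G> (lam r x))" using transport_facts(3)[OF x8 r] ws(2) by auto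
        \<comment> \<open>The faces that leave the last arrow alone feed a radial vector into a form
          that is already an image of the homotopy operator, so they vanish.\<close>
        have "cube_form (tl gs) (lam r x) (radial x r # map (transport x r) ws) = 0"
          by (rule cube_form_radial[OF admissible_tl r us]) (use ws(1) f(1) Suc.prems in simp)
        moreover have "cube_form (merge_at \<G> i gs) (lam r x) (radial x r # map (transport x r) ws) = 0" if i: "i \<in> {1..a}" for i
          by (rule cube_form_radial[OF admissible_merge[OF i] r us]) (use ws(1) f(4)[OF i] Suc.prems in simp)
        ultimately show ?thesis using dlt_signed_cube_form[of gs "lam r x" "radial x r # map (transport x r) ws" a] by (simp add: gs')
      qed
      then have "(LINT r:{0..1}|lborel. \<rho> (lam r x) (?d gs (lam r x) (radial x r # map (transport x r) ws))) =
          (LINT r:{0..1}|lborel. \<rho> (lam r x) (cube_form gs' (mlt \<G> g (lam r x)) (radial x r # map (transport x r) ws)))"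
        by (intro set_lebesgue_integral_cong) auto
      moreover have "inv (\<rho> x) (LINT r:{0..1}|lborel. \<rho> (lam r x) (cube_form gs' (mlt \<G> g (lam r x)) (radial x r # map (transport x r) ws))) = cube_form gs x ws"
        unfolding gs' by (rule cube_form_step[OF admissible ws(2)]) (use gs(1) ws(1) Suc.prems in \<open>simp add: gs'\<close>)
      ultimately show ?thesis
        unfolding kop_eq signed_cube_form_def linear_scale[OF inv_rho_linear] by simp
    qed
    then show "\<exists>k. \<forall>gs g. length gs = Suc a \<longrightarrow> chained \<G> (gs @ [g]) \<longrightarrow> set gs \<subseteq> N k \<longrightarrow> g \<in> N k \<longrightarrow>
        (\<forall>vs. length vs = ?q \<and> set vs \<subseteq> algd \<G> (src \<G> g) \<longrightarrow>
          kop \<G> \<rho> lam (Suc a) ?d gs g vs = signed_cube_form (Suc a) gs g vs)"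
      by (intro exI[of _ ?k]) simp
  qed
  from dgerm_eq_trans[OF 1 this] show ?case .
qed

lemma signed_cube_form_dcochain:
  assumes "Suc a \<le> n"
  shows "signed_cube_form a \<in> dcochains \<G> a (n - Suc a)"
proof -
  have "near_units_E \<G> a (\<lambda>gs g. alternating_form (n - Suc a) (algd \<G> (src \<G> g)) (signed_cube_form a gs g))"
  proof (rule near_units_E_tower[OF near_units_E_True])
    fix N assume tower: "unit_tower \<G> \<Omega> \<epsilon> N"
    interpret van_est_tower \<G> \<Omega> \<epsilon> \<V> \<rho> n \<alpha> N by (rule van_est_towerI[OF tower])
    have "alternating_form (n - Suc a) (algd \<G> (src \<G> g)) (signed_cube_form a gs g)"
      if "length gs = a" "chained \<G> (gs @ [g])" "set gs \<subseteq> N (7 + 2 * Suc a)" "g \<in> N (7 + 2 * Suc a)" for gs g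
    proof -
      have "admissible 7 gs g" using that by (simp add: admissible_def)
      from alternating_form_scale[OF cube_form_alternating[OF this]] that(1) assms
      show ?thesis by (simp add: signed_cube_form_def[abs_def])
    qed
    then show "\<exists>k. \<forall>gs g. length gs = a \<longrightarrow> chained \<G> (gs @ [g]) \<longrightarrow> set gs \<subseteq> N k \<longrightarrow> g \<in> N k \<longrightarrow>
        alternating_form (n - Suc a) (algd \<G> (src \<G> g)) (signed_cube_form a gs g)"
      by (intro exI[of _ "7 + 2 * Suc a"]) simp
  qed
  then show ?thesis by (simp add: dcochains_def)
qed

text \<open>For arbitrary sections the integral in \<open>k\<close> may diverge and additivity may
  fail. Alternation is therefore transferred from the explicit form, to which the iterate is equal
  as a germ.\<close>

lemma dk_iterate_dcochain: "a \<le> n \<Longrightarrow> dk_iterate a \<in> dcochains \<G> a (n - a)"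
proof (cases a)
  case 0
  have "near_units_E \<G> 0 (\<lambda>gs g. alternating_form n (algd \<G> (src \<G> g)) (iop \<G> \<alpha> gs g))"
    by (rule near_units_E_conj[OF near_units_E_True near_units_E_True])
      (simp add: iop_def[abs_def] alpha_alternating)
  then show ?thesis using 0 by (simp add: dcochains_def)
next
  case (Suc b)
  assume "a \<le> n"
  then have b: "Suc b \<le> n" using Suc by simp
  show ?thesis
    unfolding Suc dk_iterate.simps
    by (rule dcochains_germ[OF dlt_dcochains[OF signed_cube_form_dcochain[OF b]] dgerm_eq_uminus[OF dgerm_dlt[OF kop_dk_iterate[OF b]]]])
qed

text \<open>The equation is triangular: its part of first degree \<open>a + 1\<close> expresses that
  component of \<open>\<Psi>\<close> by the preceding one.\<close>

lemma solution_unique: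
  assumes \<Psi>: "\<forall>a\<le>n. dgerm_eq \<G> a (n - a) (one_plus_dk \<G> \<rho> lam \<Psi> a) (if a = 0 then iop \<G> \<alpha> else (\<lambda>_ _ _. 0))"
  shows "a \<le> n \<Longrightarrow> dgerm_eq \<G> a (n - a) (\<Psi> a) (dk_iterate a)"
proof (induction a)
  case 0
  have "dgerm_eq \<G> 0 n (one_plus_dk \<G> \<rho> lam \<Psi> 0) (iop \<G> \<alpha>)" using \<Psi>[rule_format, OF le0] by simp
  then show ?case by (simp add: one_plus_dk_def[abs_def])
next
  case (Suc a)
  have q: "n - a = Suc (n - Suc a)" using Suc.prems by simp
  have IH: "dgerm_eq \<G> (Suc a) (n - Suc a) (dlt \<G> a (kop \<G> \<rho> lam a (\<Psi> a))) (dlt \<G> a (kop \<G> \<rho> lam a (dk_iterate a)))"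
    using Suc.IH Suc.prems by (intro dgerm_dlt dgerm_kop) (simp add: q)
  have eq: "dgerm_eq \<G> (Suc a) (n - Suc a) (one_plus_dk \<G> \<rho> lam \<Psi> (Suc a)) (\<lambda>_ _ _. 0)"
    using \<Psi>[rule_format, OF Suc.prems] by simp
  show ?case
    using near_units_E_conj[OF IH[unfolded dgerm_eq_def] eq[unfolded dgerm_eq_def]]
    unfolding dgerm_eq_def by (auto simp: one_plus_dk_def eq_neg_iff_add_eq_0)
qed

lemma dk_iterate_solution:
  "dgerm_eq \<G> a q (one_plus_dk \<G> \<rho> lam dk_iterate a) (if a = 0 then iop \<G> \<alpha> else (\<lambda>_ _ _. 0))"
proof -
  have "near_units_E \<G> a (\<lambda>_ _. True)"
    unfolding near_units_E_def by (intro allI exI[of _ UNIV]) simp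
  note near_units_E_conj[OF this this]
  then show ?thesis
    unfolding dgerm_eq_def by (cases a) (simp_all add: one_plus_dk_def)
qed

text \<open>The integral is a vector in the fibre at \<open>m\<^sub>0\<close>, while cochains have
  values in the fibre at \<open>m\<^sub>p\<close>; the inverse action makes the identification
  explicit.\<close>

definition van_est_formula :: "'a list \<Rightarrow> 'b \<Rightarrow> 'k" where
  "van_est_formula gs m = inv (act_list \<rho> gs) (cube_integral \<A> n (cube_map \<G> lam gs m) (linv_form \<G> \<rho> \<alpha>))"

text \<open>At a unit all faces but the last vanish by \<open>cube_form_unit\<close>, and in the
  last one the product of \<open>g\<close> with the unit is \<open>g\<close>. So the final arrow of
  the tuple takes the place of \<open>x\<close>. Degree zero has no face and is the integral over a
  point.\<close>

lemma dk_iterate_unit: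
  "near_units_E \<G> n (\<lambda>gs x. \<forall>m. x = unt \<G> m \<longrightarrow> dk_iterate n gs x [] = van_est_formula gs m)"
proof (cases n)
  case 0
  have "van_est_formula [] m = \<alpha> m []" for m
  proof -
    have "van_est_formula [] m = cube_integral \<A> n (cube_map \<G> lam [] m) (linv_form \<G> \<rho> \<alpha>)"
      unfolding van_est_formula_def by simp
    also have "\<dots> = cube_integral \<A> 0 (cube_map \<G> lam [] m) (linv_form \<G> \<rho> \<alpha>)"
      by (simp only: 0)
    also have "\<dots> = \<alpha> m []"
      unfolding cube_integral_def cube_map.simps upt_0 list.map set_integral_cube_0
      by (simp add: linv_form_def)
    finally show ?thesis .
  qed
  then have "near_units_E \<G> 0 (\<lambda>gs x. \<forall>m. x = unt \<G> m \<longrightarrow> dk_iterate 0 gs x [] = van_est_formula gs m)"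
    unfolding near_units_E_iff EG_iff by (intro allI exI[of _ UNIV]) (simp add: iop_def)
  then show ?thesis by (simp only: 0)
next
  case (Suc a)
  have le: "Suc a \<le> n" using Suc by simp
  have germ: "dgerm_eq \<G> (Suc a) 0 (dk_iterate (Suc a)) (\<lambda>gs g vs. - dlt \<G> a (signed_cube_form a) gs g vs)"
    unfolding dk_iterate.simps using dgerm_eq_uminus[OF dgerm_dlt[OF kop_dk_iterate[OF le]]] Suc by simp
  have "near_units_E \<G> (Suc a) (\<lambda>gs x. \<forall>m. x = unt \<G> m \<longrightarrow> - dlt \<G> a (signed_cube_form a) gs x [] = van_est_formula gs m)"
  proof (rule near_units_E_tower[OF near_units_E_True])
    fix N assume tower: "unit_tower \<G> \<Omega> \<epsilon> N"
    interpret van_est_tower \<G> \<Omega> \<epsilon> \<V> \<rho> n \<alpha> N by (rule van_est_towerI[OF tower])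
    \<comment> \<open>\<open>cube_form_unit\<close> asks for \<open>admissible 8\<close> of faces of
      length \<open>a\<close>, and taking faces costs one further level.\<close>
    let ?k = "Suc (8 + 2 * Suc a)"
    have "- dlt \<G> a (signed_cube_form a) gs (unt \<G> m) [] = van_est_formula gs m"
      if gs: "length gs = Suc a" "chained \<G> (gs @ [unt \<G> m])" "set gs \<subseteq> N ?k" "unt \<G> m \<in> N ?k" for gs m
    proof -
      note f = faces[OF gs]
      obtain gs' g where gs': "gs = gs' @ [g]" using gs(1) by (cases gs rule: rev_cases) auto
      have len: "length gs' = a" using gs(1) by (simp add: gs')
      have g: "g \<in> N (Suc (Suc 0))" "src \<G> g = m"
        using gs(2,3) N_mono[of "Suc (Suc 0)" ?k g] by (auto simp: gs' chained_append)
      have gm: "mlt \<G> g (unt \<G> m) = g" using N_unt_right(2)[OF g(1)] g(2) by simp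
      have "cube_form (tl gs) (unt \<G> m) [] = 0"
        using f(1-3,10) Suc by (intro cube_form_unit) (auto simp: admissible_def)
      moreover have "cube_form (merge_at \<G> i gs) (unt \<G> m) [] = 0" if "i \<in> {1..a}" for i
        using f(4)[OF that] f(10) Suc by (intro cube_form_unit) (auto simp: admissible_def)
      ultimately have "- dlt \<G> a (signed_cube_form a) gs (unt \<G> m) [] = cube_form gs' g []"
        using dlt_signed_cube_form[of gs "unt \<G> m" "[]" a] by (simp add: gs' gm)
      also have "\<dots> = van_est_formula gs m"
      proof -
        have admissible: "admissible 7 gs' g"
          using gs(2,3) len N_mono[of "7 + 2 * Suc a" ?k] by (auto simp: admissible_def gs' chained_append)
        have cube_map: "cube_map \<G> lam gs m t = iter_retr gs' g t" for t unfolding gs' by (rule cube_map_iter_retr)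
        have vel: "velocity \<A> {0..1} (\<lambda>h. iter_retr gs' g (t(i := h))) (t i) = cube_vel gs' g t i"
          if t: "t \<in> cube (Suc (length gs'))" and i: "i \<le> length gs'" for t i
        proof -
          have "t i \<in> {0..1}" using cubeD[OF t, of i] i by auto
          then show ?thesis
            using cube_vel_facts'(1)[OF admissible i t] unfolding cube_vel_def
            by (intro velocity_within_unit_interval) (auto simp: fcurve_def)
        qed
        have "pullback_form gs' g [] t = linv_form \<G> \<rho> \<alpha> (cube_map \<G> lam gs m t)
            (map (\<lambda>i. velocity \<A> {0..1} (\<lambda>h. cube_map \<G> lam gs m (t(i := h))) (t i)) [0..<Suc (length gs')])"
          if "t \<in> cube (Suc (length gs'))" for t
        proof -
          have "map (cube_vel gs' g t) [0..<Suc (length gs')] =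
              map (\<lambda>i. velocity \<A> {0..1} (\<lambda>h. iter_retr gs' g (t(i := h))) (t i)) [0..<Suc (length gs')]"
            by (rule map_cong[OF refl], rule vel[OF that, symmetric]) (simp del: upt_Suc)
          then show ?thesis unfolding pullback_form_def cube_map by (simp del: upt_Suc map_eq_conv)
        qed
        then have "(LINT t:cube (Suc (length gs'))|cube_measure (Suc (length gs')). pullback_form gs' g [] t) =
            cube_integral \<A> (Suc (length gs')) (cube_map \<G> lam gs m) (linv_form \<G> \<rho> \<alpha>)"
          unfolding cube_integral_def by (intro set_lebesgue_integral_cong[OF sets_cube]) blast
        then show ?thesis unfolding cube_form_def van_est_formula_def by (simp add: len Suc flip: gs')
      qed
      finally show ?thesis .
    qed
    then show "\<exists>k. \<forall>gs g. length gs = Suc a \<longrightarrow> chained \<G> (gs @ [g]) \<longrightarrow> set gs \<subseteq> N k \<longrightarrow> g \<in> N k \<longrightarrow>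
        (\<forall>m. g = unt \<G> m \<longrightarrow> - dlt \<G> a (signed_cube_form a) gs g [] = van_est_formula gs m)"
      by (intro exI[of _ ?k] allI impI) blast
  qed
  then have "near_units_E \<G> (Suc a) (\<lambda>gs x. \<forall>m. x = unt \<G> m \<longrightarrow> dk_iterate (Suc a) gs x [] = van_est_formula gs m)"
  proof (rule near_units_E_conj[OF germ[unfolded dgerm_eq_def]])
    fix gs g
    assume "\<forall>vs. length vs = 0 \<and> set vs \<subseteq> algd \<G> (src \<G> g) \<longrightarrow>
        dk_iterate (Suc a) gs g vs = - dlt \<G> a (signed_cube_form a) gs g vs"
    then have "dk_iterate (Suc a) gs g [] = - dlt \<G> a (signed_cube_form a) gs g []" by (simp del: dk_iterate.simps)
    moreover assume "\<forall>m. g = unt \<G> m \<longrightarrow> - dlt \<G> a (signed_cube_form a) gs g [] = van_est_formula gs m"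
    ultimately show "\<forall>m. g = unt \<G> m \<longrightarrow> dk_iterate (Suc a) gs g [] = van_est_formula gs m" by (simp only: simp_thms)
  qed
  then show ?thesis by (simp only: Suc)
qed

text \<open>Every solution has the iterate as its germ, so all admissible \<open>\<Psi>\<close>
  yield the same germ; the iterate itself shows that one exists.\<close>

lemma van_est_eq: "van_est \<G> \<rho> lam n \<alpha> = germ_B \<G> n van_est_formula"
proof -
  have q: "germ_B \<G> n (qop \<G> \<rho> (\<Psi> n)) = germ_B \<G> n van_est_formula"
    if \<Psi>: "dgerm_eq \<G> n 0 (\<Psi> n) (dk_iterate n)" for \<Psi> :: "nat \<Rightarrow> ('a, 'c, 'k) dcochain"
  proof (rule germ_B_cong, rule near_units_B_of_E[OF lie near_units_E_conj[OF \<Psi>[unfolded dgerm_eq_def] dk_iterate_unit]])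
    fix gs g
    assume "\<forall>vs. length vs = 0 \<and> set vs \<subseteq> algd \<G> (src \<G> g) \<longrightarrow> \<Psi> n gs g vs = dk_iterate n gs g vs"
    then have "\<Psi> n gs g [] = dk_iterate n gs g []" by simp
    moreover assume "\<forall>m. g = unt \<G> m \<longrightarrow> dk_iterate n gs g [] = van_est_formula gs m"
    ultimately show "\<forall>m. g = unt \<G> m \<longrightarrow> \<Psi> n gs g [] = van_est_formula gs m" by (simp only: simp_thms)
  qed (simp add: qop_def to_form_def)
  have 1: "germ_B \<G> n (qop \<G> \<rho> (\<Psi> n)) = germ_B \<G> n van_est_formula"
    if "\<forall>a\<le>n. dgerm_eq \<G> a (n - a) (one_plus_dk \<G> \<rho> lam \<Psi> a) (if a = 0 then iop \<G> \<alpha> else (\<lambda>_ _ _. 0))"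
    for \<Psi> :: "nat \<Rightarrow> ('a, 'c, 'k) dcochain"
    using solution_unique[OF that, of n] by (intro q) simp
  have 2: "germ_B \<G> n (qop \<G> \<rho> (dk_iterate n)) = germ_B \<G> n van_est_formula"
    by (rule 1) (simp only: dk_iterate_solution simp_thms)
  show ?thesis
  proof (rule set_eqI, rule iffI)
    fix c assume "c \<in> van_est \<G> \<rho> lam n \<alpha>"
    then obtain \<Psi> where "\<forall>a\<le>n. dgerm_eq \<G> a (n - a) (one_plus_dk \<G> \<rho> lam \<Psi> a) (if a = 0 then iop \<G> \<alpha> else (\<lambda>_ _ _. 0))"
      "c \<in> germ_B \<G> n (qop \<G> \<rho> (\<Psi> n))"
      unfolding van_est_def by blast
    with 1 show "c \<in> germ_B \<G> n van_est_formula" by blast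
  next
    fix c assume "c \<in> germ_B \<G> n van_est_formula"
    then have c: "c \<in> germ_B \<G> n (qop \<G> \<rho> (dk_iterate n))" unfolding 2 .
    show "c \<in> van_est \<G> \<rho> lam n \<alpha>"
      unfolding van_est_def mem_Collect_eq
      by (intro exI[of _ dk_iterate] conjI allI impI dk_iterate_dcochain dk_iterate_solution c)
  qed
qed

text \<open>Two levels per arrow suffice, with the last arrow of the tuple in the role of
  \<open>x\<close>. For the empty tuple the map is a constant unit.\<close>

lemma cube_map_smooth:
  "near_units_B \<G> p (\<lambda>gs m. smooth_on_cube p \<A> (cube_map \<G> lam gs m) \<and>
     cube_map \<G> lam gs m ` cube p \<subseteq> tfib \<G> (base0 \<G> gs m))"
proof -
  let ?Q = "\<lambda>gs m. smooth_on_cube p \<A> (cube_map \<G> lam gs m) \<and> cube_map \<G> lam gs m ` cube p \<subseteq> tfib \<G> (base0 \<G> gs m)"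
  have "near_units_E \<G> p (\<lambda>gs x. \<forall>m. ?Q gs m)"
  proof (rule near_units_E_tower[OF near_units_E_True])
    fix N assume tower: "unit_tower \<G> \<Omega> \<epsilon> N"
    interpret van_est_tower \<G> \<Omega> \<epsilon> \<V> \<rho> n \<alpha> N by (rule van_est_towerI[OF tower])
    have "?Q gs m" if gs: "length gs = p" "chained \<G> (gs @ [x])" "set gs \<subseteq> N (2 * p)" for gs x m
    proof (cases gs rule: rev_cases)
      case Nil
      have "smooth_on_cube 0 \<A> (\<lambda>t. unt \<G> m)"
        unfolding smooth_on_cube_def
      proof
        fix t assume "t \<in> cube 0"
        obtain U \<phi> where "(U, \<phi>) \<in> \<A>" "unt \<G> m \<in> U"
          using atlas_cover[OF manifold_atlas_cover[OF manifolds(1)]] by blast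
        then show "\<exists>(U, \<phi>)\<in>\<A>. unt \<G> m \<in> U \<and> (\<exists>Q F. open Q \<and> t \<in> Q \<and> (\<forall>n. cube_Ck 0 n Q F) \<and>
            (\<forall>t'\<in>cube 0 \<inter> Q. unt \<G> m \<in> U \<and> \<phi> (unt \<G> m) = F t'))"
          using cube_Ck_const[OF open_UNIV, of 0 _ "\<phi> (unt \<G> m)"]
          by (intro bexI[of _ "(U, \<phi>)"]) (auto intro!: exI[of _ UNIV] exI[of _ "\<lambda>_. \<phi> (unt \<G> m)"])
      qed
      moreover have "cube_map \<G> lam gs m = (\<lambda>t. unt \<G> m)" using Nil by (simp add: fun_eq_iff)
      ultimately show ?thesis using Nil gs(1) by (auto simp: base0_def tfib_def)
    next
      case (snoc gs' g)
      have p: "p = Suc (length gs')" using gs(1) snoc by simp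
      have admissible: "admissible 0 gs' g" using gs(2,3) snoc p by (auto simp: admissible_def chained_append)
      have eq: "cube_map \<G> lam gs m = iter_retr gs' g" using snoc cube_map_iter_retr by (simp add: fun_eq_iff)
      have "iter_retr gs' g ` cube p \<subseteq> tfib \<G> (base0 \<G> gs m)"
        using iter_retr_mem_cube(2)[OF admissible] snoc p by (auto simp: tfib_def base0_def)
      then show ?thesis using iter_retr_smooth_on_cube[OF admissible] unfolding eq p by blast
    qed
    then show "\<exists>k. \<forall>gs g. length gs = p \<longrightarrow> chained \<G> (gs @ [g]) \<longrightarrow> set gs \<subseteq> N k \<longrightarrow> g \<in> N k \<longrightarrow> (\<forall>m. ?Q gs m)"
      by (intro exI[of _ "2 * p"]) blast
  qed
  then show ?thesis by (rule near_units_B_of_E[OF lie]) blast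
qed

end

theorem theorem4p8:
  fixes \<G> :: "('g::topological_space, 'm::topological_space, 'e::findim, 'b::findim) groupoid"
    and \<V> :: "('m, 'k::findim) vbundle"
    and \<rho> :: "'g \<Rightarrow> 'k \<Rightarrow> 'k"
    and \<Omega> :: "('g \<times> 'e) set" and \<epsilon> :: "'g \<times> 'e \<Rightarrow> 'g"
    and p :: nat and \<alpha> :: "'m \<Rightarrow> 'e list \<Rightarrow> 'k"
  assumes "local_lie_groupoid \<G>"
    and "vector_bundle (chartsM \<G>) \<V>"
    and "groupoid_representation \<G> \<V> \<rho>"
    and "tubular_structure \<G> \<Omega> \<epsilon>"
    and "\<alpha> \<in> algd_cochains \<G> \<V> p"
  shows "near_units_B \<G> p (\<lambda>gs m.
           smooth_on_cube p (chartsG \<G>) (cube_map \<G> (retr \<Omega> \<epsilon>) gs m) \<and>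
           cube_map \<G> (retr \<Omega> \<epsilon>) gs m ` cube p \<subseteq> tfib \<G> (base0 \<G> gs m))
         \<and> van_est \<G> \<rho> (retr \<Omega> \<epsilon>) p \<alpha> =
         germ_B \<G> p (\<lambda>gs m. inv (act_list \<rho> gs)
           (cube_integral (chartsG \<G>) p (cube_map \<G> (retr \<Omega> \<epsilon>) gs m) (linv_form \<G> \<rho> \<alpha>)))"
proof -
  interpret van_est_data \<G> \<Omega> \<epsilon> \<V> \<rho> p \<alpha>
    using assms by unfold_locales
  show ?thesis
    using cube_map_smooth[of p] van_est_eq unfolding van_est_formula_def[abs_def] by blast
qed

end
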